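(* Let $\hat{\mathbf{A}}$ be the stiffness matrix of $\hat A_h(\cdot,\cdot)$ with respect to the basis $\{(\phi_j,0)\}_{j\in I_0}\cup\{(0,\phi_j^\Gamma)\}_{j\in I^\Gamma}$ of $V_h\times V_h^\Gamma$, let $\hat{\mathbf{A}}_0$ and $\hat{\mathbf{A}}_1$ be its diagonal blocks corresponding to the index sets $I_0$ and $I^\Gamma$, respectively, and let $\mathbf{D}_A:=\mathrm{blockdiag}(\hat{\mathbf{A}}_0,\hat{\mathbf{A}}_1)$. Then $\mathbf{D}_A$ is uniformly spectrally equivalent to $\hat{\mathbf{A}}$, i.e. $\mathbf{x}^T\mathbf{D}_A\mathbf{x}\sim\mathbf{x}^T\hat{\mathbf{A}}\mathbf{x}$ for all coefficient vectors $\mathbf{x}$. In particular, the spectral condition number $\lambda_{\max}(\mathbf{D}_A^{-1}\hat{\mathbf{A}})/\lambda_{\min}(\mathbf{D}_A^{-1}\hat{\mathbf{A}})$ is uniformly bounded with respect to both $h$ and the location of $\Gamma$ in the triangulation.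
   Context: Geometry and mesh. $d\in\{2,3\}$, $k\ge 1$; $\Omega\subset\mathbb{R}^d$ is a bounded connected polygonal domain with a non-overlapping partitioning into $\Omega_1,\Omega_2$, and $\Gamma=\overline{\Omega}_1\cap\overline{\Omega}_2$ is the (smooth) interface with unit normal $\mathbf{n}_\Gamma$ pointing from $\Omega_1$ into $\Omega_2$. $\{\mathcal{T}_h\}_{h>0}$ is a family of shape regular (not necessarily quasi-uniform) simplicial triangulations of $\Omega$, not fitted to $\Gamma$; $h_T$ is the diameter of $T\in\mathcal{T}_h$. $V_h$ is the space of continuous piecewise polynomials of degree $\le k$ on $\mathcal{T}_h$ vanishing on $\partial\Omega$. $\mathcal{T}_h^\Gamma$ is the set of simplices cut by $\Gamma$ and $\Omega_h^\Gamma$ is the domain they form; $\Omega_{i,h}^{\rm ex}$ is the domain formed by all simplices with nonzero intersection with $\Omega_i$. $V_{i,h}=\{(v_h)_{|\Omega_{i,h}^{\rm ex}}: v_h\in V_h\}$. Norms. $\|\cdot\|_\omega$ is the $L^2$ norm on $\omega$ and $(\cdot,\cdot)_\omega$ the $L^2$ scalar product. Scalings with $h$ are element-wise: $(h^{-1}u,v)_\Gamma=\sum_{T\in\mathcal{T}_h^\Gamma}h_T^{-1}(u,v)_{T\cap\Gamma}$, $\|h^{-1/2}v\|_\Gamma^2=(h^{-1}v,v)_\Gamma$. $A\sim B$ means $c_1B\le A\le c_2B$ with constants $c_1,c_2>0$ independent of $h$ and of the location of $\Gamma$ in the triangulation (they may depend on shape regularity, $d$, $k$, the smoothness of $\Gamma$,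 $\alpha_1,\alpha_2$, $\gamma$, $\beta$). Spaces. $\phi_j$, $j\in I_0$, are the nodal basis functions of $V_h$. $I^\Gamma\subset I_0$ are the labels of nodes in $\Omega_h^\Gamma$, $I_i^\Gamma=\{j\in I^\Gamma:\text{node } j\text{ is not in }\Omega_i\}$, $i=1,2$. It is assumed that no nodes lie on $\Gamma$; then $I^\Gamma=I_1^\Gamma\cup I_2^\Gamma$ is a disjoint partition. Cut basis functions: $\phi_j^\Gamma=\phi_j|_{\Omega_h^\Gamma}$, $j\in I^\Gamma$. $V_i^\Gamma=\mathrm{span}\{\phi_j^\Gamma: j\in I_i^\Gamma\}$ and $V_h^\Gamma=V_1^\Gamma\oplus V_2^\Gamma$; $Q_i:V_h^\Gamma\to V_i^\Gamma$, $Q_i\big(\sum_{j\in I^\Gamma}\beta_j\phi_j^\Gamma\big)=\sum_{j\in I_i^\Gamma}\beta_j\phi_j^\Gamma$. Functions in $V_i^\Gamma$ are extended by zero to $\Omega_{i,h}^{\rm ex}$. The isomorphism $L:V_h\times V_h^\Gamma\to V_{1,h}\times V_{2,h}$ is $L(u_0,u^\Gamma)=(u_{1,h},u_{2,h})$ with $u_{i,h}={u_0}_{|\Omega_{i,h}^{\rm ex}}+Q_iu^\Gamma$. Bilinear forms. $\alpha_1,\alpha_2>0$ are the diffusion coefficients, $\gamma,\beta>0$ fixed parameters, $[\![\cdot]\!]$ the jump across $\Gamma$ (resp. across a face), $[\![u_h]\!]=(u_{1,h}-u_{2,h})_{|\Gamma}$, $\{\!\!\{\cdot\}\!\!\}$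 a weighted averaging operator across $\Gamma$, $\bar\alpha$ a corresponding average of $\alpha_1,\alpha_2$, and $\mathcal{F}_{g,i}$ a suitable subset of faces in $\Omega_h^\Gamma$ with face diameters $h_F$. For $u_h,v_h\in V_{1,h}\times V_{2,h}$: $$A_h(u_h,v_h)=\sum_{i=1}^2(\alpha_i\nabla u_{i,h},\nabla v_{i,h})_{\Omega_i}+N_h^c(u_h,v_h)+N_h^c(v_h,u_h)+\bar\alpha\gamma(h^{-1}[\![u_h]\!],[\![v_h]\!])_\Gamma+G_h(u_h,v_h),$$ $$N_h^c(u_h,v_h)=(\{\!\!\{-\alpha\nabla v_h\}\!\!\}\cdot\mathbf{n}_\Gamma,[\![u_h]\!])_\Gamma,\quad G_h(u_h,v_h)=\beta\sum_{i=1}^2\sum_{\ell=1}^k\sum_{F\in\mathcal{F}_{g,i}}h_F^{2\ell-1}([\![\partial_n^\ell u_{i,h}]\!],[\![\partial_n^\ell v_{i,h}]\!])_F .$$ Set $\hat A_h(\hat u_h,\hat v_h)=A_h(L\hat u_h,L\hat v_h)$ on $V_h\times V_h^\Gamma$. The averaging, $\gamma$, $\beta$ and $\mathcal{F}_{g,i}$ are such that the following norm equivalence, known from the CutFEM literature, holds: $\hat A_h(\hat u_h,\hat u_h)\sim\sum_{i=1}^2\|\nabla u_{i,h}\|_{\Omega_{i,h}^{\rm ex}}^2+\|h^{-1/2}(u_{1,h}-u_{2,h})\|_\Gamma^2$ for all $\hat u_h\in V_h\times V_h^\Gamma$. *)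

theory Defs
  imports "HOL-Analysis.Analysis" "Jordan_Normal_Form.Spectral_Radius"
    "Jordan_Normal_Form.Gauss_Jordan_Elimination"
begin

(* Normalised Hausdorff measure; it serves as surface measure on the interface and on faces.
   The covering sets are required to be bounded because diameter is unspecified otherwise. *)

definition hausdorff_pre :: "nat \<Rightarrow> real \<Rightarrow> 'a::metric_space set \<Rightarrow> ennreal" where
  "hausdorff_pre s \<delta> A =
     Inf {(\<Sum>n. if E n = {} then 0
                else ennreal (unit_ball_vol (real s) * (diameter (E n) / 2) ^ s)) | E.
          A \<subseteq> (\<Union>n::nat. E n) \<and> (\<forall>n. bounded (E n) \<and> diameter (E n) \<le> \<delta>)}"

definition hausdorff_outer :: "nat \<Rightarrow> 'a::metric_space set \<Rightarrow> ennreal" where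
  "hausdorff_outer s A = (SUP \<delta>\<in>{0<..}. hausdorff_pre s \<delta> A)"

definition hausdorff :: "nat \<Rightarrow> 'a::metric_space measure" where
  "hausdorff s = measure_of UNIV (sets borel) (hausdorff_outer s)"

abbreviation surf :: "(real ^ 'n::finite) measure" where
  "surf \<equiv> hausdorff (CARD('n) - 1)"


definition poly_le :: "nat \<Rightarrow> (real ^ 'n::finite \<Rightarrow> real) set" where
  "poly_le k = {\<lambda>x. \<Sum>a\<in>{a::'n \<Rightarrow> nat. sum a UNIV \<le> k}. c a * (\<Prod>i\<in>UNIV. vec_nth x i ^ a i) | c. True}"

(* The polynomial that u agrees with on the simplex T, as a function on the whole space: gradients
   and normal derivatives of finite element functions are elementwise, i.e. one-sided on faces. *)
definition lpoly :: "nat \<Rightarrow> (real ^ 'n::finite \<Rightarrow> real) \<Rightarrow> (real ^ 'n) set \<Rightarrow> real ^ 'n \<Rightarrow> real" where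
  "lpoly k u T = (THE p. p \<in> poly_le k \<and> (\<forall>x\<in>T. p x = u x))"

definition lgrad :: "nat \<Rightarrow> (real ^ 'n::finite \<Rightarrow> real) \<Rightarrow> (real ^ 'n) set \<Rightarrow> real ^ 'n \<Rightarrow> real ^ 'n" where
  "lgrad k u T x = (\<chi> i. frechet_derivative (lpoly k u T) (at x) (axis i 1))"

definition dir_deriv :: "nat \<Rightarrow> real ^ 'n::finite \<Rightarrow> (real ^ 'n \<Rightarrow> real) \<Rightarrow> real ^ 'n \<Rightarrow> real" where
  "dir_deriv l n p x = (deriv ^^ l) (\<lambda>t. p (x + t *\<^sub>R n)) 0"


definition polygonal_domain :: "(real ^ 'n::finite) set \<Rightarrow> bool" where
  "polygonal_domain \<Omega> \<longleftrightarrow> \<Omega> \<noteq> {} \<and> connected \<Omega> \<and>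
     (\<exists>\<P>. finite \<P> \<and> (\<forall>P\<in>\<P>. polytope P) \<and> \<Omega> = interior (\<Union>\<P>))"

definition simplicial_mesh :: "(real ^ 'n::finite) set \<Rightarrow> (real ^ 'n) set set \<Rightarrow> bool" where
  "simplicial_mesh \<Omega> \<T> \<longleftrightarrow>
     triangulation \<T> \<and> (\<forall>T\<in>\<T>. int CARD('n) simplex T) \<and> \<Union>\<T> = closure \<Omega>"

definition shape_regular :: "real \<Rightarrow> (real ^ 'n::finite) set set \<Rightarrow> bool" where
  "shape_regular \<sigma> \<T> \<longleftrightarrow> (\<forall>T\<in>\<T>. \<exists>x. ball x (diameter T / \<sigma>) \<subseteq> T)"

(* Nodes of the degree k Lagrange element: the points with barycentric coordinates in {0,1/k,...,1}. *)
definition lagrange_nodes :: "nat \<Rightarrow> (real ^ 'n::finite) set \<Rightarrow> (real ^ 'n) set" where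
  "lagrange_nodes k T =
     {\<Sum>v\<in>{v. v extreme_point_of T}. (real (a v) / real k) *\<^sub>R v | a.
        sum a {v. v extreme_point_of T} = k}"


(* All data of one discretization.  The pair of subdomains, the diffusion coefficients, the
   averaging weights and the ghost penalty faces are indexed by i in {1,2}. *)
record ('n::finite) cutfem =
  dom_of :: "(real ^ 'n) set"
  sub :: "nat \<Rightarrow> (real ^ 'n) set"
  nrm :: "real ^ 'n \<Rightarrow> real ^ 'n"
  mesh :: "(real ^ 'n) set set"
  deg :: nat
  coef :: "nat \<Rightarrow> real"
  gam :: real
  bet :: real
  wt :: "nat \<Rightarrow> real ^ 'n \<Rightarrow> real"
  coef_avg :: real
  ghost :: "nat \<Rightarrow> (real ^ 'n) set set"

definition interface :: "'n::finite cutfem \<Rightarrow> (real ^ 'n) set" where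
  "interface S = closure (sub S 1) \<inter> closure (sub S 2)"

definition cut_mesh :: "'n::finite cutfem \<Rightarrow> (real ^ 'n) set set" where
  "cut_mesh S = {T \<in> mesh S. interior T \<inter> interface S \<noteq> {}}"

definition cut_dom :: "'n::finite cutfem \<Rightarrow> (real ^ 'n) set" where
  "cut_dom S = \<Union>(cut_mesh S)"

definition act_mesh :: "'n::finite cutfem \<Rightarrow> nat \<Rightarrow> (real ^ 'n) set set" where
  "act_mesh S i = {T \<in> mesh S. T \<inter> sub S i \<noteq> {}}"

definition act_dom :: "'n::finite cutfem \<Rightarrow> nat \<Rightarrow> (real ^ 'n) set" where
  "act_dom S i = \<Union>(act_mesh S i)"


(* Functions on a subset of space are represented by their extension by zero to the whole space. *)

definition restr :: "(real ^ 'n::finite) set \<Rightarrow> (real ^ 'n \<Rightarrow> real) \<Rightarrow> real ^ 'n \<Rightarrow> real" where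
  "restr A u x = (if x \<in> A then u x else 0)"

definition Vh :: "'n::finite cutfem \<Rightarrow> (real ^ 'n \<Rightarrow> real) set" where
  "Vh S = {v. continuous_on (closure (dom_of S)) v \<and>
              (\<forall>T\<in>mesh S. \<exists>p\<in>poly_le (deg S). \<forall>x\<in>T. v x = p x) \<and>
              (\<forall>x\<in>frontier (dom_of S). v x = 0) \<and> (\<forall>x. x \<notin> closure (dom_of S) \<longrightarrow> v x = 0)}"

(* Nodes themselves are used as labels. *)

definition I0 :: "'n::finite cutfem \<Rightarrow> (real ^ 'n) set" where
  "I0 S = (\<Union>T\<in>mesh S. lagrange_nodes (deg S) T) \<inter> dom_of S"

definition I\<Gamma> :: "'n::finite cutfem \<Rightarrow> (real ^ 'n) set" where
  "I\<Gamma> S = I0 S \<inter> cut_dom S"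

definition I\<Gamma>_sub :: "'n::finite cutfem \<Rightarrow> nat \<Rightarrow> (real ^ 'n) set" where
  "I\<Gamma>_sub S i = {j \<in> I\<Gamma> S. j \<notin> sub S i}"

definition \<phi> :: "'n::finite cutfem \<Rightarrow> real ^ 'n \<Rightarrow> real ^ 'n \<Rightarrow> real" where
  "\<phi> S j = (THE v. v \<in> Vh S \<and> (\<forall>l\<in>I0 S. v l = (if l = j then 1 else 0)))"

definition \<phi>\<Gamma> :: "'n::finite cutfem \<Rightarrow> real ^ 'n \<Rightarrow> real ^ 'n \<Rightarrow> real" where
  "\<phi>\<Gamma> S j = restr (cut_dom S) (\<phi> S j)"

definition V\<Gamma>_sub :: "'n::finite cutfem \<Rightarrow> nat \<Rightarrow> (real ^ 'n \<Rightarrow> real) set" where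
  "V\<Gamma>_sub S i = {\<lambda>x. \<Sum>j\<in>I\<Gamma>_sub S i. b j * \<phi>\<Gamma> S j x | b. True}"

definition V\<Gamma> :: "'n::finite cutfem \<Rightarrow> (real ^ 'n \<Rightarrow> real) set" where
  "V\<Gamma> S = {\<lambda>x. u x + v x | u v. u \<in> V\<Gamma>_sub S 1 \<and> v \<in> V\<Gamma>_sub S 2}"

definition Q :: "'n::finite cutfem \<Rightarrow> nat \<Rightarrow> (real ^ 'n \<Rightarrow> real) \<Rightarrow> real ^ 'n \<Rightarrow> real" where
  "Q S i u = (THE w. \<exists>b. u = (\<lambda>x. \<Sum>j\<in>I\<Gamma> S. b j * \<phi>\<Gamma> S j x) \<and>
                         w = (\<lambda>x. \<Sum>j\<in>I\<Gamma>_sub S i. b j * \<phi>\<Gamma> S j x))"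

definition L :: "'n::finite cutfem \<Rightarrow> (real ^ 'n \<Rightarrow> real) \<times> (real ^ 'n \<Rightarrow> real) \<Rightarrow>
    nat \<Rightarrow> real ^ 'n \<Rightarrow> real" where
  "L S u i = (\<lambda>x. restr (act_dom S i) (fst u) x + Q S i (snd u) x)"


(* Integrals over the interface are sums over the cut simplices, as in the definition of the
   h-weighted scalar product. *)

definition jumpG :: "(nat \<Rightarrow> real ^ 'n::finite \<Rightarrow> real) \<Rightarrow> real ^ 'n \<Rightarrow> real" where
  "jumpG u x = u 1 x - u 2 x"

definition jump_form :: "'n::finite cutfem \<Rightarrow>
    (nat \<Rightarrow> real ^ 'n \<Rightarrow> real) \<Rightarrow> (nat \<Rightarrow> real ^ 'n \<Rightarrow> real) \<Rightarrow> real" where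
  "jump_form S u v = (\<Sum>T\<in>cut_mesh S. inverse (diameter T) *
     (LINT x:T \<inter> interface S|surf. jumpG u x * jumpG v x))"

definition nitsche :: "'n::finite cutfem \<Rightarrow>
    (nat \<Rightarrow> real ^ 'n \<Rightarrow> real) \<Rightarrow> (nat \<Rightarrow> real ^ 'n \<Rightarrow> real) \<Rightarrow> real" where
  "nitsche S u v = (\<Sum>T\<in>cut_mesh S. LINT x:T \<inter> interface S|surf.
     inner (\<Sum>i\<in>{1,2}. wt S i x *\<^sub>R (- (coef S i *\<^sub>R lgrad (deg S) (v i) T x))) (nrm S x) * jumpG u x)"

definition bulk :: "'n::finite cutfem \<Rightarrow>
    (nat \<Rightarrow> real ^ 'n \<Rightarrow> real) \<Rightarrow> (nat \<Rightarrow> real ^ 'n \<Rightarrow> real) \<Rightarrow> real" where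
  "bulk S u v = (\<Sum>i\<in>{1,2}. \<Sum>T\<in>act_mesh S i. LINT x:T \<inter> sub S i|lborel.
     coef S i * inner (lgrad (deg S) (u i) T x) (lgrad (deg S) (v i) T x))"

(* The order of the two neighbours and the sign of the face normal are chosen arbitrarily; in
   products of two jumps the choice cancels. *)

definition face_nbrs :: "'n::finite cutfem \<Rightarrow> (real ^ 'n) set \<Rightarrow> (real ^ 'n) set \<times> (real ^ 'n) set" where
  "face_nbrs S F = (SOME (T, T'). T \<in> mesh S \<and> T' \<in> mesh S \<and> T \<noteq> T' \<and> T \<inter> T' = F)"

definition face_nrm :: "(real ^ 'n::finite) set \<Rightarrow> real ^ 'n" where
  "face_nrm F = (SOME n. norm n = 1 \<and> (\<forall>x\<in>F. \<forall>y\<in>F. inner n (x - y) = 0))"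

definition face_jump :: "'n::finite cutfem \<Rightarrow> nat \<Rightarrow> (real ^ 'n) set \<Rightarrow>
    (real ^ 'n \<Rightarrow> real) \<Rightarrow> real ^ 'n \<Rightarrow> real" where
  "face_jump S l F u x =
     dir_deriv l (face_nrm F) (lpoly (deg S) u (fst (face_nbrs S F))) x -
     dir_deriv l (face_nrm F) (lpoly (deg S) u (snd (face_nbrs S F))) x"

definition ghost_form :: "'n::finite cutfem \<Rightarrow>
    (nat \<Rightarrow> real ^ 'n \<Rightarrow> real) \<Rightarrow> (nat \<Rightarrow> real ^ 'n \<Rightarrow> real) \<Rightarrow> real" where
  "ghost_form S u v = bet S * (\<Sum>i\<in>{1,2}. \<Sum>l=1..deg S. \<Sum>F\<in>ghost S i.
     diameter F ^ (2 * l - 1) * (LINT x:F|surf. face_jump S l F (u i) x * face_jump S l F (v i) x))"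

definition Ah :: "'n::finite cutfem \<Rightarrow>
    (nat \<Rightarrow> real ^ 'n \<Rightarrow> real) \<Rightarrow> (nat \<Rightarrow> real ^ 'n \<Rightarrow> real) \<Rightarrow> real" where
  "Ah S u v = bulk S u v + nitsche S u v + nitsche S v u +
     coef_avg S * gam S * jump_form S u v + ghost_form S u v"

definition Ahat :: "'n::finite cutfem \<Rightarrow> (real ^ 'n \<Rightarrow> real) \<times> (real ^ 'n \<Rightarrow> real) \<Rightarrow>
    (real ^ 'n \<Rightarrow> real) \<times> (real ^ 'n \<Rightarrow> real) \<Rightarrow> real" where
  "Ahat S u v = Ah S (L S u) (L S v)"

definition energy :: "'n::finite cutfem \<Rightarrow> (nat \<Rightarrow> real ^ 'n \<Rightarrow> real) \<Rightarrow> real" where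
  "energy S u = (\<Sum>i\<in>{1,2}. \<Sum>T\<in>act_mesh S i. LINT x:T|lborel. (norm (lgrad (deg S) (u i) T x))\<^sup>2) +
     jump_form S u u"


definition norm_equivalence :: "'n::finite cutfem \<Rightarrow> real \<Rightarrow> real \<Rightarrow> bool" where
  "norm_equivalence S a b \<longleftrightarrow> (\<forall>u0\<in>Vh S. \<forall>uG\<in>V\<Gamma> S.
     a * energy S (L S (u0, uG)) \<le> Ahat S (u0, uG) (u0, uG) \<and>
     Ahat S (u0, uG) (u0, uG) \<le> b * energy S (L S (u0, uG)))"

(* The interface is of class C^{1,1} with quantitative constants r and K, hence in particular every
   smooth interface is covered: near each of its points the subdomains are the parts of the domain
   where a function rho, with K-Lipschitz gradient g of unit length at that point, is negative
   resp. positive.  The interface may end at the boundary of the domain. *)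
definition smooth_interface :: "'n::finite cutfem \<Rightarrow> real \<Rightarrow> real \<Rightarrow> bool" where
  "smooth_interface S r K \<longleftrightarrow> (\<forall>x0\<in>interface S. \<exists>\<rho> g.
     (\<forall>x\<in>ball x0 r. (\<rho> has_derivative inner (g x)) (at x)) \<and>
     lipschitz_on K (ball x0 r) g \<and> norm (g x0) = 1 \<and>
     sub S 1 \<inter> ball x0 r = {x \<in> dom_of S \<inter> ball x0 r. \<rho> x < 0} \<and>
     sub S 2 \<inter> ball x0 r = {x \<in> dom_of S \<inter> ball x0 r. \<rho> x > 0} \<and>
     (\<forall>x\<in>interface S \<inter> ball x0 r. g x \<noteq> 0 \<and> nrm S x = g x /\<^sub>R norm (g x)))"

definition cutfem_setting :: "'n::finite cutfem \<Rightarrow> bool" where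
  "cutfem_setting S \<longleftrightarrow>
     open (sub S 1) \<and> open (sub S 2) \<and> sub S 1 \<noteq> {} \<and> sub S 2 \<noteq> {} \<and> sub S 1 \<inter> sub S 2 = {} \<and>
     dom_of S = sub S 1 \<union> sub S 2 \<union> (interface S \<inter> dom_of S) \<and>
     simplicial_mesh (dom_of S) (mesh S) \<and>
     I0 S \<inter> interface S = {} \<and>
     (\<forall>i\<in>{1,2}. wt S i \<in> borel_measurable borel \<and> (\<forall>x. 0 \<le> wt S i x)) \<and>
     (\<forall>x. wt S 1 x + wt S 2 x = 1) \<and>
     min (coef S 1) (coef S 2) \<le> coef_avg S \<and> coef_avg S \<le> max (coef S 1) (coef S 2) \<and>
     (\<forall>i\<in>{1,2}. \<forall>F\<in>ghost S i. F \<subseteq> cut_dom S \<and>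
        (\<exists>T\<in>act_mesh S i. \<exists>T'\<in>act_mesh S i. T \<noteq> T' \<and> F = T \<inter> T' \<and> F facet_of T))"


definition hat_basis :: "'n::finite cutfem \<Rightarrow> (real ^ 'n) list \<Rightarrow> (real ^ 'n) list \<Rightarrow>
    ((real ^ 'n \<Rightarrow> real) \<times> (real ^ 'n \<Rightarrow> real)) list" where
  "hat_basis S ns gs = map (\<lambda>j. (\<phi> S j, \<lambda>x. 0)) ns @ map (\<lambda>j. (\<lambda>x. 0, \<phi>\<Gamma> S j)) gs"

definition stiffness :: "'n::finite cutfem \<Rightarrow> (real ^ 'n) list \<Rightarrow> (real ^ 'n) list \<Rightarrow> real mat" where
  "stiffness S ns gs = (let b = hat_basis S ns gs in
     Matrix.mat (length b) (length b) (\<lambda>(i, j). Ahat S (b ! j) (b ! i)))"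

definition block_diagonal :: "nat \<Rightarrow> real mat \<Rightarrow> real mat" where
  "block_diagonal n A = (case split_block A n n of (A0, _, _, A1) \<Rightarrow> diag_block_mat [A0, A1])"

definition spectral_cond :: "real mat \<Rightarrow> real" where
  "spectral_cond M = Max (spectrum M) / Min (spectrum M)"

end

(* The splitting into the basis functions of V_h and the extra ones is stable as soon as the energy
   of the extra part is bounded by the energy of the whole pair.  On the cut simplices the jump of the
   pair coincides with one continuous finite element function w, whose nodal values are up to sign the
   coefficients of the extra part; hence the gradient of the extra part on a cut simplex T is bounded
   by h_T^(d-2) max_T |w|^2.  To bound this maximum, start from a point of Gamma in T.  The gradients
   of w on the neighbouring cut simplices control how much w varies along Gamma.  Within a distance
   of order h_T, either Gamma leaves the domain, where w = 0, or it contains a piece of surface measure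
   of order h_T^(d-1), on which the weighted L2 norm of w over Gamma controls w. Neighbouring cut
   simplices share an edge at each interior point of Gamma, because vertices are nodes and no node
   lies on Gamma, so their sizes are comparable without quasi-uniformity. *)

theory Submission
  imports Defs "HOL-Library.Function_Algebras"
begin

text \<open>The walk along the interface is confined to cut simplices sharing one vertex, whose hat
  function is at least 1/(d+1) at the starting point. Shape regularity bounds the number of
  simplices at a vertex; this bounds the number of terms and, along chains of neighbours, the ratio
  of their sizes. Within a small multiple of h_T of the start that hat function cannot become small,
  so the walk does not leave this star. This replaces the patches of comparable elements of a
  quasi-uniform mesh. No smallness of h_T is assumed: the piece of the interface has width
  \<open>key_width\<close> times h_T, and \<open>key_width\<close> is small enough, relative to the
  diameter of the domain, for the piece to fit into a ball where the interface is a graph. The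
  surface measure is defined by coverings, so its bounds have to come from that graph as well. All
  constants are fixed before the discretization; alpha, gamma and beta enter them only through the
  constants \<open>a\<close> and \<open>b\<close> of the norm equivalence. The mixed term of the two
  parts is handled by nonnegativity of the form at two scalings of the extra part.\<close>

no_notation vec_index (infixl "$" 100)
hide_const (open) Order.top

section \<open>Hausdorff measure\<close>

abbreviation hcost :: "nat \<Rightarrow> 'a::metric_space set \<Rightarrow> ennreal" where
  "hcost s E \<equiv> (if E = {} then 0 else ennreal (unit_ball_vol (real s) * (diameter E / 2) ^ s))"

lemma hausdorff_pre_le:
  assumes "A \<subseteq> (\<Union>n. E n)" "\<And>n. bounded (E n)" "\<And>n. diameter (E n) \<le> \<delta>"
  shows "hausdorff_pre s \<delta> A \<le> (\<Sum>n. hcost s (E n))"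
  unfolding hausdorff_pre_def using assms by (intro Inf_lower) blast

lemma hausdorff_pre_ge:
  assumes "\<And>E. A \<subseteq> (\<Union>n. E n) \<Longrightarrow> (\<And>n. bounded (E n)) \<Longrightarrow> (\<And>n. diameter (E n) \<le> \<delta>) \<Longrightarrow>
    c \<le> (\<Sum>n. hcost s (E n))"
  shows "c \<le> hausdorff_pre s \<delta> A"
  unfolding hausdorff_pre_def using assms by (intro Inf_greatest) blast

lemma hausdorff_pre_approx:
  assumes "hausdorff_pre s \<delta> A < top" "0 < e"
  obtains E where "A \<subseteq> (\<Union>n. E n)" "\<And>n. bounded (E n)" "\<And>n. diameter (E n) \<le> \<delta>"
    "(\<Sum>n. hcost s (E n)) \<le> hausdorff_pre s \<delta> A + ennreal e"
proof -
  have "hausdorff_pre s \<delta> A < hausdorff_pre s \<delta> A + ennreal e"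
    using assms ennreal_add_left_cancel_less[of "hausdorff_pre s \<delta> A" 0 "ennreal e"] by auto
  then obtain y where "y \<in> {(\<Sum>n. hcost s (E n)) | E.
          A \<subseteq> (\<Union>n::nat. E n) \<and> (\<forall>n. bounded (E n) \<and> diameter (E n) \<le> \<delta>)}"
     "y < hausdorff_pre s \<delta> A + ennreal e"
    unfolding hausdorff_pre_def Inf_less_iff by blast
  then show thesis using that by (auto intro: less_imp_le)
qed

lemma hausdorff_pre_mono:
  assumes "A \<subseteq> B" shows "hausdorff_pre s \<delta> A \<le> hausdorff_pre s \<delta> B"
  by (rule hausdorff_pre_ge, rule hausdorff_pre_le) (use assms in auto)

lemma hausdorff_pre_antimono:
  assumes "\<delta>' \<le> \<delta>" shows "hausdorff_pre s \<delta> A \<le> hausdorff_pre s \<delta>' A"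
  by (rule hausdorff_pre_ge, rule hausdorff_pre_le) (use assms in \<open>auto intro: order_trans\<close>)

lemma hausdorff_pre_le_outer: "0 < \<delta> \<Longrightarrow> hausdorff_pre s \<delta> A \<le> hausdorff_outer s A"
  unfolding hausdorff_outer_def by (intro SUP_upper) auto

lemma hausdorff_outer_mono: "A \<subseteq> B \<Longrightarrow> hausdorff_outer s A \<le> hausdorff_outer s B"
  unfolding hausdorff_outer_def by (intro SUP_mono) (use hausdorff_pre_mono in blast)

lemma hausdorff_outer_empty [simp]: "hausdorff_outer s {} = 0"
proof -
  have "hausdorff_pre s \<delta> ({}::'a::metric_space set) \<le> 0" if "0 < \<delta>" for \<delta>
    using hausdorff_pre_le[of "{}" "\<lambda>_. {}" \<delta> s] that by simp
  then show ?thesis unfolding hausdorff_outer_def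
    by (intro antisym SUP_least) auto
qed

text \<open>Covers of the \<open>A n\<close> that are optimal up to \<open>e / 2^(n+1)\<close> are
  merged into one sequence by the pairing function; the errors add up to \<open>e\<close>.\<close>

lemma hausdorff_pre_countably_subadditive:
  "hausdorff_pre s \<delta> (\<Union>n. A n) \<le> (\<Sum>n. hausdorff_pre s \<delta> (A n))"
proof (rule ennreal_le_epsilon)
  fix e :: real assume fin: "(\<Sum>n. hausdorff_pre s \<delta> (A n)) < top" and e: "0 < e"
  have "\<exists>E. A n \<subseteq> (\<Union>k. E k) \<and> (\<forall>k. bounded (E k)) \<and> (\<forall>k. diameter (E k) \<le> \<delta>) \<and>
    (\<Sum>k. hcost s (E k)) \<le> hausdorff_pre s \<delta> (A n) + ennreal (e * (1/2)^Suc n)" for n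
  proof -
    have "hausdorff_pre s \<delta> (A n) < top" using fin ennreal_suminf_lessD by blast
    moreover have "0 < e * (1/2)^Suc n" using e by simp
    ultimately show ?thesis by (rule hausdorff_pre_approx) blast
  qed
  then obtain E where E0: "\<forall>n. A n \<subseteq> (\<Union>k. E n k) \<and> (\<forall>k. bounded (E n k)) \<and> (\<forall>k. diameter (E n k) \<le> \<delta>) \<and>
    (\<Sum>k. hcost s (E n k)) \<le> hausdorff_pre s \<delta> (A n) + ennreal (e * (1/2)^Suc n)"
    by (rule choice[OF allI, THEN exE])
  then have E: "\<And>n. A n \<subseteq> (\<Union>k. E n k)" "\<And>n k. bounded (E n k)"
    "\<And>n k. diameter (E n k) \<le> \<delta>"
    "\<And>n. (\<Sum>k. hcost s (E n k)) \<le> hausdorff_pre s \<delta> (A n) + ennreal (e * (1/2)^Suc n)"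
    by blast+
  let ?F = "\<lambda>m. E (fst (prod_decode m)) (snd (prod_decode m))"
  have "hausdorff_pre s \<delta> (\<Union>n. A n) \<le> (\<Sum>m. hcost s (?F m))"
  proof (rule hausdorff_pre_le)
    show "(\<Union>n. A n) \<subseteq> (\<Union>m. ?F m)"
    proof
      fix x assume "x \<in> (\<Union>n. A n)"
      then obtain n k where "x \<in> E n k" using E(1) by blast
      then have "x \<in> ?F (prod_encode (n, k))" by simp
      then show "x \<in> (\<Union>m. ?F m)" by blast
    qed
  qed (use E in auto)
  also have "\<dots> = (\<Sum>n. \<Sum>k. hcost s (E n k))"
    by (rule suminf_ennreal_2dimen[of _ "\<lambda>p. hcost s (E (fst p) (snd p))"]) (simp only: fst_conv snd_conv)
  also have "\<dots> \<le> (\<Sum>n. hausdorff_pre s \<delta> (A n) + ennreal (e * (1/2)^Suc n))"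
    by (intro suminf_le E(4)) auto
  also have "\<dots> = (\<Sum>n. hausdorff_pre s \<delta> (A n)) + (\<Sum>n. ennreal (e * (1/2)^Suc n))"
    by (rule suminf_add[symmetric]) auto
  also have "(\<Sum>n. ennreal (e * (1/2)^Suc n)) = ennreal e"
    using e sums_mult[OF power_half_series, of e] by (intro suminf_ennreal_eq) auto
  finally show "hausdorff_pre s \<delta> (\<Union>n. A n) \<le> (\<Sum>n. hausdorff_pre s \<delta> (A n)) + ennreal e" .
qed

lemma hausdorff_outer_countably_subadditive:
  "hausdorff_outer s (\<Union>n. A n) \<le> (\<Sum>n. hausdorff_outer s (A n))"
  unfolding hausdorff_outer_def[of s "\<Union>n. A n"]
proof (rule SUP_least)
  fix \<delta> :: real assume "\<delta> \<in> {0<..}"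
  then have "(\<Sum>n. hausdorff_pre s \<delta> (A n)) \<le> (\<Sum>n. hausdorff_outer s (A n))"
    by (intro suminf_le hausdorff_pre_le_outer) auto
  with hausdorff_pre_countably_subadditive
  show "hausdorff_pre s \<delta> (\<Union>n. A n) \<le> (\<Sum>n. hausdorff_outer s (A n))"
    by (rule order_trans)
qed

lemma hausdorff_outer_Un: "hausdorff_outer s (A \<union> B) \<le> hausdorff_outer s A + hausdorff_outer s B"
proof -
  let ?C = "\<lambda>n::nat. if n = 0 then A else if n = 1 then B else {}"
  have "A \<union> B \<subseteq> (\<Union>n. ?C n)"
  proof
    fix x assume "x \<in> A \<union> B"
    then have "x \<in> ?C 0 \<or> x \<in> ?C 1" by auto
    then show "x \<in> (\<Union>n. ?C n)" by blast
  qed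
  then have "hausdorff_outer s (A \<union> B) \<le> (\<Sum>n. hausdorff_outer s (?C n))"
    using hausdorff_outer_countably_subadditive hausdorff_outer_mono order_trans by blast
  also have "\<dots> = (\<Sum>n\<in>{0,1}. hausdorff_outer s (?C n))"
    by (intro suminf_finite) auto
  finally show ?thesis by simp
qed

lemma hausdorff_outer_Union_finite:
  assumes "finite I" "\<And>i. i \<in> I \<Longrightarrow> hausdorff_outer s (A i) < top"
  shows "hausdorff_outer s (\<Union>i\<in>I. A i) < top"
  using assms
proof (induction I rule: finite_induct)
  case (insert i I)
  have "hausdorff_outer s (\<Union>i\<in>insert i I. A i) \<le> hausdorff_outer s (A i) + hausdorff_outer s (\<Union>i\<in>I. A i)"
    using hausdorff_outer_Un[of s "A i" "\<Union>i\<in>I. A i"] by simp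
  also have "\<dots> < top" using insert by simp
  finally show ?case .
qed simp

text \<open>A covering set of diameter below \<open>d\<close> cannot meet both sets, so every fine
  cover of the union splits into a cover of \<open>A\<close> and one of \<open>B\<close>. This is
  the property of a metric outer measure that makes closed sets measurable.\<close>

lemma hausdorff_outer_separated:
  assumes d: "0 < d" and sep: "\<And>a b. a \<in> A \<Longrightarrow> b \<in> B \<Longrightarrow> d \<le> dist a b"
  shows "hausdorff_outer s A + hausdorff_outer s B \<le> hausdorff_outer s (A \<union> B)"
proof -
  have pre: "hausdorff_pre s \<delta> A + hausdorff_pre s \<delta> B \<le> hausdorff_pre s \<delta> (A \<union> B)"
    if \<delta>: "0 < \<delta>" "\<delta> < d" for \<delta>
  proof (rule hausdorff_pre_ge)
    fix E :: "nat \<Rightarrow> 'a set"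
    assume E: "A \<union> B \<subseteq> (\<Union>n. E n)" "\<And>n. bounded (E n)" "\<And>n. diameter (E n) \<le> \<delta>"
    let ?F = "\<lambda>n. if E n \<inter> A = {} then {} else E n"
    let ?G = "\<lambda>n. if E n \<inter> B = {} then {} else E n"
    have disj: "E n \<inter> A = {} \<or> E n \<inter> B = {}" for n
    proof (rule ccontr)
      assume "\<not> ?thesis"
      then obtain a b where "a \<in> E n" "a \<in> A" "b \<in> E n" "b \<in> B" by blast
      then have "dist a b \<le> \<delta>" using diameter_bounded_bound[OF E(2)] E(3) order_trans by blast
      with sep \<open>a \<in> A\<close> \<open>b \<in> B\<close> \<delta> show False by force
    qed
    have "A \<subseteq> (\<Union>n. ?F n)" "B \<subseteq> (\<Union>n. ?G n)"
      using E(1) by (fastforce split: if_splits)+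
    then have "hausdorff_pre s \<delta> A \<le> (\<Sum>n. hcost s (?F n))"
      using E \<delta> by (intro hausdorff_pre_le) auto
    moreover have "hausdorff_pre s \<delta> B \<le> (\<Sum>n. hcost s (?G n))"
      using E \<delta> \<open>B \<subseteq> (\<Union>n. ?G n)\<close> by (intro hausdorff_pre_le) auto
    ultimately have "hausdorff_pre s \<delta> A + hausdorff_pre s \<delta> B \<le>
        (\<Sum>n. hcost s (?F n)) + (\<Sum>n. hcost s (?G n))" by (rule add_mono)
    also have "\<dots> = (\<Sum>n. hcost s (?F n) + hcost s (?G n))" by (rule suminf_add) auto
    also have "\<dots> \<le> (\<Sum>n. hcost s (E n))"
      using disj by (intro suminf_le) (auto split: if_splits)
    finally show "hausdorff_pre s \<delta> A + hausdorff_pre s \<delta> B \<le> (\<Sum>n. hcost s (E n))" .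
  qed
  have "hausdorff_outer s A + hausdorff_outer s B
      = (SUP \<delta>\<in>{0<..}. hausdorff_pre s \<delta> A + hausdorff_pre s \<delta> B)"
    unfolding hausdorff_outer_def
  proof (rule SUP_add_directed_ennreal[symmetric])
    fix i j :: real assume ij: "i \<in> {0<..}" "j \<in> {0<..}"
    show "\<exists>k\<in>{0<..}. hausdorff_pre s i A + hausdorff_pre s j B \<le> hausdorff_pre s k A + hausdorff_pre s k B"
      by (rule bexI[of _ "min i j"]) (use ij in \<open>auto intro!: add_mono hausdorff_pre_antimono\<close>)
  qed
  also have "\<dots> \<le> hausdorff_outer s (A \<union> B)"
  proof (rule SUP_least)
    fix \<delta> :: real assume \<delta>: "\<delta> \<in> {0<..}"
    let ?m = "min \<delta> (d/2)"
    have "hausdorff_pre s \<delta> A + hausdorff_pre s \<delta> B \<le> hausdorff_pre s ?m A + hausdorff_pre s ?m B"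
      by (intro add_mono hausdorff_pre_antimono) auto
    also have "\<dots> \<le> hausdorff_pre s ?m (A \<union> B)" using \<delta> d by (intro pre) auto
    also have "\<dots> \<le> hausdorff_outer s (A \<union> B)" using \<delta> d by (intro hausdorff_pre_le_outer) auto
    finally show "hausdorff_pre s \<delta> A + hausdorff_pre s \<delta> B \<le> hausdorff_outer s (A \<union> B)" .
  qed
  finally show ?thesis .
qed

text \<open>The complement of a closed set is exhausted by the sets of points at distance at least
  \<open>1/(n+1)\<close>; the layers in between of equal parity are mutually separated, so their outer
  measures are summable.\<close>

lemma hausdorff_outer_closed_split:
  assumes C: "closed C"
  shows "hausdorff_outer s (A \<inter> C) + hausdorff_outer s (A - C) \<le> hausdorff_outer s A"
proof (cases "C = {} \<or> hausdorff_outer s A = top")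
  case True
  then show ?thesis by (auto simp: top_unique)
next
  case False
  then have C0: "C \<noteq> {}" and fin: "hausdorff_outer s A < top" by (auto simp: top.not_eq_extremum)
  define f where "f = (hausdorff_outer s :: 'a set \<Rightarrow> ennreal)"
  define D where "D x = infdist x C" for x :: 'a
  define An where "An n = {x\<in>A. 1 / (real n + 1) \<le> D x}" for n :: nat
  define R where "R n = {x\<in>A. 1 / (real n + 2) \<le> D x \<and> D x < 1 / (real n + 1)}" for n :: nat
  have D_lip: "D x - D y \<le> dist x y" for x y
    unfolding D_def using infdist_triangle[of x C y] by (simp add: dist_commute)
  have D0: "x \<in> C \<Longrightarrow> D x = 0" for x unfolding D_def by simp
  have Dpos: "x \<notin> C \<Longrightarrow> D x > 0" for x
    unfolding D_def using in_closed_iff_infdist_zero[OF C C0, of x] infdist_nonneg[of x C] by linarith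
  have part: "(\<Sum>i<N. f (R (2*i+p))) \<le> f (\<Union>i<N. R (2*i+p))" for N p
  proof (induction N)
    case (Suc N)
    have "(\<Sum>i<Suc N. f (R (2*i+p))) \<le> f (\<Union>i<N. R (2*i+p)) + f (R (2*N+p))"
      using Suc by (simp add: add_mono)
    also have "\<dots> \<le> f ((\<Union>i<N. R (2*i+p)) \<union> R (2*N+p))"
      unfolding f_def
    \<comment> \<open>The separation constant needs \<open>2*N+p\<close> to be positive, because
      \<open>1 / 0\<close> is 0. For \<open>N = 0\<close> the first union is empty and nothing is to
      be separated.\<close>
    proof (cases "N = 0")
      case False
      show "hausdorff_outer s (\<Union>i<N. R (2*i+p)) + hausdorff_outer s (R (2*N+p))
          \<le> hausdorff_outer s ((\<Union>i<N. R (2*i+p)) \<union> R (2*N+p))"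
      proof (rule hausdorff_outer_separated)
        show "0 < 1 / real (2*N+p) - 1 / (real (2*N+p) + 1)"
          using False by (simp add: divide_strict_left_mono)
        fix a b assume "a \<in> (\<Union>i<N. R (2*i+p))" and b: "b \<in> R (2*N+p)"
        then obtain i where i: "i < N" "a \<in> R (2*i+p)" by blast
        have "1 / real (2*N+p) \<le> 1 / (real (2*i+p) + 2)"
          using i by (intro divide_left_mono) auto
        also have "\<dots> \<le> D a" using i by (auto simp: R_def)
        finally have "1 / real (2*N+p) \<le> D a" .
        moreover have "D b < 1 / (real (2*N+p) + 1)" using b by (auto simp: R_def)
        ultimately show "1 / real (2*N+p) - 1 / (real (2*N+p) + 1) \<le> dist a b"
          using D_lip[of a b] by linarith
      qed
    qed simp
    also have "(\<Union>i<N. R (2*i+p)) \<union> R (2*N+p) = (\<Union>i<Suc N. R (2*i+p))"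
      by (auto simp: lessThan_Suc)
    finally show ?case .
  qed simp
  have sum_le: "(\<Sum>i. f (R (2*i+p))) \<le> f A" for p
  proof (rule suminf_le_const)
    show "(\<Sum>i<N. f (R (2*i+p))) \<le> f A" for N
      using part[of p N] hausdorff_outer_mono[of "\<Union>i<N. R (2*i+p)" A s]
      by (auto simp: f_def R_def intro: order_trans)
  qed simp
  have Rfin: "f (R n) < top" for n
    using hausdorff_outer_mono[of "R n" A s] fin by (auto simp: f_def R_def intro: le_less_trans)
  define g where "g p i = enn2real (f (R (2*i+p)))" for p i
  have fg: "f (R (2*i+p)) = ennreal (g p i)" for i p
    unfolding g_def using Rfin by (simp add: top.not_eq_extremum)
  have summ: "summable (g p)" for p
  proof (rule summable_suminf_not_top)
    show "(\<Sum>i. ennreal (g p i)) \<noteq> top"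
      using le_less_trans[OF sum_le[of p] fin[folded f_def]] unfolding fg by simp
  qed (simp add: g_def)
  have "f (A \<inter> C) + f (A - C) \<le> f A"
  proof (rule ennreal_le_epsilon)
    fix e :: real assume e: "0 < e"
    obtain N0 where N0: "\<forall>n\<ge>N0. norm (\<Sum>i. g 0 (i+n)) < e/2"
      using suminf_exist_split[OF _ summ[of 0], of "e/2"] e by auto
    obtain N1 where N1: "\<forall>n\<ge>N1. norm (\<Sum>i. g 1 (i+n)) < e/2"
      using suminf_exist_split[OF _ summ[of 1], of "e/2"] e by auto
    define m where "m = max N0 N1"
    have tail: "(\<Sum>i. f (R (2*(i+m)+p))) \<le> ennreal (e/2)" if "p \<in> {0,1}" for p
    proof -
      have "(\<Sum>i. f (R (2*(i+m)+p))) = (\<Sum>i. ennreal (g p (i+m)))" by (simp only: fg)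
      also have "\<dots> = ennreal (\<Sum>i. g p (i+m))"
        using summable_ignore_initial_segment[OF summ[of p], of m]
        by (intro suminf_ennreal2) (auto simp: g_def)
      also have "\<dots> \<le> ennreal (e/2)"
        using N0[rule_format, of m] N1[rule_format, of m] that unfolding m_def
        by (intro ennreal_leI) (auto simp del: One_nat_def)
      finally show ?thesis .
    qed
    have "A - C \<subseteq> An (2*m) \<union> ((\<Union>i. R (2*(i+m)+0)) \<union> (\<Union>i. R (2*(i+m)+1)))"
    proof
      fix x assume x: "x \<in> A - C"
      then have px: "D x > 0" using Dpos by auto
      show "x \<in> An (2*m) \<union> ((\<Union>i. R (2*(i+m)+0)) \<union> (\<Union>i. R (2*(i+m)+1)))"
      proof (cases "1 / (real (2*m) + 1) \<le> D x")
        case True then show ?thesis using x by (auto simp: An_def)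
      next
        case False
        define n where "n = (LEAST n. 1 / (real n + 2) \<le> D x)"
        obtain n0 where "1 / D x < real n0" using reals_Archimedean2 by blast
        then have "1 < real n0 * D x" using px by (simp add: pos_divide_less_eq)
        also have "\<dots> \<le> D x * (real n0 + 2)" using px by (simp add: algebra_simps)
        finally have "1 / (real n0 + 2) \<le> D x" by (simp add: pos_divide_le_eq)
        then have n1: "1 / (real n + 2) \<le> D x" unfolding n_def by (rule LeastI)
        have nm: "2*m \<le> n"
        proof (rule ccontr)
          assume "\<not> 2*m \<le> n"
          then have "real n + 2 \<le> real (2*m) + 1" by linarith
          then have "1 / (real (2*m) + 1) \<le> 1 / (real n + 2)" by (intro divide_left_mono) auto
          with n1 False show False by linarith
        qed
        have n2: "D x < 1 / (real n + 1)"
        proof (cases "n = 2*m")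
          case True then show ?thesis using False by simp
        next
          case ne: False
          then have "n - 1 < n" using nm by linarith
          then have "\<not> 1 / (real (n-1) + 2) \<le> D x" unfolding n_def by (rule not_less_Least)
          moreover have "real (n-1) + 2 = real n + 1" using ne nm by auto
          ultimately show ?thesis by (simp add: add.commute not_le)
        qed
        have xR: "x \<in> R n" using x n1 n2 by (auto simp: R_def)
        have "n = 2*((n div 2 - m) + m) + 0 \<or> n = 2*((n div 2 - m) + m) + 1"
          using nm by (cases "even n") (auto elim!: evenE oddE)
        then consider "x \<in> R (2*((n div 2 - m) + m) + 0)" | "x \<in> R (2*((n div 2 - m) + m) + 1)"
          using xR by auto
        then show ?thesis by cases blast+
      qed
    qed
    then have "f (A - C) \<le> f (An (2*m) \<union> ((\<Union>i. R (2*(i+m)+0)) \<union> (\<Union>i. R (2*(i+m)+1))))"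
      unfolding f_def by (rule hausdorff_outer_mono)
    also have "\<dots> \<le> f (An (2*m)) + (f (\<Union>i. R (2*(i+m)+0)) + f (\<Union>i. R (2*(i+m)+1)))"
      unfolding f_def by (meson add_left_mono hausdorff_outer_Un order_trans)
    also have "\<dots> \<le> f (An (2*m)) + (ennreal (e/2) + ennreal (e/2))"
      using tail[of 0] tail[of 1] hausdorff_outer_countably_subadditive[of s "\<lambda>i. R (2*(i+m)+0)"]
         hausdorff_outer_countably_subadditive[of s "\<lambda>i. R (2*(i+m)+1)"]
      unfolding f_def by (intro add_mono order_refl) (auto intro: order_trans)
    also have "ennreal (e/2) + ennreal (e/2) = ennreal e"
      using e by (simp flip: ennreal_plus)
    finally have "f (A \<inter> C) + f (A - C) \<le> (f (A \<inter> C) + f (An (2*m))) + ennreal e"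
      by (simp add: add.assoc add_left_mono)
    also have "f (A \<inter> C) + f (An (2*m)) \<le> f (A \<inter> C \<union> An (2*m))"
      unfolding f_def
    proof (rule hausdorff_outer_separated)
      show "0 < 1 / (real (2*m) + 1)" by (simp add: add_pos_nonneg)
      fix a b assume "a \<in> A \<inter> C" "b \<in> An (2*m)"
      then show "1 / (real (2*m) + 1) \<le> dist a b"
        using D_lip[of b a] D0[of a] by (auto simp: An_def dist_commute)
    qed
    also have "\<dots> \<le> f A" unfolding f_def An_def by (intro hausdorff_outer_mono) auto
    finally show "f (A \<inter> C) + f (A - C) \<le> f A + ennreal e" by (simp add: add_right_mono)
  qed
  then show ?thesis by (simp add: f_def)
qed

text \<open>Caratheodory's construction with all sets as test sets: the sets that split every set
  additively form a sigma-algebra on which the outer measure is a measure. It contains the closed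
  sets and therefore the Borel sets.\<close>

lemma measure_space_hausdorff: "measure_space UNIV (sets borel) (hausdorff_outer s :: 'a::metric_space set \<Rightarrow> ennreal)"
proof -
  let ?f = "hausdorff_outer s :: 'a set \<Rightarrow> ennreal"
  interpret P: sigma_algebra UNIV "UNIV :: 'a set set"
    using sigma_algebra_Pow[of "UNIV::'a set"] by simp
  have "outer_measure_space UNIV ?f"
    unfolding outer_measure_space_def positive_def increasing_def countably_subadditive_def
    using hausdorff_outer_mono hausdorff_outer_countably_subadditive by auto
  then have ms: "measure_space UNIV (lambda_system UNIV UNIV ?f) ?f"
    by (rule P.caratheodory_lemma)
  then have sa: "sigma_algebra UNIV (lambda_system UNIV UNIV ?f)" by (simp add: measure_space_def)
  have closed_in: "C \<in> lambda_system UNIV UNIV ?f" if "closed C" for C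
    unfolding P.lambda_system_eq using hausdorff_outer_closed_split[OF that, of s] hausdorff_outer_Un[of s]
  proof (simp, intro allI antisym)
    fix x
    show "?f x \<le> ?f (x \<inter> C) + ?f (x - C)"
      using hausdorff_outer_Un[of s "x \<inter> C" "x - C"] by (simp add: Int_Diff_Un)
  qed
  have "sets borel = sigma_sets UNIV (Collect closed :: 'a set set)"
    using borel_eq_closed by (metis sets_measure_of top_greatest Pow_UNIV)
  also have "\<dots> \<subseteq> lambda_system UNIV UNIV ?f"
    using closed_in by (intro sigma_algebra.sigma_sets_subset[OF sa]) auto
  finally have "sets borel \<subseteq> lambda_system UNIV UNIV ?f" .
  moreover have "sigma_algebra UNIV (sets (borel::'a measure))"
    using sets.sigma_algebra_axioms[of "borel::'a measure"] by simp
  ultimately show ?thesis using measure_down[OF ms] by blast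
qed

lemma sets_hausdorff [simp, measurable_cong]: "sets (hausdorff s) = sets borel"
  unfolding hausdorff_def by (simp add: sigma_algebra.sets_measure_of_eq sigma_algebra.sigma_sets_eq
      sets.sigma_algebra_axioms[of borel, simplified])

lemma space_hausdorff [simp]: "space (hausdorff s) = UNIV"
  unfolding hausdorff_def by (simp add: space_measure_of_conv)

lemma emeasure_hausdorff:
  assumes "A \<in> sets borel" shows "emeasure (hausdorff s) A = hausdorff_outer s A"
proof -
  have m: "measure_space UNIV (sets borel) (hausdorff_outer s :: 'a set \<Rightarrow> ennreal)"
    by (rule measure_space_hausdorff)
  have sa: "sigma_algebra UNIV (sets (borel::'a measure))"
    using sets.sigma_algebra_axioms[of "borel::'a measure"] by simp
  show ?thesis unfolding hausdorff_def
    using m assms sa by (intro emeasure_measure_of_sigma) (auto simp: measure_space_def)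
qed

text \<open>The projection of \<open>M\<close> along coordinate \<open>i\<close> contains a cube of
  half width \<eta>. Each covering set is thickened to a box that spans a fixed interval of length 2
  in direction \<open>i\<close>; these boxes cover the box over the cube, so that full-dimensional
  Lebesgue measure can be compared instead of a measure on the projection.\<close>

lemma hausdorff_outer_lower_bound:
  fixes M :: "(real ^ 'n::finite) set" and i :: 'n
  assumes \<eta>: "0 < \<eta>"
    and proj: "\<And>z. (\<And>j. j \<noteq> i \<Longrightarrow> \<bar>z $ j - x $ j\<bar> \<le> \<eta>) \<Longrightarrow> \<exists>m\<in>M. \<forall>j. j \<noteq> i \<longrightarrow> m $ j = z $ j"
  shows "ennreal (unit_ball_vol (real (CARD('n) - 1)) * (\<eta> / 2) ^ (CARD('n) - 1))
    \<le> hausdorff_outer (CARD('n) - 1) M"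
proof -
  let ?s = "CARD('n) - 1"
  define box where "box c D = cbox (\<chi> j. if j = i then x $ i - 1 else c $ j - D)
      (\<chi> j. if j = i then x $ i + 1 else c $ j + D)" for c :: "real ^ 'n" and D :: real
  have vol: "emeasure lborel (box c D) = ennreal (2 * (2 * D) ^ ?s)" if "0 \<le> D" for c D
  proof -
    let ?a = "\<chi> j. if j = i then x $ i - 1 else c $ j - D"
    let ?b = "\<chi> j. if j = i then x $ i + 1 else c $ j + D"
    have ne: "cbox ?a ?b \<noteq> {}" using that by (simp add: interval_ne_empty_cart)
    have "measure lborel (cbox ?a ?b) = (\<Prod>j\<in>UNIV. ?b $ j - ?a $ j)"
      using content_cbox_cart[OF ne] .
    also have "\<dots> = (\<Prod>j\<in>UNIV. if j = i then 2 else 2 * D)" by (intro prod.cong) auto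
    also have "\<dots> = 2 * (\<Prod>j\<in>UNIV - {i}. if j = i then 2 else 2 * D)"
      by (subst prod.remove[of _ i]) auto
    also have "(\<Prod>j\<in>UNIV - {i}. if j = i then 2 else 2 * D) = (\<Prod>j\<in>UNIV - {i}. 2 * D)"
      by (intro prod.cong) auto
    also have "\<dots> = (2 * D) ^ ?s" by (simp add: card_Diff_singleton)
    finally have "measure lborel (cbox ?a ?b) = 2 * (2 * D) ^ ?s" .
    moreover have "emeasure lborel (cbox ?a ?b) = ennreal (measure lborel (cbox ?a ?b))"
      using emeasure_lborel_cbox_finite[of ?a ?b]
      by (intro emeasure_eq_ennreal_measure) (auto simp: top.not_eq_extremum)
    ultimately show ?thesis unfolding box_def by simp
  qed
  have "ennreal (unit_ball_vol (real ?s) * (\<eta> / 2) ^ ?s) \<le> hausdorff_pre ?s 1 M"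
  proof (rule hausdorff_pre_ge)
    fix E :: "nat \<Rightarrow> (real ^ 'n) set"
    assume E: "M \<subseteq> (\<Union>n. E n)" "\<And>n. bounded (E n)" "\<And>n. diameter (E n) \<le> 1"
    define c where "c n = (SOME y. y \<in> E n)" for n
    have c: "E n \<noteq> {} \<Longrightarrow> c n \<in> E n" for n unfolding c_def by (simp add: some_in_eq)
    have d0: "0 \<le> diameter (E n)" for n using E(2) by (rule diameter_ge_0)
    define B where "B n = (if E n = {} then {} else box (c n) (diameter (E n)))" for n
    have "box x \<eta> \<subseteq> (\<Union>n. B n)"
    proof
      fix z assume z: "z \<in> box x \<eta>"
      have "\<bar>z $ j - x $ j\<bar> \<le> \<eta>" if "j \<noteq> i" for j
        using z that unfolding box_def mem_box_cart by (auto dest: spec[of _ j])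
      then obtain m where m: "m \<in> M" "\<And>j. j \<noteq> i \<Longrightarrow> m $ j = z $ j" using proj by blast
      then obtain n where n: "m \<in> E n" using E(1) by blast
      have dd: "\<bar>m $ j - c n $ j\<bar> \<le> diameter (E n)" for j
        using diameter_bounded_bound[OF E(2) n, of "c n"] c[of n] n component_le_norm_cart[of "m - c n" j]
        by (fastforce simp: dist_norm)
      have "z \<in> box (c n) (diameter (E n))"
        unfolding box_def mem_box_cart
      proof
        fix j
        show "(\<chi> j. if j = i then x $ i - 1 else c n $ j - diameter (E n)) $ j \<le> z $ j \<and>
          z $ j \<le> (\<chi> j. if j = i then x $ i + 1 else c n $ j + diameter (E n)) $ j"
        proof (cases "j = i")
          case True
          then show ?thesis using z unfolding box_def mem_box_cart by (auto dest: spec[of _ i])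
        next
          case False
          then show ?thesis using dd[of j] m(2)[of j] by (auto simp: abs_le_iff)
        qed
      qed
      then have "z \<in> B n" using n by (auto simp: B_def)
      then show "z \<in> (\<Union>n. B n)" by blast
    qed
    then have "emeasure lborel (box x \<eta>) \<le> emeasure lborel (\<Union>n. B n)"
      by (intro emeasure_mono) (auto simp: B_def box_def)
    also have "\<dots> \<le> (\<Sum>n. emeasure lborel (B n))"
      by (intro emeasure_subadditive_countably) (auto simp: B_def box_def)
    finally have le: "ennreal (2 * (2 * \<eta>) ^ ?s) \<le> (\<Sum>n. emeasure lborel (B n))"
      using vol[of \<eta> x] \<eta> by simp
    \<comment> \<open>\<open>?K\<close> converts the volume \<open>2 * (2 * D) ^ ?s\<close> of a box
      into the cost of a set of diameter \<open>D\<close>, which is the volume of a ball of radius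
      \<open>D / 2\<close> in dimension \<open>?s\<close>.\<close>
    let ?K = "unit_ball_vol (real ?s) / (2 * 4 ^ ?s)"
    have four: "(4::real) ^ m = 2 ^ m * 2 ^ m" for m by (simp flip: power_mult_distrib)
    have "ennreal (unit_ball_vol (real ?s) * (\<eta> / 2) ^ ?s) = ennreal ?K * ennreal (2 * (2 * \<eta>) ^ ?s)"
      using \<eta> by (subst ennreal_mult[symmetric])
        (auto intro!: arg_cong[where f = ennreal] simp: power_mult_distrib power_divide four)
    also have "\<dots> \<le> ennreal ?K * (\<Sum>n. emeasure lborel (B n))" using le by (rule mult_left_mono) simp
    also have "\<dots> = (\<Sum>n. ennreal ?K * emeasure lborel (B n))" by simp
    also have "\<dots> \<le> (\<Sum>n. hcost ?s (E n))"
    proof (intro suminf_le)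
      fix n
      show "ennreal ?K * emeasure lborel (B n) \<le> hcost ?s (E n)"
      proof (cases "E n = {}")
        case False
        then have "ennreal ?K * emeasure lborel (B n) = ennreal (?K * (2 * (2 * diameter (E n)) ^ ?s))"
          using d0[of n] by (simp add: B_def vol ennreal_mult[symmetric])
        also have "?K * (2 * (2 * diameter (E n)) ^ ?s) = unit_ball_vol (real ?s) * (diameter (E n) / 2) ^ ?s"
          by (simp add: power_mult_distrib power_divide four)
        finally show ?thesis using False by simp
      qed (simp add: B_def)
    qed auto
    finally show "ennreal (unit_ball_vol (real ?s) * (\<eta> / 2) ^ ?s) \<le> (\<Sum>n. hcost ?s (E n))" .
  qed
  also have "\<dots> \<le> hausdorff_outer ?s M" by (rule hausdorff_pre_le_outer) simp
  finally show ?thesis .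
qed

lemma hausdorff_pre_finite_cover:
  assumes "finite F" "A \<subseteq> (\<Union>f\<in>F. E f)" "\<And>f. f \<in> F \<Longrightarrow> bounded (E f)"
    "\<And>f. f \<in> F \<Longrightarrow> diameter (E f) \<le> \<delta>" "0 \<le> \<delta>"
  shows "hausdorff_pre s \<delta> A \<le> (\<Sum>f\<in>F. hcost s (E f))"
proof -
  obtain h where h: "bij_betw h {0..<card F} F" using ex_bij_betw_nat_finite[OF assms(1)] by blast
  let ?G = "\<lambda>n. if n < card F then E (h n) else {}"
  have hF: "n < card F \<Longrightarrow> h n \<in> F" for n using bij_betwE[OF h] by auto
  have "hausdorff_pre s \<delta> A \<le> (\<Sum>n. hcost s (?G n))"
  proof (rule hausdorff_pre_le)
    show "A \<subseteq> (\<Union>n. ?G n)"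
    proof
      fix x assume "x \<in> A"
      then obtain f where f: "f \<in> F" "x \<in> E f" using assms(2) by blast
      then obtain n where "n < card F" "h n = f" using h by (metis atLeastLessThan_iff bij_betw_iff_bijections)
      then have "x \<in> ?G n" using f by simp
      then show "x \<in> (\<Union>n. ?G n)" by blast
    qed
  qed (use assms hF in auto)
  also have "\<dots> = (\<Sum>n\<in>{0..<card F}. hcost s (?G n))" by (intro suminf_finite) auto
  also have "\<dots> = (\<Sum>n\<in>{0..<card F}. hcost s (E (h n)))" by (intro sum.cong) auto
  also have "\<dots> = (\<Sum>f\<in>F. hcost s (E f))" using sum.reindex_bij_betw[OF h] by simp
  finally show ?thesis .
qed

text \<open>Cut the range of each remaining coordinate into \<open>N\<close> intervals. The graph
  inequality bounds the diameter of each of the \<open>N ^ ?s\<close> pieces by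
  \<open>D / N\<close>, so the total cost does not grow with \<open>N\<close>, while the pieces
  become finer than any \<delta>.\<close>

lemma hausdorff_outer_graph_finite:
  fixes A :: "(real ^ 'n::finite) set" and i :: 'n
  assumes bd: "bounded A" and C: "0 \<le> C"
    and graph: "\<And>x y. x \<in> A \<Longrightarrow> y \<in> A \<Longrightarrow> \<bar>x $ i - y $ i\<bar> \<le> C * (\<Sum>j\<in>UNIV - {i}. \<bar>x $ j - y $ j\<bar>)"
  shows "hausdorff_outer (CARD('n) - 1) A < top"
proof -
  let ?s = "CARD('n) - 1"
  obtain B where B: "0 < B" "\<And>x. x \<in> A \<Longrightarrow> norm x \<le> B" using bd unfolding bounded_pos by blast
  have xB: "\<bar>x $ j\<bar> \<le> B" if "x \<in> A" for x j using B(2)[OF that] component_le_norm_cart[of x j] by linarith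
  define D where "D = (1 + C) * (real ?s * (2 * B))"
  have D0: "0 \<le> D" unfolding D_def using B C by simp
  have pre: "hausdorff_pre ?s \<delta> A \<le> ennreal (unit_ball_vol (real ?s) * (D / 2) ^ ?s)" if \<delta>: "0 < \<delta>" for \<delta>
  proof -
    obtain N :: nat where N: "D / \<delta> < real N" "0 < N"
      by (metis D0 \<delta> divide_nonneg_pos less_le_trans of_nat_0_less_iff order_le_less_trans reals_Archimedean2)
    let ?F = "PiE (UNIV - {i}) (\<lambda>_. {..<N})"
    define E where "E f = {x\<in>A. \<forall>j\<in>UNIV - {i}. 2 * B * real (f j) / real N - B \<le> x $ j \<and>
        x $ j \<le> 2 * B * (real (f j) + 1) / real N - B}" for f :: "'n \<Rightarrow> nat"
    have diam: "norm (x - y) \<le> D / real N" if "x \<in> E f" "y \<in> E f" for x y f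
    proof -
      have j: "\<bar>x $ j - y $ j\<bar> \<le> 2 * B / real N" if "j \<noteq> i" for j
      proof -
        have "2 * B * (real (f j) + 1) / real N - 2 * B * real (f j) / real N = 2 * B / real N"
          by (simp add: diff_divide_distrib[symmetric] algebra_simps)
        moreover have "2 * B * real (f j) / real N - B \<le> x $ j" "x $ j \<le> 2 * B * (real (f j) + 1) / real N - B"
            "2 * B * real (f j) / real N - B \<le> y $ j" "y $ j \<le> 2 * B * (real (f j) + 1) / real N - B"
          using \<open>x \<in> E f\<close> \<open>y \<in> E f\<close> \<open>j \<noteq> i\<close> unfolding E_def by auto
        ultimately show ?thesis by linarith
      qed
      have S: "(\<Sum>j\<in>UNIV - {i}. \<bar>x $ j - y $ j\<bar>) \<le> real ?s * (2 * B / real N)"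
        using sum_bounded_above[of "UNIV - {i}" "\<lambda>j. \<bar>x $ j - y $ j\<bar>" "2 * B / real N"] j
        by (auto simp: card_Diff_singleton)
      have "norm (x - y) \<le> (\<Sum>j\<in>UNIV. \<bar>(x - y) $ j\<bar>)" by (rule norm_le_l1_cart)
      also have "\<dots> = \<bar>x $ i - y $ i\<bar> + (\<Sum>j\<in>UNIV - {i}. \<bar>x $ j - y $ j\<bar>)"
        by (subst sum.remove[of _ i]) auto
      also have "\<dots> \<le> (1 + C) * (\<Sum>j\<in>UNIV - {i}. \<bar>x $ j - y $ j\<bar>)"
        using graph[of x y] that by (auto simp: E_def algebra_simps)
      also have "\<dots> \<le> (1 + C) * (real ?s * (2 * B / real N))"
        using S C by (intro mult_left_mono) auto
      also have "\<dots> = D / real N" by (simp add: D_def)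
      finally show ?thesis .
    qed
    have DN: "D / real N \<le> \<delta>" using N \<delta> by (simp add: field_simps)
    have d1: "diameter (E f) \<le> D / real N" for f
      using D0 diam by (intro diameter_le) auto
    have "hausdorff_pre ?s \<delta> A \<le> (\<Sum>f\<in>?F. hcost ?s (E f))"
    proof (rule hausdorff_pre_finite_cover)
      show "finite ?F" by (intro finite_PiE) auto
      show "bounded (E f)" for f using bd by (rule bounded_subset) (auto simp: E_def)
      show "diameter (E f) \<le> \<delta>" for f using d1[of f] DN by linarith
      show "A \<subseteq> (\<Union>f\<in>?F. E f)"
      proof
        fix x assume x: "x \<in> A"
        have "\<exists>m<N. 2 * B * real m / real N - B \<le> x $ j \<and> x $ j \<le> 2 * B * (real m + 1) / real N - B" for j
        proof -
          let ?t = "(x $ j + B) * real N / (2 * B)"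
          have xj: "0 \<le> x $ j + B" "x $ j + B \<le> 2 * B" using xB[OF x, of j] by (auto simp: abs_le_iff)
          have t: "0 \<le> ?t" using xj B(1) by simp
          have "(x $ j + B) * real N \<le> (2 * B) * real N" using xj by (intro mult_right_mono) auto
          then have t2: "?t \<le> real N" using B(1) by (simp add: field_simps)
          note t = t t2
          have xe: "x $ j = 2 * B * ?t / real N - B" using B(1) N(2) by (simp add: field_simps)
          have mono: "2 * B * a / real N - B \<le> 2 * B * b / real N - B" if "a \<le> b" for a b
            using that B(1) by (simp add: divide_right_mono)
          show ?thesis
          proof (cases "nat \<lfloor>?t\<rfloor> < N")
            case True
            then show ?thesis
              using t mono[of "real (nat \<lfloor>?t\<rfloor>)" ?t] mono[of ?t "real (nat \<lfloor>?t\<rfloor>) + 1"]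
              by (intro exI[of _ "nat \<lfloor>?t\<rfloor>"]) (unfold xe[symmetric], auto)
          next
            \<comment> \<open>Only the right end point, where \<open>?t\<close> equals
              \<open>N\<close>, is left; it goes into the last interval.\<close>
            case False
            then have "?t = real N" using t by linarith
            then show ?thesis using N(2) mono[of "real (N-1)" ?t] mono[of ?t "real (N-1) + 1"]
              by (intro exI[of _ "N-1"]) (unfold xe[symmetric], auto simp: of_nat_diff)
          qed
        qed
        then obtain m where m: "\<And>j. m j < N" "\<And>j. 2 * B * real (m j) / real N - B \<le> x $ j"
          "\<And>j. x $ j \<le> 2 * B * (real (m j) + 1) / real N - B" by metis
        then have "x \<in> E (restrict m (UNIV - {i}))" using x by (auto simp: E_def)
        moreover have "restrict m (UNIV - {i}) \<in> ?F" using m(1) by auto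
        ultimately show "x \<in> (\<Union>f\<in>?F. E f)" by blast
      qed
    qed (use \<delta> in simp)
    also have "\<dots> \<le> (\<Sum>f\<in>?F. ennreal (unit_ball_vol (real ?s) * (D / real N / 2) ^ ?s))"
    proof (rule sum_mono)
      fix f
      have "0 \<le> diameter (E f)" by (rule diameter_ge_0, rule bounded_subset[OF bd]) (auto simp: E_def)
      then show "hcost ?s (E f) \<le> ennreal (unit_ball_vol (real ?s) * (D / real N / 2) ^ ?s)"
        using d1[of f] by (auto intro!: ennreal_leI mult_left_mono power_mono divide_right_mono)
    qed
    also have "\<dots> = ennreal (real (card ?F) * (unit_ball_vol (real ?s) * (D / real N / 2) ^ ?s))"
      using D0 by (simp add: ennreal_of_nat_eq_real_of_nat ennreal_mult)
    also have "card ?F = N ^ ?s" by (simp add: card_PiE card_Diff_singleton)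
    also have "real (N ^ ?s) * (unit_ball_vol (real ?s) * (D / real N / 2) ^ ?s) = unit_ball_vol (real ?s) * (D / 2) ^ ?s"
      using N(2) by (simp add: power_divide)
    finally show ?thesis .
  qed
  have "hausdorff_outer ?s A \<le> ennreal (unit_ball_vol (real ?s) * (D / 2) ^ ?s)"
    unfolding hausdorff_outer_def by (intro SUP_least pre) auto
  also have "\<dots> < top" by simp
  finally show ?thesis .
qed

lemma set_integrable_hausdorff:
  fixes f :: "'a::metric_space \<Rightarrow> real"
  assumes "A \<in> sets borel" "hausdorff_outer s A < top"
    and "set_borel_measurable borel A f" and "\<And>x. x \<in> A \<Longrightarrow> \<bar>f x\<bar> \<le> B"
  shows "set_integrable (hausdorff s) A f"
  unfolding set_integrable_def
proof (rule integrableI_bounded_set[where A = A and B = B])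
  show "A \<in> sets (hausdorff s)" using assms by simp
  show "(\<lambda>x. indicat_real A x *\<^sub>R f x) \<in> borel_measurable (hausdorff s)"
    using assms(3) unfolding set_borel_measurable_def
    by (simp cong: measurable_cong_sets)
  show "emeasure (hausdorff s) A < \<infinity>" using assms by (simp add: emeasure_hausdorff)
qed (use assms(4) in auto)

section \<open>Polynomials of bounded total degree\<close>

abbreviation mexp :: "nat \<Rightarrow> ('n::finite \<Rightarrow> nat) set" where
  "mexp k \<equiv> {a. sum a UNIV \<le> k}"

abbreviation monf :: "('n::finite \<Rightarrow> nat) \<Rightarrow> real ^ 'n \<Rightarrow> real" where
  "monf a x \<equiv> \<Prod>i\<in>UNIV. x $ i ^ a i"

lemma finite_mexp: "finite (mexp k :: ('n::finite \<Rightarrow> nat) set)"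
proof (rule finite_subset)
  show "mexp k \<subseteq> (PiE UNIV (\<lambda>_. {..k}) :: ('n \<Rightarrow> nat) set)"
  proof
    fix a :: "'n \<Rightarrow> nat" assume "a \<in> mexp k"
    then have "a i \<le> k" for i using member_le_sum[of i UNIV a] by auto
    then show "a \<in> PiE UNIV (\<lambda>_. {..k})" by auto
  qed
qed (intro finite_PiE, auto)

lemma poly_leI: "p = (\<lambda>x. \<Sum>a\<in>mexp k. c a * monf a x) \<Longrightarrow> p \<in> poly_le k"
  unfolding poly_le_def by blast

lemma poly_leE:
  assumes "p \<in> poly_le k" obtains c where "p = (\<lambda>x. \<Sum>a\<in>mexp k. c a * monf a x)"
  using assms unfolding poly_le_def by blast

lemma poly_le_mon: "sum a UNIV \<le> k \<Longrightarrow> monf a \<in> poly_le k"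
proof (rule poly_leI[where c = "\<lambda>b. if b = a then 1 else 0"])
  assume "sum a UNIV \<le> k"
  then show "monf a = (\<lambda>x. \<Sum>b\<in>mexp k. (if b = a then 1 else 0) * monf b x)"
  proof (intro ext)
    fix x :: "real ^ 'a"
    have "(\<Sum>b\<in>mexp k. (if b = a then 1 else 0) * monf b x) = (\<Sum>b\<in>mexp k. if b = a then monf b x else 0)"
      by (intro sum.cong) auto
    then show "monf a x = (\<Sum>b\<in>mexp k. (if b = a then 1 else 0) * monf b x)"
      using sum.delta[OF finite_mexp[of k], of a "\<lambda>b. monf b x"] \<open>sum a UNIV \<le> k\<close> by simp
  qed
qed

lemma poly_le_zero: "(\<lambda>x. 0) \<in> poly_le k"
  by (rule poly_leI[where c = "\<lambda>_. 0"]) simp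

lemma poly_le_add:
  assumes "p \<in> poly_le k" "q \<in> poly_le k" shows "(\<lambda>x. p x + q x) \<in> poly_le k"
proof -
  from assms obtain c d where c: "p = (\<lambda>x. \<Sum>a\<in>mexp k. c a * monf a x)"
    "q = (\<lambda>x. \<Sum>a\<in>mexp k. d a * monf a x)" by (elim poly_leE) blast
  show ?thesis unfolding c
    by (rule poly_leI[where c = "\<lambda>a. c a + d a"]) (simp add: sum.distrib algebra_simps)
qed

lemma poly_le_cmult:
  assumes "p \<in> poly_le k" shows "(\<lambda>x. c * p x) \<in> poly_le k"
proof -
  from assms obtain d where d: "p = (\<lambda>x. \<Sum>a\<in>mexp k. d a * monf a x)" by (elim poly_leE)
  show ?thesis unfolding d
    by (rule poly_leI[where c = "\<lambda>a. c * d a"]) (simp add: sum_distrib_left mult.assoc)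
qed

lemma poly_le_diff:
  assumes "p \<in> poly_le k" "q \<in> poly_le k" shows "(\<lambda>x. p x - q x) \<in> poly_le k"
  using poly_le_add[OF assms(1) poly_le_cmult[OF assms(2), of "-1"]] by simp

lemma poly_le_sum:
  assumes "\<And>i. i \<in> I \<Longrightarrow> p i \<in> poly_le k" shows "(\<lambda>x. \<Sum>i\<in>I. p i x) \<in> poly_le k"
  using assms by (induction I rule: infinite_finite_induct) (auto intro: poly_le_zero poly_le_add)

lemma poly_le_mono:
  assumes "p \<in> poly_le k" "k \<le> l" shows "p \<in> poly_le l"
proof -
  from assms obtain d where d: "p = (\<lambda>x. \<Sum>a\<in>mexp k. d a * monf a x)" by (elim poly_leE)
  show ?thesis unfolding d using assms(2)
    by (intro poly_le_sum poly_le_cmult poly_le_mon) auto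
qed

lemma poly_le_mult:
  fixes p q :: "real ^ 'n::finite \<Rightarrow> real"
  assumes "p \<in> poly_le k" "q \<in> poly_le l" shows "(\<lambda>x. p x * q x) \<in> poly_le (k + l)"
proof -
  from assms obtain c d where c: "p = (\<lambda>x. \<Sum>a\<in>mexp k. c a * monf a x)"
    "q = (\<lambda>x. \<Sum>a\<in>mexp l. d a * monf a x)" by (elim poly_leE) blast
  have "(\<lambda>x. p x * q x) = (\<lambda>x. \<Sum>a\<in>mexp k. \<Sum>b\<in>mexp l. (c a * d b) * monf (\<lambda>i. a i + b i) x)"
    unfolding c by (simp add: fun_eq_iff sum_product power_add prod.distrib algebra_simps)
  moreover have "(\<lambda>x. \<Sum>a\<in>mexp k. \<Sum>b\<in>mexp l. (c a * d b) * monf (\<lambda>i. a i + b i) x) \<in> poly_le (k + l)"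
    by (intro poly_le_sum poly_le_cmult poly_le_mon) (auto simp: sum.distrib intro: add_mono)
  ultimately show ?thesis by simp
qed

lemma poly_le_const: "(\<lambda>x. c) \<in> poly_le k"
  using poly_le_cmult[OF poly_le_mon[of "\<lambda>_. 0" k], of c] by simp

lemma poly_le_coord: "(\<lambda>x. x $ i) \<in> poly_le 1"
proof -
  have "(\<Prod>j\<in>UNIV. x $ j ^ (if j = i then 1 else 0)) = x $ i" for x :: "real ^ 'a"
    by (simp add: prod.delta if_distrib[of "power _"] cong: if_cong)
  then show ?thesis using poly_le_mon[of "\<lambda>j. if j = i then 1 else 0" 1] by simp
qed

lemma poly_le_prod:
  assumes "\<And>i. i \<in> I \<Longrightarrow> p i \<in> poly_le (d i)"
  shows "(\<lambda>x. \<Prod>i\<in>I. p i x) \<in> poly_le (\<Sum>i\<in>I. d i)"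
  using assms by (induction I rule: infinite_finite_induct) (auto intro: poly_le_const poly_le_mult)

lemma poly_le_power:
  assumes "p \<in> poly_le d" shows "(\<lambda>x. p x ^ n) \<in> poly_le (n * d)"
  using assms by (induction n) (auto intro: poly_le_const poly_le_mult)

lemma poly_le_compose_affine:
  fixes p :: "real ^ 'n::finite \<Rightarrow> real"
  assumes "p \<in> poly_le k" "\<And>i. (\<lambda>x. f x $ i) \<in> poly_le 1" shows "(\<lambda>x. p (f x)) \<in> poly_le k"
proof -
  from assms obtain c where c: "p = (\<lambda>x. \<Sum>a\<in>mexp k. c a * monf a x)" by (elim poly_leE)
  have "(\<lambda>x. monf a (f x)) \<in> poly_le k" if "a \<in> mexp k" for a
  proof -
    have "(\<lambda>x. monf a (f x)) \<in> poly_le (\<Sum>i\<in>UNIV. a i * 1)"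
      using assms(2) by (intro poly_le_prod poly_le_power)
    then show ?thesis using that by (auto intro: poly_le_mono)
  qed
  then show ?thesis unfolding c by (intro poly_le_sum poly_le_cmult) auto
qed

lemma poly_le_compose_scale_shift:
  fixes p :: "real ^ 'n::finite \<Rightarrow> real"
  assumes "p \<in> poly_le k" shows "(\<lambda>x. p (t *\<^sub>R x + b)) \<in> poly_le k"
  by (rule poly_le_compose_affine[OF assms])
    (simp only: vector_add_component vector_scaleR_component real_scaleR_def,
      intro poly_le_add poly_le_cmult poly_le_coord poly_le_const)

lemma poly_le_continuous: "p \<in> poly_le k \<Longrightarrow> continuous_on S p"
  by (auto elim!: poly_leE intro!: continuous_intros)

lemma poly_le_measurable [measurable_dest]: "p \<in> poly_le k \<Longrightarrow> p \<in> borel_measurable borel"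
  by (intro borel_measurable_continuous_onI poly_le_continuous)

text \<open>Induction on the total degree, splitting off one factor \<open>x $ i\<close> and using
  the product rule. The degree bound is kept rather than lowered: this way every estimate proved for
  polynomials of degree \<open>k\<close> applies to their partial derivatives too.\<close>

lemma mon_derivative:
  fixes a :: "'n::finite \<Rightarrow> nat"
  shows "\<exists>q. (\<forall>i. q i \<in> poly_le (sum a UNIV)) \<and> (\<forall>x. (monf a has_derivative (\<lambda>h. \<Sum>i\<in>UNIV. h $ i * q i x)) (at x))"
proof (induction "sum a UNIV" arbitrary: a)
  case 0
  then have "\<And>i. a i = 0" using sum_eq_0_iff[of UNIV a] by simp
  then have "monf a = (\<lambda>x. 1)" by simp
  then show ?case by (intro exI[of _ "\<lambda>_ _. 0"]) (auto intro: poly_le_zero)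
next
  case (Suc m)
  have "\<exists>i. a i > 0"
  proof (rule ccontr)
    assume "\<not> ?thesis" then have "sum a UNIV = 0" by simp
    with Suc.hyps(2) show False by simp
  qed
  then obtain i where i: "a i > 0" by blast
  define b where "b = (\<lambda>j. if j = i then a j - 1 else a j)"
  have sa: "sum a UNIV = a i + sum a (UNIV - {i})" by (subst sum.remove[of _ i]) auto
  have sb: "sum b UNIV = (a i - 1) + sum a (UNIV - {i})"
    by (subst sum.remove[of _ i]) (auto simp: b_def)
  have m: "m = sum b UNIV" using Suc.hyps(2) i sa sb by linarith
  then obtain q where q: "\<And>j. q j \<in> poly_le (sum b UNIV)"
    "\<And>x. (monf b has_derivative (\<lambda>h. \<Sum>j\<in>UNIV. h $ j * q j x)) (at x)"
    using Suc.hyps(1)[of b] by blast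
  have monf: "monf a = (\<lambda>x. x $ i * monf b x)"
  proof
    fix x :: "real ^ 'n"
    have "monf a x = x $ i ^ a i * (\<Prod>j\<in>UNIV - {i}. x $ j ^ a j)" by (subst prod.remove[of _ i]) auto
    moreover have "monf b x = x $ i ^ (a i - 1) * (\<Prod>j\<in>UNIV - {i}. x $ j ^ a j)"
      by (subst prod.remove[of _ i]) (auto simp: b_def)
    moreover have "x $ i ^ a i = x $ i * x $ i ^ (a i - 1)" using i by (cases "a i") auto
    ultimately show "monf a x = x $ i * monf b x" by (simp only: mult.assoc)
  qed
  let ?q = "\<lambda>j x. x $ i * q j x + (if j = i then monf b x else 0)"
  show ?case
  proof (intro exI[of _ ?q] conjI allI)
    fix j
    have k: "sum a UNIV = 1 + sum b UNIV" using Suc.hyps(2) m by linarith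
    have "(\<lambda>x. x $ i * q j x) \<in> poly_le (1 + sum b UNIV)" by (intro poly_le_mult poly_le_coord q)
    moreover have "(\<lambda>x. if j = i then monf b x else 0) \<in> poly_le (1 + sum b UNIV)"
      by (cases "j = i") (auto intro: poly_le_zero poly_le_mon)
    ultimately show "?q j \<in> poly_le (sum a UNIV)" unfolding k by (rule poly_le_add)
  next
    fix x
    have "((\<lambda>x. x $ i * monf b x) has_derivative
        (\<lambda>h. x $ i * (\<Sum>j\<in>UNIV. h $ j * q j x) + h $ i * monf b x)) (at x)"
      by (rule has_derivative_mult[OF bounded_linear_imp_has_derivative[OF bounded_linear_vec_nth] q(2)])
    moreover have "(\<lambda>h. x $ i * (\<Sum>j\<in>UNIV. h $ j * q j x) + h $ i * monf b x)
        = (\<lambda>h. \<Sum>j\<in>UNIV. h $ j * ?q j x)"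
      by (simp add: fun_eq_iff distrib_left sum.distrib sum_distrib_left mult.left_commute
          if_distrib[of "(*) _"] sum.delta cong: if_cong)
    ultimately show "(monf a has_derivative (\<lambda>h. \<Sum>j\<in>UNIV. h $ j * ?q j x)) (at x)"
      unfolding monf by simp
  qed
qed

definition pd :: "'n::finite \<Rightarrow> (real ^ 'n \<Rightarrow> real) \<Rightarrow> real ^ 'n \<Rightarrow> real" where
  "pd i p x = frechet_derivative p (at x) (axis i 1)"

lemma poly_le_derivative_ex:
  fixes p :: "real ^ 'n::finite \<Rightarrow> real"
  assumes "p \<in> poly_le k"
  shows "\<exists>q. (\<forall>i. q i \<in> poly_le k) \<and> (\<forall>x. (p has_derivative (\<lambda>h. \<Sum>i\<in>UNIV. h $ i * q i x)) (at x))"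
proof -
  from assms obtain c where c: "p = (\<lambda>x. \<Sum>a\<in>mexp k. c a * monf a x)" by (elim poly_leE)
  have "\<exists>q. \<forall>a::'n \<Rightarrow> nat. (\<forall>i. q a i \<in> poly_le (sum a UNIV)) \<and>
     (\<forall>x. (monf a has_derivative (\<lambda>h. \<Sum>i\<in>UNIV. h $ i * q a i x)) (at x))"
    by (rule choice) (intro allI mon_derivative)
  then obtain q where q0: "\<forall>a::'n \<Rightarrow> nat. (\<forall>i. q a i \<in> poly_le (sum a UNIV)) \<and>
     (\<forall>x. (monf a has_derivative (\<lambda>h. \<Sum>i\<in>UNIV. h $ i * q a i x)) (at x))" ..
  let ?q = "\<lambda>i x. \<Sum>a\<in>mexp k. c a * q a i x"
  show ?thesis
  proof (intro exI[of _ ?q] conjI allI)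
    show "?q i \<in> poly_le k" for i
      using q0 by (intro poly_le_sum poly_le_cmult) (auto intro: poly_le_mono)
    fix x
    have "(p has_derivative (\<lambda>h. \<Sum>a\<in>mexp k. c a * (\<Sum>i\<in>UNIV. h $ i * q a i x))) (at x)"
      unfolding c using q0 by (intro has_derivative_sum has_derivative_mult_right) blast
    moreover have "(\<Sum>a\<in>mexp k. c a * (\<Sum>i\<in>UNIV. h $ i * q a i x)) = (\<Sum>i\<in>UNIV. h $ i * ?q i x)"
      for h :: "real ^ 'n"
    proof -
      have "(\<Sum>a\<in>mexp k. c a * (\<Sum>i\<in>UNIV. h $ i * q a i x))
          = (\<Sum>a\<in>mexp k. \<Sum>i\<in>UNIV. h $ i * (c a * q a i x))"
        by (simp add: sum_distrib_left mult.left_commute)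
      also have "\<dots> = (\<Sum>i\<in>UNIV. \<Sum>a\<in>mexp k. h $ i * (c a * q a i x))" by (rule sum.swap)
      finally show ?thesis by (simp add: sum_distrib_left)
    qed
    ultimately show "(p has_derivative (\<lambda>h. \<Sum>i\<in>UNIV. h $ i * ?q i x)) (at x)" by simp
  qed
qed

lemma
  fixes p :: "real ^ 'n::finite \<Rightarrow> real"
  assumes p: "p \<in> poly_le k"
  shows pd_poly_le: "pd i p \<in> poly_le k"
    and poly_le_has_derivative: "(p has_derivative (\<lambda>h. \<Sum>i\<in>UNIV. h $ i * pd i p x)) (at x)"
proof -
  obtain q where q: "\<And>i. q i \<in> poly_le k" "\<And>x. (p has_derivative (\<lambda>h. \<Sum>i\<in>UNIV. h $ i * q i x)) (at x)"
    using poly_le_derivative_ex[OF p] by blast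
  have "pd i p x = q i x" for i x
    unfolding pd_def frechet_derivative_at[OF q(2), symmetric]
    by (simp add: axis_def if_distrib[of "\<lambda>t. t * _"] sum.delta cong: if_cong)
  then have "pd i p = q i" for i by auto
  then show "pd i p \<in> poly_le k" "(p has_derivative (\<lambda>h. \<Sum>i\<in>UNIV. h $ i * pd i p x)) (at x)"
    using q by auto
qed

lemma pd_unique:
  assumes "(p has_derivative (\<lambda>h. \<Sum>i\<in>UNIV. h $ i * q i)) (at x)" shows "pd i p x = q i"
  unfolding pd_def frechet_derivative_at[OF assms, symmetric]
  by (simp add: axis_def if_distrib[of "\<lambda>t. t * _"] sum.delta cong: if_cong)

lemma pd_linear:
  fixes p q :: "real ^ 'n::finite \<Rightarrow> real"
  assumes "p \<in> poly_le k" "q \<in> poly_le l"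
  shows "pd i (\<lambda>x. c * p x + q x) = (\<lambda>x. c * pd i p x + pd i q x)"
proof
  fix x
  have "((\<lambda>x. c * p x + q x) has_derivative (\<lambda>h. c * (\<Sum>i\<in>UNIV. h $ i * pd i p x) + (\<Sum>i\<in>UNIV. h $ i * pd i q x))) (at x)"
    by (intro has_derivative_add has_derivative_mult_right poly_le_has_derivative[OF assms(1)] poly_le_has_derivative[OF assms(2)])
  then have "((\<lambda>x. c * p x + q x) has_derivative (\<lambda>h. \<Sum>i\<in>UNIV. h $ i * (c * pd i p x + pd i q x))) (at x)"
    by (simp add: sum_distrib_left distrib_left sum.distrib mult.left_commute)
  then show "pd i (\<lambda>x. c * p x + q x) x = c * pd i p x + pd i q x" by (rule pd_unique)
qed

lemma poly_le_line_deriv: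
  fixes p :: "real ^ 'n::finite \<Rightarrow> real"
  assumes "p \<in> poly_le k"
  shows "((\<lambda>t. p (x + t *\<^sub>R n)) has_real_derivative (\<Sum>i\<in>UNIV. n $ i * pd i p (x + t *\<^sub>R n))) (at t)"
proof -
  have "((\<lambda>t. x + t *\<^sub>R n) has_derivative (\<lambda>s. s *\<^sub>R n)) (at t)"
    by (auto intro!: derivative_eq_intros)
  from has_derivative_compose[OF this poly_le_has_derivative[OF assms]]
  show ?thesis unfolding has_field_derivative_def
    by (rule has_derivative_eq_rhs) (simp add: fun_eq_iff sum_distrib_left sum_distrib_right mult_ac)
qed

text \<open>Differentiating \<open>l\<close> times along a line is the same as applying the
  first-order operator in direction \<open>n\<close> \<open>l\<close> times, and that operator maps
  \<open>poly_le k\<close> into itself. Linearity and continuity of the face jumps follow from this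
  description.\<close>

lemma dir_deriv_poly_le:
  fixes p :: "real ^ 'n::finite \<Rightarrow> real"
  assumes "p \<in> poly_le k" shows "dir_deriv l n p \<in> poly_le k"
    and "dir_deriv l n p = ((\<lambda>q x. \<Sum>i\<in>UNIV. n $ i * pd i q x) ^^ l) p"
proof -
  let ?D = "\<lambda>q x. \<Sum>i\<in>UNIV. n $ i * pd i q x"
  have *: "(deriv ^^ l) (\<lambda>t. p (x + t *\<^sub>R n)) = (\<lambda>t. ((?D ^^ l) p) (x + t *\<^sub>R n)) \<and> (?D ^^ l) p \<in> poly_le k" for x
  proof (induction l)
    case (Suc l)
    then have P: "(?D ^^ l) p \<in> poly_le k" by simp
    have "deriv (\<lambda>t. ((?D ^^ l) p) (x + t *\<^sub>R n)) = (\<lambda>t. (?D ((?D ^^ l) p)) (x + t *\<^sub>R n))"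
      using poly_le_line_deriv[OF P] by (auto intro!: DERIV_imp_deriv)
    moreover have "?D ((?D ^^ l) p) \<in> poly_le k"
      by (intro poly_le_sum poly_le_cmult pd_poly_le[OF P])
    ultimately show ?case using Suc by simp
  qed (use assms in simp)
  show "dir_deriv l n p = (?D ^^ l) p" unfolding dir_deriv_def using * by (simp add: fun_eq_iff)
  then show "dir_deriv l n p \<in> poly_le k" using * by simp
qed

lemma dir_deriv_linear:
  fixes p q :: "real ^ 'n::finite \<Rightarrow> real"
  assumes "p \<in> poly_le k" "q \<in> poly_le k"
  shows "dir_deriv l n (\<lambda>x. c * p x + q x) x = c * dir_deriv l n p x + dir_deriv l n q x"
proof -
  let ?D = "\<lambda>q x. \<Sum>i\<in>UNIV. n $ i * pd i q x"
  have pq: "(\<lambda>x. c * p x + q x) \<in> poly_le k" by (intro poly_le_add poly_le_cmult assms)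
  have "(?D ^^ l) (\<lambda>x. c * p x + q x) = (\<lambda>x. c * (?D ^^ l) p x + (?D ^^ l) q x)"
  proof (induction l)
    case (Suc l)
    have P: "(?D ^^ l) p \<in> poly_le k" "(?D ^^ l) q \<in> poly_le k"
      using dir_deriv_poly_le[OF assms(1), of l n] dir_deriv_poly_le[OF assms(2), of l n] by simp_all
    show ?case using Suc
      by (simp add: pd_linear[OF P] distrib_left sum.distrib sum_distrib_left mult.left_commute)
  qed simp
  then show ?thesis
    by (simp add: dir_deriv_poly_le(2)[OF pq] dir_deriv_poly_le(2)[OF assms(1)] dir_deriv_poly_le(2)[OF assms(2)])
qed

section \<open>Barycentric coordinates and the Lagrange basis of a simplex\<close>

definition verts :: "(real ^ 'n::finite) set \<Rightarrow> (real ^ 'n) set" where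
  "verts T = {v. v extreme_point_of T}"

abbreviation nsimplex :: "(real ^ 'n::finite) set \<Rightarrow> bool" where
  "nsimplex (T :: (real ^ 'n) set) \<equiv> int CARD('n) simplex T"

lemma nsimplex_verts:
  fixes T :: "(real ^ 'n::finite) set"
  assumes "nsimplex T"
  shows finite_verts: "finite (verts T)" and affine_independent_verts: "\<not> affine_dependent (verts T)"
    and card_verts: "card (verts T) = CARD('n) + 1" and convex_hull_verts: "T = convex hull (verts T)"
    and affine_hull_verts: "affine hull (verts T) = UNIV"
proof -
  obtain C where C: "finite C" "\<not> affine_dependent C" "int (card C) = int CARD('n) + 1" "T = convex hull C"
    using assms unfolding simplex by blast
  have V: "verts T = C" unfolding verts_def C(4) using extreme_point_of_convex_hull_affine_independent[OF C(2)] by auto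
  have "aff_dim C = int CARD('n)" using aff_dim_affine_independent[OF C(2)] C(3) by simp
  then have "affine hull C = UNIV" using aff_dim_eq_full[of C] by simp
  then show "finite (verts T)" "\<not> affine_dependent (verts T)" "card (verts T) = CARD('n) + 1"
    "T = convex hull (verts T)" "affine hull (verts T) = UNIV" using C V by auto
qed

lemma verts_subset: "verts T \<subseteq> T"
  unfolding verts_def extreme_point_of_def by auto

lemma convex_nsimplex: "nsimplex T \<Longrightarrow> convex T"
  by (rule convex_simplex)

lemma compact_nsimplex: "nsimplex T \<Longrightarrow> compact T"
  by (rule compact_simplex)

text \<open>Affine coordinates with respect to the vertices. They exist on the whole space because
  the vertices span it affinely, and may be negative outside \<open>T\<close>; affine independence
  makes the chosen coefficients unique.\<close>

definition bary :: "(real ^ 'n::finite) set \<Rightarrow> real ^ 'n \<Rightarrow> real ^ 'n \<Rightarrow> real" where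
  "bary T v x = (SOME u. sum u (verts T) = 1 \<and> (\<Sum>v\<in>verts T. u v *\<^sub>R v) = x) v"

context
  fixes T :: "(real ^ 'n::finite) set"
  assumes T: "nsimplex T"
begin

lemma bary_sum: "(\<Sum>v\<in>verts T. bary T v x) = 1"
  and bary_comb: "(\<Sum>v\<in>verts T. bary T v x *\<^sub>R v) = x"
proof -
  have "x \<in> affine hull (verts T)" using affine_hull_verts[OF T] by simp
  then have ex: "\<exists>u. sum u (verts T) = 1 \<and> (\<Sum>v\<in>verts T. u v *\<^sub>R v) = x"
    unfolding affine_hull_finite[OF finite_verts[OF T]] by simp
  from someI_ex[OF ex]
  show "(\<Sum>v\<in>verts T. bary T v x) = 1" "(\<Sum>v\<in>verts T. bary T v x *\<^sub>R v) = x"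
    unfolding bary_def by auto
qed

lemma bary_unique:
  assumes "sum u (verts T) = 1" "(\<Sum>v\<in>verts T. u v *\<^sub>R v) = x" "v \<in> verts T"
  shows "bary T v x = u v"
proof (rule ccontr)
  assume ne: "bary T v x \<noteq> u v"
  have "affine_dependent (verts T)"
    unfolding affine_dependent_explicit_finite[OF finite_verts[OF T]]
  proof (intro exI conjI)
    show "(\<Sum>v\<in>verts T. bary T v x - u v) = 0" using assms bary_sum by (simp add: sum_subtractf)
    show "\<exists>v\<in>verts T. bary T v x - u v \<noteq> 0" using ne assms by (intro bexI[of _ v]) auto
    show "(\<Sum>v\<in>verts T. (bary T v x - u v) *\<^sub>R v) = 0"
      using assms bary_comb by (simp add: sum_subtractf scaleR_diff_left)
  qed
  then show False using affine_independent_verts[OF T] by simp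
qed

lemma bary_affine:
  assumes "v \<in> verts T" "finite I" "sum c I = 1"
  shows "bary T v (\<Sum>i\<in>I. c i *\<^sub>R x i) = (\<Sum>i\<in>I. c i * bary T v (x i))"
proof (rule bary_unique[OF _ _ assms(1)])
  have "(\<Sum>v\<in>verts T. \<Sum>i\<in>I. c i * bary T v (x i)) = (\<Sum>i\<in>I. \<Sum>v\<in>verts T. c i * bary T v (x i))"
    by (rule sum.swap)
  also have "\<dots> = 1" using assms by (simp add: sum_distrib_left[symmetric] bary_sum)
  finally show "(\<Sum>v\<in>verts T. \<Sum>i\<in>I. c i * bary T v (x i)) = 1" .
  have "(\<Sum>v\<in>verts T. (\<Sum>i\<in>I. c i * bary T v (x i)) *\<^sub>R v)
      = (\<Sum>v\<in>verts T. \<Sum>i\<in>I. c i *\<^sub>R (bary T v (x i) *\<^sub>R v))" by (simp add: scaleR_sum_left)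
  also have "\<dots> = (\<Sum>i\<in>I. \<Sum>v\<in>verts T. c i *\<^sub>R (bary T v (x i) *\<^sub>R v))" by (rule sum.swap)
  also have "\<dots> = (\<Sum>i\<in>I. c i *\<^sub>R x i)" by (simp only: scaleR_sum_right[symmetric] bary_comb)
  finally show "(\<Sum>v\<in>verts T. (\<Sum>i\<in>I. c i * bary T v (x i)) *\<^sub>R v) = (\<Sum>i\<in>I. c i *\<^sub>R x i)" .
qed

lemma bary_move:
  assumes "v \<in> verts T"
  shows "bary T v (x + t *\<^sub>R (y - z)) = bary T v x + t * (bary T v y - bary T v z)"
proof (rule bary_unique[OF _ _ assms])
  show "(\<Sum>v\<in>verts T. bary T v x + t * (bary T v y - bary T v z)) = 1"
    by (simp add: sum.distrib sum_distrib_left[symmetric] sum_subtractf bary_sum)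
  show "(\<Sum>v\<in>verts T. (bary T v x + t * (bary T v y - bary T v z)) *\<^sub>R v) = x + t *\<^sub>R (y - z)"
    by (simp only: scaleR_add_left scaleR_diff_left scaleR_scaleR[symmetric] sum.distrib
      scaleR_sum_right[symmetric] sum_subtractf bary_comb)
qed

lemma bary_vertex:
  assumes "v \<in> verts T" "w \<in> verts T" shows "bary T v w = (if v = w then 1 else 0)"
proof (rule bary_unique[OF _ _ assms(1)])
  show "(\<Sum>v\<in>verts T. if v = w then 1 else 0) = (1::real)"
    using finite_verts[OF T] assms by (simp add: sum.delta)
  have "(\<Sum>v\<in>verts T. (if v = w then 1 else 0) *\<^sub>R v) = (\<Sum>v\<in>verts T. if v = w then v else 0)"
    by (intro sum.cong) auto
  then show "(\<Sum>v\<in>verts T. (if v = w then 1 else 0) *\<^sub>R v) = w"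
    using finite_verts[OF T] assms by (simp add: sum.delta)
qed

lemma mem_nsimplex_iff: "x \<in> T \<longleftrightarrow> (\<forall>v\<in>verts T. 0 \<le> bary T v x)"
proof
  assume "x \<in> T"
  then have "x \<in> convex hull (verts T)" using convex_hull_verts[OF T] by simp
  then obtain u where u: "\<forall>v\<in>verts T. 0 \<le> u v" "sum u (verts T) = 1" "(\<Sum>v\<in>verts T. u v *\<^sub>R v) = x"
    unfolding convex_hull_finite[OF finite_verts[OF T]] by blast
  then show "\<forall>v\<in>verts T. 0 \<le> bary T v x" using bary_unique by simp
next
  assume "\<forall>v\<in>verts T. 0 \<le> bary T v x"
  then have "x \<in> convex hull (verts T)"
    unfolding convex_hull_finite[OF finite_verts[OF T]] mem_Collect_eq
    by (intro exI[of _ "\<lambda>v. bary T v x"] conjI bary_sum bary_comb)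
  then show "x \<in> T" using convex_hull_verts[OF T] by simp
qed

lemma bary_nonneg: "x \<in> T \<Longrightarrow> v \<in> verts T \<Longrightarrow> 0 \<le> bary T v x"
  using mem_nsimplex_iff by blast

lemma bary_le_1:
  assumes "x \<in> T" "v \<in> verts T" shows "bary T v x \<le> 1"
  using member_le_sum[of v "verts T" "\<lambda>v. bary T v x"] bary_nonneg[OF assms(1)] assms(2) finite_verts[OF T]
  by (simp add: bary_sum)

lemma bary_poly_le:
  assumes "v \<in> verts T" shows "bary T v \<in> poly_le 1"
proof -
  have "bary T v = (\<lambda>x. bary T v 0 + (\<Sum>i\<in>UNIV. (bary T v (axis i 1) - bary T v 0) * x $ i))"
  proof
    fix x :: "real ^ 'n"
    \<comment> \<open>Write \<open>x\<close> as an affine combination of the origin and the unit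
      vectors: \<open>None\<close> stands for the origin and takes the weight that makes the sum
      1.\<close>
    let ?I = "UNIV :: 'n option set"
    let ?c = "\<lambda>i. case i of None \<Rightarrow> 1 - (\<Sum>j\<in>UNIV. x $ j) | Some j \<Rightarrow> x $ j"
    let ?p = "\<lambda>i::'n option. case i of None \<Rightarrow> 0 :: real ^ 'n | Some j \<Rightarrow> axis j 1"
    have opt: "(\<Sum>i\<in>?I. f i) = f None + (\<Sum>j\<in>UNIV. f (Some j))" for f :: "'n option \<Rightarrow> 'z::comm_monoid_add"
      unfolding UNIV_option_conv by (subst sum.insert) (auto simp: sum.reindex)
    have "(\<Sum>i\<in>?I. ?c i *\<^sub>R ?p i) = (\<Sum>j\<in>UNIV. x $ j *\<^sub>R axis j 1)" by (simp add: opt)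
    also have "\<dots> = x" using basis_expansion[of x] by (simp add: scalar_mult_eq_scaleR)
    finally have "bary T v x = bary T v (\<Sum>i\<in>?I. ?c i *\<^sub>R ?p i)" by simp
    also have "\<dots> = (\<Sum>i\<in>?I. ?c i * bary T v (?p i))"
      by (rule bary_affine[OF assms]) (simp_all add: opt)
    finally show "bary T v x = bary T v 0 + (\<Sum>i\<in>UNIV. (bary T v (axis i 1) - bary T v 0) * x $ i)"
      by (simp add: opt algebra_simps sum_subtractf sum_distrib_left sum_distrib_right)
  qed
  moreover have "(\<lambda>x. bary T v 0 + (\<Sum>i\<in>UNIV. (bary T v (axis i 1) - bary T v 0) * x $ i)) \<in> poly_le 1"
    by (intro poly_le_add poly_le_const poly_le_sum poly_le_cmult poly_le_coord)
  ultimately show ?thesis by simp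
qed

text \<open>On the inscribed ball an affine coordinate takes values in [0,1] only, so it changes by
  at most 1 along a displacement of length \<open>\<rho> / 2\<close>.\<close>

lemma bary_lipschitz:
  assumes v: "v \<in> verts T" and b: "ball c \<rho> \<subseteq> T" "0 < \<rho>"
  shows "\<bar>bary T v x - bary T v y\<bar> \<le> 2 / \<rho> * norm (x - y)"
proof (cases "x = y")
  case False
  define t where "t = \<rho> / (2 * norm (x - y))"
  have t: "0 < t" using False b by (simp add: t_def)
  have "norm (t *\<^sub>R (x - y)) < \<rho>" using False b t by (simp add: t_def)
  then have "c + t *\<^sub>R (x - y) \<in> T" "c \<in> T" using b by (auto simp: dist_norm subset_iff)
  then have "0 \<le> bary T v (c + t *\<^sub>R (x - y))" "bary T v (c + t *\<^sub>R (x - y)) \<le> 1" "0 \<le> bary T v c" "bary T v c \<le> 1"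
    using bary_nonneg bary_le_1 v by auto
  then have "\<bar>t * (bary T v x - bary T v y)\<bar> \<le> 1" unfolding bary_move[OF v] by linarith
  then have "t * \<bar>bary T v x - bary T v y\<bar> \<le> 1" using t by (simp add: abs_mult)
  then show ?thesis using t False b by (simp add: t_def field_simps)
qed simp

text \<open>A face is the convex hull of some of the vertices; by uniqueness the coordinates of its
  points are carried by these vertices.\<close>

lemma bary_face_zero:
  assumes F: "F face_of T" and x: "x \<in> F" and v: "v \<in> verts T" "v \<notin> F"
  shows "bary T v x = 0"
proof -
  have "F face_of convex hull (verts T)" using F convex_hull_verts[OF T] by simp
  then obtain C where C: "C \<subseteq> verts T" "F = convex hull C"
    unfolding face_of_convex_hull_affine_independent[OF affine_independent_verts[OF T]] by blast
  have fC: "finite C" using C finite_verts[OF T] finite_subset by blast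
  obtain u where u: "sum u C = 1" "(\<Sum>v\<in>C. u v *\<^sub>R v) = x"
    using x unfolding C(2) convex_hull_finite[OF fC] by blast
  have vC: "v \<notin> C" using v hull_subset[of C convex] C(2) by auto
  have "bary T v x = (if v \<in> C then u v else 0)"
  proof (rule bary_unique[OF _ _ v(1)])
    show "(\<Sum>v\<in>verts T. if v \<in> C then u v else 0) = 1"
      using u(1) C(1) finite_verts[OF T] by (simp add: sum.If_cases Int_absorb1)
    have "(\<Sum>v\<in>verts T. (if v \<in> C then u v else 0) *\<^sub>R v) = (\<Sum>v\<in>verts T. if v \<in> C then u v *\<^sub>R v else 0)"
      by (intro sum.cong) auto
    then show "(\<Sum>v\<in>verts T. (if v \<in> C then u v else 0) *\<^sub>R v) = x"
      using u(2) C(1) finite_verts[OF T] by (simp add: sum.If_cases Int_absorb1)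
  qed
  then show ?thesis using vC by simp
qed

lemma mem_face_if_bary_zero:
  assumes F: "F face_of T" and x: "x \<in> T" and z: "\<And>v. v \<in> verts T \<Longrightarrow> v \<notin> F \<Longrightarrow> bary T v x = 0"
  shows "x \<in> F"
proof -
  let ?V = "verts T \<inter> F"
  have fV: "finite ?V" using finite_verts[OF T] by simp
  have "(\<Sum>v\<in>?V. bary T v x) = (\<Sum>v\<in>verts T. bary T v x)"
    using z finite_verts[OF T] by (intro sum.mono_neutral_left) auto
  moreover have "(\<Sum>v\<in>?V. bary T v x *\<^sub>R v) = (\<Sum>v\<in>verts T. bary T v x *\<^sub>R v)"
    using z finite_verts[OF T] by (intro sum.mono_neutral_left) auto
  ultimately have "(\<Sum>v\<in>?V. bary T v x) = 1" "(\<Sum>v\<in>?V. bary T v x *\<^sub>R v) = x"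
    by (simp_all only: bary_sum bary_comb)
  moreover have "\<forall>v\<in>?V. 0 \<le> bary T v x" using bary_nonneg[OF x] by auto
  ultimately have "x \<in> convex hull ?V" unfolding convex_hull_finite[OF fV] mem_Collect_eq
    by (intro exI[of _ "\<lambda>v. bary T v x"] conjI)
  moreover have "convex F" by (rule face_of_imp_convex[OF F])
  then have "convex hull ?V \<subseteq> F" by (intro hull_minimal Int_lower2)
  ultimately show ?thesis by (rule rev_subsetD)
qed

end

lemma verts_Int:
  assumes "(T \<inter> T') face_of T" "(T \<inter> T') face_of T'"
  shows "verts T \<inter> T' = verts T \<inter> verts T'"
proof -
  have "v \<in> verts T \<longleftrightarrow> v \<in> verts T'" if "v \<in> T \<inter> T'" for v
    using that extreme_point_of_face[OF assms(1), of v] extreme_point_of_face[OF assms(2), of v]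
    unfolding verts_def by auto
  then show ?thesis using verts_subset by blast
qed

text \<open>A point of the common face is a combination of the shared vertices, and by uniqueness
  its coefficients are the coordinates in both simplices. This is where conformity of the mesh
  enters: it makes hat functions well defined.\<close>

lemma bary_common_face:
  assumes T: "nsimplex T" "nsimplex T'" and F: "(T \<inter> T') face_of T" "(T \<inter> T') face_of T'"
    and x: "x \<in> T" "x \<in> T'"
  shows "v \<in> verts T \<Longrightarrow> v \<in> verts T' \<Longrightarrow> bary T v x = bary T' v x"
    and "v \<in> verts T \<Longrightarrow> v \<notin> verts T' \<Longrightarrow> bary T v x = 0"
proof -
  have V: "verts T \<inter> T' = verts T \<inter> verts T'" using verts_Int[OF F] .
  have z: "bary T v x = 0" if "v \<in> verts T" "v \<notin> verts T'" for v
    using bary_face_zero[OF T(1) F(1), of x v] that V x by auto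
  then show "v \<in> verts T \<Longrightarrow> v \<notin> verts T' \<Longrightarrow> bary T v x = 0" .
  assume v: "v \<in> verts T" "v \<in> verts T'"
  let ?u = "\<lambda>v. if v \<in> verts T then bary T v x else 0"
  have "bary T' v x = ?u v"
  proof (rule bary_unique[OF T(2) _ _ v(2)])
    have "(\<Sum>v\<in>verts T'. ?u v) = (\<Sum>v\<in>verts T'\<inter>verts T. bary T v x)"
      using finite_verts[OF T(2)] by (simp add: sum.If_cases)
    also have "\<dots> = (\<Sum>v\<in>verts T. bary T v x)"
      using z finite_verts[OF T(1)] by (intro sum.mono_neutral_left) auto
    finally show "(\<Sum>v\<in>verts T'. ?u v) = 1" using bary_sum[OF T(1)] by simp
    have "(\<Sum>v\<in>verts T'. ?u v *\<^sub>R v) = (\<Sum>v\<in>verts T'. if v \<in> verts T then bary T v x *\<^sub>R v else 0)"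
      by (intro sum.cong) auto
    also have "\<dots> = (\<Sum>v\<in>verts T'\<inter>verts T. bary T v x *\<^sub>R v)"
      using finite_verts[OF T(2)] by (simp add: sum.If_cases)
    also have "\<dots> = (\<Sum>v\<in>verts T. bary T v x *\<^sub>R v)"
      using z finite_verts[OF T(1)] by (intro sum.mono_neutral_left) auto
    finally show "(\<Sum>v\<in>verts T'. ?u v *\<^sub>R v) = x" using bary_comb[OF T(1)] by simp
  qed
  then show "bary T v x = bary T' v x" using v by simp
qed

section \<open>Nodal functions of a single simplex\<close>

definition nidx :: "(real ^ 'n::finite) set \<Rightarrow> nat \<Rightarrow> real ^ 'n \<Rightarrow> real ^ 'n \<Rightarrow> nat" where
  "nidx T k j v = nat \<lfloor>real k * bary T v j\<rfloor>"

text \<open>The classical product formula for the Lagrange basis: \<open>nidx\<close> is the integer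
  lattice index of the node \<open>j\<close>, and the binomial for vertex \<open>v\<close> vanishes
  at the nodes whose index at \<open>v\<close> is smaller.\<close>

definition lag :: "(real ^ 'n::finite) set \<Rightarrow> nat \<Rightarrow> real ^ 'n \<Rightarrow> real ^ 'n \<Rightarrow> real" where
  "lag T k j x = (\<Prod>v\<in>verts T. (real k * bary T v x) gchoose nidx T k j v)"

lemma poly_le_gbinomial:
  assumes "p \<in> poly_le 1" shows "(\<lambda>x. p x gchoose n) \<in> poly_le n"
proof -
  have "(\<lambda>x. \<Prod>i=0..<n. p x - real i) \<in> poly_le (\<Sum>i=0..<n. 1)"
    by (intro poly_le_prod poly_le_diff assms poly_le_const)
  then have "(\<lambda>x. (1 / fact n) * (\<Prod>i=0..<n. p x - real i)) \<in> poly_le n"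
    by (intro poly_le_cmult) simp
  then show ?thesis by (simp add: gbinomial_prod_rev)
qed

context
  fixes T :: "(real ^ 'n::finite) set" and k :: nat
  assumes T: "nsimplex T" and k: "k \<ge> 1"
begin

lemma lagrange_nodes_bary:
  assumes "sum a (verts T) = k" "j = (\<Sum>v\<in>verts T. (real (a v) / real k) *\<^sub>R v)" "v \<in> verts T"
  shows "bary T v j = real (a v) / real k" and "nidx T k j v = a v"
proof -
  have "(\<Sum>v\<in>verts T. real (a v) / real k) = 1"
    using assms(1) k by (simp add: sum_divide_distrib[symmetric] flip: of_nat_sum)
  then show *: "bary T v j = real (a v) / real k" using assms by (intro bary_unique[OF T]) auto
  show "nidx T k j v = a v" unfolding nidx_def * using k by simp
qed

lemma lagrange_nodes_nidx:
  assumes "j \<in> lagrange_nodes k T"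
  shows "v \<in> verts T \<Longrightarrow> real k * bary T v j = real (nidx T k j v)"
    and "(\<Sum>v\<in>verts T. nidx T k j v) = k"
proof -
  obtain a where a: "sum a (verts T) = k" "j = (\<Sum>v\<in>verts T. (real (a v) / real k) *\<^sub>R v)"
    using assms unfolding lagrange_nodes_def verts_def by blast
  note b = lagrange_nodes_bary[OF a]
  show "v \<in> verts T \<Longrightarrow> real k * bary T v j = real (nidx T k j v)" using b k by simp
  show "(\<Sum>v\<in>verts T. nidx T k j v) = k" using b(2) a(1) by simp
qed

lemma lagrange_nodesI:
  assumes "sum a (verts T) = k" "\<And>v. v \<in> verts T \<Longrightarrow> real k * bary T v j = real (a v)"
  shows "j \<in> lagrange_nodes k T"
proof -
  have "j = (\<Sum>v\<in>verts T. bary T v j *\<^sub>R v)" using bary_comb[OF T] by simp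
  also have "\<dots> = (\<Sum>v\<in>verts T. (real (a v) / real k) *\<^sub>R v)"
    using assms(2) k by (intro sum.cong refl) (simp add: field_simps)
  finally show ?thesis unfolding lagrange_nodes_def verts_def[symmetric] using assms(1) by blast
qed

lemma lagrange_nodes_subset: "lagrange_nodes k T \<subseteq> T"
proof
  fix j assume j: "j \<in> lagrange_nodes k T"
  have "0 \<le> bary T v j" if "v \<in> verts T" for v
  proof -
    have "0 \<le> real k * bary T v j" using lagrange_nodes_nidx(1)[OF j that] by simp
    then show ?thesis using k by (simp add: zero_le_mult_iff)
  qed
  then show "j \<in> T" using mem_nsimplex_iff[OF T] by blast
qed

lemma verts_subset_lagrange_nodes: "verts T \<subseteq> lagrange_nodes k T"
proof
  fix w assume w: "w \<in> verts T"
  show "w \<in> lagrange_nodes k T"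
    by (rule lagrange_nodesI[where a = "\<lambda>v. if v = w then k else 0"])
      (use w finite_verts[OF T] in \<open>auto simp: bary_vertex[OF T] sum.delta\<close>)
qed

lemma lagrange_nodes_image:
  "lagrange_nodes k T \<subseteq> (\<lambda>a. \<Sum>v\<in>verts T. (real (a v) / real k) *\<^sub>R v) ` PiE (verts T) (\<lambda>_. {..k})"
proof
  fix j assume "j \<in> lagrange_nodes k T"
  then obtain a where a: "sum a (verts T) = k" "j = (\<Sum>v\<in>verts T. (real (a v) / real k) *\<^sub>R v)"
    unfolding lagrange_nodes_def verts_def by blast
  have "restrict a (verts T) \<in> PiE (verts T) (\<lambda>_. {..k})"
    using a(1) finite_verts[OF T] member_le_sum[of _ "verts T" a] by auto
  moreover have "j = (\<Sum>v\<in>verts T. (real (restrict a (verts T) v) / real k) *\<^sub>R v)"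
    unfolding a(2) by (intro sum.cong) auto
  ultimately show "j \<in> (\<lambda>a. \<Sum>v\<in>verts T. (real (a v) / real k) *\<^sub>R v) ` PiE (verts T) (\<lambda>_. {..k})"
    using image_eqI[of j "\<lambda>a. \<Sum>v\<in>verts T. (real (a v) / real k) *\<^sub>R v" "restrict a (verts T)"] by simp
qed

lemma finite_lagrange_nodes: "finite (lagrange_nodes k T)"
  by (rule finite_subset[OF lagrange_nodes_image]) (intro finite_imageI finite_PiE finite_verts[OF T], auto)

lemma card_lagrange_nodes_le: "card (lagrange_nodes k T) \<le> (k + 1) ^ (CARD('n) + 1)"
proof -
  have "card (lagrange_nodes k T) \<le> card (PiE (verts T) (\<lambda>_. {..k}))"
    by (rule surj_card_le[OF _ lagrange_nodes_image]) (intro finite_PiE finite_verts[OF T], auto)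
  also have "\<dots> = (k + 1) ^ (CARD('n) + 1)" by (simp add: card_PiE finite_verts[OF T] card_verts[OF T])
  finally show ?thesis .
qed

lemma lag_poly_le: assumes "j \<in> lagrange_nodes k T" shows "lag T k j \<in> poly_le k"
proof -
  have "(\<lambda>x. \<Prod>v\<in>verts T. (real k * bary T v x) gchoose nidx T k j v) \<in> poly_le (\<Sum>v\<in>verts T. nidx T k j v)"
    by (intro poly_le_prod poly_le_gbinomial poly_le_cmult bary_poly_le[OF T])
  then show ?thesis using lagrange_nodes_nidx(2)[OF assms] by (simp add: lag_def[abs_def])
qed

lemma lagrange_nodes_eqI:
  assumes "j \<in> lagrange_nodes k T" "l \<in> lagrange_nodes k T"
    and "\<And>v. v \<in> verts T \<Longrightarrow> nidx T k j v = nidx T k l v"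
  shows "j = l"
proof -
  have "bary T v j = bary T v l" if "v \<in> verts T" for v
    using lagrange_nodes_nidx(1)[OF assms(1) that] lagrange_nodes_nidx(1)[OF assms(2) that] assms(3)[OF that] k
    by (metis mult_cancel_left not_one_le_zero of_nat_eq_0_iff)
  then have "(\<Sum>v\<in>verts T. bary T v j *\<^sub>R v) = (\<Sum>v\<in>verts T. bary T v l *\<^sub>R v)" by simp
  then show ?thesis using bary_comb[OF T] by metis
qed

text \<open>All nodes have the same index sum \<open>k\<close>. If \<open>l\<close> differs from
  \<open>j\<close>, some index of \<open>l\<close> is therefore smaller than that of
  \<open>j\<close>, and the corresponding binomial is 0.\<close>

lemma lag_node:
  assumes "j \<in> lagrange_nodes k T" "l \<in> lagrange_nodes k T"
  shows "lag T k j l = (if l = j then 1 else 0)"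
proof -
  have "lag T k j l = (\<Prod>v\<in>verts T. real (nidx T k l v choose nidx T k j v))"
    unfolding lag_def using lagrange_nodes_nidx(1)[OF assms(2)]
    by (intro prod.cong refl) (simp add: binomial_gbinomial)
  also have "\<dots> = (if l = j then 1 else 0)"
  proof (cases "l = j")
    case False
    have "\<exists>v\<in>verts T. nidx T k l v < nidx T k j v"
    proof (rule ccontr)
      assume "\<not> ?thesis"
      then have le: "\<And>v. v \<in> verts T \<Longrightarrow> nidx T k j v \<le> nidx T k l v" by force
      have "(\<Sum>v\<in>verts T. nidx T k j v) = (\<Sum>v\<in>verts T. nidx T k l v)"
        using lagrange_nodes_nidx(2) assms by simp
      then have "nidx T k j v = nidx T k l v" if "v \<in> verts T" for v
        by (rule sum_mono_inv[OF _ le that finite_verts[OF T]])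
      then have "j = l" using assms by (intro lagrange_nodes_eqI) auto
      then show False using False by simp
    qed
    then show ?thesis using False finite_verts[OF T] by (auto intro!: prod_zero)
  qed simp
  finally show ?thesis .
qed

lemma lag_zero:
  assumes "v \<in> verts T" "bary T v x = 0" "bary T v j \<noteq> 0" "j \<in> lagrange_nodes k T"
  shows "lag T k j x = 0"
proof -
  have "nidx T k j v \<noteq> 0"
  proof
    assume "nidx T k j v = 0"
    then have "real k * bary T v j = 0" using lagrange_nodes_nidx(1)[OF assms(4,1)] by simp
    then show False using assms(3) k by simp
  qed
  then have "(real k * bary T v x) gchoose nidx T k j v = 0" using assms(2) by (cases "nidx T k j v") auto
  then show ?thesis unfolding lag_def using assms(1) finite_verts[OF T] by (auto intro: prod_zero)
qed

text \<open>An exponent of total degree at most \<open>k\<close> becomes a lattice index with sum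
  exactly \<open>k\<close> when a spare vertex \<open>v0\<close> receives the missing degree. This
  injects monomials into nodes.\<close>

lemma card_mexp_le: "card (mexp k :: ('n \<Rightarrow> nat) set) \<le> card (lagrange_nodes k T)"
proof -
  obtain v0 where v0: "v0 \<in> verts T" using card_verts[OF T] by fastforce
  have "card (verts T - {v0}) = CARD('n)" using card_verts[OF T] v0 by simp
  then obtain e where e: "bij_betw e (UNIV::'n set) (verts T - {v0})"
    using finite_same_card_bij[of "UNIV::'n set" "verts T - {v0}"] finite_verts[OF T] by auto
  define ie where "ie = the_inv_into UNIV e"
  have ie: "ie (e i) = i" for i unfolding ie_def using e by (auto simp: bij_betw_def the_inv_into_f_f)
  define A where "A a v = (if v = v0 then k - sum a UNIV else a (ie v))" for a :: "'n \<Rightarrow> nat" and v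
  have eV: "e i \<in> verts T" "e i \<noteq> v0" for i using e bij_betwE by fastforce+
  have A: "A a (e i) = a i" for a i using eV by (simp add: A_def ie)
  have sA: "sum (A a) (verts T) = k" if "a \<in> mexp k" for a
  proof -
    have "sum (A a) (verts T) = A a v0 + sum (A a) (verts T - {v0})"
      using v0 finite_verts[OF T] by (simp add: sum.remove)
    also have "sum (A a) (verts T - {v0}) = (\<Sum>i\<in>UNIV. A a (e i))"
      using sum.reindex_bij_betw[OF e, of "A a"] by simp
    also have "\<dots> = sum a UNIV" by (simp add: A)
    finally show ?thesis using that by (simp add: A_def)
  qed
  let ?N = "\<lambda>a. \<Sum>v\<in>verts T. (real (A a v) / real k) *\<^sub>R v"
  have inj: "inj_on ?N (mexp k)"
  proof
    fix a b assume ab: "a \<in> mexp k" "b \<in> mexp k" "?N a = ?N b"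
    have "nidx T k (?N a) (e i) = a i" for i using lagrange_nodes_bary(2)[OF sA[OF ab(1)] refl eV(1)] A by simp
    moreover have "nidx T k (?N b) (e i) = b i" for i using lagrange_nodes_bary(2)[OF sA[OF ab(2)] refl eV(1)] A by simp
    ultimately show "a = b" using ab(3) by (auto simp: fun_eq_iff)
  qed
  have "?N ` mexp k \<subseteq> lagrange_nodes k T"
    unfolding lagrange_nodes_def verts_def[symmetric] using sA by blast
  then show ?thesis using card_inj_on_le[OF inj _ finite_lagrange_nodes] by blast
qed

end

interpretation fs: vector_space "\<lambda>(c::real) (f::'z \<Rightarrow> real) x. c * f x"
  by unfold_locales (simp_all add: fun_eq_iff algebra_simps)

lemma sum_fun_at: "(\<Sum>i\<in>I. (f i :: 'z \<Rightarrow> real)) x = (\<Sum>i\<in>I. f i x)"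
  by (induction I rule: infinite_finite_induct) auto

text \<open>The nodal functions are linearly independent and at least as many as the monomials.\<close>

theorem lagrange_interpolation:
  fixes T :: "(real ^ 'n::finite) set"
  assumes T: "nsimplex T" and k: "k \<ge> 1" and p: "p \<in> poly_le k"
  shows "p x = (\<Sum>j\<in>lagrange_nodes k T. p j * lag T k j x)"
proof -
  let ?N = "lagrange_nodes k T"
  define q where "q x = p x - (\<Sum>j\<in>?N. p j * lag T k j x)" for x
  have fin: "finite ?N" by (rule finite_lagrange_nodes[OF T k])
  have q: "q \<in> poly_le k" unfolding q_def
    by (intro poly_le_diff p poly_le_sum poly_le_cmult lag_poly_le[OF T k])
  have q0: "q l = 0" if "l \<in> ?N" for l
    unfolding q_def using that fin
    by (simp add: lag_node[OF T k] if_distrib[of "(*) _"] sum.delta' cong: if_cong)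
  have "q = (\<lambda>x. 0)"
  proof (rule ccontr)
    assume qn: "q \<noteq> (\<lambda>x. 0)"
    \<comment> \<open>The interpolation error vanishes at all nodes. If it were not 0, it would form
      together with the nodal functions an independent family with more members than there are
      monomials spanning \<open>poly_le k\<close>.\<close>
    let ?S = "insert q (lag T k ` ?N)"
    have inj: "inj_on (lag T k) ?N"
      by (intro inj_onI) (metis lag_node[OF T k] zero_neq_one)
    have qS: "q \<notin> lag T k ` ?N"
    proof
      assume "q \<in> lag T k ` ?N"
      then obtain j where j: "j \<in> ?N" "q = lag T k j" by blast
      then show False using q0[OF j(1)] lag_node[OF T k j(1) j(1)] by simp
    qed
    have cS: "card ?S = card ?N + 1" using fin qS card_image[OF inj] by simp
    have "fs.independent ?S"
    proof
      assume "fs.dependent ?S"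
      then obtain u where u: "\<exists>f\<in>?S. u f \<noteq> 0" "(\<Sum>f\<in>?S. (\<lambda>x. u f * f x)) = 0"
        using fs.dependent_finite[of ?S] fin by auto
      have ev: "u q * q x + (\<Sum>j\<in>?N. u (lag T k j) * lag T k j x) = 0" for x
      proof -
        have "(\<Sum>f\<in>?S. u f * f x) = 0" using fun_cong[OF u(2), of x] by (simp only: sum_fun_at zero_fun_apply)
        then show ?thesis using fin qS by (simp add: sum.reindex[OF inj])
      qed
      have ul: "u (lag T k l) = 0" if "l \<in> ?N" for l
        using ev[of l] q0[OF that] fin that
        by (simp add: lag_node[OF T k] if_distrib[of "(*) _"] sum.delta' cong: if_cong)
      then have "u q * q x = 0" for x using ev[of x] by simp
      then have "u q = 0" using qn by auto
      then show False using u(1) ul by auto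
    qed
    moreover have "?S \<subseteq> fs.span (monf ` mexp k)"
    proof
      fix f assume "f \<in> ?S"
      then have "f \<in> poly_le k" using q lag_poly_le[OF T k] by auto
      then obtain c where c: "f = (\<lambda>x. \<Sum>a\<in>mexp k. c a * monf a x)" by (elim poly_leE)
      have "f = (\<Sum>a\<in>mexp k. (\<lambda>x. c a * monf a x))" unfolding c by (simp add: fun_eq_iff sum_fun_at)
      also have "\<dots> \<in> fs.span (monf ` mexp k)"
        by (intro fs.span_sum fs.span_scale fs.span_base imageI)
      finally show "f \<in> fs.span (monf ` mexp k)" .
    qed
    ultimately have "card ?S \<le> card (monf ` mexp k :: (real ^ 'n \<Rightarrow> real) set)"
      using fs.independent_span_bound[of "monf ` mexp k" ?S] finite_mexp by blast
    also have "\<dots> \<le> card (mexp k :: ('n \<Rightarrow> nat) set)" by (rule card_image_le[OF finite_mexp])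
    also have "\<dots> \<le> card ?N" by (rule card_mexp_le[OF T k])
    finally show False using cS by simp
  qed
  then have "q x = 0" by simp
  then show ?thesis by (simp add: q_def)
qed

lemma poly_le_eq_if_eq_on_nsimplex:
  assumes T: "nsimplex T" and k: "k \<ge> 1" and p: "p \<in> poly_le k" "q \<in> poly_le k"
    and eq: "\<And>x. x \<in> lagrange_nodes k T \<Longrightarrow> p x = q x"
  shows "p = q"
proof
  fix x
  have "p x = (\<Sum>j\<in>lagrange_nodes k T. p j * lag T k j x)" by (rule lagrange_interpolation[OF T k p(1)])
  also have "\<dots> = (\<Sum>j\<in>lagrange_nodes k T. q j * lag T k j x)" using eq by (intro sum.cong) auto
  also have "\<dots> = q x" by (rule lagrange_interpolation[OF T k p(2), symmetric])
  finally show "p x = q x" .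
qed

text \<open>A node off the face has a nonzero coordinate at some vertex off the face. That
  coordinate vanishes on the face, hence so does the nodal function, and the interpolation formula
  at \<open>x\<close> only sees the nodes in \<open>F\<close>.\<close>

lemma poly_le_vanish_on_face:
  assumes T: "nsimplex T" and k: "k \<ge> 1" and p: "p \<in> poly_le k" and F: "F face_of T" and x: "x \<in> F"
    and z: "\<And>j. j \<in> lagrange_nodes k T \<Longrightarrow> j \<in> F \<Longrightarrow> p j = 0"
  shows "p x = 0"
proof -
  have "p j * lag T k j x = 0" if j: "j \<in> lagrange_nodes k T" for j
  proof (cases "j \<in> F")
    case False
    have "j \<in> T" using j lagrange_nodes_subset[OF T k] by auto
    then have "\<not> (\<forall>v. v \<in> verts T \<longrightarrow> v \<notin> F \<longrightarrow> bary T v j = 0)"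
      using mem_face_if_bary_zero[OF T F, of j] False by auto
    then obtain v where v: "v \<in> verts T" "v \<notin> F" "bary T v j \<noteq> 0" by auto
    then show ?thesis using lag_zero[OF T k v(1) bary_face_zero[OF T F x v(1,2)] v(3) j] by simp
  qed (use z j in simp)
  then show ?thesis using lagrange_interpolation[OF T k p, of x] by simp
qed

section \<open>Inverse estimates on shape regular simplices\<close>

lemma square_le_if_abs_le: "\<bar>a\<bar> \<le> b \<Longrightarrow> a\<^sup>2 \<le> (b::real)\<^sup>2"
  using power_mono[of "\<bar>a\<bar>" b 2] by simp

lemma power_split_2: "2 \<le> n \<Longrightarrow> (h::real) ^ n = h ^ (n - 2) * h\<^sup>2"
  by (metis le_add_diff_inverse2 power_add)

text \<open>Dividing all factors by \<open>B\<close> brings them into the unit interval, where the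
  difference of products is at most the sum of the differences.\<close>

lemma abs_prod_diff_le:
  fixes a b :: "'i \<Rightarrow> real"
  assumes B: "1 \<le> B" and I: "finite I"
    and a: "\<And>i. i \<in> I \<Longrightarrow> \<bar>a i\<bar> \<le> B" and b: "\<And>i. i \<in> I \<Longrightarrow> \<bar>b i\<bar> \<le> B"
    and D: "\<And>i. i \<in> I \<Longrightarrow> \<bar>a i - b i\<bar> \<le> D"
  shows "\<bar>(\<Prod>i\<in>I. a i) - (\<Prod>i\<in>I. b i)\<bar> \<le> B ^ card I * (real (card I) * D)"
proof -
  have pr: "(\<Prod>i\<in>I. f i) = B ^ card I * (\<Prod>i\<in>I. f i / B)" for f
    using B by (simp add: prod_dividef)
  have "norm ((\<Prod>i\<in>I. a i / B) - (\<Prod>i\<in>I. b i / B)) \<le> (\<Sum>i\<in>I. norm (a i / B - b i / B))"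
    by (rule norm_prod_diff) (use B a b in auto)
  also have "\<dots> \<le> (\<Sum>i\<in>I. D)"
  proof (rule sum_mono)
    fix i assume i: "i \<in> I"
    have "norm (a i / B - b i / B) = \<bar>a i - b i\<bar> / B" using B by (simp flip: diff_divide_distrib)
    also have "\<dots> \<le> \<bar>a i - b i\<bar>" using B mult_left_mono[of 1 B "\<bar>a i - b i\<bar>"] by (simp add: divide_le_eq)
    finally show "norm (a i / B - b i / B) \<le> D" using D[OF i] by linarith
  qed
  finally have "\<bar>(\<Prod>i\<in>I. a i / B) - (\<Prod>i\<in>I. b i / B)\<bar> \<le> real (card I) * D" by simp
  then have "B ^ card I * \<bar>(\<Prod>i\<in>I. a i / B) - (\<Prod>i\<in>I. b i / B)\<bar> \<le> B ^ card I * (real (card I) * D)"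
    using B by (intro mult_left_mono) auto
  then show ?thesis using B by (subst (1 2) pr) (simp add: abs_mult flip: right_diff_distrib)
qed

lemma abs_gbinomial_le:
  fixes s :: real assumes "\<bar>s\<bar> + real n \<le> B" shows "\<bar>s gchoose n\<bar> \<le> B ^ n"
proof -
  have B0: "0 \<le> B" using assms by linarith
  have "\<bar>s gchoose n\<bar> = \<bar>\<Prod>i=0..<n. s - real i\<bar> / fact n" by (simp add: gbinomial_prod_rev)
  also have "\<dots> \<le> \<bar>\<Prod>i=0..<n. s - real i\<bar> / 1" by (intro divide_left_mono) auto
  also have "\<dots> = (\<Prod>i=0..<n. \<bar>s - real i\<bar>)" by (simp add: abs_prod)
  also have "\<dots> \<le> (\<Prod>i=0..<n. B)" using assms by (intro prod_mono) auto
  finally show ?thesis by simp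
qed

lemma gbinomial_lipschitz:
  fixes s t :: real assumes "0 \<le> s" "s \<le> real k" "0 \<le> t" "t \<le> real k" "n \<le> k" "1 \<le> k"
  shows "\<bar>(s gchoose n) - (t gchoose n)\<bar> \<le> real k ^ k * (real k * \<bar>s - t\<bar>)"
proof -
  have "(s gchoose n) - (t gchoose n) = ((\<Prod>i=0..<n. s - real i) - (\<Prod>i=0..<n. t - real i)) / fact n"
    by (simp add: gbinomial_prod_rev diff_divide_distrib)
  then have "\<bar>(s gchoose n) - (t gchoose n)\<bar> = \<bar>(\<Prod>i=0..<n. s - real i) - (\<Prod>i=0..<n. t - real i)\<bar> / fact n"
    by simp
  also have "\<dots> \<le> \<bar>(\<Prod>i=0..<n. s - real i) - (\<Prod>i=0..<n. t - real i)\<bar> / 1"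
    by (intro divide_left_mono) auto
  also have "\<dots> \<le> real k ^ card {0..<n} * (real (card {0..<n}) * \<bar>s - t\<bar>)"
    unfolding div_by_1 by (rule abs_prod_diff_le) (use assms in \<open>auto simp: abs_le_iff\<close>)
  also have "\<dots> \<le> real k ^ k * (real k * \<bar>s - t\<bar>)"
    using assms by (intro mult_mono power_increasing) auto
  finally show ?thesis .
qed

lemma nsimplex_diameter_pos:
  fixes T :: "(real ^ 'n::finite) set"
  assumes T: "nsimplex T" shows "0 < diameter T"
proof -
  have c: "card (verts T) \<ge> 2" using card_verts[OF T] by simp
  then obtain v where v: "v \<in> verts T" by fastforce
  have "verts T \<noteq> {v}" using c by auto
  then obtain w where w: "w \<in> verts T" "w \<noteq> v" using v by blast
  have "dist v w \<le> diameter T"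
    using v w verts_subset compact_imp_bounded[OF compact_nsimplex[OF T]]
    by (intro diameter_bounded_bound) auto
  moreover have "0 < dist v w" using w(2) by simp
  ultimately show ?thesis by (rule less_le_trans[rotated])
qed

abbreviation shape :: "real \<Rightarrow> (real ^ 'n::finite) set \<Rightarrow> bool" where
  "shape \<sigma> T \<equiv> nsimplex T \<and> (\<exists>c. ball c (diameter T / \<sigma>) \<subseteq> T)"

lemma bary_lipschitz_shape:
  assumes T: "shape \<sigma> T" and \<sigma>: "\<sigma> > 0" and v: "v \<in> verts T"
  shows "\<bar>bary T v x - bary T v y\<bar> \<le> 2 * \<sigma> / diameter T * norm (x - y)"
proof -
  obtain c where c: "ball c (diameter T / \<sigma>) \<subseteq> T" using T by blast
  have nT: "nsimplex T" using T by simp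
  show ?thesis using bary_lipschitz[OF nT v c, of x y] nsimplex_diameter_pos[OF nT] \<sigma> by simp
qed

text \<open>The coordinate of \<open>v\<close> drops from 1 to 0 along the edge and has Lipschitz
  constant \<open>2 * \<sigma> / diameter T\<close>. So every edge is comparable to the diameter,
  and two simplices sharing an edge have comparable sizes.\<close>

lemma diameter_le_vertex_dist:
  assumes T: "shape \<sigma> T" and \<sigma>: "\<sigma> > 0" and v: "v \<in> verts T" "w \<in> verts T" "v \<noteq> w"
  shows "diameter T \<le> 2 * \<sigma> * norm (v - w)"
proof -
  have nT: "nsimplex T" using T by simp
  have "1 \<le> 2 * \<sigma> / diameter T * norm (v - w)"
    using bary_lipschitz_shape[OF T \<sigma> v(1), of v w] v by (simp add: bary_vertex[OF nT])
  then show ?thesis using nsimplex_diameter_pos[OF nT] by (simp add: field_simps)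
qed

lemma abs_lag_le:
  fixes T :: "(real ^ 'n::finite) set"
  assumes T: "nsimplex T" and k: "k \<ge> 1" and j: "j \<in> lagrange_nodes k T" and R: "0 \<le> R"
    and y: "\<And>v. v \<in> verts T \<Longrightarrow> \<bar>bary T v y\<bar> \<le> R"
  shows "\<bar>lag T k j y\<bar> \<le> (real k * R + real k) ^ k"
proof -
  let ?B = "real k * R + real k"
  have B1: "1 \<le> ?B" 
  proof -
    have "0 \<le> real k * R" "1 \<le> real k" using k R by auto
    then show ?thesis by linarith
  qed
  have n: "nidx T k j v \<le> k" if "v \<in> verts T" for v
    using member_le_sum[of v "verts T" "nidx T k j"] finite_verts[OF T] that lagrange_nodes_nidx(2)[OF T k j] by simp
  have "\<bar>lag T k j y\<bar> = (\<Prod>v\<in>verts T. \<bar>(real k * bary T v y) gchoose nidx T k j v\<bar>)"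
    unfolding lag_def by (simp add: abs_prod)
  also have "\<dots> \<le> (\<Prod>v\<in>verts T. ?B ^ nidx T k j v)"
  proof (intro prod_mono conjI)
    fix v assume v: "v \<in> verts T"
    have "\<bar>real k * bary T v y\<bar> \<le> real k * R" using y[OF v] by (simp add: abs_mult mult_left_mono)
    then show "\<bar>(real k * bary T v y) gchoose nidx T k j v\<bar> \<le> ?B ^ nidx T k j v"
      using n[OF v] by (intro abs_gbinomial_le) linarith
  qed simp
  also have "\<dots> = ?B ^ k" using lagrange_nodes_nidx(2)[OF T k j] by (simp flip: power_sum)
  finally show ?thesis .
qed

text \<open>Values on \<open>T\<close> are controlled by the values at the Lagrange nodes of the half-sized
  copy of \<open>T\<close>, shifted by any small \<open>b\<close>; all these nodes lie well inside \<open>T\<close>.\<close>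

lemma abs_le_sum_inner_nodes:
  fixes T :: "(real ^ 'n::finite) set"
  assumes T: "nsimplex T" and k: "k \<ge> 1" and \<sigma>: "\<sigma> > 0" and c: "ball c (diameter T / \<sigma>) \<subseteq> T"
    and p: "p \<in> poly_le k" and y: "y \<in> T" and b: "norm b < diameter T / (2 * \<sigma>)"
  shows "\<bar>p y\<bar> \<le> (real k * (2 * \<sigma> + 3) + real k) ^ k * (\<Sum>j\<in>lagrange_nodes k T. \<bar>p ((1/2) *\<^sub>R (j + c) + b)\<bar>)"
proof -
  let ?h = "diameter T" let ?B = "(real k * (2 * \<sigma> + 3) + real k) ^ k"
  have h: "0 < ?h" by (rule nsimplex_diameter_pos[OF T])
  have cT: "c \<in> T" using c h \<sigma> by (auto simp: subset_iff)
  \<comment> \<open>The map from \<open>x\<close> to \<open>(x + c) / 2 + b\<close> carries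
    \<open>T\<close> to its shifted half-size copy, and \<open>z\<close> is the preimage of
    \<open>y\<close>. Since \<open>z\<close> is close to \<open>y\<close> relative to the size of
    \<open>T\<close>, its coordinates are at most \<open>2 * \<sigma> + 3\<close> in absolute
    value.\<close>
  define z where "z = 2 *\<^sub>R (y - b) - c"
  define q where "q x = p ((1/2) *\<^sub>R x + ((1/2) *\<^sub>R c + b))" for x
  have q: "q \<in> poly_le k" unfolding q_def by (rule poly_le_compose_scale_shift[OF p])
  have "(1/2) *\<^sub>R z + ((1/2) *\<^sub>R c + b) = y" unfolding z_def by (simp add: algebra_simps)
  then have "p y = q z" by (simp add: q_def)
  also have "\<dots> = (\<Sum>j\<in>lagrange_nodes k T. q j * lag T k j z)" by (rule lagrange_interpolation[OF T k q])
  also have "\<bar>\<dots>\<bar> \<le> (\<Sum>j\<in>lagrange_nodes k T. \<bar>q j\<bar> * \<bar>lag T k j z\<bar>)"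
    using sum_abs[of "\<lambda>j. q j * lag T k j z"] by (simp add: abs_mult)
  also have "\<dots> \<le> (\<Sum>j\<in>lagrange_nodes k T. \<bar>q j\<bar> * ?B)"
  proof (intro sum_mono mult_left_mono)
    fix j assume j: "j \<in> lagrange_nodes k T"
    show "\<bar>lag T k j z\<bar> \<le> ?B"
    proof (rule abs_lag_le[OF T k j])
      fix v assume v: "v \<in> verts T"
      have "norm (z - y) \<le> norm (y - c) + 2 * norm b"
      proof -
        have "z - y = (y - c) - 2 *\<^sub>R b" by (rule Finite_Cartesian_Product.vec_eq_iff[THEN iffD2], rule allI, simp add: z_def algebra_simps)
        then show ?thesis using norm_triangle_ineq4[of "y - c" "2 *\<^sub>R b"] by (simp only: norm_scaleR abs_numeral)
      qed
      also have "\<dots> \<le> ?h + ?h / \<sigma>"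
      proof (rule add_mono)
        show "norm (y - c) \<le> ?h"
          using diameter_bounded_bound[OF compact_imp_bounded[OF compact_nsimplex[OF T]] y cT] by (simp add: dist_norm)
        show "2 * norm b \<le> ?h / \<sigma>" using b \<sigma> by (simp add: field_simps)
      qed
      finally have "2 * \<sigma> / ?h * norm (z - y) \<le> 2 * \<sigma> / ?h * (?h + ?h / \<sigma>)"
        using h \<sigma> by (intro mult_left_mono) auto
      also have "\<dots> = 2 * \<sigma> + 2" using h \<sigma> by (simp add: field_simps)
      finally have "\<bar>bary T v z - bary T v y\<bar> \<le> 2 * \<sigma> + 2"
        using bary_lipschitz_shape[OF _ \<sigma> v, of z y] T c by fastforce
      then show "\<bar>bary T v z\<bar> \<le> 2 * \<sigma> + 3"
        using bary_nonneg[OF T y v] bary_le_1[OF T y v] by linarith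
    qed (use \<sigma> in simp)
  qed simp
  also have "\<dots> = ?B * (\<Sum>j\<in>lagrange_nodes k T. \<bar>p ((1/2) *\<^sub>R (j + c) + b)\<bar>)"
    by (simp add: q_def sum_distrib_left algebra_simps)
  finally show ?thesis .
qed

lemma set_integrable_poly:
  fixes T :: "(real ^ 'n::finite) set"
  assumes "T \<in> sets borel" "bounded T" "continuous_on UNIV f"
  shows "set_integrable lborel T (f :: real ^ 'n \<Rightarrow> real)"
proof -
  obtain r where r: "0 < r" "T \<subseteq> cball 0 r" using assms(2) bounded_pos[of T] by (auto simp: subset_iff)
  have "set_integrable lborel (cball 0 r) f"
    unfolding set_integrable_def
    by (rule borel_integrable_compact) (auto intro: continuous_on_subset[OF assms(3)])
  then show ?thesis by (rule set_integrable_subset) (use assms r in auto)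
qed

lemma set_integral_mono_subset:
  fixes f :: "'a \<Rightarrow> real"
  assumes "set_integrable M B f" "A \<in> sets M" "A \<subseteq> B" "\<And>x. x \<in> B \<Longrightarrow> 0 \<le> f x"
  shows "(LINT x:A|M. f x) \<le> (LINT x:B|M. f x)"
  unfolding set_lebesgue_integral_def
proof (rule integral_mono)
  show "integrable M (\<lambda>x. indicat_real A x *\<^sub>R f x)"
    using set_integrable_subset[OF assms(1-3)] by (simp add: set_integrable_def)
qed (use assms in \<open>auto simp: set_integrable_def indicator_def\<close>)

text \<open>The small ball is the image of \<open>ball c r\<close> under the contraction by one half
  towards \<open>j\<close>, which keeps the convex set \<open>T\<close> inside itself.\<close>

lemma ball_half_subset:
  fixes T :: "'a::euclidean_space set"
  assumes "convex T" "ball c r \<subseteq> T" "j \<in> T"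
  shows "ball ((1/2) *\<^sub>R (j + c)) (r / 2) \<subseteq> T"
proof
  fix x assume "x \<in> ball ((1/2) *\<^sub>R (j + c)) (r / 2)"
  then have e: "norm (x - (1/2) *\<^sub>R (j + c)) < r / 2" by (simp add: dist_norm norm_minus_commute)
  define e where "e = x - (1/2) *\<^sub>R (j + c)"
  have "norm (2 *\<^sub>R e) < r" using e unfolding e_def[symmetric] by simp
  then have "c + 2 *\<^sub>R e \<in> T" using assms(2) by (auto simp: subset_iff dist_norm)
  then have "(1/2) *\<^sub>R (c + 2 *\<^sub>R e) + (1/2) *\<^sub>R j \<in> T" using assms by (intro convexD) auto
  then show "x \<in> T" by (simp add: e_def algebra_simps)
qed

text \<open>Average the preceding pointwise bound over all shifts \<open>b\<close> in a ball of
  radius \<open>diameter T / (2 * \<sigma>)\<close>. Each inner node then sweeps out a ball inside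
  \<open>T\<close>, so every term is bounded by the integral over \<open>T\<close>. The constant is
  explicit, without transformation to a reference simplex.\<close>

lemma L2_bounds_sup:
  fixes \<sigma> :: real
  assumes k: "k \<ge> 1" and \<sigma>: "\<sigma> > 0"
  obtains C where "C > 0" "\<And>(T :: (real ^ 'n::finite) set) (p :: real ^ 'n \<Rightarrow> real) y. shape \<sigma> T \<Longrightarrow> p \<in> poly_le k \<Longrightarrow> y \<in> T \<Longrightarrow>
      diameter T ^ CARD('n) * (p y)\<^sup>2 \<le> C * (LINT x:T|lborel. (p x)\<^sup>2)"
proof
  let ?B = "(real k * (2 * \<sigma> + 3) + real k) ^ k"
  let ?N = "real ((k + 1) ^ (CARD('n) + 1))"
  let ?u = "unit_ball_vol (real CARD('n))"
  \<comment> \<open>The first factor turns the volume of the ball of shifts into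
    \<open>diameter T ^ CARD('n)\<close>. One \<open>?N\<close> comes from squaring a sum over
    nodes, the other from adding up the integrals over the nodes.\<close>
  define C where "C = (2 * \<sigma>) ^ CARD('n) / ?u * (?B\<^sup>2 * (?N * ?N))"
  have B0: "0 < real k * (2 * \<sigma> + 3) + real k" using k \<sigma> by (intro add_pos_pos mult_pos_pos) auto
  have B: "0 < ?B" by (intro zero_less_power B0)
  have N0: "0 < ?N" unfolding of_nat_0_less_iff by simp
  show "C > 0" unfolding C_def by (intro mult_pos_pos divide_pos_pos zero_less_power B0 N0) (use \<sigma> in simp_all)
  fix T :: "(real ^ 'n) set" and p :: "real ^ 'n \<Rightarrow> real" and y
  assume T0: "shape \<sigma> T" and p: "p \<in> poly_le k" and y: "y \<in> T"
  then obtain c where T: "nsimplex T" and c: "ball c (diameter T / \<sigma>) \<subseteq> T" by blast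
  let ?h = "diameter T" let ?U = "ball (0::real ^ 'n) (?h / (2 * \<sigma>))"
  let ?J = "lagrange_nodes k T" let ?z = "\<lambda>j. (1/2) *\<^sub>R (j + c)"
  have h: "0 < ?h" by (rule nsimplex_diameter_pos[OF T])
  have bT: "bounded T" "T \<in> sets borel"
    using compact_nsimplex[OF T] by (auto intro: compact_imp_bounded borel_compact)
  have cp: "continuous_on UNIV (\<lambda>x. (p x)\<^sup>2)" by (intro continuous_intros poly_le_continuous[OF p])
  have cpz: "continuous_on UNIV (\<lambda>b. (p (?z j + b))\<^sup>2)" for j
    by (rule continuous_on_compose2[OF cp]) (auto intro!: continuous_on_add continuous_on_const continuous_on_id)
  have intT: "set_integrable lborel T (\<lambda>x. (p x)\<^sup>2)" by (rule set_integrable_poly[OF bT(2,1) cp])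
  have intU: "set_integrable lborel ?U (\<lambda>b. (p (?z j + b))\<^sup>2)" for j
    by (rule set_integrable_poly[OF _ _ cpz]) auto
  have pt: "(p y)\<^sup>2 \<le> ?B\<^sup>2 * ?N * (\<Sum>j\<in>?J. (p (?z j + b))\<^sup>2)" if b: "b \<in> ?U" for b
  proof -
    have "\<bar>p y\<bar> \<le> ?B * (\<Sum>j\<in>?J. \<bar>p (?z j + b)\<bar>)"
      using b by (intro abs_le_sum_inner_nodes[OF T k \<sigma> c p y]) simp
    then have "(p y)\<^sup>2 \<le> (?B * (\<Sum>j\<in>?J. \<bar>p (?z j + b)\<bar>))\<^sup>2" by (rule square_le_if_abs_le)
    also have "\<dots> \<le> ?B\<^sup>2 * ((\<Sum>j\<in>?J. (p (?z j + b))\<^sup>2) * real (card ?J))"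
      unfolding power_mult_distrib using sum_squared_le_sum_of_squares[of "\<lambda>j. \<bar>p (?z j + b)\<bar>" ?J]
      by (intro mult_left_mono) (auto simp: mult.commute)
    also have "\<dots> \<le> ?B\<^sup>2 * ((\<Sum>j\<in>?J. (p (?z j + b))\<^sup>2) * ?N)"
      using card_lagrange_nodes_le[OF T k] by (intro mult_left_mono of_nat_mono sum_nonneg) auto
    finally show ?thesis by (simp only: mult_ac)
  qed
  have shift: "(LINT b:?U|lborel. (p (?z j + b))\<^sup>2) \<le> (LINT x:T|lborel. (p x)\<^sup>2)" if j: "j \<in> ?J" for j
  proof -
    let ?V = "ball (?z j) (?h / (2 * \<sigma>))"
    have "(LINT b:?U|lborel. (p (?z j + b))\<^sup>2) = (LINT b|lborel. (\<lambda>x. indicat_real ?V x *\<^sub>R (p x)\<^sup>2) (?z j + b))"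
      unfolding set_lebesgue_integral_def by (intro Bochner_Integration.integral_cong refl) (simp add: indicator_def dist_norm)
    also have "\<dots> = (LINT x|distr lborel borel ((+) (?z j)). indicat_real ?V x *\<^sub>R (p x)\<^sup>2)"
      by (subst integral_distr)
        (auto intro!: borel_measurable_times borel_measurable_indicator borel_measurable_power poly_le_measurable[OF p])
    also have "\<dots> = (LINT x:?V|lborel. (p x)\<^sup>2)" unfolding lborel_distr_plus set_lebesgue_integral_def ..
    also have "\<dots> \<le> (LINT x:T|lborel. (p x)\<^sup>2)"
    proof (rule set_integral_mono_subset)
      have "j \<in> T" using lagrange_nodes_subset[OF T k] j by auto
      then show "?V \<subseteq> T"
        using ball_half_subset[OF convex_nsimplex[OF T] c] by (simp add: mult.commute)
    qed (use intT in auto)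
    finally show ?thesis .
  qed
  have "measure lborel ?U * (p y)\<^sup>2 = (LINT b:?U|lborel. (p y)\<^sup>2)"
    using set_integral_const[of ?U lborel "(p y)\<^sup>2"] emeasure_bounded_finite[of ?U] by simp
  also have "\<dots> \<le> (LINT b:?U|lborel. ?B\<^sup>2 * ?N * (\<Sum>j\<in>?J. (p (?z j + b))\<^sup>2))"
    using pt by (intro set_integral_mono set_integrable_mult_right set_integrable_poly continuous_intros cpz) auto
  also have "\<dots> = ?B\<^sup>2 * ?N * (LINT b:?U|lborel. (\<Sum>j\<in>?J. (p (?z j + b))\<^sup>2))"
    by (rule set_integral_mult_right)
  also have "(LINT b:?U|lborel. (\<Sum>j\<in>?J. (p (?z j + b))\<^sup>2)) = (\<Sum>j\<in>?J. LINT b:?U|lborel. (p (?z j + b))\<^sup>2)"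
    using intU unfolding set_lebesgue_integral_def set_integrable_def
    by (simp only: scaleR_sum_right) (rule Bochner_Integration.integral_sum, simp)
  also have "?B\<^sup>2 * ?N * (\<Sum>j\<in>?J. LINT b:?U|lborel. (p (?z j + b))\<^sup>2) \<le> ?B\<^sup>2 * ?N * (\<Sum>j\<in>?J. LINT x:T|lborel. (p x)\<^sup>2)"
    using shift by (intro mult_left_mono sum_mono) auto
  also have "\<dots> \<le> ?B\<^sup>2 * ?N * (?N * (LINT x:T|lborel. (p x)\<^sup>2))"
  proof -
    have "0 \<le> (LINT x:T|lborel. (p x)\<^sup>2)"
      unfolding set_lebesgue_integral_def by (intro Bochner_Integration.integral_nonneg) auto
    moreover have "real (card ?J) \<le> ?N" using card_lagrange_nodes_le[OF T k] by (rule of_nat_mono)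
    ultimately have "real (card ?J) * (LINT x:T|lborel. (p x)\<^sup>2) \<le> ?N * (LINT x:T|lborel. (p x)\<^sup>2)"
      by (rule mult_right_mono[rotated])
    then show ?thesis
      by (subst sum_constant) (intro mult_left_mono mult_nonneg_nonneg zero_le_power2 of_nat_0_le_iff)
  qed
  finally have main: "measure lborel ?U * (p y)\<^sup>2 \<le> ?B\<^sup>2 * (?N * ?N) * (LINT x:T|lborel. (p x)\<^sup>2)"
    by (simp only: mult_ac)
  have "measure lborel ?U = ?u * (?h / (2 * \<sigma>)) ^ CARD('n)"
    using content_ball[of "?h / (2 * \<sigma>)" "0::real ^ 'n"] h \<sigma> by simp
  then have "?h ^ CARD('n) = (2 * \<sigma>) ^ CARD('n) / ?u * measure lborel ?U"
    using \<sigma> less_imp_neq[OF unit_ball_vol_pos[of "real CARD('n)"]] by (simp add: power_divide)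
  then have "?h ^ CARD('n) * (p y)\<^sup>2 = (2 * \<sigma>) ^ CARD('n) / ?u * (measure lborel ?U * (p y)\<^sup>2)"
    by simp
  also have "\<dots> \<le> (2 * \<sigma>) ^ CARD('n) / ?u * (?B\<^sup>2 * (?N * ?N) * (LINT x:T|lborel. (p x)\<^sup>2))"
    using \<sigma> by (intro mult_left_mono main) auto
  finally show "?h ^ CARD('n) * (p y)\<^sup>2 \<le> C * (LINT x:T|lborel. (p x)\<^sup>2)"
    by (simp add: C_def mult.assoc)
qed

definition grad2 :: "(real ^ 'n::finite \<Rightarrow> real) \<Rightarrow> real ^ 'n \<Rightarrow> real" where
  "grad2 p x = (\<Sum>i\<in>UNIV. (pd i p x)\<^sup>2)"

lemma continuous_grad2: "p \<in> poly_le k \<Longrightarrow> continuous_on UNIV (grad2 p)"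
  unfolding grad2_def[abs_def] by (intro continuous_intros poly_le_continuous pd_poly_le)

lemma set_integrable_nsimplex:
  assumes "nsimplex T" "continuous_on UNIV f"
  shows "set_integrable lborel T (f :: real ^ 'n::finite \<Rightarrow> real)"
  using compact_nsimplex[OF assms(1)] assms(2)
  by (intro set_integrable_poly) (auto intro: compact_imp_bounded borel_compact)

lemma set_integral_grad2_nonneg: "0 \<le> (LINT x:T|lborel. grad2 p x)"
  unfolding set_lebesgue_integral_def grad2_def
  by (intro Bochner_Integration.integral_nonneg) (auto intro!: sum_nonneg mult_nonneg_nonneg)

text \<open>Mean value theorem on the segment, then the bound above for each partial derivative at
  the intermediate point. The squared length of the segment uses up two of the
  \<open>CARD('n)\<close> powers of the diameter.\<close>

lemma oscillation_le_gradient: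
  fixes \<sigma> :: real
  assumes k: "k \<ge> 1" and \<sigma>: "\<sigma> > 0" and n: "CARD('n) \<ge> 2"
  obtains C where "C > 0" "\<And>(T :: (real ^ 'n::finite) set) (p :: real ^ 'n \<Rightarrow> real) x y. shape \<sigma> T \<Longrightarrow> p \<in> poly_le k \<Longrightarrow>
      x \<in> T \<Longrightarrow> y \<in> T \<Longrightarrow> diameter T ^ (CARD('n) - 2) * (p x - p y)\<^sup>2 \<le> C * (LINT x:T|lborel. grad2 p x)"
proof -
  obtain C where C: "C > 0" "\<And>(T :: (real ^ 'n) set) (p :: real ^ 'n \<Rightarrow> real) y. shape \<sigma> T \<Longrightarrow> p \<in> poly_le k \<Longrightarrow> y \<in> T \<Longrightarrow>
      diameter T ^ CARD('n) * (p y)\<^sup>2 \<le> C * (LINT x:T|lborel. (p x)\<^sup>2)"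
    using L2_bounds_sup[OF k \<sigma>] by blast
  show thesis
  proof (rule that[OF C(1)])
    fix T :: "(real ^ 'n) set" and p :: "real ^ 'n \<Rightarrow> real" and x y
    assume T: "shape \<sigma> T" and p: "p \<in> poly_le k" and x: "x \<in> T" and y: "y \<in> T"
    let ?h = "diameter T"
    have nT: "nsimplex T" using T by simp
    have h: "0 < ?h" by (rule nsimplex_diameter_pos[OF nT])
    let ?g = "\<lambda>t. p (x + t *\<^sub>R (y - x))"
    let ?D = "\<lambda>t. \<Sum>i\<in>UNIV. (y - x) $ i * pd i p (x + t *\<^sub>R (y - x))"
    have "\<exists>t>0. t < 1 \<and> ?g 1 - ?g 0 = (1 - 0) * ?D t"
      by (rule MVT2[of 0 1 ?g ?D]) (simp, rule poly_le_line_deriv[OF p])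
    then obtain t where t: "0 < t" "t < 1" "?g 1 - ?g 0 = (1 - 0) * ?D t" by blast
    define z where "z = x + t *\<^sub>R (y - x)"
    have "z = (1 - t) *\<^sub>R x + t *\<^sub>R y" by (simp add: z_def algebra_simps)
    then have zT: "z \<in> T" using convexD_alt[OF convex_nsimplex[OF nT] x y, of t] t by simp
    have "(p x - p y)\<^sup>2 = (\<Sum>i\<in>UNIV. (y - x) $ i * pd i p z)\<^sup>2"
      using t(3) power2_commute[of "p x" "p y"] by (simp add: z_def)
    also have "\<dots> \<le> (\<Sum>i\<in>UNIV. ((y - x) $ i)\<^sup>2) * (\<Sum>i\<in>UNIV. (pd i p z)\<^sup>2)"
      by (rule Cauchy_Schwarz_ineq_sum)
    also have "(\<Sum>i\<in>UNIV. ((y - x) $ i)\<^sup>2) = (norm (y - x))\<^sup>2"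
      by (simp add: norm_vec_def L2_set_def real_sqrt_pow2 sum_nonneg)
    also have "(norm (y - x))\<^sup>2 * (\<Sum>i\<in>UNIV. (pd i p z)\<^sup>2) \<le> ?h\<^sup>2 * (\<Sum>i\<in>UNIV. (pd i p z)\<^sup>2)"
      using diameter_bounded_bound[OF compact_imp_bounded[OF compact_nsimplex[OF nT]] y x]
      by (intro mult_right_mono power_mono sum_nonneg) (auto simp: dist_norm)
    finally have "?h ^ (CARD('n) - 2) * (p x - p y)\<^sup>2 \<le> ?h ^ (CARD('n) - 2) * (?h\<^sup>2 * (\<Sum>i\<in>UNIV. (pd i p z)\<^sup>2))"
      using h by (intro mult_left_mono) auto
    also have "\<dots> = (\<Sum>i\<in>UNIV. ?h ^ CARD('n) * (pd i p z)\<^sup>2)"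
      by (simp only: power_split_2[OF n, of ?h] sum_distrib_left mult.assoc)
    also have "\<dots> \<le> (\<Sum>i\<in>UNIV. C * (LINT x:T|lborel. (pd i p x)\<^sup>2))"
      by (intro sum_mono C(2)[OF T pd_poly_le[OF p] zT])
    also have "\<dots> = C * (\<Sum>i\<in>UNIV. (LINT x:T|lborel. (pd i p x)\<^sup>2))" by (simp add: sum_distrib_left)
    also have "(\<Sum>i\<in>UNIV. (LINT x:T|lborel. (pd i p x)\<^sup>2)) = (LINT x:T|lborel. grad2 p x)"
    proof -
      have "set_integrable lborel T (\<lambda>x. (pd i p x)\<^sup>2)" for i
        by (intro set_integrable_nsimplex[OF nT] continuous_intros poly_le_continuous[OF pd_poly_le[OF p]])
      then show ?thesis
        unfolding set_lebesgue_integral_def set_integrable_def grad2_def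
        by (simp only: scaleR_sum_right) (rule Bochner_Integration.integral_sum[symmetric], simp)
    qed
    finally show "?h ^ (CARD('n) - 2) * (p x - p y)\<^sup>2 \<le> C * (LINT x:T|lborel. grad2 p x)" .
  qed
qed

lemma lag_lipschitz:
  fixes T :: "(real ^ 'n::finite) set"
  assumes T: "shape \<sigma> T" and \<sigma>: "\<sigma> > 0" and k: "k \<ge> 1" and j: "j \<in> lagrange_nodes k T"
    and x: "x \<in> T" and y: "y \<in> T"
  shows "\<bar>lag T k j x - lag T k j y\<bar> \<le>
    ((2 * real k) ^ k) ^ (CARD('n) + 1) * (real (CARD('n) + 1) * (real k ^ k * (real k * (real k * (2 * \<sigma> / diameter T * norm (x - y))))))"
proof -
  have nT: "nsimplex T" using T by simp
  have n: "nidx T k j v \<le> k" if "v \<in> verts T" for v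
    using member_le_sum[of v "verts T" "nidx T k j"] finite_verts[OF nT] that lagrange_nodes_nidx(2)[OF nT k j] by simp
  have kb: "0 \<le> real k * bary T v z" "real k * bary T v z \<le> real k" if "v \<in> verts T" "z \<in> T" for v z
    using bary_nonneg[OF nT that(2,1)] bary_le_1[OF nT that(2,1)] k by (auto simp: mult_le_cancel_left1)
  have bd: "\<bar>(real k * bary T v z) gchoose nidx T k j v\<bar> \<le> (2 * real k) ^ k" if "v \<in> verts T" "z \<in> T" for v z
  proof -
    have "\<bar>(real k * bary T v z) gchoose nidx T k j v\<bar> \<le> (2 * real k) ^ nidx T k j v"
      using kb[OF that] n[OF that(1)] by (intro abs_gbinomial_le) linarith
    also have "\<dots> \<le> (2 * real k) ^ k" using n[OF that(1)] k by (intro power_increasing) auto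
    finally show ?thesis .
  qed
  have "\<bar>lag T k j x - lag T k j y\<bar> \<le> ((2 * real k) ^ k) ^ card (verts T) * (real (card (verts T)) *
     (real k ^ k * (real k * (real k * (2 * \<sigma> / diameter T * norm (x - y))))))"
    unfolding lag_def
  proof (rule abs_prod_diff_le)
    show "1 \<le> (2 * real k) ^ k" using k by (intro one_le_power) auto
    fix v assume v: "v \<in> verts T"
    have "\<bar>((real k * bary T v x) gchoose nidx T k j v) - ((real k * bary T v y) gchoose nidx T k j v)\<bar>
        \<le> real k ^ k * (real k * \<bar>real k * bary T v x - real k * bary T v y\<bar>)"
      using kb[OF v x] kb[OF v y] n[OF v] k by (intro gbinomial_lipschitz)
    also have "\<bar>real k * bary T v x - real k * bary T v y\<bar> = real k * \<bar>bary T v x - bary T v y\<bar>"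
      by (simp add: abs_mult flip: right_diff_distrib)
    also have "real k ^ k * (real k * (real k * \<bar>bary T v x - bary T v y\<bar>))
       \<le> real k ^ k * (real k * (real k * (2 * \<sigma> / diameter T * norm (x - y))))"
      by (intro mult_left_mono bary_lipschitz_shape[OF T \<sigma> v]) auto
    finally show "\<bar>((real k * bary T v x) gchoose nidx T k j v) - ((real k * bary T v y) gchoose nidx T k j v)\<bar>
       \<le> real k ^ k * (real k * (real k * (2 * \<sigma> / diameter T * norm (x - y))))" .
  qed (use bd x y finite_verts[OF nT] in auto)
  then show ?thesis by (simp only: card_verts[OF nT])
qed

lemma abs_pd_le_if_lipschitz:
  fixes p :: "real ^ 'n::finite \<Rightarrow> real"
  assumes p: "p \<in> poly_le k" and r: "r > 0" and lip: "\<And>y. y \<in> ball x r \<Longrightarrow> \<bar>p y - p x\<bar> \<le> M * norm (y - x)"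
  shows "\<bar>pd i p x\<bar> \<le> M"
proof -
  have "((\<lambda>t. p (x + t *\<^sub>R axis i 1)) has_real_derivative pd i p x) (at 0)"
    using poly_le_line_deriv[OF p, of x "axis i 1" 0]
    by (simp add: axis_def if_distrib[of "\<lambda>t. t * _"] sum.delta cong: if_cong)
  then have "((\<lambda>t. \<bar>(p (x + t *\<^sub>R axis i 1) - p x) / t\<bar>) \<longlongrightarrow> \<bar>pd i p x\<bar>) (at 0)"
    by (intro tendsto_rabs) (simp add: DERIV_def)
  moreover have "\<forall>\<^sub>F t in at 0. \<bar>(p (x + t *\<^sub>R axis i 1) - p x) / t\<bar> \<le> M"
    unfolding eventually_at
  proof (intro exI[of _ r] conjI ballI impI r)
    fix t :: real assume t: "t \<noteq> 0 \<and> dist t 0 < r"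
    have "x + t *\<^sub>R axis i 1 \<in> ball x r" using t by (simp add: dist_norm)
    from lip[OF this] have "\<bar>p (x + t *\<^sub>R axis i 1) - p x\<bar> \<le> M * \<bar>t\<bar>" by simp
    then show "\<bar>(p (x + t *\<^sub>R axis i 1) - p x) / t\<bar> \<le> M" using t by (simp add: field_simps)
  qed
  ultimately show ?thesis by (rule tendsto_upperbound) simp
qed

text \<open>Nodal values control the Lipschitz constant on \<open>T\<close> by a multiple of
  \<open>m / diameter T\<close>, and thus the partial derivatives at interior points. Evaluated at
  the inner nodes, \<open>abs_le_sum_inner_nodes\<close> with shift 0 carries this bound over to all
  of \<open>T\<close>, including its boundary.\<close>

lemma gradient_le_nodal_values:
  fixes \<sigma> :: real
  assumes k: "k \<ge> 1" and \<sigma>: "\<sigma> > 0" and n: "CARD('n) \<ge> 2"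
  obtains C where "C > 0" "\<And>(T :: (real ^ 'n::finite) set) (p :: real ^ 'n \<Rightarrow> real) m. shape \<sigma> T \<Longrightarrow> p \<in> poly_le k \<Longrightarrow>
      (\<And>j. j \<in> lagrange_nodes k T \<Longrightarrow> \<bar>p j\<bar> \<le> m) \<Longrightarrow>
      (LINT x:T|lborel. grad2 p x) \<le> C * diameter T ^ (CARD('n) - 2) * m\<^sup>2"
proof
  let ?N = "real ((k + 1) ^ (CARD('n) + 1))"
  define Lp where "Lp = ((2 * real k) ^ k) ^ (CARD('n) + 1) * (real (CARD('n) + 1) * (real k ^ k * (real k * (real k * (2 * \<sigma>)))))"
  let ?B = "(real k * (2 * \<sigma> + 3) + real k) ^ k"
  let ?u = "unit_ball_vol (real CARD('n))"
  define C where "C = ?u * (real CARD('n) * (?B * (?N * (?N * Lp)))\<^sup>2)"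
  have Lp: "Lp > 0" unfolding Lp_def using k \<sigma> by (intro mult_pos_pos zero_less_power) auto
  have B0: "0 < real k * (2 * \<sigma> + 3) + real k" using k \<sigma> by (intro add_pos_pos mult_pos_pos) auto
  have B: "0 < ?B" by (intro zero_less_power B0)
  have N0: "0 < ?N" unfolding of_nat_0_less_iff by simp
  show "C > 0" unfolding C_def by (intro mult_pos_pos zero_less_power B0 N0 Lp) simp_all
  fix T :: "(real ^ 'n) set" and p :: "real ^ 'n \<Rightarrow> real" and m
  assume T: "shape \<sigma> T" and p: "p \<in> poly_le k" and m: "\<And>j. j \<in> lagrange_nodes k T \<Longrightarrow> \<bar>p j\<bar> \<le> m"
  then obtain c where nT: "nsimplex T" and c: "ball c (diameter T / \<sigma>) \<subseteq> T" by blast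
  let ?h = "diameter T" let ?J = "lagrange_nodes k T"
  have h: "0 < ?h" by (rule nsimplex_diameter_pos[OF nT])
  have cardJ: "real (card ?J) \<le> ?N" using card_lagrange_nodes_le[OF nT k] by (rule of_nat_mono)
  have "?J \<noteq> {}" using verts_subset_lagrange_nodes[OF nT k] card_verts[OF nT] by auto
  then have m0: "0 \<le> m" using m by force
  have lip: "\<bar>p x - p y\<bar> \<le> ?N * Lp * m / ?h * norm (x - y)" if "x \<in> T" "y \<in> T" for x y
  proof -
    have "p x - p y = (\<Sum>j\<in>?J. p j * (lag T k j x - lag T k j y))"
      using lagrange_interpolation[OF nT k p, of x] lagrange_interpolation[OF nT k p, of y]
      by (simp add: right_diff_distrib sum_subtractf)
    also have "\<bar>\<dots>\<bar> \<le> (\<Sum>j\<in>?J. \<bar>p j\<bar> * \<bar>lag T k j x - lag T k j y\<bar>)"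
      using sum_abs[of "\<lambda>j. p j * (lag T k j x - lag T k j y)"] by (simp add: abs_mult)
    also have "\<dots> \<le> (\<Sum>j\<in>?J. m * (Lp / ?h * norm (x - y)))"
    proof (intro sum_mono mult_mono m m0)
      fix j assume "j \<in> ?J"
      from lag_lipschitz[OF T \<sigma> k this that]
      show "\<bar>lag T k j x - lag T k j y\<bar> \<le> Lp / ?h * norm (x - y)" by (simp add: Lp_def mult.assoc)
    qed auto
    also have "\<dots> = real (card ?J) * (m * (Lp / ?h * norm (x - y)))" by simp
    also have "\<dots> \<le> ?N * (m * (Lp / ?h * norm (x - y)))"
      using cardJ m0 Lp h by (intro mult_right_mono mult_nonneg_nonneg) auto
    finally show ?thesis by (simp add: mult_ac)
  qed
  have pdb: "\<bar>pd i p y\<bar> \<le> ?B * (?N * (?N * Lp)) * (m / ?h)" if y: "y \<in> T" for y i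
  proof -
    have "\<bar>pd i p y\<bar> \<le> ?B * (\<Sum>j\<in>?J. \<bar>pd i p ((1/2) *\<^sub>R (j + c) + 0)\<bar>)"
      by (rule abs_le_sum_inner_nodes[OF nT k \<sigma> c pd_poly_le[OF p] y]) (use h \<sigma> in simp)
    also have "\<dots> \<le> ?B * (\<Sum>j\<in>?J. ?N * Lp * m / ?h)"
    proof (intro mult_left_mono sum_mono)
      fix j assume j: "j \<in> ?J"
      let ?z = "(1/2) *\<^sub>R (j + c) + 0"
      have "j \<in> T" using lagrange_nodes_subset[OF nT k] j by auto
      then have sub: "ball ?z (?h / (2 * \<sigma>)) \<subseteq> T"
        using ball_half_subset[OF convex_nsimplex[OF nT] c] by (simp add: mult.commute)
      have r: "0 < ?h / (2 * \<sigma>)" using h \<sigma> by simp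
      have "?z \<in> T" using sub r by (meson centre_in_ball subsetD)
      then show "\<bar>pd i p ?z\<bar> \<le> ?N * Lp * m / ?h"
        by (intro abs_pd_le_if_lipschitz[OF p r] lip) (use sub in auto)
    qed (use B in simp)
    also have "\<dots> = ?B * (real (card ?J) * (?N * Lp * m / ?h))" by simp
    also have "\<dots> \<le> ?B * (?N * (?N * Lp * m / ?h))"
      using cardJ B m0 Lp h by (intro mult_left_mono mult_right_mono) auto
    finally show ?thesis by (simp add: mult.assoc)
  qed
  have cT: "c \<in> T" using c h \<sigma> by (auto simp: subset_iff)
  have Tball: "T \<subseteq> cball c ?h"
    using diameter_bounded_bound[OF compact_imp_bounded[OF compact_nsimplex[OF nT]] cT] by auto
  let ?K = "real CARD('n) * (?B * (?N * (?N * Lp)) * (m / ?h))\<^sup>2"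
  have K0: "0 \<le> ?K" by simp
  have "(LINT x:T|lborel. grad2 p x) \<le> (LINT x:T|lborel. ?K)"
  proof (rule set_integral_mono)
    show "set_integrable lborel T (grad2 p)" by (rule set_integrable_nsimplex[OF nT continuous_grad2[OF p]])
    show "set_integrable lborel T (\<lambda>x. ?K)" by (rule set_integrable_nsimplex[OF nT]) (rule continuous_on_const)
    fix x assume x: "x \<in> T"
    have sq: "(pd i p x)\<^sup>2 \<le> (?B * (?N * (?N * Lp)) * (m / ?h))\<^sup>2" for i
      by (rule square_le_if_abs_le) (rule pdb[OF x])
    have "grad2 p x \<le> (\<Sum>i\<in>(UNIV::'n set). (?B * (?N * (?N * Lp)) * (m / ?h))\<^sup>2)"
      unfolding grad2_def
    by (intro sum_mono sq)
    then show "grad2 p x \<le> ?K" by (simp only: sum_constant)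
  qed
  also have "\<dots> = measure lborel T * ?K"
    using compact_nsimplex[OF nT] emeasure_compact_finite[of T]
    by (subst set_integral_const) (auto intro: borel_compact)
  also have "\<dots> \<le> measure lborel (cball c ?h) * ?K"
    using Tball K0 compact_nsimplex[OF nT]
    by (intro mult_right_mono measure_mono_fmeasurable)
      (auto intro!: borel_compact fmeasurableI emeasure_compact_finite)
  also have "measure lborel (cball c ?h) = ?u * ?h ^ CARD('n)" using content_cball[of ?h c] h by simp
  also have "?h ^ CARD('n) = ?h ^ (CARD('n) - 2) * ?h\<^sup>2" using n by (rule power_split_2)
  also have "?u * (?h ^ (CARD('n) - 2) * ?h\<^sup>2) * ?K = C * ?h ^ (CARD('n) - 2) * m\<^sup>2"
    using h by (simp add: C_def power_mult_distrib power_divide)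
  finally show "(LINT x:T|lborel. grad2 p x) \<le> C * ?h ^ (CARD('n) - 2) * m\<^sup>2" .
qed

section \<open>The nodal basis on a mesh\<close>

lemma interior_nsimplex_nonempty:
  fixes T :: "(real ^ 'n::finite) set"
  assumes nT: "nsimplex T" shows "interior T \<noteq> {}"
proof -
  have "aff_dim T = int CARD('n)" using affine_hull_verts[OF nT] convex_hull_verts[OF nT]
    by (metis DIM_cart DIM_real affine_hull_convex_hull aff_dim_eq_full mult.right_neutral)
  then show ?thesis using convex_nsimplex[OF nT] interior_rel_interior[of T] rel_interior_eq_empty[of T] by fastforce
qed

locale fe_mesh =
  fixes S :: "'n::finite cutfem"
  assumes polygonal: "polygonal_domain (dom_of S)"
    and mesh: "simplicial_mesh (dom_of S) (mesh S)"
    and deg_pos: "deg S \<ge> 1"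
begin

abbreviation "Dom \<equiv> dom_of S"

text \<open>As the interior of a closed set the domain has no slits: it equals the interior of its
  closure, so the interiors of mesh simplices lie inside it.\<close>

lemma open_dom: "open Dom" and bounded_dom: "bounded Dom" and dom_nonempty: "Dom \<noteq> {}"
  and connected_dom: "connected Dom" and interior_closure_dom: "interior (closure Dom) = Dom"
proof -
  obtain \<P> where P: "finite \<P>" "\<And>P. P \<in> \<P> \<Longrightarrow> polytope P" "Dom = interior (\<Union>\<P>)"
    using polygonal unfolding polygonal_domain_def by blast
  show "Dom \<noteq> {}" "connected Dom" using polygonal unfolding polygonal_domain_def by auto
  show "open Dom" using P by simp
  have "bounded (\<Union>\<P>)" using P polytope_imp_bounded by (intro bounded_Union) auto
  then show "bounded Dom" using P(3) interior_subset bounded_subset by metis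
  have "closed (\<Union>\<P>)" using P polytope_imp_closed by (intro closed_Union) auto
  then have "closure Dom \<subseteq> \<Union>\<P>" unfolding P(3) by (simp add: closure_minimal interior_subset)
  then have "interior (closure Dom) \<subseteq> Dom" unfolding P(3) by (rule interior_mono)
  then show "interior (closure Dom) = Dom"
    using P(3) by (metis closure_subset interior_interior interior_mono subset_antisym)
qed

lemma finite_mesh: "finite (mesh S)"
  and nsimplex_mesh: "T \<in> mesh S \<Longrightarrow> nsimplex T"
  and Union_mesh: "\<Union>(mesh S) = closure Dom"
  and face_mesh: "T \<in> mesh S \<Longrightarrow> T' \<in> mesh S \<Longrightarrow> (T \<inter> T') face_of T"
  using mesh unfolding simplicial_mesh_def triangulation_def by auto

lemma face_mesh': "T \<in> mesh S \<Longrightarrow> T' \<in> mesh S \<Longrightarrow> (T \<inter> T') face_of T'"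
  using face_mesh[of T' T] by (simp add: Int_commute)

lemma closed_mesh: "T \<in> mesh S \<Longrightarrow> closed T"
  using compact_nsimplex[OF nsimplex_mesh] by (rule compact_imp_closed)

lemma mesh_subset: "T \<in> mesh S \<Longrightarrow> T \<subseteq> closure Dom"
  using Union_mesh by blast

lemma mesh_cover: "x \<in> closure Dom \<Longrightarrow> \<exists>T\<in>mesh S. x \<in> T"
  using Union_mesh by blast

lemma interior_mesh_subset: "T \<in> mesh S \<Longrightarrow> interior T \<subseteq> Dom"
  using interior_mono[OF mesh_subset] interior_closure_dom by simp

lemma mesh_eqI:
  assumes "T \<in> mesh S" "T' \<in> mesh S" "interior (T \<inter> T') \<noteq> {}" shows "T = T'"
proof -
  have "T \<inter> T' = T"
    using face_of_disjoint_interior[OF face_mesh[OF assms(1,2)]] assms(3) interior_subset by fastforce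
  moreover have "T \<inter> T' = T'"
    using face_of_disjoint_interior[OF face_mesh'[OF assms(1,2)]] assms(3) interior_subset by fastforce
  ultimately show ?thesis by simp
qed

lemma bary_common:
  assumes "T \<in> mesh S" "T' \<in> mesh S" "x \<in> T" "x \<in> T'"
  shows "v \<in> verts T \<Longrightarrow> v \<in> verts T' \<Longrightarrow> bary T v x = bary T' v x"
    and "v \<in> verts T \<Longrightarrow> v \<notin> verts T' \<Longrightarrow> bary T v x = 0"
  using bary_common_face[OF nsimplex_mesh nsimplex_mesh face_mesh face_mesh'] assms by blast+

lemma nearby_mesh:
  assumes "y \<in> Dom"
  obtains e where "e > 0" "ball y e \<subseteq> Dom" "ball y e \<subseteq> \<Union>{T\<in>mesh S. y \<in> T}"
proof -
  let ?C = "\<Union>{T\<in>mesh S. y \<notin> T}"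
  have "closed ?C" using finite_mesh closed_mesh by (intro closed_Union) auto
  then have "open (Dom - ?C)" using open_dom by (intro open_Diff)
  moreover have "y \<in> Dom - ?C" using assms by auto
  ultimately obtain e where e: "e > 0" "ball y e \<subseteq> Dom - ?C" by (rule openE)
  have "ball y e \<subseteq> \<Union>{T\<in>mesh S. y \<in> T}"
  proof
    fix z assume "z \<in> ball y e"
    then have z: "z \<in> Dom" "z \<notin> ?C" using e by auto
    then obtain T where "T \<in> mesh S" "z \<in> T" using mesh_cover closure_subset by blast
    then show "z \<in> \<Union>{T\<in>mesh S. y \<in> T}" using z by blast
  qed
  then show thesis using that e by auto
qed

text \<open>The elements around a point \<open>y\<close> and around a point \<open>x\<close> of the same open face span
  the same cone, so both points are interior or both are boundary points.\<close>

lemma mem_dom_if_support: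
  assumes T: "T \<in> mesh S" and x: "x \<in> T" and j: "j \<in> T" "j \<in> Dom"
    and supp: "\<And>v. v \<in> verts T \<Longrightarrow> bary T v j > 0 \<Longrightarrow> bary T v x > 0"
  shows "x \<in> Dom"
proof -
  note nT = nsimplex_mesh[OF T]
  obtain e0 where e0: "e0 > 0" "ball j e0 \<subseteq> Dom" using open_dom j(2) by (rule openE)
  define t where "t = min (1/2) (e0 / (2 * (norm (x - j) + 1)))"
  have t: "0 < t" using e0 by (auto simp: t_def intro!: divide_pos_pos add_nonneg_pos)
  have t2: "t \<le> 1/2" unfolding t_def by (rule min.cobounded1)
  note t = t t2
  \<comment> \<open>\<open>y\<close> is close enough to \<open>j\<close> to stay in the domain, and
    by \<open>supp\<close> its positive coordinates are exactly those of \<open>x\<close>: it lies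
    in the same open face as \<open>x\<close>.\<close>
  define y where "y = j + t *\<^sub>R (x - j)"
  have "norm (t *\<^sub>R (x - j)) < e0"
  proof -
    have "t * norm (x - j) \<le> e0 / (2 * (norm (x - j) + 1)) * norm (x - j)"
      by (intro mult_right_mono) (auto simp: t_def)
    also have "\<dots> \<le> e0 / 2"
    proof -
      have "norm (x - j) / (norm (x - j) + 1) \<le> 1" by (simp add: divide_le_eq_1 add_nonneg_pos)
      then have "e0 / 2 * (norm (x - j) / (norm (x - j) + 1)) \<le> e0 / 2 * 1" using e0 by (intro mult_left_mono) auto
      then show ?thesis by simp
    qed
    also have "\<dots> < e0" using e0 by simp
    finally show ?thesis using t by simp
  qed
  then have ydom: "y \<in> Dom" using e0 by (auto simp: y_def dist_norm subset_iff)
  have bry: "bary T v y = (1 - t) * bary T v j + t * bary T v x" if "v \<in> verts T" for v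
    unfolding y_def bary_move[OF nT that] by (simp add: algebra_simps)
  have yT: "y \<in> T"
    unfolding mem_nsimplex_iff[OF nT] using t by (auto simp: bry bary_nonneg[OF nT x] bary_nonneg[OF nT j(1)])
  have supp': "bary T v y > 0 \<longleftrightarrow> bary T v x > 0" if v: "v \<in> verts T" for v
  proof -
    have "0 \<le> bary T v j" "0 \<le> bary T v x" using bary_nonneg[OF nT _ v] x j by auto
    then show ?thesis unfolding bry[OF v] using supp[OF v] t
      by (cases "bary T v j = 0"; cases "bary T v x = 0") (auto simp: add_pos_pos add_nonneg_pos add_pos_nonneg zero_less_mult_iff)
  qed
  obtain d where d: "d > 0" "ball y d \<subseteq> \<Union>{T\<in>mesh S. y \<in> T}" using nearby_mesh[OF ydom] by metis
  let ?M = "{T'\<in>mesh S. y \<in> T'}"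
  have xM: "x \<in> T'" if T': "T' \<in> ?M" for T'
  proof -
    have "x \<in> T \<inter> T'"
    proof (rule mem_face_if_bary_zero[OF nT face_mesh[OF T] x])
      fix v assume v: "v \<in> verts T" "v \<notin> T \<inter> T'"
      have "bary T v y = 0" using bary_face_zero[OF nT face_mesh[OF T] _ v] T' yT by auto
      then show "bary T v x = 0" using supp'[OF v(1)] bary_nonneg[OF nT x v(1)] by simp
    qed (use T' in auto)
    then show ?thesis by simp
  qed
  have suppM: "bary T' v x = 0" if "T' \<in> ?M" "v \<in> verts T'" "bary T' v y = 0" for T' v
  proof (cases "v \<in> verts T")
    case True
    have "bary T' v y = bary T v y" "bary T' v x = bary T v x"
      using bary_common(1)[of T' T y v] bary_common(1)[of T' T x v] that T yT x xM[OF that(1)] True by auto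
    then show ?thesis using supp'[OF True] that(3) bary_nonneg[OF nT x True] by simp
  next
    case False
    then show ?thesis using bary_common(2)[of T' T x v] that T x xM[OF that(1)] by auto
  qed
  have "\<forall>\<^sub>F z in nhds x. \<forall>T'\<in>?M. \<forall>v\<in>verts T'. bary T' v x > 0 \<longrightarrow> bary T' v z > 0"
  proof (intro eventually_ball_finite ballI)
    show "finite ?M" using finite_mesh by simp
    fix T' v assume T': "T' \<in> ?M"
    then have nT': "nsimplex T'" using nsimplex_mesh by simp
    show "finite (verts T')" using finite_verts[OF nT'] .
    assume v: "v \<in> verts T'"
    show "\<forall>\<^sub>F z in nhds x. bary T' v x > 0 \<longrightarrow> bary T' v z > 0"
    proof (cases "bary T' v x > 0")
      case True
      have "continuous_on UNIV (bary T' v)" using poly_le_continuous[OF bary_poly_le[OF nT' v]] .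
      then have "open (bary T' v -` {0<..})" by (rule open_vimage[rotated]) simp
      then have "\<forall>\<^sub>F z in nhds x. z \<in> bary T' v -` {0<..}" using True by (intro eventually_nhds_in_open) auto
      then show ?thesis by (rule eventually_mono) auto
    qed simp
  qed
  then obtain U where U: "open U" "x \<in> U" "\<And>z T' v. z \<in> U \<Longrightarrow> T' \<in> ?M \<Longrightarrow> v \<in> verts T' \<Longrightarrow>
      bary T' v x > 0 \<Longrightarrow> bary T' v z > 0"
    unfolding eventually_nhds by blast
  have "U \<subseteq> closure Dom"
  proof
    fix z assume z: "z \<in> U"
    \<comment> \<open>The displacement from \<open>x\<close> to \<open>z\<close> is scaled down and
      attached to \<open>y\<close>, where simplices around \<open>y\<close> cover a full ball.
      Coordinates vanishing at \<open>x\<close> also vanish at \<open>y\<close>, so for them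
      nonnegativity at the new point gives nonnegativity at \<open>z\<close> by homogeneity; the
      others are positive near \<open>x\<close>.\<close>
    define s where "s = d / (2 * (norm (z - x) + 1))"
    have s: "0 < s" using d by (auto simp: s_def intro!: divide_pos_pos add_nonneg_pos)
    have "norm (z - x) / (norm (z - x) + 1) \<le> 1" by (simp add: divide_le_eq_1 add_nonneg_pos)
    then have "d / 2 * (norm (z - x) / (norm (z - x) + 1)) \<le> d / 2 * 1" using d by (intro mult_left_mono) auto
    then have "s * norm (z - x) \<le> d / 2" by (simp add: s_def)
    then have "s * norm (z - x) < d" using d by linarith
    then have "y + s *\<^sub>R (z - x) \<in> ball y d" using s by (simp add: dist_norm)
    then obtain T' where T': "T' \<in> ?M" "y + s *\<^sub>R (z - x) \<in> T'" using d(2) by blast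
    then have nT': "nsimplex T'" using nsimplex_mesh by simp
    have "0 \<le> bary T' v z" if v: "v \<in> verts T'" for v
    proof (cases "bary T' v x > 0")
      case True then show ?thesis using U(3)[OF z T'(1) v] by simp
    next
      case False
      then have x0: "bary T' v x = 0" using bary_nonneg[OF nT' xM[OF T'(1)] v] by simp
      have y0: "bary T' v y = 0"
      proof (cases "v \<in> verts T")
        case True
        have "bary T' v y = bary T v y" "bary T' v x = bary T v x"
          using bary_common(1)[of T' T y v] bary_common(1)[of T' T x v] T' v T yT x xM[OF T'(1)] True by auto
        then show ?thesis using supp'[OF True] x0 bary_nonneg[OF nT yT True] by simp
      next
        case False
        then show ?thesis using bary_common(2)[of T' T y v] T' v T yT by auto
      qed
      have "0 \<le> bary T' v (y + s *\<^sub>R (z - x))" using bary_nonneg[OF nT' T'(2) v] .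
      then have "0 \<le> s * bary T' v z" unfolding bary_move[OF nT' v] using x0 y0 by simp
      then show ?thesis using s by (simp add: zero_le_mult_iff)
    qed
    then have "z \<in> T'" using mem_nsimplex_iff[OF nT'] by blast
    then show "z \<in> closure Dom" using mesh_subset T' by blast
  qed
  then have "x \<in> interior (closure Dom)" using U by (meson interiorI)
  then show ?thesis using interior_closure_dom by simp
qed

section \<open>Hat functions and global nodal functions\<close>

definition hat :: "real ^ 'n \<Rightarrow> real ^ 'n \<Rightarrow> real" where
  "hat v x = (if \<exists>T\<in>mesh S. x \<in> T \<and> v \<in> verts T
     then bary (SOME T. T \<in> mesh S \<and> x \<in> T \<and> v \<in> verts T) v x else 0)"

text \<open>Two simplices containing \<open>x\<close> agree there on the coordinates of shared
  vertices, so the simplex picked in the definition does not matter.\<close>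

lemma hat_eq:
  assumes T: "T \<in> mesh S" "x \<in> T"
  shows "hat v x = (if v \<in> verts T then bary T v x else 0)"
proof (cases "\<exists>T\<in>mesh S. x \<in> T \<and> v \<in> verts T")
  case True
  define T' where "T' = (SOME T. T \<in> mesh S \<and> x \<in> T \<and> v \<in> verts T)"
  have T': "T' \<in> mesh S" "x \<in> T'" "v \<in> verts T'"
    using someI_ex[of "\<lambda>T. T \<in> mesh S \<and> x \<in> T \<and> v \<in> verts T"] True unfolding T'_def by blast+
  have "hat v x = bary T' v x" unfolding hat_def T'_def using True by simp
  then show ?thesis using bary_common[OF T'(1) T(1) T'(2) T(2), of v] T'(3) by auto
next
  case False
  then show ?thesis using T unfolding hat_def by auto
qed

lemma continuous_on_pieces:
  assumes "\<And>T. T \<in> mesh S \<Longrightarrow> \<exists>p\<in>poly_le m. \<forall>x\<in>T. f x = p x"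
  shows "continuous_on (closure Dom) f"
proof -
  have "continuous_on (\<Union>T\<in>mesh S. T) f"
  proof (rule continuous_on_closed_Union[OF finite_mesh])
    fix T assume T: "T \<in> mesh S"
    then show "closed T" by (rule closed_mesh)
    obtain p where "p \<in> poly_le m" "\<forall>x\<in>T. f x = p x" using assms[OF T] by blast
    then show "continuous_on T f" using poly_le_continuous[of p m T] continuous_on_cong[of T T f p] by simp
  qed
  then show ?thesis using Union_mesh by simp
qed

text \<open>The Lagrange product taken over all mesh vertices at once, with hat functions as
  coordinates. On a simplex, vertices foreign to it contribute the factor 1 when the node
  \<open>j\<close> belongs to the simplex, and at least one of them contributes 0 when it does not;
  no gluing of local functions is needed.\<close>

definition nb :: "real ^ 'n \<Rightarrow> real ^ 'n \<Rightarrow> real" where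
  "nb j x = (if x \<in> closure Dom then
     \<Prod>v\<in>\<Union>(verts ` mesh S). (real (deg S) * hat v x) gchoose nat \<lfloor>real (deg S) * hat v j\<rfloor> else 0)"

definition nodes :: "(real ^ 'n) set" where
  "nodes = (\<Union>T\<in>mesh S. lagrange_nodes (deg S) T)"

lemma finite_nodes: "finite nodes"
  unfolding nodes_def using finite_mesh finite_lagrange_nodes[OF nsimplex_mesh deg_pos] by auto

lemma I0_eq: "I0 S = nodes \<inter> Dom" unfolding I0_def nodes_def ..

lemma finite_I0: "finite (I0 S)" unfolding I0_eq using finite_nodes by simp

text \<open>The coordinates of \<open>j\<close> sit on the vertices shared by both simplices and
  have the same values in each, so the lattice index carries over.\<close>

lemma node_in_lagrange_nodes:
  assumes j: "j \<in> nodes" and T: "T \<in> mesh S" "j \<in> T" shows "j \<in> lagrange_nodes (deg S) T"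
proof -
  obtain T' where T': "T' \<in> mesh S" "j \<in> lagrange_nodes (deg S) T'" using j unfolding nodes_def by blast
  note nT = nsimplex_mesh[OF T(1)] and nT' = nsimplex_mesh[OF T'(1)]
  have jT': "j \<in> T'" using lagrange_nodes_subset[OF nT' deg_pos] T'(2) by blast
  let ?a = "\<lambda>v. if v \<in> verts T' then nidx T' (deg S) j v else 0"
  show ?thesis
  proof (rule lagrange_nodesI[OF nT deg_pos])
    have "(\<Sum>v\<in>verts T. ?a v) = (\<Sum>v\<in>verts T \<inter> verts T'. nidx T' (deg S) j v)"
      using finite_verts[OF nT] by (simp add: sum.If_cases)
    also have "\<dots> = (\<Sum>v\<in>verts T'. nidx T' (deg S) j v)"
    proof (rule sum.mono_neutral_left)
      show "\<forall>v\<in>verts T' - verts T \<inter> verts T'. nidx T' (deg S) j v = 0"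
      proof
        fix v assume "v \<in> verts T' - verts T \<inter> verts T'"
        then have "bary T' v j = 0" using bary_common(2)[OF T'(1) T(1) jT' T(2), of v] by blast
        then show "nidx T' (deg S) j v = 0" by (simp add: nidx_def)
      qed
    qed (use finite_verts[OF nT'] in auto)
    finally show "(\<Sum>v\<in>verts T. ?a v) = deg S" using lagrange_nodes_nidx(2)[OF nT' deg_pos T'(2)] by simp
    fix v assume v: "v \<in> verts T"
    show "real (deg S) * bary T v j = real (?a v)"
      using bary_common[OF T(1) T'(1) T(2) jT' v] lagrange_nodes_nidx(1)[OF nT' deg_pos T'(2), of v] by auto
  qed
qed

lemma nb_eq_lag:
  assumes j: "j \<in> nodes" and T: "T \<in> mesh S" "x \<in> T" "j \<in> T" shows "nb j x = lag T (deg S) j x"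
proof -
  note nT = nsimplex_mesh[OF T(1)]
  have fin: "finite (\<Union>(verts ` mesh S))" using finite_mesh finite_verts[OF nsimplex_mesh] by auto
  have "x \<in> closure Dom" using T mesh_subset by blast
  then have "nb j x = (\<Prod>v\<in>\<Union>(verts ` mesh S). (real (deg S) * hat v x) gchoose nat \<lfloor>real (deg S) * hat v j\<rfloor>)"
    by (simp add: nb_def)
  also have "\<dots> = (\<Prod>v\<in>verts T. (real (deg S) * hat v x) gchoose nat \<lfloor>real (deg S) * hat v j\<rfloor>)"
    using T fin by (intro prod.mono_neutral_right) (auto simp: hat_eq[OF T(1,2)] hat_eq[OF T(1,3)])
  also have "\<dots> = lag T (deg S) j x"
    unfolding lag_def nidx_def by (intro prod.cong) (auto simp: hat_eq[OF T(1,2)] hat_eq[OF T(1,3)])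
  finally show ?thesis .
qed

lemma nb_eq_0:
  assumes j: "j \<in> nodes" and T: "T \<in> mesh S" "x \<in> T" "j \<notin> T" shows "nb j x = 0"
proof -
  have fin: "finite (\<Union>(verts ` mesh S))" using finite_mesh finite_verts[OF nsimplex_mesh] by auto
  obtain T' where T': "T' \<in> mesh S" "j \<in> lagrange_nodes (deg S) T'" using j unfolding nodes_def by blast
  note nT = nsimplex_mesh[OF T(1)] and nT' = nsimplex_mesh[OF T'(1)]
  have jT': "j \<in> T'" using lagrange_nodes_subset[OF nT' deg_pos] T'(2) by blast
  have "\<not> (\<forall>v. v \<in> verts T' \<longrightarrow> v \<notin> T \<inter> T' \<longrightarrow> bary T' v j = 0)"
    using mem_face_if_bary_zero[OF nT' face_mesh'[OF T(1) T'(1)] jT'] T(3) by auto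
  then obtain v where v: "v \<in> verts T'" "v \<notin> T" "bary T' v j \<noteq> 0" using verts_subset by blast
  have "v \<notin> verts T" using v(2) verts_subset by blast
  then have "hat v x = 0" using hat_eq[OF T(1,2)] by simp
  moreover have "hat v j = bary T' v j" using hat_eq[OF T'(1) jT'] v by simp
  moreover have "nat \<lfloor>real (deg S) * bary T' v j\<rfloor> \<noteq> 0"
  proof
    assume "nat \<lfloor>real (deg S) * bary T' v j\<rfloor> = 0"
    then have "nidx T' (deg S) j v = 0" by (simp add: nidx_def)
    then have "real (deg S) * bary T' v j = 0" using lagrange_nodes_nidx(1)[OF nT' deg_pos T'(2) v(1)] by simp
    then show False using v(3) deg_pos by simp
  qed
  then have "(0::real) gchoose nat \<lfloor>real (deg S) * bary T' v j\<rfloor> = 0"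
    by (cases "nat \<lfloor>real (deg S) * bary T' v j\<rfloor>") auto
  ultimately have "(real (deg S) * hat v x) gchoose nat \<lfloor>real (deg S) * hat v j\<rfloor> = 0" by simp
  moreover have "v \<in> \<Union>(verts ` mesh S)" using v(1) T'(1) by blast
  ultimately show ?thesis unfolding nb_def using fin by (auto intro!: prod_zero)
qed

lemma nb_node: assumes "j \<in> nodes" "l \<in> nodes" shows "nb j l = (if l = j then 1 else 0)"
proof -
  obtain T where T: "T \<in> mesh S" "l \<in> lagrange_nodes (deg S) T" using assms(2) unfolding nodes_def by blast
  have lT: "l \<in> T" using T lagrange_nodes_subset[OF nsimplex_mesh deg_pos] by blast
  show ?thesis
  proof (cases "j \<in> T")
    case True
    then have "j \<in> lagrange_nodes (deg S) T" using node_in_lagrange_nodes[OF assms(1) T(1)] by simp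
    then show ?thesis using nb_eq_lag[OF assms(1) T(1) lT True] lag_node[OF nsimplex_mesh[OF T(1)] deg_pos _ T(2)] by simp
  next
    case False
    then show ?thesis using nb_eq_0[OF assms(1) T(1) lT False] lT by auto
  qed
qed

lemma nb_Vh: assumes j: "j \<in> I0 S" shows "nb j \<in> Vh S"
proof -
  have jn: "j \<in> nodes" "j \<in> Dom" using j I0_eq by auto
  have piece: "\<exists>p\<in>poly_le (deg S). \<forall>x\<in>T. nb j x = p x" if T: "T \<in> mesh S" for T
  proof (cases "j \<in> T")
    case True
    then show ?thesis using nb_eq_lag[OF jn(1) T] node_in_lagrange_nodes[OF jn(1) T]
        lag_poly_le[OF nsimplex_mesh[OF T] deg_pos] by blast
  next
    case False
    then have "\<forall>x\<in>T. nb j x = 0" using nb_eq_0[OF jn(1) T] by blast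
    then show ?thesis by (intro bexI[OF _ poly_le_zero])
  qed
  moreover have "nb j x = 0" if x: "x \<in> frontier Dom" for x
  proof -
    have "x \<in> closure Dom" "x \<notin> Dom" using x open_dom by (auto simp: frontier_def interior_open)
    then obtain T where T: "T \<in> mesh S" "x \<in> T" using mesh_cover by blast
    show ?thesis
    proof (cases "j \<in> T")
      case True
      note nT = nsimplex_mesh[OF T(1)]
      \<comment> \<open>By contraposition of \<open>mem_dom_if_support\<close>: a boundary point
        cannot have all the coordinates positive that are positive at an interior node. A coordinate
        missing at \<open>x\<close> makes the nodal function vanish there.\<close>
      have "\<not> (\<forall>v. v \<in> verts T \<longrightarrow> bary T v j > 0 \<longrightarrow> bary T v x > 0)"
        using mem_dom_if_support[OF T True jn(2)] \<open>x \<notin> Dom\<close> by blast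
      then obtain v where v: "v \<in> verts T" "bary T v j > 0" "\<not> bary T v x > 0" by blast
      have "bary T v x = 0" using bary_nonneg[OF nT T(2) v(1)] v(3) by simp
      then show ?thesis using nb_eq_lag[OF jn(1) T True] lag_zero[OF nT deg_pos v(1)] v(2)
          node_in_lagrange_nodes[OF jn(1) T(1) True] by simp
    qed (use nb_eq_0[OF jn(1) T] in simp)
  qed
  ultimately show ?thesis
    unfolding Vh_def using continuous_on_pieces[of "deg S" "nb j"] by (auto simp: nb_def)
qed

lemma Vh_continuous: assumes "v \<in> Vh S" shows "continuous_on UNIV v"
proof -
  have "continuous_on (- Dom) v"
  proof -
    have "v x = 0" if "x \<in> - Dom" for x
      using assms that open_dom unfolding Vh_def frontier_def by (auto simp: interior_open)
    then show ?thesis using continuous_on_cong[of "- Dom" "- Dom" v "\<lambda>_. 0"] by simp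
  qed
  moreover have "continuous_on (closure Dom) v" using assms unfolding Vh_def by simp
  moreover have "closed (- Dom)" using open_dom by (simp add: closed_def)
  ultimately have "continuous_on (closure Dom \<union> - Dom) v" by (intro continuous_on_closed_Un) auto
  moreover have "closure Dom \<union> - Dom = UNIV" using closure_subset by auto
  ultimately show ?thesis by simp
qed

lemma Vh_zero_outside: "v \<in> Vh S \<Longrightarrow> x \<notin> Dom \<Longrightarrow> v x = 0"
  using open_dom unfolding Vh_def frontier_def by (auto simp: interior_open)

lemma Vh_piece: "v \<in> Vh S \<Longrightarrow> T \<in> mesh S \<Longrightarrow> \<exists>p\<in>poly_le (deg S). \<forall>x\<in>T. v x = p x"
  unfolding Vh_def by blast

lemma Vh_node_zero: "v \<in> Vh S \<Longrightarrow> j \<in> nodes \<Longrightarrow> j \<notin> I0 S \<Longrightarrow> v j = 0"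
  using Vh_zero_outside I0_eq by blast

lemma Vh_lagrange:
  assumes v: "v \<in> Vh S" and T: "T \<in> mesh S" "x \<in> T"
  shows "v x = (\<Sum>j\<in>lagrange_nodes (deg S) T. v j * lag T (deg S) j x)"
proof -
  note nT = nsimplex_mesh[OF T(1)]
  obtain p where p: "p \<in> poly_le (deg S)" "\<forall>x\<in>T. v x = p x" using Vh_piece[OF v T(1)] by blast
  have "v x = (\<Sum>j\<in>lagrange_nodes (deg S) T. p j * lag T (deg S) j x)"
    using lagrange_interpolation[OF nT deg_pos p(1), of x] bspec[OF p(2) T(2)] by (rule trans[rotated])
  also have "\<dots> = (\<Sum>j\<in>lagrange_nodes (deg S) T. v j * lag T (deg S) j x)"
    using p(2) lagrange_nodes_subset[OF nT deg_pos] by (intro sum.cong) auto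
  finally show ?thesis .
qed

lemma Vh_eqI:
  assumes u: "u \<in> Vh S" and v: "v \<in> Vh S" and eq: "\<And>j. j \<in> I0 S \<Longrightarrow> u j = v j"
  shows "u = v"
proof
  fix x
  show "u x = v x"
  proof (cases "x \<in> Dom")
    case True
    then obtain T where T: "T \<in> mesh S" "x \<in> T" using mesh_cover closure_subset by blast
    have "u j = v j" if "j \<in> lagrange_nodes (deg S) T" for j
    proof -
      have "j \<in> nodes" using that T unfolding nodes_def by blast
      then show ?thesis using eq Vh_node_zero[OF u] Vh_node_zero[OF v] by (cases "j \<in> I0 S") auto
    qed
    then show ?thesis unfolding Vh_lagrange[OF u T] Vh_lagrange[OF v T] by (intro sum.cong) auto
  qed (simp add: Vh_zero_outside[OF u] Vh_zero_outside[OF v])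
qed

lemma phi_eq: assumes j: "j \<in> I0 S" shows "\<phi> S j = nb j"
  unfolding \<phi>_def
proof (rule the_equality)
  show "nb j \<in> Vh S \<and> (\<forall>l\<in>I0 S. nb j l = (if l = j then 1 else 0))"
    using nb_Vh[OF j] nb_node j I0_eq by auto
  then show "v \<in> Vh S \<and> (\<forall>l\<in>I0 S. v l = (if l = j then 1 else 0)) \<Longrightarrow> v = nb j" for v
    by (intro Vh_eqI) auto
qed

lemma phi_Vh: "j \<in> I0 S \<Longrightarrow> \<phi> S j \<in> Vh S"
  using nb_Vh phi_eq by simp

lemma phi_node: "j \<in> I0 S \<Longrightarrow> l \<in> I0 S \<Longrightarrow> \<phi> S j l = (if l = j then 1 else 0)"
  using nb_node phi_eq I0_eq by auto

lemma phi_eq_0: "j \<in> I0 S \<Longrightarrow> T \<in> mesh S \<Longrightarrow> x \<in> T \<Longrightarrow> j \<notin> T \<Longrightarrow> \<phi> S j x = 0"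
  using nb_eq_0 phi_eq I0_eq by auto

lemma Vh_zero: "(\<lambda>x. 0) \<in> Vh S"
  unfolding Vh_def by (auto intro!: bexI[of _ "\<lambda>x. 0"] poly_le_zero)

lemma Vh_linear:
  assumes "u \<in> Vh S" "v \<in> Vh S" shows "(\<lambda>x. c * u x + v x) \<in> Vh S"
proof -
  have "\<exists>p\<in>poly_le (deg S). \<forall>x\<in>T. c * u x + v x = p x" if T: "T \<in> mesh S" for T
  proof -
    obtain p q where "p \<in> poly_le (deg S)" "\<forall>x\<in>T. u x = p x" "q \<in> poly_le (deg S)" "\<forall>x\<in>T. v x = q x"
      using Vh_piece[OF assms(1) T] Vh_piece[OF assms(2) T] by blast
    then show ?thesis by (intro bexI[of _ "\<lambda>x. c * p x + q x"]) (auto intro: poly_le_add poly_le_cmult)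
  qed
  then show ?thesis using assms unfolding Vh_def by (auto intro!: continuous_intros)
qed

lemma Vh_sum:
  assumes "\<And>j. j \<in> I \<Longrightarrow> u j \<in> Vh S" shows "(\<lambda>x. \<Sum>j\<in>I. c j * u j x) \<in> Vh S"
  using assms
  by (induction I rule: infinite_finite_induct) (auto intro: Vh_zero Vh_linear)

text \<open>Shrink each simplex at \<open>y\<close> towards \<open>y\<close> until its diameter is
  the smallest one, \<open>e\<close>. By convexity the shrunken inscribed balls, now all of radius
  \<open>e / \<sigma>\<close>, stay in their simplices and are disjoint, and they lie within
  distance \<open>e * (1 + 1 / \<sigma>)\<close> of \<open>y\<close>. Comparing volumes works
  however different the original sizes are.\<close>

lemma mesh_card_at_point:
  assumes sh: "\<And>T. T \<in> mesh S \<Longrightarrow> shape \<sigma> T" and \<sigma>: "\<sigma> > 0"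
  shows "real (card {T\<in>mesh S. y \<in> T}) \<le> (\<sigma> + 1) ^ CARD('n)"
proof (cases "{T\<in>mesh S. y \<in> T} = {}")
  case False
  let ?M = "{T\<in>mesh S. y \<in> T}"
  have finM: "finite ?M" using finite_mesh by simp
  have h: "0 < diameter T" if "T \<in> ?M" for T using that nsimplex_diameter_pos nsimplex_mesh by blast
  define e where "e = Min (diameter ` ?M)"
  have e: "0 < e" "\<And>T. T \<in> ?M \<Longrightarrow> e \<le> diameter T"
    unfolding e_def using finM False h by (auto simp: Min_gr_iff)
  have "\<exists>c. \<forall>T\<in>?M. ball (c T) (diameter T / \<sigma>) \<subseteq> T" using sh by (intro bchoice) auto
  then obtain c where c: "\<And>T. T \<in> ?M \<Longrightarrow> ball (c T) (diameter T / \<sigma>) \<subseteq> T" by blast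
  define B where "B T = ball (y + (e / diameter T) *\<^sub>R (c T - y)) (e / \<sigma>)" for T
  have BT: "B T \<subseteq> T" if T: "T \<in> ?M" for T
  proof
    fix x assume x: "x \<in> B T"
    define s where "s = e / diameter T"
    have s: "0 < s" "s \<le> 1" using e h[OF T] T by (auto simp: s_def)
    define w where "w = y + (1 / s) *\<^sub>R (x - y)"
    have "w - c T = (1 / s) *\<^sub>R (x - (y + s *\<^sub>R (c T - y)))"
      using s by (simp add: w_def algebra_simps)
    then have "norm (w - c T) = norm (x - (y + s *\<^sub>R (c T - y))) / s" using s by simp
    also have "\<dots> < (e / \<sigma>) / s"
      using x s unfolding B_def s_def[symmetric] by (intro divide_strict_right_mono) (auto simp: dist_norm norm_minus_commute)
    also have "\<dots> = diameter T / \<sigma>" using e h[OF T] \<sigma> by (simp add: s_def field_simps)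
    finally have "w \<in> T" using c[OF T] by (auto simp: subset_iff dist_norm norm_minus_commute)
    then have "(1 - s) *\<^sub>R y + s *\<^sub>R w \<in> T"
      using convexD_alt[OF convex_nsimplex[OF nsimplex_mesh], of T y w s] T s by auto
    moreover have "(1 - s) *\<^sub>R y + s *\<^sub>R w = x" using s by (simp add: w_def algebra_simps)
    ultimately show "x \<in> T" by simp
  qed
  have Bball: "B T \<subseteq> cball y (e * (1 + 1 / \<sigma>))" if T: "T \<in> ?M" for T
  proof
    fix x assume x: "x \<in> B T"
    have "c T \<in> T" using c[OF T] h[OF T] \<sigma> by (auto simp: subset_iff)
    then have "norm (c T - y) \<le> diameter T"
      using diameter_bounded_bound[OF compact_imp_bounded[OF compact_nsimplex[OF nsimplex_mesh]], of T "c T" y] T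
      by (auto simp: dist_norm)
    then have "e / diameter T * norm (c T - y) \<le> e" using h[OF T] e(1) by (simp add: field_simps)
    moreover have "norm (x - y) \<le> norm (x - (y + (e / diameter T) *\<^sub>R (c T - y))) + norm ((e / diameter T) *\<^sub>R (c T - y))"
      using norm_triangle_ineq[of "x - (y + (e / diameter T) *\<^sub>R (c T - y))" "(e / diameter T) *\<^sub>R (c T - y)"] by simp
    moreover have "norm (x - (y + (e / diameter T) *\<^sub>R (c T - y))) < e / \<sigma>"
      using x unfolding B_def by (simp add: dist_norm norm_minus_commute)
    moreover have "norm ((e / diameter T) *\<^sub>R (c T - y)) = e / diameter T * norm (c T - y)"
      using h[OF T] e(1) by simp
    moreover have "e * (1 + 1 / \<sigma>) = e + e / \<sigma>" by (simp add: distrib_left)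
    ultimately have "norm (x - y) \<le> e * (1 + 1 / \<sigma>)" by linarith
    then show "x \<in> cball y (e * (1 + 1 / \<sigma>))" by (simp add: dist_norm norm_minus_commute)
  qed
  have disj: "disjoint_family_on B ?M"
    unfolding disjoint_family_on_def
  proof (intro ballI impI)
    fix T T' assume T: "T \<in> ?M" "T' \<in> ?M" "T \<noteq> T'"
    have "open (B T \<inter> B T')" unfolding B_def by auto
    moreover have "B T \<inter> B T' \<subseteq> T \<inter> T'" using BT T by blast
    ultimately have "B T \<inter> B T' \<subseteq> interior (T \<inter> T')" by (rule interior_maximal[rotated])
    then show "B T \<inter> B T' = {}" using mesh_eqI[of T T'] T by auto
  qed
  let ?u = "unit_ball_vol (real CARD('n))"
  have u: "0 < ?u" by simp
  have "(\<Sum>T\<in>?M. emeasure lborel (B T)) = emeasure lborel (\<Union>T\<in>?M. B T)"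
    by (rule sum_emeasure[OF _ disj finM]) (auto simp: B_def)
  also have "\<dots> \<le> emeasure lborel (cball y (e * (1 + 1 / \<sigma>)))"
    using Bball by (intro emeasure_mono) auto
  also have "\<dots> = ennreal (?u * (e * (1 + 1 / \<sigma>)) ^ CARD('n))"
    using e \<sigma> by (subst emeasure_cball) auto
  also have "(\<Sum>T\<in>?M. emeasure lborel (B T)) = (\<Sum>T\<in>?M. ennreal (?u * (e / \<sigma>) ^ CARD('n)))"
    using e \<sigma> by (intro sum.cong) (auto simp: B_def emeasure_ball)
  also have "\<dots> = ennreal (real (card ?M) * (?u * (e / \<sigma>) ^ CARD('n)))"
    using e \<sigma> by (subst sum_ennreal) auto
  finally have "real (card ?M) * (?u * (e / \<sigma>) ^ CARD('n)) \<le> ?u * (e * (1 + 1 / \<sigma>)) ^ CARD('n)"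
    using e \<sigma> by (subst (asm) ennreal_le_iff) auto
  also have "e * (1 + 1 / \<sigma>) = (e / \<sigma>) * (\<sigma> + 1)" using \<sigma> by (simp add: field_simps)
  finally have "real (card ?M) * (?u * (e / \<sigma>) ^ CARD('n)) \<le> (\<sigma> + 1) ^ CARD('n) * (?u * (e / \<sigma>) ^ CARD('n))"
    by (simp only: power_mult_distrib mult_ac)
  moreover have "0 < ?u * (e / \<sigma>) ^ CARD('n)" using e \<sigma> u by (intro mult_pos_pos zero_less_power) auto
  ultimately show ?thesis by (rule mult_right_le_imp_le)
next
  case True
  show ?thesis unfolding True using \<sigma> by simp
qed

text \<open>The sign of the barycentric coordinate of the vertex opposite to a facet tells on which side
  of the facet a neighbour lies; two simplices on the same side overlap.\<close>

lemma same_side_eq: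
  assumes T: "T \<in> mesh S" "T' \<in> mesh S" and v: "v \<in> verts T" and W: "verts T - {v} \<subseteq> verts T'"
    and v': "v' \<in> verts T'" "bary T v v' > 0" and n: "CARD('n) \<ge> 1"
  shows "T = T'"
proof -
  note nT = nsimplex_mesh[OF T(1)] and nT' = nsimplex_mesh[OF T(2)]
  let ?W = "verts T - {v}"
  have cW: "card ?W = CARD('n)" using v card_verts[OF nT] finite_verts[OF nT] by simp
  have fW: "finite ?W" using finite_verts[OF nT] by simp
  \<comment> \<open>\<open>z\<close> is the barycentre of the facet opposite to \<open>v\<close>. A
    short step from it towards \<open>v'\<close> makes all coordinates with respect to
    \<open>T\<close> positive and stays in \<open>T'\<close>.\<close>
  define z where "z = (\<Sum>w\<in>?W. (1 / real (card ?W)) *\<^sub>R w)"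
  have bz: "bary T u z = (if u = v then 0 else 1 / real CARD('n))" if u: "u \<in> verts T" for u
  proof -
    have "bary T u z = (\<Sum>w\<in>?W. (1 / real (card ?W)) * bary T u w)"
      unfolding z_def by (rule bary_affine[OF nT u fW]) (use cW in simp)
    also have "\<dots> = (\<Sum>w\<in>?W. if u = w then 1 / real (card ?W) else 0)"
      using u by (intro sum.cong) (auto simp: bary_vertex[OF nT])
    also have "\<dots> = (if u = v then 0 else 1 / real CARD('n))"
      using u fW by (auto simp: cW)
    finally show ?thesis .
  qed
  have zT': "z \<in> T'"
    unfolding z_def using W verts_subset cW by (intro convex_sum[OF fW convex_nsimplex[OF nT']]) auto
  have v'T': "v' \<in> T'" using v' verts_subset by blast
  have "\<forall>\<^sub>F t in at_right 0. bary T u (z + t *\<^sub>R (v' - z)) > 0" if u: "u \<in> verts T" for u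
  proof (cases "u = v")
    case True
    have "bary T u (z + t *\<^sub>R (v' - z)) > 0" if "t > 0" for t
      unfolding bary_move[OF nT u] using True v' that bz[OF u] by simp
    then show ?thesis using eventually_at_right_less[of "0::real"] by (auto elim: eventually_mono)
  next
    case False
    have "((\<lambda>t. bary T u z + t * (bary T u v' - bary T u z)) \<longlongrightarrow> bary T u z + 0 * (bary T u v' - bary T u z)) (at_right 0)"
      by (intro tendsto_intros)
    moreover have "bary T u z + 0 * (bary T u v' - bary T u z) > 0" using False by (simp add: bz[OF u])
    ultimately show ?thesis unfolding bary_move[OF nT u] by (rule order_tendstoD(1))
  qed
  then have "\<forall>\<^sub>F t in at_right 0. \<forall>u\<in>verts T. bary T u (z + t *\<^sub>R (v' - z)) > 0"
    using finite_verts[OF nT] by (intro eventually_ball_finite) auto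
  moreover have "\<forall>\<^sub>F t in at_right (0::real). t < 1" by (rule eventually_at_right_real[THEN eventually_mono, of 0 1]) auto
  moreover have "\<forall>\<^sub>F t in at_right (0::real). 0 < t" by (rule eventually_at_right_less)
  ultimately have "\<forall>\<^sub>F t in at_right 0. (\<forall>u\<in>verts T. bary T u (z + t *\<^sub>R (v' - z)) > 0) \<and> t < 1 \<and> 0 < t"
    by eventually_elim auto
  then obtain t where t: "\<forall>u\<in>verts T. bary T u (z + t *\<^sub>R (v' - z)) > 0" "t < 1" "0 < t"
    using eventually_happens[of _ "at_right (0::real)"] trivial_limit_at_right_real by blast
  let ?y = "z + t *\<^sub>R (v' - z)"
  have "(1 - t) *\<^sub>R z + t *\<^sub>R v' \<in> T'" using convexD_alt[OF convex_nsimplex[OF nT'] zT' v'T', of t] t by simp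
  then have yT': "?y \<in> T'" by (simp add: algebra_simps)
  have yT: "?y \<in> T" unfolding mem_nsimplex_iff[OF nT] using t(1) by (auto intro: less_imp_le)
  have "verts T \<subseteq> T'"
  proof
    fix u assume u: "u \<in> verts T"
    show "u \<in> T'"
    proof (rule ccontr)
      assume "u \<notin> T'"
      then have "bary T u ?y = 0" using bary_face_zero[OF nT face_mesh[OF T] _ u] yT yT' by auto
      then show False using t(1) u by auto
    qed
  qed
  then have "T \<subseteq> T'" using convex_hull_verts[OF nT] hull_minimal[of "verts T" T' convex] convex_nsimplex[OF nT'] by simp
  moreover have "interior T \<noteq> {}" by (rule interior_nsimplex_nonempty[OF nT])
  ultimately show ?thesis by (intro mesh_eqI[OF T]) (simp add: Int_absorb2)
qed

text \<open>\<open>T'\<close> and a third simplex on the same facet would both have their apex on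
  the side of the facet away from \<open>T\<close>, hence on the same side of it, and two such
  simplices coincide.\<close>

lemma facet_two_neighbours:
  assumes T: "T \<in> mesh S" "T' \<in> mesh S" "T'' \<in> mesh S" "T \<noteq> T'"
    and F: "(T \<inter> T') facet_of T" "T \<inter> T' \<subseteq> T''" and n: "CARD('n) \<ge> 1"
  shows "T'' = T \<or> T'' = T'"
proof (rule ccontr)
  assume ne: "\<not> ?thesis"
  note nT = nsimplex_mesh[OF T(1)] and nT' = nsimplex_mesh[OF T(2)] and nT'' = nsimplex_mesh[OF T(3)]
  have "(T \<inter> T') facet_of convex hull (verts T)" using F(1) convex_hull_verts[OF nT] by simp
  then obtain v where v: "v \<in> verts T" "T \<inter> T' = convex hull (verts T - {v})"
    using facet_of_convex_hull_affine_independent[OF affine_independent_verts[OF nT]] by blast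
  have vi: "verts T \<inter> R = verts T \<inter> verts R" if "R \<in> mesh S" for R
    using verts_Int[OF face_mesh[OF T(1) that] face_mesh'[OF T(1) that]] .
  let ?W = "verts T - {v}"
  have W: "?W \<subseteq> T \<inter> T'" unfolding v(2) by (rule hull_subset)
  have W1: "?W \<subseteq> verts T'" using W vi[OF T(2)] by blast
  have W2: "?W \<subseteq> verts T''" using W F(2) vi[OF T(3)] by blast
  have cW: "card ?W = CARD('n)" using v card_verts[OF nT] finite_verts[OF nT] by simp
  have apex: "\<exists>u. u \<notin> ?W \<and> verts R = insert u ?W" if "nsimplex R" "?W \<subseteq> verts R" for R
  proof -
    have "card (verts R - ?W) = 1"
      using that cW card_verts[OF that(1)] finite_verts[OF that(1)] finite_verts[OF nT] by (simp add: card_Diff_subset)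
    then obtain u where "verts R - ?W = {u}" using card_1_singletonE by blast
    then show ?thesis using that(2) by blast
  qed
  obtain v1 where v1: "v1 \<notin> ?W" "verts T' = insert v1 ?W" using apex[OF nT' W1] by blast
  obtain v2 where v2: "v2 \<notin> ?W" "verts T'' = insert v2 ?W" using apex[OF nT'' W2] by blast
  have l0: "bary T v w = 0" if "w \<in> ?W" for w using that v(1) bary_vertex[OF nT v(1), of w] by auto
  have le: "bary T v u \<le> 0" if "R \<in> mesh S" "R \<noteq> T" "?W \<subseteq> verts R" "u \<in> verts R" for R u
    using same_side_eq[OF T(1) that(1) v(1) that(3,4) _ n] that(2) by (metis not_le)
  \<comment> \<open>The coordinate of \<open>v\<close> vanishes on the common facet, so it is a
    multiple of the apex coordinate of the simplex \<open>R\<close> on the other side.\<close>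
  have factor: "bary T v x = bary R u x * bary T v u" if "nsimplex R" "verts R = insert u ?W" "u \<notin> ?W" for R u x
  proof -
    have "bary T v x = bary T v (\<Sum>w\<in>verts R. bary R w x *\<^sub>R w)" by (simp add: bary_comb[OF that(1)])
    also have "\<dots> = (\<Sum>w\<in>verts R. bary R w x * bary T v w)"
      by (rule bary_affine[OF nT v(1) finite_verts[OF that(1)] bary_sum[OF that(1)]])
    also have "\<dots> = bary R u x * bary T v u + (\<Sum>w\<in>?W. bary R w x * bary T v w)"
      unfolding that(2) using that(3) finite_verts[OF nT] by (subst sum.insert) auto
    also have "(\<Sum>w\<in>?W. bary R w x * bary T v w) = 0" using l0 by (intro sum.neutral) auto
    finally show ?thesis by simp
  qed
  have vv: "bary T v v = 1" using bary_vertex[OF nT v(1) v(1)] by simp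
  have "bary T v v1 \<noteq> 0" using factor[OF nT' v1(2,1), of v] vv by auto
  then have n1: "bary T v v1 < 0" using le[OF T(2) _ W1, of v1] v1 T(4) by auto
  have "bary T v v2 \<noteq> 0" using factor[OF nT'' v2(2,1), of v] vv by auto
  then have n2: "bary T v v2 < 0" using le[OF T(3) _ W2, of v2] v2 ne by auto
  have "bary T' v1 v2 > 0" using factor[OF nT' v1(2,1), of v2] n1 n2
    by (metis linorder_not_less mult_nonpos_nonpos less_imp_le order_less_irrefl order_le_less_trans)
  moreover have "verts T' - {v1} \<subseteq> verts T''" using v1 W2 by auto
  ultimately have "T' = T''" using same_side_eq[OF T(2,3), of v1 v2] v1 v2 n by auto
  then show False using ne by simp
qed

end

section \<open>Connected sets covered by finitely many closed pieces\<close>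

text \<open>The levels \<open>{T. h T \<le> \<tau>^j * h T0}\<close> grow strictly until they exhaust all pieces, since a
  level that does not grow would separate the connected set.\<close>

lemma chain_ratio_bound:
  fixes h :: "'a::topological_space set \<Rightarrow> real"
  assumes C: "connected C" "C \<subseteq> \<Union>F" and F: "finite F" "\<And>T. T \<in> F \<Longrightarrow> closed T \<and> T \<inter> C \<noteq> {}"
    and h: "\<And>T. T \<in> F \<Longrightarrow> 0 < h T" and \<tau>: "1 \<le> \<tau>"
    and adj: "\<And>T T' y. T \<in> F \<Longrightarrow> T' \<in> F \<Longrightarrow> y \<in> T \<Longrightarrow> y \<in> T' \<Longrightarrow> y \<in> C \<Longrightarrow> h T' \<le> \<tau> * h T"
    and T: "T0 \<in> F" "T \<in> F"
  shows "h T \<le> \<tau> ^ card F * h T0"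
proof -
  have T0F: "T0 \<in> F" by (rule T(1))
  define E where "E j = {T\<in>F. h T \<le> \<tau> ^ j * h T0}" for j
  have mono: "E j \<subseteq> E (Suc j)" for j
  proof
    fix T assume "T \<in> E j"
    then have T: "T \<in> F" "h T \<le> \<tau> ^ j * h T0" by (auto simp: E_def)
    have "1 * (\<tau> ^ j * h T0) \<le> \<tau> * (\<tau> ^ j * h T0)"
      using \<tau> less_imp_le[OF h[OF T0F]] by (intro mult_right_mono) auto
    then show "T \<in> E (Suc j)" using T by (auto simp: E_def mult.assoc)
  qed
  have T0E: "T0 \<in> E j" for j
    using T(1) h[OF T(1)] one_le_power[OF \<tau>, of j] by (auto simp: E_def mult_le_cancel_right1)
  have stable: "E j = F" if eq: "E (Suc j) = E j" for j
  proof (rule ccontr)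
    assume ne: "E j \<noteq> F"
    let ?A = "\<Union>(E j)" let ?B = "\<Union>(F - E j)"
    have "closed ?A" "closed ?B" using F by (auto simp: E_def intro!: closed_Union)
    moreover have "C \<subseteq> ?A \<union> ?B" using C(2) by blast
    moreover have "?A \<inter> ?B \<inter> C = {}"
    proof (rule ccontr)
      assume "?A \<inter> ?B \<inter> C \<noteq> {}"
      then obtain y T T' where y: "y \<in> C" "y \<in> T" "T \<in> E j" "y \<in> T'" "T' \<in> F - E j" by blast
      have "h T' \<le> \<tau> * h T" using adj y by (auto simp: E_def)
      also have "\<dots> \<le> \<tau> * (\<tau> ^ j * h T0)" using y \<tau> by (intro mult_left_mono) (auto simp: E_def)
      finally have "T' \<in> E (Suc j)" using y by (auto simp: E_def mult.assoc)
      then show False using eq y by auto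
    qed
    moreover have "?A \<inter> C \<noteq> {}" using T0E F T by blast
    moreover have "?B \<inter> C \<noteq> {}"
    proof -
      obtain T where "T \<in> F" "T \<notin> E j" using ne by (auto simp: E_def)
      then show ?thesis using F(2)[of T] by blast
    qed
    ultimately show False using C(1) unfolding connected_closed by blast
  qed
  have "E j = F \<or> card (E j) \<ge> j + 1" for j
  proof (induction j)
    case 0
    have "finite (E 0)" using F by (simp add: E_def)
    then have "card (E 0) > 0" using T0E[of 0] card_gt_0_iff by blast
    then show ?case by simp
  next
    case (Suc j)
    show ?case
    proof (cases "E j = F \<or> E (Suc j) = E j")
      case True
      then have "E j = F" using stable by blast
      then have "E (Suc j) = F" using mono[of j] by (auto simp: E_def)
      then show ?thesis by simp
    next
      case False
      then have "E j \<subset> E (Suc j)" using mono[of j] by blast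
      moreover have "finite (E (Suc j))" using F by (simp add: E_def)
      ultimately have "card (E j) < card (E (Suc j))" by (rule psubset_card_mono[rotated])
      then show ?thesis using Suc False by auto
    qed
  qed
  moreover have "card (E (card F)) \<le> card F" using F by (intro card_mono) (auto simp: E_def)
  ultimately have "E (card F) = F" by (metis Suc_eq_plus1 not_less_eq_eq)
  then show ?thesis using T(2) by (auto simp: E_def)
qed

text \<open>The image of the connected set is an interval, covered by intervals of length \<open>osc T\<close>;
  compare Lebesgue measures.\<close>

lemma oscillation_le_sum:
  fixes f :: "'a::topological_space \<Rightarrow> real"
  assumes C: "connected C" "continuous_on C f" "C \<subseteq> \<Union>F" and F: "finite F"
    and osc: "\<And>T a b. T \<in> F \<Longrightarrow> a \<in> T \<Longrightarrow> b \<in> T \<Longrightarrow> a \<in> C \<Longrightarrow> b \<in> C \<Longrightarrow> \<bar>f a - f b\<bar> \<le> osc T"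
    and pos: "\<And>T. T \<in> F \<Longrightarrow> 0 \<le> osc T" and xy: "x \<in> C" "y \<in> C"
  shows "\<bar>f x - f y\<bar> \<le> (\<Sum>T\<in>F. osc T)"
proof -
  have *: "f y - f x \<le> (\<Sum>T\<in>F. osc T)" if xy: "x \<in> C" "y \<in> C" "f x \<le> f y" for x y
  proof -
    have iv: "{f x..f y} \<subseteq> f ` C"
      using connected_contains_Icc[OF connected_continuous_image[OF C(2,1)]] xy by auto
    define a where "a T = Inf (f ` (T \<inter> C))" for T
    have "{f x..f y} \<subseteq> (\<Union>T\<in>F. {a T..a T + osc T})"
    proof
      fix s assume "s \<in> {f x..f y}"
      then obtain z where z: "z \<in> C" "s = f z" using iv by blast
      then obtain T where T: "T \<in> F" "z \<in> T" using C(3) by blast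
      have low: "f z - osc T \<le> f z'" if "z' \<in> T \<inter> C" for z'
        using osc[OF T(1,2) _ z(1), of z'] that by (auto simp: abs_le_iff)
      have bdd: "bdd_below (f ` (T \<inter> C))" using low by (intro bdd_belowI2[where m = "f z - osc T"])
      have "a T \<le> f z" unfolding a_def using T z bdd by (intro cINF_lower) auto
      moreover have "f z - osc T \<le> a T" unfolding a_def using T z low by (intro cINF_greatest) auto
      ultimately show "s \<in> (\<Union>T\<in>F. {a T..a T + osc T})" using T z by (intro UN_I[of T]) auto
    qed
    then have "emeasure lborel {f x..f y} \<le> emeasure lborel (\<Union>T\<in>F. {a T..a T + osc T})"
      using F by (intro emeasure_mono sets.finite_UN) auto
    also have "\<dots> \<le> (\<Sum>T\<in>F. emeasure lborel {a T..a T + osc T})"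
      using F by (intro emeasure_subadditive_finite) auto
    also have "\<dots> = (\<Sum>T\<in>F. ennreal (osc T))" using pos by (intro sum.cong) auto
    also have "\<dots> = ennreal (\<Sum>T\<in>F. osc T)" using pos by (intro sum_ennreal)
    finally show ?thesis using xy pos by (simp add: ennreal_le_iff sum_nonneg)
  qed
  show ?thesis using *[OF xy] *[OF xy(2,1)] by (cases "f x \<le> f y") auto
qed

section \<open>Level sets with Lipschitz gradient as graphs\<close>

text \<open>The box is longer in direction \<open>i\<close>, so that a level set of slope bounded in
  terms of \<open>CARD('n)\<close> leaves it sideways only. The factor is chosen in
  \<open>patch_lift\<close>.\<close>

definition patch_box :: "real ^ 'n::finite \<Rightarrow> 'n \<Rightarrow> real \<Rightarrow> (real ^ 'n) set" where
  "patch_box x i \<eta> = {z. \<bar>z $ i - x $ i\<bar> \<le> 8 * (real CARD('n))\<^sup>2 * \<eta> \<and> (\<forall>j. j \<noteq> i \<longrightarrow> \<bar>z $ j - x $ j\<bar> \<le> \<eta>)}"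

definition replace_coord :: "'n::finite \<Rightarrow> real \<Rightarrow> real ^ 'n \<Rightarrow> real ^ 'n" where
  "replace_coord i t z = (\<chi> j. if j = i then t else z $ j)"

lemma replace_coord_nth [simp]: "replace_coord i t z $ j = (if j = i then t else z $ j)"
  by (simp add: replace_coord_def)

lemma norm_le_coords:
  fixes z :: "real ^ 'n::finite"
  shows "norm z \<le> \<bar>z $ i\<bar> + (\<Sum>j\<in>UNIV - {i}. \<bar>z $ j\<bar>)"
  using norm_le_l1_cart[of z] by (subst (asm) sum.remove[of _ i]) auto

lemma patch_box_norm:
  fixes x :: "real ^ 'n::finite"
  assumes "z \<in> patch_box x i \<eta>" "0 \<le> \<eta>"
  shows "norm (z - x) \<le> (real CARD('n) + 8 * (real CARD('n))\<^sup>2) * \<eta>"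
proof -
  have "(\<Sum>j\<in>UNIV - {i}. \<bar>(z - x) $ j\<bar>) \<le> (\<Sum>j\<in>UNIV - {i}. \<eta>)"
    using assms by (intro sum_mono) (auto simp: patch_box_def)
  also have "\<dots> \<le> real CARD('n) * \<eta>"
    using assms(2) by (simp add: mult_right_mono)
  finally have "(\<Sum>j\<in>UNIV - {i}. \<bar>(z - x) $ j\<bar>) \<le> real CARD('n) * \<eta>" .
  then show ?thesis
    using norm_le_coords[of "z - x" i] assms(1) by (auto simp: patch_box_def algebra_simps)
qed

lemma line_mean_value:
  fixes \<rho> :: "real ^ 'n::finite \<Rightarrow> real"
  assumes "\<And>z. z \<in> closed_segment a b \<Longrightarrow> (\<rho> has_derivative inner (g z)) (at z)"
  obtains z where "z \<in> closed_segment a b" "\<rho> b - \<rho> a = inner (g z) (b - a)"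
proof -
  let ?l = "\<lambda>t. a + t *\<^sub>R (b - a)"
  have seg: "?l t \<in> closed_segment a b" if "0 \<le> t" "t \<le> 1" for t
    using that unfolding closed_segment_def by (auto simp: algebra_simps intro!: exI[of _ t])
  have "\<exists>t>0. t < 1 \<and> \<rho> (?l 1) - \<rho> (?l 0) = (1 - 0) * inner (g (?l t)) (b - a)"
  proof (rule MVT2[where f = "\<lambda>t. \<rho> (?l t)"])
    fix t :: real assume t: "0 \<le> t" "t \<le> 1"
    have "(?l has_derivative (\<lambda>s. s *\<^sub>R (b - a))) (at t)" by (auto intro!: derivative_eq_intros)
    from has_derivative_compose[OF this assms[OF seg[OF t]]]
    show "((\<lambda>t. \<rho> (?l t)) has_real_derivative inner (g (?l t)) (b - a)) (at t)"
      unfolding has_field_derivative_def by (rule has_derivative_eq_rhs) (simp add: fun_eq_iff mult.commute)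
  qed simp
  then show thesis using that seg by (auto intro: less_imp_le)
qed

text \<open>The ball is so small that the gradient deviates from its unit value at the centre by at
  most \<open>1 / (2 * CARD('n))\<close>. One component of it is at least twice that at the centre,
  so \<rho> is strictly monotone in this coordinate throughout the ball.\<close>

locale level_patch =
  fixes x :: "real ^ 'n::finite" and \<rho> g r0 K
  assumes deriv: "\<And>z. z \<in> ball x r0 \<Longrightarrow> (\<rho> has_derivative inner (g z)) (at z)"
    and lip: "lipschitz_on K (ball x r0) g" and unit: "norm (g x) = 1"
    and small: "K * r0 \<le> 1 / (2 * real CARD('n))" and r0: "0 < r0" and zero: "\<rho> x = 0"
begin

lemma card_ge_1: "1 \<le> real CARD('n)"
  by (simp add: Suc_leI)

definition "dir = (SOME i. 1 / real CARD('n) \<le> \<bar>g x $ i\<bar>)"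
definition "orient = sgn (g x $ dir)"

text \<open>The sum of the absolute components of a unit vector is at least 1.\<close>

lemma dir: "1 / real CARD('n) \<le> \<bar>g x $ dir\<bar>"
proof -
  have "\<exists>i. 1 / real CARD('n) \<le> \<bar>g x $ i\<bar>"
  proof (rule ccontr)
    assume "\<not> ?thesis"
    then have "(\<Sum>i\<in>UNIV. \<bar>g x $ i\<bar>) < (\<Sum>i\<in>(UNIV::'n set). 1 / real CARD('n))"
      by (intro sum_strict_mono) (auto simp: not_le)
    then show False using norm_le_l1_cart[of "g x"] unit by simp
  qed
  then show ?thesis unfolding dir_def by (rule someI_ex)
qed

lemma g_close: assumes z: "z \<in> ball x r0" shows "norm (g z - g x) \<le> 1 / (2 * real CARD('n))"
proof -
  have K: "0 \<le> K" using lip unfolding lipschitz_on_def by simp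
  have "dist (g z) (g x) \<le> K * dist z x" using lip z r0 unfolding lipschitz_on_def by auto
  also have "\<dots> \<le> K * r0" using z K by (intro mult_left_mono) (auto simp: dist_commute)
  finally show ?thesis using small by (simp add: dist_norm)
qed

lemma orient_abs: "\<bar>orient\<bar> = 1"
proof -
  have "0 < 1 / real CARD('n)" by simp
  then have "g x $ dir \<noteq> 0" using dir by (metis abs_zero not_le)
  then show ?thesis unfolding orient_def by (simp add: abs_sgn_eq)
qed

lemma g_dir: assumes z: "z \<in> ball x r0" shows "1 / (2 * real CARD('n)) \<le> orient * g z $ dir"
proof -
  have "\<bar>(g z - g x) $ dir\<bar> \<le> 1 / (2 * real CARD('n))"
    using g_close[OF z] component_le_norm_cart[of "g z - g x" dir] by linarith
  then have "\<bar>orient * (g z - g x) $ dir\<bar> \<le> 1 / (2 * real CARD('n))" by (simp add: abs_mult orient_abs)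
  moreover have "orient * g x $ dir = \<bar>g x $ dir\<bar>" using abs_sgn[of "g x $ dir"] by (simp add: orient_def mult.commute)
  moreover have "1 / real CARD('n) = 1 / (2 * real CARD('n)) + 1 / (2 * real CARD('n))" by simp
  moreover have "orient * g z $ dir = orient * g x $ dir + orient * (g z - g x) $ dir" by (simp add: algebra_simps)
  ultimately show ?thesis using dir by linarith
qed

lemma g_norm: assumes z: "z \<in> ball x r0" shows "norm (g z) \<le> 2"
proof -
  have "1 / (2 * real CARD('n)) \<le> 1" using card_ge_1 by (subst divide_le_eq_1_pos) linarith+
  then show ?thesis using g_close[OF z] norm_triangle_sub[of "g z" "g x"] unit by linarith
qed

lemma rho_mono:
  assumes "z \<in> ball x r0" "replace_coord dir t z \<in> ball x r0" "z $ dir \<le> t"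
  shows "(t - z $ dir) / (2 * real CARD('n)) \<le> orient * (\<rho> (replace_coord dir t z) - \<rho> z)"
proof -
  let ?b = "replace_coord dir t z"
  have seg: "closed_segment z ?b \<subseteq> ball x r0" using assms by (intro closed_segment_subset) auto
  obtain y where y: "y \<in> closed_segment z ?b" "\<rho> ?b - \<rho> z = inner (g y) (?b - z)"
    using line_mean_value[of z ?b \<rho> g] deriv seg by blast
  have "?b - z = (t - z $ dir) *\<^sub>R axis dir 1" by (auto simp: Finite_Cartesian_Product.vec_eq_iff axis_def)
  then have "inner (g y) (?b - z) = (t - z $ dir) * g y $ dir" by (simp add: inner_axis)
  then have "orient * (\<rho> ?b - \<rho> z) = orient * ((t - z $ dir) * g y $ dir)" unfolding y(2) by (rule arg_cong)
  also have "\<dots> = (t - z $ dir) * (orient * g y $ dir)" by (rule mult.left_commute)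
  also have "\<dots> \<ge> (t - z $ dir) * (1 / (2 * real CARD('n)))"
    using g_dir[of y] y seg assms(3) by (intro mult_left_mono) auto
  finally show ?thesis by (simp only: times_divide_eq_right mult_1_right)
qed

lemma rho_lip:
  assumes "a \<in> ball x r0" "b \<in> ball x r0" shows "\<bar>\<rho> b - \<rho> a\<bar> \<le> 2 * norm (b - a)"
proof -
  have seg: "closed_segment a b \<subseteq> ball x r0" using assms by (intro closed_segment_subset) auto
  obtain y where y: "y \<in> closed_segment a b" "\<rho> b - \<rho> a = inner (g y) (b - a)"
    using line_mean_value[of a b \<rho> g] deriv seg by blast
  have "\<bar>inner (g y) (b - a)\<bar> \<le> norm (g y) * norm (b - a)" by (rule Cauchy_Schwarz_ineq2)
  also have "\<dots> \<le> 2 * norm (b - a)" using g_norm[of y] y seg by (intro mult_right_mono) auto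
  finally show ?thesis using y by simp
qed

definition patch :: "real \<Rightarrow> (real ^ 'n) set" where
  "patch \<eta> = {z \<in> patch_box x dir \<eta>. \<rho> z = 0}"

context
  fixes \<eta> :: real
  assumes \<eta>: "0 < \<eta>" and fit: "(real CARD('n) + 8 * (real CARD('n))\<^sup>2) * \<eta> < r0"
begin

lemma box_ball: "patch_box x dir \<eta> \<subseteq> ball x r0"
  using patch_box_norm[of _ x dir \<eta>] \<eta> fit by (force simp: dist_norm norm_minus_commute)

lemma patch_ball: "patch \<eta> \<subseteq> ball x r0" unfolding patch_def using box_ball by auto

lemma center_patch: "x \<in> patch \<eta>"
  unfolding patch_def patch_box_def using \<eta> zero by simp

lemma patch_norm: "z \<in> patch \<eta> \<Longrightarrow> norm (z - x) \<le> (real CARD('n) + 8 * (real CARD('n))\<^sup>2) * \<eta>"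
  unfolding patch_def using patch_box_norm[of z x dir \<eta>] \<eta> by auto

text \<open>Move \<open>a\<close> in direction \<open>dir\<close> to the height of \<open>b\<close>.
  This changes \<rho> by at least \<open>1 / (2 * CARD('n))\<close> times the height difference; the
  moved point differs from \<open>b\<close> only in the other coordinates, along which \<rho> has
  Lipschitz constant 2, and \<rho> is 0 at both \<open>a\<close> and \<open>b\<close>.\<close>

lemma patch_graph:
  assumes "a \<in> patch \<eta>" "b \<in> patch \<eta>"
  shows "\<bar>a $ dir - b $ dir\<bar> \<le> 4 * real CARD('n) * (\<Sum>j\<in>UNIV - {dir}. \<bar>a $ j - b $ j\<bar>)"
proof -
  have *: "b $ dir - a $ dir \<le> 4 * real CARD('n) * (\<Sum>j\<in>UNIV - {dir}. \<bar>a $ j - b $ j\<bar>)"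
    if ab: "a \<in> patch \<eta>" "b \<in> patch \<eta>" "a $ dir \<le> b $ dir" for a b
  proof -
    let ?c = "replace_coord dir (b $ dir) a"
    have c: "?c \<in> ball x r0" by (rule subsetD[OF box_ball]) (use ab in \<open>auto simp: patch_def patch_box_def\<close>)
    have "(b $ dir - a $ dir) / (2 * real CARD('n)) \<le> orient * (\<rho> ?c - \<rho> a)"
      using ab patch_ball c by (intro rho_mono) auto
    also have "\<dots> \<le> \<bar>\<rho> ?c - \<rho> a\<bar>"
      using abs_ge_self[of "orient * (\<rho> ?c - \<rho> a)"] by (simp add: abs_mult orient_abs)
    also have "\<dots> = \<bar>\<rho> ?c - \<rho> b\<bar>" using ab by (simp add: patch_def)
    also have "\<dots> \<le> 2 * norm (?c - b)" using ab patch_ball c by (intro rho_lip) auto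
    also have "norm (?c - b) \<le> \<bar>(?c - b) $ dir\<bar> + (\<Sum>j\<in>UNIV - {dir}. \<bar>(?c - b) $ j\<bar>)" by (rule norm_le_coords)
    also have "\<dots> = (\<Sum>j\<in>UNIV - {dir}. \<bar>a $ j - b $ j\<bar>)" by (auto intro!: sum.cong)
    finally have "(b $ dir - a $ dir) / (2 * real CARD('n)) \<le> 2 * (\<Sum>j\<in>UNIV - {dir}. \<bar>a $ j - b $ j\<bar>)" by simp
    then show ?thesis by (simp add: field_simps)
  qed
  have "(\<Sum>j\<in>UNIV - {dir}. \<bar>b $ j - a $ j\<bar>) = (\<Sum>j\<in>UNIV - {dir}. \<bar>a $ j - b $ j\<bar>)"
    by (intro sum.cong) (auto simp: abs_minus_commute)
  then show ?thesis using *[OF assms] *[OF assms(2,1)] by (cases "a $ dir \<le> b $ dir") auto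
qed

text \<open>Intermediate value theorem on a line in direction \<open>dir\<close>. At the height of
  \<open>x\<close> the value is at most \<open>2 * ?N * \<eta>\<close> in size, and going
  \<open>?H\<close> up or down changes it by at least \<open>4 * ?N * \<eta>\<close>, which produces
  both signs.\<close>

lemma patch_lift:
  assumes y: "\<And>j. j \<noteq> dir \<Longrightarrow> \<bar>y $ j - x $ j\<bar> \<le> \<eta>"
  shows "\<exists>z\<in>patch \<eta>. \<forall>j. j \<noteq> dir \<longrightarrow> z $ j = y $ j"
proof -
  let ?N = "real CARD('n)" let ?H = "8 * ?N\<^sup>2 * \<eta>"
  have N: "1 \<le> ?N" by (simp add: Suc_leI)
  have H: "0 < ?H" using \<eta> N by simp
  let ?q = "\<lambda>t. replace_coord dir t y"
  have qb: "?q t \<in> ball x r0" if "\<bar>t - x $ dir\<bar> \<le> ?H" for t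
    by (rule subsetD[OF box_ball]) (use y that in \<open>auto simp: patch_box_def\<close>)
  have rr: "replace_coord dir t (?q u) = ?q t" for t u by (simp add: Finite_Cartesian_Product.vec_eq_iff)
  have mid: "\<bar>\<rho> (?q (x $ dir))\<bar> \<le> 2 * (?N * \<eta>)"
  proof -
    have "\<bar>\<rho> (?q (x $ dir)) - \<rho> x\<bar> \<le> 2 * norm (?q (x $ dir) - x)"
      using qb H r0 by (intro rho_lip) auto
    also have "norm (?q (x $ dir) - x) \<le> \<bar>(?q (x $ dir) - x) $ dir\<bar> + (\<Sum>j\<in>UNIV - {dir}. \<bar>(?q (x $ dir) - x) $ j\<bar>)"
      by (rule norm_le_coords)
    also have "\<dots> = (\<Sum>j\<in>UNIV - {dir}. \<bar>(?q (x $ dir) - x) $ j\<bar>)" by simp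
    also have "\<dots> \<le> (\<Sum>j\<in>UNIV - {dir}. \<eta>)" by (rule sum_mono) (use y in auto)
    also have "\<dots> \<le> ?N * \<eta>" using \<eta> by (simp add: mult_right_mono)
    finally show ?thesis using zero by simp
  qed
  have step: "?H / (2 * ?N) = 4 * (?N * \<eta>)" using N by (simp add: power2_eq_square)
  have up: "0 < orient * \<rho> (?q (x $ dir + ?H))"
  proof -
    have "?H / (2 * ?N) \<le> orient * (\<rho> (?q (x $ dir + ?H)) - \<rho> (?q (x $ dir)))"
      using rho_mono[of "?q (x $ dir)" "x $ dir + ?H"] qb H by (simp add: rr)
    moreover have "\<bar>orient * \<rho> (?q (x $ dir))\<bar> \<le> 2 * (?N * \<eta>)" using mid by (simp add: abs_mult orient_abs)
    moreover have "0 < ?N * \<eta>" using \<eta> N by (intro mult_pos_pos) auto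
    ultimately show ?thesis using step unfolding right_diff_distrib by linarith
  qed
  have dn: "orient * \<rho> (?q (x $ dir - ?H)) < 0"
  proof -
    have "?H / (2 * ?N) \<le> orient * (\<rho> (?q (x $ dir)) - \<rho> (?q (x $ dir - ?H)))"
      using rho_mono[of "?q (x $ dir - ?H)" "x $ dir"] qb H by (simp add: rr)
    moreover have "\<bar>orient * \<rho> (?q (x $ dir))\<bar> \<le> 2 * (?N * \<eta>)" using mid by (simp add: abs_mult orient_abs)
    moreover have "0 < ?N * \<eta>" using \<eta> N by (intro mult_pos_pos) auto
    ultimately show ?thesis using step unfolding right_diff_distrib by linarith
  qed
  have contq: "continuous_on UNIV ?q"
  proof -
    have eq: "?q = (\<lambda>t. replace_coord dir 0 y + t *\<^sub>R axis dir 1)"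
      by (auto simp: fun_eq_iff Finite_Cartesian_Product.vec_eq_iff axis_def)
    show ?thesis by (subst eq) (intro continuous_intros)
  qed
  have contr: "continuous_on (ball x r0) \<rho>"
    using deriv has_derivative_continuous by (intro continuous_at_imp_continuous_on) blast
  have cont: "continuous_on {x $ dir - ?H..x $ dir + ?H} (\<lambda>t. orient * \<rho> (?q t))"
  proof (intro continuous_intros continuous_on_compose2[OF contr])
    show "continuous_on {x $ dir - ?H..x $ dir + ?H} ?q" using contq continuous_on_subset by blast
    show "?q ` {x $ dir - ?H..x $ dir + ?H} \<subseteq> ball x r0" by (auto intro!: qb simp: abs_le_iff)
  qed
  have "\<exists>t\<ge>x $ dir - ?H. t \<le> x $ dir + ?H \<and> orient * \<rho> (?q t) = 0"
    using up dn H by (intro IVT'[OF _ _ _ cont]) auto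
  then obtain t where t: "x $ dir - ?H \<le> t" "t \<le> x $ dir + ?H" "orient * \<rho> (?q t) = 0" by blast
  have "\<rho> (?q t) = 0" using t(3) orient_abs by auto
  then have "?q t \<in> patch \<eta>" unfolding patch_def patch_box_def using y t(1,2) by (auto simp: abs_le_iff)
  then show ?thesis by (intro bexI[of _ "?q t"]) auto
qed

lemma closed_patch: "closed (patch \<eta>)"
proof -
  have cb: "closed (patch_box x dir \<eta>)"
    unfolding patch_box_def by (intro closed_Collect_conj closed_Collect_all closed_Collect_imp closed_Collect_le
        open_Collect_const continuous_intros)
  have "continuous_on (patch_box x dir \<eta>) \<rho>"
    using deriv box_ball has_derivative_continuous by (intro continuous_at_imp_continuous_on) blast
  from continuous_closed_preimage[OF this cb closed_singleton[of 0]]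
  show ?thesis unfolding patch_def by (simp add: vimage_def Int_def conj_commute)
qed

lemma near_patch: "\<rho> z = 0 \<Longrightarrow> norm (z - x) < \<eta> \<Longrightarrow> z \<in> patch \<eta>"
proof -
  assume z: "\<rho> z = 0" "norm (z - x) < \<eta>"
  have c: "\<bar>z $ j - x $ j\<bar> \<le> \<eta>" for j using component_le_norm_cart[of "z - x" j] z(2) by simp
  have "1 \<le> (real CARD('n))\<^sup>2" by (intro one_le_power card_ge_1)
  then have "1 * \<eta> \<le> (8 * (real CARD('n))\<^sup>2) * \<eta>" using \<eta> by (intro mult_right_mono) linarith+
  then show ?thesis unfolding patch_def patch_box_def using z(1) c order_trans[OF c[of dir]] by auto
qed

lemma patch_measure_finite: "hausdorff_outer (CARD('n) - 1) (patch \<eta>) < top"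
proof (rule hausdorff_outer_graph_finite[where i = dir and C = "4 * real CARD('n)"])
  show "bounded (patch \<eta>)" by (rule bounded_subset[OF bounded_ball patch_ball])
qed (use patch_graph in auto)

lemma patch_measure_lower:
  "ennreal (unit_ball_vol (real (CARD('n) - 1)) * (\<eta> / 2) ^ (CARD('n) - 1)) \<le> hausdorff_outer (CARD('n) - 1) (patch \<eta>)"
  by (rule hausdorff_outer_lower_bound[OF \<eta>, where i = dir and x = x]) (rule patch_lift)

text \<open>Lift the straight segment in the remaining coordinates to the level set. By the graph
  inequality the lift is unique and Lipschitz, so the chosen points form a continuous path.\<close>

lemma patch_path:
  assumes z: "z \<in> patch \<eta>"
  obtains p where "continuous_on {0..1::real} p" "p ` {0..1} \<subseteq> patch \<eta>" "p 0 = x" "p 1 = z"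
proof -
  have zc: "\<bar>z $ j - x $ j\<bar> \<le> \<eta>" if "j \<noteq> dir" for j using z that by (auto simp: patch_def patch_box_def)
  have "\<exists>y\<in>patch \<eta>. \<forall>j. j \<noteq> dir \<longrightarrow> y $ j = (x + t *\<^sub>R (z - x)) $ j" if t: "t \<in> {0..1}" for t
  proof (rule patch_lift)
    fix j assume "j \<noteq> dir"
    have "\<bar>t * (z $ j - x $ j)\<bar> \<le> 1 * \<bar>z $ j - x $ j\<bar>" using t by (auto simp: abs_mult intro!: mult_left_le_one_le)
    then show "\<bar>(x + t *\<^sub>R (z - x)) $ j - x $ j\<bar> \<le> \<eta>" using zc[OF \<open>j \<noteq> dir\<close>] by simp
  qed
  then have "\<exists>p. \<forall>t\<in>{0..1}. p t \<in> patch \<eta> \<and> (\<forall>j. j \<noteq> dir \<longrightarrow> p t $ j = (x + t *\<^sub>R (z - x)) $ j)"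
    by (intro bchoice) blast
  then obtain p where p0: "\<forall>t\<in>{0..1}. p t \<in> patch \<eta> \<and> (\<forall>j. j \<noteq> dir \<longrightarrow> p t $ j = (x + t *\<^sub>R (z - x)) $ j)" ..
  then have p: "\<And>t. t \<in> {0..1} \<Longrightarrow> p t \<in> patch \<eta>"
    "\<And>t j. t \<in> {0..1} \<Longrightarrow> j \<noteq> dir \<Longrightarrow> p t $ j = x $ j + t * (z $ j - x $ j)" by auto
  let ?D = "\<Sum>j\<in>UNIV - {dir}. \<bar>z $ j - x $ j\<bar>"
  have uniq: "a = b" if "a \<in> patch \<eta>" "b \<in> patch \<eta>" "\<And>j. j \<noteq> dir \<Longrightarrow> a $ j = b $ j" for a b
  proof -
    have "(\<Sum>j\<in>UNIV - {dir}. \<bar>a $ j - b $ j\<bar>) = 0" using that(3) by (intro sum.neutral) auto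
    then have "a $ dir = b $ dir" using patch_graph[OF that(1,2)] by simp
    then have "a $ j = b $ j" for j using that(3) by (cases "j = dir") auto
    then show ?thesis by (simp add: Finite_Cartesian_Product.vec_eq_iff)
  qed
  have "lipschitz_on ((4 * real CARD('n) + 1) * ?D) {0..1} p"
  proof (rule lipschitz_onI)
    fix s t :: real assume st: "s \<in> {0..1}" "t \<in> {0..1}"
    have S: "(\<Sum>j\<in>UNIV - {dir}. \<bar>p s $ j - p t $ j\<bar>) = \<bar>s - t\<bar> * ?D"
      unfolding sum_distrib_left
    proof (intro sum.cong refl)
      fix j assume "j \<in> UNIV - {dir}"
      then have "p s $ j - p t $ j = (s - t) * (z $ j - x $ j)" using p(2)[OF st(1), of j] p(2)[OF st(2), of j] by (simp add: algebra_simps)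
      then show "\<bar>p s $ j - p t $ j\<bar> = \<bar>s - t\<bar> * \<bar>z $ j - x $ j\<bar>" by (simp add: abs_mult)
    qed
    have "dist (p s) (p t) \<le> \<bar>(p s - p t) $ dir\<bar> + (\<Sum>j\<in>UNIV - {dir}. \<bar>(p s - p t) $ j\<bar>)"
      unfolding dist_norm by (rule norm_le_coords)
    also have "\<dots> \<le> (4 * real CARD('n) + 1) * (\<Sum>j\<in>UNIV - {dir}. \<bar>p s $ j - p t $ j\<bar>)"
      using patch_graph[OF p(1)[OF st(1)] p(1)[OF st(2)]] by (simp add: algebra_simps)
    finally show "dist (p s) (p t) \<le> (4 * real CARD('n) + 1) * ?D * dist s t"
      by (simp add: S dist_real_def mult_ac)
  qed (simp add: sum_nonneg)
  then have "continuous_on {0..1} p" by (rule lipschitz_on_continuous_on)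
  moreover have "p 0 = x" by (rule uniq[OF p(1) center_patch]) (use p(2)[of 0] in auto)
  moreover have "p 1 = z" by (rule uniq[OF p(1) z]) (use p(2)[of 1] in auto)
  ultimately show thesis using that p(1) by blast
qed

end

end

section \<open>The cut elements and the interface\<close>

lemma fractions_of_inverse:
  fixes a :: real assumes "0 < a"
  shows "1 / (2 * a) < 1 / a" "1 / (2 * a) < 3 / (4 * a)" "1 / a = 3 / (4 * a) + 1 / (4 * a)"
  using assms by (simp_all add: field_simps)

text \<open>The radius for which the smallness condition of \<open>level_patch\<close> holds; adding
  1 to the absolute value of \<open>K\<close> keeps the denominator positive.\<close>

definition patch_radius :: "nat \<Rightarrow> real \<Rightarrow> real \<Rightarrow> real" where
  "patch_radius n r K = min r (1 / (2 * real n * (\<bar>K\<bar> + 1)))"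

lemma patch_radius_pos: "0 < r \<Longrightarrow> 0 < n \<Longrightarrow> 0 < patch_radius n r K"
  unfolding patch_radius_def by (auto intro!: divide_pos_pos mult_pos_pos)

lemma patch_radius_small:
  assumes "0 < n" "0 < r" shows "K * patch_radius n r K \<le> 1 / (2 * real n)"
proof -
  have p: "0 < patch_radius n r K" using patch_radius_pos assms by blast
  have "K * patch_radius n r K \<le> \<bar>K\<bar> * patch_radius n r K" using p by (intro mult_right_mono) auto
  also have "\<dots> \<le> (\<bar>K\<bar> + 1) * (1 / (2 * real n * (\<bar>K\<bar> + 1)))"
    using p by (intro mult_mono) (auto simp: patch_radius_def)
  also have "\<dots> = 1 / (2 * real n)" by simp
  finally show ?thesis .
qed

lemma lpoly_eq:
  assumes "nsimplex T" "1 \<le> k" "p \<in> poly_le k" "\<And>x. x \<in> T \<Longrightarrow> p x = u x"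
  shows "lpoly k u T = p"
  unfolding lpoly_def
proof (rule the_equality)
  show "p \<in> poly_le k \<and> (\<forall>x\<in>T. p x = u x)" using assms by blast
  fix q assume q: "q \<in> poly_le k \<and> (\<forall>x\<in>T. q x = u x)"
  show "q = p"
    by (rule poly_le_eq_if_eq_on_nsimplex[OF assms(1,2)])
      (use q assms lagrange_nodes_subset[OF assms(1,2)] in auto)
qed

text \<open>The volume bound of \<open>mesh_card_at_point\<close>, rounded up to a natural
  number.\<close>

definition mult_bound :: "nat \<Rightarrow> real \<Rightarrow> nat" where
  "mult_bound n \<sigma> = nat \<lceil>(\<sigma> + 1) ^ n\<rceil>"

locale cutfem_geom = fe_mesh S for S :: "'n::finite cutfem" +
  fixes \<sigma> r K :: real
  assumes setting: "cutfem_setting S" and shapes: "shape_regular \<sigma> (mesh S)"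
    and smooth: "smooth_interface S r K" and sigma_pos: "0 < \<sigma>" and r_pos: "0 < r"
    and dim_ge_2: "CARD('n) \<ge> 2"
begin

abbreviation "Gam \<equiv> interface S"

lemma shape_mesh: "T \<in> mesh S \<Longrightarrow> shape \<sigma> T"
  using shapes nsimplex_mesh unfolding shape_regular_def by blast

lemma open_sub: "i \<in> {1,2} \<Longrightarrow> open (sub S i)"
  and sub_disjoint: "sub S 1 \<inter> sub S 2 = {}"
  and dom_split: "Dom = sub S 1 \<union> sub S 2 \<union> (Gam \<inter> Dom)"
  and nodes_not_on_interface: "I0 S \<inter> Gam = {}"
  using setting[unfolded cutfem_setting_def] by (simp_all) blast+

lemma sub_closure_disjoint: "sub S 1 \<inter> closure (sub S 2) = {}" "sub S 2 \<inter> closure (sub S 1) = {}"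
  using open_Int_closure_eq_empty[of "sub S 1" "sub S 2"] open_Int_closure_eq_empty[of "sub S 2" "sub S 1"]
    open_sub sub_disjoint by (auto simp: Int_commute)

lemma sub_subset_dom: "i \<in> {1,2} \<Longrightarrow> sub S i \<subseteq> Dom"
  using dom_split by blast

lemma closed_interface: "closed Gam" unfolding interface_def by auto

lemma interface_subset: "Gam \<subseteq> closure Dom"
  unfolding interface_def using closure_mono[OF sub_subset_dom[of 1]] by auto

lemma compact_interface: "compact Gam"
  using closed_interface interface_subset bounded_dom bounded_closure bounded_subset compact_eq_bounded_closed by blast

lemma closure_interior_mesh: "T \<in> mesh S \<Longrightarrow> closure (interior T) = T"
  using convex_closure_interior[OF convex_nsimplex[OF nsimplex_mesh] interior_nsimplex_nonempty[OF nsimplex_mesh]]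
    closure_closed[OF closed_mesh] by metis

text \<open>The interior is connected and covered by the two disjoint open subdomains, so it lies in
  one of them. Being dense in \<open>T\<close>, it meets every open set that \<open>T\<close>
  meets.\<close>

lemma mesh_one_side:
  assumes T: "T \<in> mesh S" and uncut: "interior T \<inter> Gam = {}" and i: "i \<in> {1,2}" and meets: "T \<inter> sub S i \<noteq> {}"
  shows "interior T \<subseteq> sub S i" and "T \<subseteq> closure (sub S i)"
proof -
  have m: "sub S i \<inter> interior T \<noteq> {}"
    using open_Int_closure_eq_empty[OF open_sub[OF i], of "interior T"] closure_interior_mesh[OF T] meets by auto
  have sub: "interior T \<subseteq> sub S 1 \<union> sub S 2" using interior_mesh_subset[OF T] uncut dom_split by blast
  have "connected (interior T)" using convex_nsimplex[OF nsimplex_mesh[OF T]] by (intro convex_connected convex_interior)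
  then have "sub S 1 \<inter> interior T = {} \<or> sub S 2 \<inter> interior T = {}"
    using open_sub sub_disjoint sub by (intro connectedD) auto
  then show *: "interior T \<subseteq> sub S i" using m sub i by auto
  show "T \<subseteq> closure (sub S i)" using closure_mono[OF *] closure_interior_mesh[OF T] by simp
qed

text \<open>An extra basis function for side \<open>i\<close> has its node outside
  \<open>sub S i\<close>. Consequently it vanishes on the uncut active simplices of that side, which
  is why its extension by zero remains a polynomial on every active simplex.\<close>

lemma act_mesh_uncut:
  assumes i: "i \<in> {1,2}" and T: "T \<in> act_mesh S i" "T \<notin> cut_mesh S" and j: "j \<in> I0 S" "j \<in> T"
  shows "j \<in> sub S i"
proof -
  have "T \<subseteq> closure (sub S i)"
    using T i unfolding act_mesh_def cut_mesh_def by (intro mesh_one_side) auto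
  moreover have "j \<in> Dom" "j \<notin> Gam" using j nodes_not_on_interface I0_eq by auto
  ultimately show ?thesis using dom_split sub_closure_disjoint i j by blast
qed

lemma cut_mesh_subset_act_mesh:
  assumes T: "T \<in> cut_mesh S" and i: "i \<in> {1,2}" shows "T \<in> act_mesh S i"
proof -
  obtain x where x: "x \<in> interior T" "x \<in> Gam" using T unfolding cut_mesh_def by blast
  then have "x \<in> closure (sub S i)" using i unfolding interface_def by auto
  then have "interior T \<inter> sub S i \<noteq> {}" using x open_Int_closure_eq_empty[OF open_interior, of T "sub S i"] by blast
  then show ?thesis using T interior_subset unfolding cut_mesh_def act_mesh_def by blast
qed

lemma cut_mesh_subset: "T \<in> cut_mesh S \<Longrightarrow> T \<in> mesh S" unfolding cut_mesh_def by simp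

lemma finite_cut_mesh: "finite (cut_mesh S)" unfolding cut_mesh_def using finite_mesh by simp

text \<open>Where the interface runs through mesh faces only, it contains a common face of elements on
  different sides. No node of that face belongs to the basis, so the functions in \<open>Vh\<close> vanish on it.\<close>

lemma Vh_zero_off_cut_dom:
  assumes z: "z \<in> Gam" "z \<in> Dom" "z \<notin> cut_dom S" and v: "v \<in> Vh S"
  shows "v z = 0"
proof -
  have side: "\<exists>T\<in>mesh S. z \<in> T \<and> T \<subseteq> closure (sub S i)" if i: "i \<in> {1,2}" for i
  proof -
    obtain e where e: "e > 0" "ball z e \<subseteq> \<Union>{T\<in>mesh S. z \<in> T}" using nearby_mesh[OF z(2)] by metis
    have "z \<in> closure (sub S i)" using z(1) i unfolding interface_def by auto
    then obtain y where y: "y \<in> sub S i" "dist y z < e" using e(1) closure_approachable by blast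
    then obtain T where T: "T \<in> mesh S" "z \<in> T" "y \<in> T" using e(2) by (auto simp: dist_commute subset_iff)
    have "T \<notin> cut_mesh S" using z(3) T unfolding cut_dom_def by blast
    then have "interior T \<inter> Gam = {}" using T unfolding cut_mesh_def by blast
    then have "T \<subseteq> closure (sub S i)" using T y i by (intro mesh_one_side) auto
    then show ?thesis using T by blast
  qed
  obtain T1 where T1: "T1 \<in> mesh S" "z \<in> T1" "T1 \<subseteq> closure (sub S 1)" using side[of 1] by auto
  obtain T2 where T2: "T2 \<in> mesh S" "z \<in> T2" "T2 \<subseteq> closure (sub S 2)" using side[of 2] by auto
  have F: "T1 \<inter> T2 \<subseteq> Gam" using T1 T2 unfolding interface_def by blast
  obtain p where p: "p \<in> poly_le (deg S)" "\<forall>x\<in>T1. v x = p x" using Vh_piece[OF v T1(1)] by blast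
  have "p z = 0"
  proof (rule poly_le_vanish_on_face[OF nsimplex_mesh[OF T1(1)] deg_pos p(1) face_mesh[OF T1(1) T2(1)]])
    fix j assume j: "j \<in> lagrange_nodes (deg S) T1" "j \<in> T1 \<inter> T2"
    have "j \<in> nodes" using j(1) T1(1) unfolding nodes_def by blast
    moreover have "j \<notin> I0 S" using nodes_not_on_interface F j(2) by blast
    ultimately show "p j = 0" using Vh_node_zero[OF v] p(2) j(2) by auto
  qed (use T1 T2 in auto)
  then show ?thesis using p(2) T1 by simp
qed

text \<open>If \<rho> had a sign at a point of the interface, continuity would keep one subdomain
  away from that point. Conversely a zero of \<rho> inside the domain belongs to neither subdomain.
  The level set may continue outside the domain, where it is no longer part of the
  interface.\<close>

lemma interface_patch:
  assumes x: "x \<in> Gam"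
  obtains \<rho> g where "level_patch x \<rho> g (patch_radius CARD('n) r K) K"
    "\<And>z. z \<in> ball x (patch_radius CARD('n) r K) \<Longrightarrow> \<rho> z = 0 \<Longrightarrow> z \<in> Dom \<Longrightarrow> z \<in> Gam"
    "\<And>z. z \<in> ball x (patch_radius CARD('n) r K) \<Longrightarrow> z \<in> Gam \<Longrightarrow> \<rho> z = 0"
proof -
  let ?r = "patch_radius CARD('n) r K"
  obtain \<rho> g where A: "\<And>z. z \<in> ball x r \<Longrightarrow> (\<rho> has_derivative inner (g z)) (at z)"
    "lipschitz_on K (ball x r) g" "norm (g x) = 1"
    "sub S 1 \<inter> ball x r = {z \<in> Dom \<inter> ball x r. \<rho> z < 0}" "sub S 2 \<inter> ball x r = {z \<in> Dom \<inter> ball x r. \<rho> z > 0}"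
    using smooth x unfolding smooth_interface_def by meson
  have sub: "ball x ?r \<subseteq> ball x r" unfolding patch_radius_def by (intro subset_ball) simp
  have cont: "isCont \<rho> z" if "z \<in> ball x r" for z using A(1)[OF that] by (rule has_derivative_continuous)
  have zero: "\<rho> z = 0" if z: "z \<in> ball x r" "z \<in> Gam" for z
  proof (rule ccontr)
    assume "\<rho> z \<noteq> 0"
    then consider "\<rho> z > 0" | "\<rho> z < 0" by linarith
    then show False
    proof cases
      case 1
      then have "\<forall>\<^sub>F y in at z. \<rho> y > 0" using cont[OF z(1)] unfolding isCont_def by (rule order_tendstoD(1)[rotated])
      then have "\<forall>\<^sub>F y in nhds z. \<rho> y > 0" using 1 by (simp add: eventually_nhds_conv_at)
      moreover have "\<forall>\<^sub>F y in nhds z. y \<in> ball x r" using z by (intro eventually_nhds_in_open) auto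
      ultimately have "\<forall>\<^sub>F y in nhds z. \<rho> y > 0 \<and> y \<in> ball x r" by eventually_elim simp
      then obtain U where U: "open U" "z \<in> U" "\<And>y. y \<in> U \<Longrightarrow> \<rho> y > 0 \<and> y \<in> ball x r" unfolding eventually_nhds by blast
      have "U \<inter> sub S 1 = {}" using U(3) A(4) by force
      then have "z \<notin> closure (sub S 1)" using U open_Int_closure_eq_empty[of U "sub S 1"] by blast
      then show False using z unfolding interface_def by simp
    next
      case 2
      then have "\<forall>\<^sub>F y in at z. \<rho> y < 0" using cont[OF z(1)] unfolding isCont_def by (rule order_tendstoD(2)[rotated])
      then have "\<forall>\<^sub>F y in nhds z. \<rho> y < 0" using 2 by (simp add: eventually_nhds_conv_at)
      moreover have "\<forall>\<^sub>F y in nhds z. y \<in> ball x r" using z by (intro eventually_nhds_in_open) auto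
      ultimately have "\<forall>\<^sub>F y in nhds z. \<rho> y < 0 \<and> y \<in> ball x r" by eventually_elim simp
      then obtain U where U: "open U" "z \<in> U" "\<And>y. y \<in> U \<Longrightarrow> \<rho> y < 0 \<and> y \<in> ball x r" unfolding eventually_nhds by blast
      have "U \<inter> sub S 2 = {}" using U(3) A(5) by force
      then have "z \<notin> closure (sub S 2)" using U open_Int_closure_eq_empty[of U "sub S 2"] by blast
      then show False using z unfolding interface_def by simp
    qed
  qed
  have n0: "0 < CARD('n)" by simp
  have "level_patch x \<rho> g ?r K"
  proof
    show "lipschitz_on K (ball x ?r) g" by (rule lipschitz_on_subset[OF A(2) sub])
    show "K * ?r \<le> 1 / (2 * real CARD('n))" by (rule patch_radius_small[OF n0 r_pos])
    show "0 < ?r" by (rule patch_radius_pos[OF r_pos n0])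
    show "\<rho> x = 0" using zero x r_pos by simp
  qed (use A sub in auto)
  moreover have "z \<in> Gam" if "z \<in> ball x ?r" "\<rho> z = 0" "z \<in> Dom" for z
  proof -
    have zb: "z \<in> ball x r" using that sub by blast
    have "z \<notin> sub S 1 \<inter> ball x r" "z \<notin> sub S 2 \<inter> ball x r" unfolding A(4,5) using that by simp_all
    then have "z \<notin> sub S 1" "z \<notin> sub S 2" using zb by simp_all
    then show ?thesis using dom_split that by blast
  qed
  ultimately show thesis using that zero sub by blast
qed

text \<open>Locally the normal is a normalized Lipschitz gradient. Continuity provides the
  measurability and boundedness needed for the Nitsche integrals.\<close>

lemma interface_normal_continuous: "continuous_on Gam (nrm S)"
proof -
  have "continuous (at x within Gam) (nrm S)" if x: "x \<in> Gam" for x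
  proof -
    obtain g where g: "lipschitz_on K (ball x r) g"
      "\<And>z. z \<in> Gam \<inter> ball x r \<Longrightarrow> g z \<noteq> 0 \<and> nrm S z = g z /\<^sub>R norm (g z)"
      using smooth x unfolding smooth_interface_def by meson
    have cg: "continuous_on (Gam \<inter> ball x r) g"
      using lipschitz_on_continuous_on[OF g(1)] continuous_on_subset by blast
    have "continuous_on (Gam \<inter> ball x r) (\<lambda>z. g z /\<^sub>R norm (g z))"
      using g(2) by (intro continuous_intros cg) auto
    then have "continuous_on (Gam \<inter> ball x r) (nrm S)"
      using continuous_on_cong[of "Gam \<inter> ball x r" "Gam \<inter> ball x r" "nrm S" "\<lambda>z. g z /\<^sub>R norm (g z)"] g(2) by simp
    then have "continuous (at x within Gam \<inter> ball x r) (nrm S)"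
      using x r_pos by (simp add: continuous_on_eq_continuous_within)
    moreover have "at x within Gam \<inter> ball x r = at x within Gam"
      using r_pos by (intro at_within_nhd[of x "ball x r"]) auto
    ultimately show ?thesis by simp
  qed
  then show ?thesis by (simp add: continuous_on_eq_continuous_within)
qed

text \<open>By compactness finitely many balls suffice, in each of which the interface is contained
  in a patch that is a Lipschitz graph.\<close>

lemma interface_measure_finite: "hausdorff_outer (CARD('n) - 1) Gam < top"
proof -
  let ?r = "patch_radius CARD('n) r K" let ?A = "real CARD('n) + 8 * (real CARD('n))\<^sup>2"
  have A: "0 < ?A" by (intro add_pos_nonneg) auto
  define a where "a = ?A"
  define \<eta> where "\<eta> = ?r / (2 * a)"
  have rp: "0 < ?r" by (rule patch_radius_pos[OF r_pos]) simp
  have "a * \<eta> = ?r / 2" using A unfolding a_def[symmetric] \<eta>_def by simp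
  then have \<eta>: "0 < \<eta>" "?A * \<eta> < ?r" using A rp unfolding a_def[symmetric] by (simp_all add: \<eta>_def)
  have loc: "hausdorff_outer (CARD('n) - 1) (Gam \<inter> ball x \<eta>) < top" if x: "x \<in> Gam" for x
  proof -
    obtain \<rho> g where P: "level_patch x \<rho> g ?r K" "\<And>z. z \<in> ball x ?r \<Longrightarrow> z \<in> Gam \<Longrightarrow> \<rho> z = 0"
      using interface_patch[OF x] by metis
    interpret level_patch x \<rho> g ?r K by (rule P(1))
    have "1 \<le> ?A" using card_ge_1 by (simp add: add_increasing2)
    then have "1 * \<eta> \<le> ?A * \<eta>" using \<eta> by (intro mult_right_mono) auto
    then have "\<eta> < ?r" using \<eta> by linarith
    then have "Gam \<inter> ball x \<eta> \<subseteq> patch \<eta>"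
      using near_patch[OF \<eta>] P(2) by (auto simp: dist_norm norm_minus_commute)
    then show ?thesis using patch_measure_finite[OF \<eta>] hausdorff_outer_mono le_less_trans by blast
  qed
  have "Gam \<subseteq> (\<Union>x\<in>Gam. ball x \<eta>)" using \<eta>(1) by auto
  then obtain X where X: "X \<subseteq> Gam" "finite X" "Gam \<subseteq> (\<Union>x\<in>X. ball x \<eta>)"
    by (rule compactE_image[OF compact_interface, rotated 1]) auto
  have "hausdorff_outer (CARD('n) - 1) (\<Union>x\<in>X. Gam \<inter> ball x \<eta>) < top"
    using X loc by (intro hausdorff_outer_Union_finite) auto
  moreover have "Gam \<subseteq> (\<Union>x\<in>X. Gam \<inter> ball x \<eta>)" using X(3) by blast
  ultimately show ?thesis using hausdorff_outer_mono le_less_trans by blast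
qed

lemma set_integrable_interface:
  fixes f :: "real ^ 'n \<Rightarrow> real"
  assumes A: "A \<subseteq> Gam" "closed A" and f: "set_borel_measurable borel A f" "\<And>x. x \<in> A \<Longrightarrow> \<bar>f x\<bar> \<le> B"
  shows "set_integrable surf A f"
  using A le_less_trans[OF hausdorff_outer_mono[OF A(1)] interface_measure_finite]
  by (intro set_integrable_hausdorff[OF _ _ f]) auto

lemma set_integrable_interface_continuous:
  fixes f :: "real ^ 'n \<Rightarrow> real"
  assumes A: "A \<subseteq> Gam" "closed A" and f: "continuous_on A f"
  shows "set_integrable surf A f"
proof -
  have "compact A" using A compact_interface compact_Int_closed[of Gam A] by (simp add: Int_absorb1)
  then have "bounded (f ` A)" using f compact_continuous_image compact_imp_bounded by blast
  then obtain B where "\<And>x. x \<in> A \<Longrightarrow> \<bar>f x\<bar> \<le> B" unfolding bounded_iff by auto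
  moreover have "set_borel_measurable borel A f"
    unfolding set_borel_measurable_def using borel_measurable_continuous_on_indicator[OF _ f] A(2) by auto
  ultimately show ?thesis using A by (intro set_integrable_interface)
qed

subsection \<open>Elements met by a connected part of the interface\<close>


lemma card_at_point: "card {T\<in>mesh S. y \<in> T} \<le> (mult_bound CARD('n) \<sigma>)"
  using mesh_card_at_point[OF shape_mesh sigma_pos, of y] unfolding mult_bound_def by linarith

text \<open>Comparability of sizes is part of the definition, since only those simplices at
  \<open>v0\<close> that are reached along the interface are known to be comparable to
  \<open>T0\<close>. The exponent is the largest possible length of such a chain; each link costs a
  factor \<open>2 * \<sigma>\<close>.\<close>

definition star :: "(real ^ 'n) set \<Rightarrow> real ^ 'n \<Rightarrow> (real ^ 'n) set set" where
  "star T0 v0 = {T\<in>cut_mesh S. v0 \<in> verts T \<and> diameter T \<le> (2 * \<sigma>) ^ (mult_bound CARD('n) \<sigma>) * diameter T0 \<and>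
     diameter T0 \<le> (2 * \<sigma>) ^ (mult_bound CARD('n) \<sigma>) * diameter T}"

lemma diameter_mesh_pos: "T \<in> mesh S \<Longrightarrow> 0 < diameter T"
  using nsimplex_diameter_pos nsimplex_mesh by blast

lemma two_sigma_ge_1: assumes T: "T \<in> mesh S" shows "1 \<le> 2 * \<sigma>"
proof -
  obtain v where v: "v \<in> verts T" using card_verts[OF nsimplex_mesh[OF T]] by fastforce
  have "verts T \<noteq> {v}" using card_verts[OF nsimplex_mesh[OF T]] by auto
  then obtain w where w: "w \<in> verts T" "v \<noteq> w" using v by blast
  have "diameter T \<le> 2 * \<sigma> * norm (v - w)" by (rule diameter_le_vertex_dist[OF shape_mesh[OF T] sigma_pos v w])
  moreover have "norm (v - w) \<le> diameter T"
    using diameter_bounded_bound[OF compact_imp_bounded[OF compact_nsimplex[OF nsimplex_mesh[OF T]]], of v w] v w verts_subset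
    by (auto simp: dist_norm)
  then have "2 * \<sigma> * norm (v - w) \<le> 2 * \<sigma> * diameter T" using sigma_pos by (intro mult_left_mono) auto
  ultimately have "1 * diameter T \<le> 2 * \<sigma> * diameter T" by linarith
  then show ?thesis using diameter_mesh_pos[OF T] by (simp only: mult_le_cancel_right_pos)
qed

text \<open>A vertex inside the domain is a node, hence not on the interface; so two elements meeting
  at a point of the interface share an edge.\<close>

lemma touching_ratio:
  assumes T: "T \<in> mesh S" "T' \<in> mesh S" and v: "v \<in> verts T" "v \<in> verts T'"
    and y: "y \<in> T" "y \<in> T'" "y \<in> Gam" "y \<in> Dom"
  shows "diameter T' \<le> 2 * \<sigma> * diameter T"
proof -
  note nT = nsimplex_mesh[OF T(1)] and nT' = nsimplex_mesh[OF T(2)]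
  have "\<exists>w. w \<in> verts T \<and> w \<in> verts T' \<and> w \<noteq> v"
  proof (rule ccontr)
    assume no: "\<not> ?thesis"
    have z: "bary T w y = 0" if "w \<in> verts T - {v}" for w
      using bary_common(2)[OF T y(1,2)] no that by blast
    have "y = (\<Sum>w\<in>verts T. bary T w y *\<^sub>R w)" using bary_comb[OF nT] by simp
    also have "\<dots> = bary T v y *\<^sub>R v" using v finite_verts[OF nT] z by (subst sum.remove[of _ v]) auto
    also have "bary T v y = (\<Sum>w\<in>verts T. bary T w y)"
      using v finite_verts[OF nT] z by (subst sum.remove[of _ v]) auto
    also have "\<dots> = 1" by (rule bary_sum[OF nT])
    finally have "y = v" by simp
    moreover have "v \<in> nodes" using verts_subset_lagrange_nodes[OF nT deg_pos] v T unfolding nodes_def by blast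
    ultimately have "y \<in> I0 S" using y I0_eq by simp
    then show False using y nodes_not_on_interface by blast
  qed
  then obtain w where w: "w \<in> verts T" "w \<in> verts T'" "v \<noteq> w" by blast
  have "diameter T' \<le> 2 * \<sigma> * norm (v - w)" by (rule diameter_le_vertex_dist[OF shape_mesh[OF T(2)] sigma_pos v(2) w(2,3)])
  also have "\<dots> \<le> 2 * \<sigma> * diameter T"
    using diameter_bounded_bound[OF compact_imp_bounded[OF compact_nsimplex[OF nT]], of v w] v w verts_subset sigma_pos
    by (intro mult_left_mono) (auto simp: dist_norm)
  finally show ?thesis .
qed

lemma finite_star: "finite (star T0 v0)" unfolding star_def using finite_cut_mesh by simp

lemma card_star: "card (star T0 v0) \<le> (mult_bound CARD('n) \<sigma>)"
proof -
  have "star T0 v0 \<subseteq> {T\<in>mesh S. v0 \<in> T}" unfolding star_def using cut_mesh_subset verts_subset by blast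
  then have "card (star T0 v0) \<le> card {T\<in>mesh S. v0 \<in> T}" using finite_mesh by (intro card_mono) auto
  then show ?thesis using card_at_point[of v0] by simp
qed

text \<open>Positivity of the hat function on \<open>C\<close> forces \<open>v0\<close> to be a
  vertex of every simplex meeting \<open>C\<close>. There are at most \<open>mult_bound\<close> of
  these, and by \<open>touching_ratio\<close> the sizes of two of them meeting in \<open>C\<close>
  differ by a factor of at most \<open>2 * \<sigma>\<close>, so \<open>chain_ratio_bound\<close>
  applies.\<close>

lemma connected_interface_part:
  assumes C: "connected C" "C \<subseteq> Gam" "C \<subseteq> Dom" "C \<subseteq> cut_dom S" "\<And>z. z \<in> C \<Longrightarrow> hat v0 z > 0"
    and x: "x \<in> C" "x \<in> T0" "T0 \<in> cut_mesh S"
  shows "C \<subseteq> \<Union>(star T0 v0)"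
proof -
  define F where "F = {T\<in>cut_mesh S. T \<inter> C \<noteq> {}}"
  have cov: "C \<subseteq> \<Union>F" using C(4) unfolding F_def cut_dom_def by blast
  have v0: "v0 \<in> verts T" if T: "T \<in> F" for T
  proof -
    obtain z where z: "z \<in> T" "z \<in> C" "T \<in> mesh S" using T cut_mesh_subset unfolding F_def by blast
    show ?thesis using C(5)[OF z(2)] hat_eq[OF z(3,1), of v0] by (auto split: if_splits)
  qed
  have finF: "finite F" unfolding F_def using finite_cut_mesh by simp
  have T0F: "T0 \<in> F" using x unfolding F_def by blast
  have \<tau>: "1 \<le> 2 * \<sigma>" using two_sigma_ge_1 x(3) cut_mesh_subset by blast
  have cF: "card F \<le> (mult_bound CARD('n) \<sigma>)"
  proof -
    have "F \<subseteq> {T\<in>mesh S. v0 \<in> T}" using v0 verts_subset cut_mesh_subset unfolding F_def by blast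
    then have "card F \<le> card {T\<in>mesh S. v0 \<in> T}" using finite_mesh by (intro card_mono) auto
    then show ?thesis using card_at_point[of v0] by simp
  qed
  have ratio: "diameter T \<le> (2 * \<sigma>) ^ (mult_bound CARD('n) \<sigma>) * diameter T'" if T: "T \<in> F" "T' \<in> F" for T T'
  proof -
    have "diameter T \<le> (2 * \<sigma>) ^ card F * diameter T'"
    proof (rule chain_ratio_bound[OF C(1) cov finF _ _ \<tau> _ T(2,1)])
      fix T assume T: "T \<in> F"
      then show "closed T \<and> T \<inter> C \<noteq> {}" using closed_mesh cut_mesh_subset unfolding F_def by auto
      show "0 < diameter T" using T diameter_mesh_pos cut_mesh_subset unfolding F_def by auto
      fix T' y assume "T' \<in> F" "y \<in> T" "y \<in> T'" "y \<in> C"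
      then show "diameter T' \<le> 2 * \<sigma> * diameter T"
        using T v0 C cut_mesh_subset by (intro touching_ratio[of T T' v0 y]) (auto simp: F_def)
    qed
    also have "\<dots> \<le> (2 * \<sigma>) ^ (mult_bound CARD('n) \<sigma>) * diameter T'"
      using \<tau> cF T diameter_mesh_pos cut_mesh_subset
      by (intro mult_right_mono power_increasing) (auto simp: F_def intro: less_imp_le)
    finally show ?thesis .
  qed
  have "F \<subseteq> star T0 v0"
    unfolding star_def using v0 ratio T0F by (auto simp: F_def)
  then show ?thesis using cov by blast
qed

lemma star_oscillation:
  fixes f :: "real ^ 'n \<Rightarrow> real"
  assumes C: "connected C" "C \<subseteq> \<Union>(star T0 v0)" "continuous_on C f"
    and osc: "\<And>T a b. T \<in> star T0 v0 \<Longrightarrow> a \<in> T \<inter> C \<Longrightarrow> b \<in> T \<inter> C \<Longrightarrow> \<bar>f a - f b\<bar> \<le> osc T"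
    and pos: "\<And>T. T \<in> star T0 v0 \<Longrightarrow> 0 \<le> osc T" and ab: "a \<in> C" "b \<in> C"
  shows "\<bar>f a - f b\<bar> \<le> (\<Sum>T\<in>star T0 v0. osc T)"
  by (rule oscillation_le_sum[OF C(1,3,2) finite_star _ pos ab]) (use osc in auto)

lemma star_subset_mesh: "T \<in> star T0 v0 \<Longrightarrow> T \<in> mesh S"
  unfolding star_def using cut_mesh_subset by auto

lemma continuous_on_hat: "continuous_on (closure Dom) (hat v)"
proof (rule continuous_on_pieces[of 1])
  fix T assume T: "T \<in> mesh S"
  show "\<exists>p\<in>poly_le 1. \<forall>x\<in>T. hat v x = p x"
  proof (cases "v \<in> verts T")
    case True
    then show ?thesis using hat_eq[OF T] bary_poly_le[OF nsimplex_mesh[OF T]] by (intro bexI[of _ "bary T v"]) auto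
  next
    case False
    then show ?thesis using hat_eq[OF T] by (intro bexI[OF _ poly_le_zero]) auto
  qed
qed

text \<open>The hat function has a Lipschitz constant of order \<open>1 / diameter T0\<close> on
  each simplex of the star. Oscillations are added over the simplices and not along the path, so a
  bound for the distance from \<open>x\<close> is enough and the length of the path does not
  matter.\<close>

lemma star_hat_oscillation:
  assumes C: "connected C" "C \<subseteq> \<Union>(star T0 v0)" "C \<subseteq> cball x R" and T0: "T0 \<in> mesh S" and ab: "a \<in> C" "b \<in> C"
  shows "\<bar>hat v0 a - hat v0 b\<bar> \<le> real (mult_bound CARD('n) \<sigma>) * (2 * \<sigma> * (2 * \<sigma>) ^ (mult_bound CARD('n) \<sigma>) / diameter T0 * (2 * R))"
proof -
  let ?o = "2 * \<sigma> * (2 * \<sigma>) ^ (mult_bound CARD('n) \<sigma>) / diameter T0 * (2 * R)"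
  have h0: "0 < diameter T0" by (rule diameter_mesh_pos[OF T0])
  have R: "0 \<le> R" using ab C(3) by (meson mem_cball order_trans subsetD zero_le_dist)
  have "C \<subseteq> closure Dom" using C(2) star_subset_mesh mesh_subset by blast
  then have cont: "continuous_on C (hat v0)" using continuous_on_hat continuous_on_subset by blast
  have "\<bar>hat v0 a - hat v0 b\<bar> \<le> (\<Sum>T\<in>star T0 v0. ?o)"
  proof (rule star_oscillation[OF C(1,2) cont _ _ ab])
    fix T y z assume T: "T \<in> star T0 v0" and yz: "y \<in> T \<inter> C" "z \<in> T \<inter> C"
    have Tm: "T \<in> mesh S" and v0: "v0 \<in> verts T" and hT: "diameter T0 \<le> (2 * \<sigma>) ^ (mult_bound CARD('n) \<sigma>) * diameter T"
      using T star_subset_mesh unfolding star_def by auto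
    have h: "0 < diameter T" by (rule diameter_mesh_pos[OF Tm])
    have "\<bar>hat v0 y - hat v0 z\<bar> \<le> 2 * \<sigma> / diameter T * norm (y - z)"
      using hat_eq[OF Tm] yz v0 bary_lipschitz_shape[OF shape_mesh[OF Tm] sigma_pos v0, of y z] by simp
    also have "\<dots> \<le> (2 * \<sigma> * (2 * \<sigma>) ^ (mult_bound CARD('n) \<sigma>) / diameter T0) * (2 * R)"
    proof (intro mult_mono)
      have "2 * \<sigma> * diameter T0 \<le> 2 * \<sigma> * ((2 * \<sigma>) ^ (mult_bound CARD('n) \<sigma>) * diameter T)" using hT sigma_pos by (intro mult_left_mono) auto
      then show "2 * \<sigma> / diameter T \<le> 2 * \<sigma> * (2 * \<sigma>) ^ (mult_bound CARD('n) \<sigma>) / diameter T0"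
        using h h0 by (simp add: field_simps)
      have "dist y x + dist x z \<le> R + R" using yz C(3) by (intro add_mono) (auto simp: dist_commute subset_iff)
      then show "norm (y - z) \<le> 2 * R" using dist_triangle[of y z x] by (simp add: dist_norm)
    qed (use h0 sigma_pos in auto)
    finally show "\<bar>hat v0 y - hat v0 z\<bar> \<le> ?o" .
  qed (use h0 sigma_pos R in auto)
  also have "\<dots> = real (card (star T0 v0)) * ?o" by simp
  also have "\<dots> \<le> real (mult_bound CARD('n) \<sigma>) * ?o"
    using card_star[of T0 v0] h0 sigma_pos R by (intro mult_right_mono) auto
  finally show ?thesis .
qed

text \<open>Walk along the interface from \<open>x\<close> until \<open>w\<close> vanishes or the hat function gets small. Up to
  that moment the path stays inside the domain, in cut elements having \<open>v0\<close> as a vertex; the hat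
  function cannot get small because the path is short.\<close>

lemma star_path:
  assumes T0: "T0 \<in> cut_mesh S" and x: "x \<in> T0" and w: "w \<in> Vh S"
    and hat0: "1 / real (CARD('n) + 1) \<le> hat v0 x"
    and p: "continuous_on {0..1::real} p" "p 0 = x" "p ` {0..1} \<subseteq> cball x R"
    and pG: "\<And>t. t \<in> {0..1} \<Longrightarrow> p t \<in> Dom \<Longrightarrow> p t \<in> Gam"
    and R: "real (mult_bound CARD('n) \<sigma>) * (2 * \<sigma> * (2 * \<sigma>) ^ (mult_bound CARD('n) \<sigma>) / diameter T0 * (2 * R)) \<le> 1 / (4 * real (CARD('n) + 1))"
    and osc: "\<And>T a b. T \<in> star T0 v0 \<Longrightarrow> a \<in> T \<Longrightarrow> b \<in> T \<Longrightarrow> \<bar>w a - w b\<bar> \<le> osc T"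
    and pos: "\<And>T. T \<in> star T0 v0 \<Longrightarrow> 0 \<le> osc T"
  shows "\<bar>w x\<bar> \<le> (\<Sum>T\<in>star T0 v0. osc T) \<or>
    (\<bar>w (p 1) - w x\<bar> \<le> (\<Sum>T\<in>star T0 v0. osc T) \<and> p 1 \<in> Gam \<and> p 1 \<in> \<Union>(star T0 v0))"
proof (cases "w x = 0")
  case True
  then show ?thesis using pos by (simp add: sum_nonneg)
next
  case wx: False
  let ?O = "\<Sum>T\<in>star T0 v0. osc T"
  let ?n1 = "real (CARD('n) + 1)"
  have T0m: "T0 \<in> mesh S" using T0 cut_mesh_subset by blast
  \<comment> \<open>The stopping times: \<open>w\<close> vanishes, or the hat function has fallen to
    half of its guaranteed initial value.\<close>
  define A where "A = {t\<in>{0..1}. w (p t) = 0} \<union> {t\<in>{0..1}. p t \<in> {z\<in>closure Dom. hat v0 z \<le> 1 / (2 * ?n1)}}"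
  have wp: "continuous_on {0..1} (\<lambda>t. w (p t))"
    by (rule continuous_on_compose2[OF Vh_continuous[OF w] p(1)]) auto
  \<comment> \<open>Before stopping, a nonzero \<open>w\<close> keeps the path in the domain, hence
    on the interface, and there in the cut elements by \<open>Vh_zero_off_cut_dom\<close>. The bound
    \<open>R\<close> costs the hat function at most a quarter of its initial value.\<close>
  have part: "p ` I \<subseteq> \<Union>(star T0 v0) \<and> (\<forall>t\<in>I. \<bar>w (p t) - w x\<bar> \<le> ?O \<and> p t \<in> Gam \<and> p t \<in> Dom \<and> 3 / (4 * ?n1) \<le> hat v0 (p t))"
    if I: "connected I" "I \<subseteq> {0..1}" "0 \<in> I" "I \<inter> A = {}" for I
  proof -
    have w0: "w (p t) \<noteq> 0" if "t \<in> I" for t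
    proof
      assume "w (p t) = 0"
      then have "t \<in> A" using that I(2) unfolding A_def by auto
      then show False using that I(4) by blast
    qed
    have dom: "p t \<in> Dom" if "t \<in> I" for t using w0[OF that] Vh_zero_outside[OF w] by blast
    have gam: "p t \<in> Gam" if "t \<in> I" for t using pG dom that I(2) by blast
    have cut: "p t \<in> cut_dom S" if "t \<in> I" for t using Vh_zero_off_cut_dom[OF gam dom _ w] w0 that by blast
    have hat: "hat v0 (p t) > 0" if "t \<in> I" for t
    proof -
      have "\<not> hat v0 (p t) \<le> 1 / (2 * ?n1)" using that I(2,4) dom[OF that] closure_subset[of Dom] unfolding A_def by blast
      moreover have "0 < 1 / (2 * ?n1)" by simp
      ultimately show ?thesis by linarith
    qed
    have pc: "continuous_on I p" using p(1) I(2) continuous_on_subset by blast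
    have con: "connected (p ` I)" by (rule connected_continuous_image[OF pc I(1)])
    have xC: "x \<in> p ` I" using I(3) p(2) by blast
    have sub: "p ` I \<subseteq> \<Union>(star T0 v0)"
      by (rule connected_interface_part[OF con _ _ _ _ xC x T0]) (use gam dom cut hat in auto)
    have "\<bar>w (p t) - w x\<bar> \<le> ?O" if "t \<in> I" for t
      by (rule star_oscillation[OF con sub continuous_on_subset[OF Vh_continuous[OF w] subset_UNIV]])
        (use osc pos that xC in auto)
    moreover have "3 / (4 * ?n1) \<le> hat v0 (p t)" if "t \<in> I" for t
    proof -
      have "p ` I \<subseteq> cball x R" using p(3) I(2) by blast
      from star_hat_oscillation[OF con sub this T0m imageI[OF that] xC]
      have "\<bar>hat v0 (p t) - hat v0 x\<bar> \<le> 1 / (4 * ?n1)" using R by (rule order_trans)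
      then have "hat v0 x - 1 / (4 * ?n1) \<le> hat v0 (p t)" unfolding abs_le_iff by linarith
      have split: "1 / ?n1 = 3 / (4 * ?n1) + 1 / (4 * ?n1)" by (rule fractions_of_inverse) simp
      have "b \<le> q" if "a = b + c" "a \<le> h" "h - c \<le> q" for a b c h q :: real using that by linarith
      from this[OF split hat0] show ?thesis using \<open>hat v0 x - 1 / (4 * ?n1) \<le> hat v0 (p t)\<close> .
    qed
    ultimately show ?thesis using sub gam dom by blast
  qed
  show ?thesis
  proof (cases "A = {}")
    case True
    then have P: "p ` {0..1} \<subseteq> \<Union>(star T0 v0) \<and> (\<forall>t\<in>{0..1}. \<bar>w (p t) - w x\<bar> \<le> ?O \<and> p t \<in> Gam \<and> p t \<in> Dom \<and>
        3 / (4 * ?n1) \<le> hat v0 (p t))"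
      by (intro part) auto
    have one: "(1::real) \<in> {0..1}" by simp
    have "p 1 \<in> \<Union>(star T0 v0)" using conjunct1[OF P] one by blast
    then show ?thesis using bspec[OF conjunct2[OF P] one] by blast
  next
    case False
    have "closed {t\<in>{0..1}. w (p t) = 0}"
      using continuous_closed_preimage[OF wp closed_atLeastAtMost closed_singleton[of 0]] by (simp add: vimage_def Int_def)
    moreover have "closed {z\<in>closure Dom. hat v0 z \<le> 1 / (2 * ?n1)}"
      using continuous_closed_preimage[OF continuous_on_hat closed_closure closed_atMost[of "1 / (2 * ?n1)"]]
      by (simp add: vimage_def Int_def)
    from continuous_closed_preimage[OF p(1) closed_atLeastAtMost this]
    have "closed {t\<in>{0..1}. p t \<in> {z\<in>closure Dom. hat v0 z \<le> 1 / (2 * ?n1)}}" by (simp add: vimage_def Int_def)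
    ultimately have clA: "closed A" unfolding A_def by (rule closed_Un)
    have bd: "bdd_below A" unfolding A_def by (intro bdd_belowI[of _ 0]) auto
    define t0 where "t0 = Inf A"
    have t0A: "t0 \<in> A" unfolding t0_def by (rule closed_contains_Inf[OF False bd clA])
    then have t01: "0 \<le> t0" "t0 \<le> 1" unfolding A_def by auto
    have xA: "0 \<notin> A"
    proof -
      have "1 / (2 * ?n1) < 1 / ?n1" by (rule fractions_of_inverse) simp
      then show ?thesis using wx hat0 p(2) unfolding A_def by auto
    qed
    then have t0p: "0 < t0" using t0A t01 by (cases "t0 = 0") auto
    have I: "{0..<t0} \<inter> A = {}" using cInf_lower[OF _ bd] unfolding t0_def by force
    have P0: "p ` {0..<t0} \<subseteq> \<Union>(star T0 v0) \<and> (\<forall>t\<in>{0..<t0}. \<bar>w (p t) - w x\<bar> \<le> ?O \<and> p t \<in> Gam \<and>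
        p t \<in> Dom \<and> 3 / (4 * ?n1) \<le> hat v0 (p t))"
    proof (rule part[OF _ _ _ I])
      show "connected {0..<t0}" by (intro convex_connected) simp
    qed (use t01 t0p in auto)
    have P: "\<And>t. t \<in> {0..<t0} \<Longrightarrow> \<bar>w (p t) - w x\<bar> \<le> ?O \<and> p t \<in> Dom \<and> 3 / (4 * ?n1) \<le> hat v0 (p t)"
      using conjunct2[OF P0] by blast
    have cl: "t0 \<in> closure {0..<t0}" using t0p by simp
    have sub01: "closure {0..<t0} \<subseteq> {0..1}" using t01 t0p by simp
    have lim: "p t0 \<in> closure (p ` {0..<t0})"
      using continuous_image_closure_subset[OF continuous_on_subset[OF p(1) sub01] order_refl] cl by blast
    \<comment> \<open>By continuity the hat function is still at least three quarters of its initial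
      bound at the first stopping time. So the walk was stopped because \<open>w\<close> vanishes,
      and the oscillation bound applies to \<open>w x\<close> itself.\<close>
    have "closed {z\<in>closure Dom. 3 / (4 * ?n1) \<le> hat v0 z}"
      using continuous_closed_preimage[OF continuous_on_hat closed_closure closed_atLeast[of "3 / (4 * ?n1)"]]
      by (simp add: vimage_def Int_def)
    moreover have "p ` {0..<t0} \<subseteq> {z\<in>closure Dom. 3 / (4 * ?n1) \<le> hat v0 z}" using P closure_subset by blast
    ultimately have "closure (p ` {0..<t0}) \<subseteq> {z\<in>closure Dom. 3 / (4 * ?n1) \<le> hat v0 z}" by (rule closure_minimal[rotated])
    then have "3 / (4 * ?n1) \<le> hat v0 (p t0)" using lim by blast
    moreover have "1 / (2 * ?n1) < 3 / (4 * ?n1)" by (rule fractions_of_inverse) simp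
    ultimately have "w (p t0) = 0" using t0A unfolding A_def by auto
    moreover have "\<bar>w (p t0) - w x\<bar> \<le> ?O"
    proof -
      have "closed {z. \<bar>w z - w x\<bar> \<le> ?O}"
        by (intro closed_Collect_le continuous_intros Vh_continuous[OF w])
      moreover have "p ` {0..<t0} \<subseteq> {z. \<bar>w z - w x\<bar> \<le> ?O}" using P by blast
      ultimately have "closure (p ` {0..<t0}) \<subseteq> {z. \<bar>w z - w x\<bar> \<le> ?O}" by (rule closure_minimal[rotated])
      then show ?thesis using lim by blast
    qed
    ultimately show ?thesis by simp
  qed
qed

end

section \<open>Control of nodal values near the interface\<close>

text \<open>Width of the patch relative to the element size. The first term makes the patch fit into
  the ball of radius \<open>patch_radius\<close> for every element of diameter at most
  \<open>D\<close>; the second keeps the hat function from losing more than a quarter of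
  \<open>1 / (n + 1)\<close>.\<close>

definition key_width :: "nat \<Rightarrow> real \<Rightarrow> real \<Rightarrow> real \<Rightarrow> real \<Rightarrow> real" where
  "key_width n \<sigma> r K D =
     min (patch_radius n r K / (2 * (real n + 8 * (real n)\<^sup>2) * D))
         (1 / (16 * \<sigma> * real (mult_bound n \<sigma>) * (2 * \<sigma>) ^ mult_bound n \<sigma> * (real n + 8 * (real n)\<^sup>2) * (real n + 1)))"

text \<open>The three terms account for the oscillation over the star, the weighted norm on the
  interface and the oscillation inside the element itself. The factors 4, 4 and 2 come from using
  \<open>square_sum_le\<close> twice.\<close>

definition key_const :: "nat \<Rightarrow> real \<Rightarrow> real \<Rightarrow> real \<Rightarrow> real \<Rightarrow> real \<Rightarrow> real" where
  "key_const n \<sigma> r K D Co =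
     4 * real (mult_bound n \<sigma>) * Co * ((2 * \<sigma>) ^ mult_bound n \<sigma>) ^ (n - 2)
     + 4 * ((2 / key_width n \<sigma> r K D) ^ (n - 1) / unit_ball_vol (real (n - 1))) * (2 * \<sigma>) ^ mult_bound n \<sigma>
     + 2 * Co"

lemma mult_bound_pos: "0 < \<sigma> \<Longrightarrow> 0 < mult_bound n \<sigma>"
  unfolding mult_bound_def by (simp add: add_pos_pos)

lemma key_width_pos:
  assumes "0 < n" "0 < \<sigma>" "0 < r" "0 < D" shows "0 < key_width n \<sigma> r K D"
proof -
  have "0 < real n + 8 * (real n)\<^sup>2" using assms by (intro add_pos_nonneg) auto
  then show ?thesis unfolding key_width_def
    using assms patch_radius_pos[of r n K] mult_bound_pos[of \<sigma> n]
    by (auto intro!: divide_pos_pos mult_pos_pos simp: add_nonneg_pos)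
qed

lemma key_const_pos:
  assumes "0 < n" "0 < \<sigma>" "0 < r" "0 < D" "0 < Co" shows "0 < key_const n \<sigma> r K D Co"
  unfolding key_const_def using assms key_width_pos[OF assms(1-4), of K]
  by (intro add_nonneg_pos add_nonneg_nonneg mult_nonneg_nonneg divide_nonneg_nonneg) auto

lemma hausdorff_measure_cover:
  fixes M :: "'a::metric_space set"
  assumes "finite F" "M \<in> sets borel" "\<And>T. T \<in> F \<Longrightarrow> T \<in> sets borel" "M \<subseteq> \<Union>F" "hausdorff_outer s M < top"
  shows "measure (hausdorff s) M \<le> (\<Sum>T\<in>F. measure (hausdorff s) (T \<inter> M))"
proof -
  have fin: "emeasure (hausdorff s) A < top" if "A \<subseteq> M" "A \<in> sets borel" for A
    using that assms(5) hausdorff_outer_mono[OF that(1), of s] by (simp add: emeasure_hausdorff le_less_trans)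
  have "M = (\<Union>T\<in>F. T \<inter> M)" using assms(4) by blast
  then have "measure (hausdorff s) M = measure (hausdorff s) (\<Union>T\<in>F. T \<inter> M)" by simp
  also have "\<dots> \<le> (\<Sum>T\<in>F. measure (hausdorff s) (T \<inter> M))"
    using assms fin by (intro measure_subadditive_finite) (auto simp: top.not_eq_extremum[symmetric])
  finally show ?thesis .
qed

context cutfem_geom
begin

definition Gen :: "(real ^ 'n \<Rightarrow> real) \<Rightarrow> (real ^ 'n) set \<Rightarrow> real" where
  "Gen w T = (LINT x:T|lborel. grad2 (lpoly (deg S) w T) x)"

definition Jen :: "(real ^ 'n \<Rightarrow> real) \<Rightarrow> (real ^ 'n) set \<Rightarrow> real" where
  "Jen w T = (LINT x:T \<inter> Gam|surf. (w x)\<^sup>2)"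

text \<open>It contains the star around every vertex of \<open>T0\<close>, so estimates stated with
  it do not mention the vertex selected by the interface point.\<close>

definition "vnbrs T0 = {T\<in>cut_mesh S. verts T \<inter> verts T0 \<noteq> {}}"

lemma Gen_nonneg: "0 \<le> Gen w T" unfolding Gen_def by (rule set_integral_grad2_nonneg)

lemma Jen_nonneg: "0 \<le> Jen w T"
  unfolding Jen_def set_lebesgue_integral_def by (intro Bochner_Integration.integral_nonneg) auto

lemma Vh_lpoly:
  assumes "w \<in> Vh S" "T \<in> mesh S"
  shows "lpoly (deg S) w T \<in> poly_le (deg S)" and "\<And>x. x \<in> T \<Longrightarrow> lpoly (deg S) w T x = w x"
proof -
  obtain p where p: "p \<in> poly_le (deg S)" "\<forall>x\<in>T. w x = p x" using Vh_piece[OF assms] by blast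
  have "lpoly (deg S) w T = p" using p by (intro lpoly_eq[OF nsimplex_mesh[OF assms(2)] deg_pos]) auto
  then show "lpoly (deg S) w T \<in> poly_le (deg S)" "\<And>x. x \<in> T \<Longrightarrow> lpoly (deg S) w T x = w x" using p by auto
qed

lemma closed_Int_interface: "T \<in> mesh S \<Longrightarrow> closed (T \<inter> Gam)"
  using closed_mesh closed_interface by blast

lemma Jen_integrable:
  assumes "w \<in> Vh S" "T \<in> mesh S" shows "set_integrable surf (T \<inter> Gam) (\<lambda>x. (w x)\<^sup>2)"
  using closed_Int_interface[OF assms(2)] continuous_on_subset[OF Vh_continuous[OF assms(1)] subset_UNIV]
  by (intro set_integrable_interface_continuous) (auto intro!: continuous_intros)

lemma hat_large_vertex:
  assumes "T \<in> mesh S" "x \<in> T" obtains v where "v \<in> verts T" "1 / real (CARD('n) + 1) \<le> hat v x"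
proof -
  note nT = nsimplex_mesh[OF assms(1)]
  have "\<exists>v\<in>verts T. 1 / real (CARD('n) + 1) \<le> bary T v x"
  proof (rule ccontr)
    assume no: "\<not> ?thesis"
    have "verts T \<noteq> {}" using card_verts[OF nT] by auto
    then have "(\<Sum>v\<in>verts T. bary T v x) < (\<Sum>v\<in>verts T. 1 / real (CARD('n) + 1))"
      using no finite_verts[OF nT] by (intro sum_strict_mono) (auto simp: not_le)
    then show False using bary_sum[OF nT] card_verts[OF nT] by simp
  qed
  then show thesis using that hat_eq[OF assms] by auto
qed

lemma star_subset_vnbrs: "v0 \<in> verts T0 \<Longrightarrow> star T0 v0 \<subseteq> vnbrs T0"
  unfolding star_def vnbrs_def by auto

lemma finite_vnbrs: "finite (vnbrs T0)" unfolding vnbrs_def using finite_cut_mesh by simp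

lemma square_sum_le:
  fixes a b :: real shows "(a + b)\<^sup>2 \<le> 2 * a\<^sup>2 + 2 * b\<^sup>2"
  using zero_le_power2[of "a - b"] by (simp add: power2_eq_square algebra_simps)

text \<open>When the value at \<open>x\<close> exceeds all possible oscillation, the first
  alternative of \<open>star_path\<close> is excluded for every path in the patch. Then the whole
  patch lies on the interface inside the star, and there \<open>w\<close> stays above the difference
  in absolute value; integrate over the patch, whose surface measure is bounded below.\<close>

lemma interface_point_dichotomy:
  assumes T0: "T0 \<in> cut_mesh S" and x: "x \<in> T0" "x \<in> Gam" and w: "w \<in> Vh S"
    and hat0: "1 / real (CARD('n) + 1) \<le> hat v0 x"
    and osc: "\<And>T a b. T \<in> star T0 v0 \<Longrightarrow> a \<in> T \<Longrightarrow> b \<in> T \<Longrightarrow> \<bar>w a - w b\<bar> \<le> osc T"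
    and pos: "\<And>T. T \<in> star T0 v0 \<Longrightarrow> 0 \<le> osc T"
    and h0: "diameter T0 \<le> D" and V: "\<bar>w x\<bar> > (\<Sum>T\<in>star T0 v0. osc T)"
  shows "(\<bar>w x\<bar> - (\<Sum>T\<in>star T0 v0. osc T))\<^sup>2 *
      (unit_ball_vol (real (CARD('n) - 1)) * (key_width CARD('n) \<sigma> r K D * diameter T0 / 2) ^ (CARD('n) - 1))
    \<le> (\<Sum>T\<in>star T0 v0. Jen w T)"
proof -
  let ?n = "CARD('n)" let ?A = "real ?n + 8 * (real ?n)\<^sup>2" let ?rp = "patch_radius ?n r K"
  let ?c = "key_width ?n \<sigma> r K D" let ?h = "diameter T0" let ?O = "\<Sum>T\<in>star T0 v0. osc T"
  let ?t = "(2 * \<sigma>) ^ (mult_bound CARD('n) \<sigma>)"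
  have T0m: "T0 \<in> mesh S" using T0 cut_mesh_subset by blast
  have hp: "0 < ?h" by (rule diameter_mesh_pos[OF T0m])
  have Dp: "0 < D" using hp h0 by linarith
  have np: "0 < ?n" by simp
  have A: "0 < ?A" by (intro add_pos_nonneg) auto
  have rp: "0 < ?rp" by (rule patch_radius_pos[OF r_pos np])
  have c: "0 < ?c" by (rule key_width_pos[OF np sigma_pos r_pos Dp])
  define \<eta> where "\<eta> = ?c * ?h"
  have \<eta>: "0 < \<eta>" using c hp by (simp add: \<eta>_def)
  have fit: "?A * \<eta> < ?rp"
  proof -
    have "?c \<le> ?rp / (2 * ?A * D)" unfolding key_width_def by simp
    then have "\<eta> \<le> ?rp / (2 * ?A * D) * D" unfolding \<eta>_def using h0 hp rp A Dp by (intro mult_mono) auto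
    then have "?A * \<eta> \<le> ?A * (?rp / (2 * ?A * D) * D)" using A by (intro mult_left_mono) auto
    also have "\<dots> = ?rp / 2" using A Dp by (simp add: divide_simps)
    finally show ?thesis using rp by linarith
  qed
  \<comment> \<open>The second term of \<open>key_width\<close> yields exactly the radius condition
    that \<open>star_path\<close> asks for.\<close>
  have R: "real (mult_bound CARD('n) \<sigma>) * (2 * \<sigma> * ?t / ?h * (2 * (?A * \<eta>))) \<le> 1 / (4 * real (?n + 1))"
  proof -
    let ?P = "16 * \<sigma> * real (mult_bound CARD('n) \<sigma>) * ?t * ?A * (real ?n + 1)"
    have P: "0 < ?P" using sigma_pos mult_bound_pos[OF sigma_pos, of ?n] A by (intro mult_pos_pos) auto
    have cl: "?c \<le> 1 / ?P" unfolding key_width_def by simp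
    have "real (mult_bound CARD('n) \<sigma>) * (2 * \<sigma> * ?t / ?h * (2 * (?A * \<eta>))) = (4 * \<sigma> * real (mult_bound CARD('n) \<sigma>) * ?t * ?A) * ?c"
      unfolding \<eta>_def using hp by (simp add: field_simps)
    also have "\<dots> \<le> (4 * \<sigma> * real (mult_bound CARD('n) \<sigma>) * ?t * ?A) * (1 / ?P)"
      using cl sigma_pos A by (intro mult_left_mono) auto
    also have "\<dots> = 1 / (4 * (real ?n + 1))"
    proof -
      have gen: "(4 * a * b * c * d) * (1 / (16 * a * b * c * d * e)) = 1 / (4 * e)" if "16 * a * b * c * d * e \<noteq> 0"
        for a b c d e :: real using that by (simp add: field_simps)
      show ?thesis by (rule gen) (rule less_imp_neq[OF P, symmetric])
    qed
    finally show ?thesis by (simp add: add.commute)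
  qed
  obtain \<rho> g where P: "level_patch x \<rho> g ?rp K" "\<And>z. z \<in> ball x ?rp \<Longrightarrow> \<rho> z = 0 \<Longrightarrow> z \<in> Dom \<Longrightarrow> z \<in> Gam"
    using interface_patch[OF x(2)] by metis
  interpret level_patch x \<rho> g ?rp K by (rule P(1))
  have Z: "\<bar>w z - w x\<bar> \<le> ?O \<and> z \<in> Gam \<and> z \<in> \<Union>(star T0 v0)" if z: "z \<in> patch \<eta>" for z
  proof -
    obtain p where p: "continuous_on {0..1::real} p" "p ` {0..1} \<subseteq> patch \<eta>" "p 0 = x" "p 1 = z"
      using patch_path[OF \<eta> fit z] by metis
    have "p t \<in> Gam" if "t \<in> {0..1}" "p t \<in> Dom" for t
    proof -
      have pt: "p t \<in> patch \<eta>" using p(2) that(1) by blast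
      then have "\<rho> (p t) = 0" by (simp add: patch_def)
      then show ?thesis using P(2) patch_ball[OF \<eta> fit] pt that(2) by blast
    qed
    moreover have "p ` {0..1} \<subseteq> cball x (?A * \<eta>)"
      using p(2) patch_norm[OF \<eta> fit] by (fastforce simp: dist_norm norm_minus_commute)
    ultimately have "\<bar>w x\<bar> \<le> ?O \<or> (\<bar>w (p 1) - w x\<bar> \<le> ?O \<and> p 1 \<in> Gam \<and> p 1 \<in> \<Union>(star T0 v0))"
      using R osc pos by (intro star_path[OF T0 x(1) w hat0 p(1,3)]) auto
    then show ?thesis using V p(4) by auto
  qed
  define M where "M = patch \<eta>"
  define V where "V = \<bar>w x\<bar> - ?O"
  have Vp: "0 < V" using assms(9) by (simp add: V_def)
  have cM: "closed M" unfolding M_def by (rule closed_patch[OF \<eta> fit])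
  have Mfin: "hausdorff_outer (?n - 1) M < top" unfolding M_def by (rule patch_measure_finite[OF \<eta> fit])
  have MB: "M \<in> sets borel" using cM by simp
  have wV: "V\<^sup>2 \<le> (w z)\<^sup>2" if "z \<in> M" for z
  proof -
    have "V \<le> \<bar>w z\<bar>" using Z that unfolding M_def V_def by fastforce
    then have "V\<^sup>2 \<le> \<bar>w z\<bar>\<^sup>2" using Vp by (intro power_mono) auto
    then show ?thesis by simp
  qed
  have "ennreal (unit_ball_vol (real (?n - 1)) * (\<eta> / 2) ^ (?n - 1)) \<le> emeasure surf M"
    using patch_measure_lower[OF \<eta> fit] MB by (simp add: emeasure_hausdorff M_def)
  also have "\<dots> = ennreal (measure surf M)"
    using Mfin MB by (intro emeasure_eq_ennreal_measure) (simp add: emeasure_hausdorff top.not_eq_extremum)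
  finally have "unit_ball_vol (real (?n - 1)) * (\<eta> / 2) ^ (?n - 1) \<le> measure surf M"
    using \<eta> by (subst (asm) ennreal_le_iff) auto
  also have "\<dots> \<le> (\<Sum>T\<in>star T0 v0. measure surf (T \<inter> M))"
    using Z closed_mesh star_subset_mesh MB Mfin
    by (intro hausdorff_measure_cover finite_star) (auto simp: M_def)
  finally have "V\<^sup>2 * (unit_ball_vol (real (?n - 1)) * (\<eta> / 2) ^ (?n - 1)) \<le> V\<^sup>2 * (\<Sum>T\<in>star T0 v0. measure surf (T \<inter> M))"
    by (rule mult_left_mono) simp
  also have "\<dots> = (\<Sum>T\<in>star T0 v0. V\<^sup>2 * measure surf (T \<inter> M))" by (simp add: sum_distrib_left)
  also have "\<dots> \<le> (\<Sum>T\<in>star T0 v0. Jen w T)"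
  proof (rule sum_mono)
    fix T assume T: "T \<in> star T0 v0"
    then have Tm: "T \<in> mesh S" by (rule star_subset_mesh)
    have TM: "T \<inter> M \<in> sets borel" using closed_mesh[OF Tm] cM by auto
    have sub: "T \<inter> M \<subseteq> T \<inter> Gam" using Z unfolding M_def by blast
    have int: "set_integrable surf (T \<inter> M) (\<lambda>x. (w x)\<^sup>2)"
      using TM by (intro set_integrable_subset[OF Jen_integrable[OF w Tm] _ sub]) simp
    have fin: "emeasure surf (T \<inter> M) < top"
      using Mfin hausdorff_outer_mono[of "T \<inter> M" M "?n - 1"] TM by (simp add: emeasure_hausdorff le_less_trans)
    have "V\<^sup>2 * measure surf (T \<inter> M) = (LINT x:T \<inter> M|surf. V\<^sup>2)"
      using fin TM by (subst set_integral_const) (auto simp: mult.commute)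
    also have "\<dots> \<le> (LINT x:T \<inter> M|surf. (w x)\<^sup>2)"
    proof (rule set_integral_mono[OF _ int])
      show "set_integrable surf (T \<inter> M) (\<lambda>x. V\<^sup>2)"
        unfolding set_integrable_def using fin TM by (simp add: integrable_mult_left integrable_real_indicator)
    qed (use wV in auto)
    also have "\<dots> \<le> Jen w T"
      unfolding Jen_def using TM sub by (intro set_integral_mono_subset[OF Jen_integrable[OF w Tm]]) auto
    finally show "V\<^sup>2 * measure surf (T \<inter> M) \<le> Jen w T" .
  qed
  finally show ?thesis unfolding V_def \<eta>_def .
qed

text \<open>Both contributions scale alike: oscillations squared times \<open>h ^ (d - 2)\<close>
  are bounded by gradient energies, and the interface term is \<open>1 / h\<close> times an integral
  over a surface of measure of order \<open>h ^ (d - 1)\<close>.\<close>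

lemma key_estimate:
  assumes Co: "0 < Co" "\<And>(T :: (real ^ 'n) set) (p :: real ^ 'n \<Rightarrow> real) x y. shape \<sigma> T \<Longrightarrow> p \<in> poly_le (deg S) \<Longrightarrow>
      x \<in> T \<Longrightarrow> y \<in> T \<Longrightarrow> diameter T ^ (CARD('n) - 2) * (p x - p y)\<^sup>2 \<le> Co * (LINT x:T|lborel. grad2 p x)"
    and T0: "T0 \<in> cut_mesh S" and w: "w \<in> Vh S" and y: "y \<in> T0" and D: "diameter T0 \<le> D"
  shows "diameter T0 ^ (CARD('n) - 2) * (w y)\<^sup>2 \<le> key_const CARD('n) \<sigma> r K D Co *
    (\<Sum>T\<in>vnbrs T0. Gen w T + inverse (diameter T) * Jen w T)"
proof -
  let ?n = "CARD('n)" let ?m = "?n - 2" let ?h = "diameter T0" let ?t = "(2 * \<sigma>) ^ (mult_bound CARD('n) \<sigma>)"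
  let ?c = "key_width ?n \<sigma> r K D" let ?u = "unit_ball_vol (real (?n - 1))"
  have T0m: "T0 \<in> mesh S" using T0 cut_mesh_subset by blast
  have hp: "0 < ?h" by (rule diameter_mesh_pos[OF T0m])
  have Dp: "0 < D" using hp D by linarith
  have c: "0 < ?c" by (rule key_width_pos[OF _ sigma_pos r_pos Dp]) simp
  have t: "1 \<le> ?t" using two_sigma_ge_1[OF T0m] by (rule one_le_power)
  have u: "0 < ?u" by simp
  obtain x where x: "x \<in> interior T0" "x \<in> Gam" using T0 unfolding cut_mesh_def by blast
  then have xT: "x \<in> T0" using interior_subset by blast
  obtain v0 where v0: "v0 \<in> verts T0" "1 / real (?n + 1) \<le> hat v0 x" using hat_large_vertex[OF T0m xT] by metis
  have wosc: "diameter T ^ ?m * (w a - w b)\<^sup>2 \<le> Co * Gen w T" if "T \<in> mesh S" "a \<in> T" "b \<in> T" for T a b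
    using Co(2)[OF shape_mesh[OF that(1)] Vh_lpoly(1)[OF w that(1)] that(2,3)]
      Vh_lpoly(2)[OF w that(1,2)] Vh_lpoly(2)[OF w that(1,3)] by (simp add: Gen_def)
  \<comment> \<open>The inverse estimate on \<open>T\<close>, solved for the oscillation of
    \<open>w\<close>.\<close>
  define o2 where "o2 T = sqrt (Co * Gen w T / diameter T ^ ?m)" for T
  let ?St = "star T0 v0" let ?O = "\<Sum>T\<in>?St. o2 T"
  define X where "X = (\<Sum>T\<in>vnbrs T0. Gen w T + inverse (diameter T) * Jen w T)"
  have Xi: "0 \<le> Gen w T + inverse (diameter T) * Jen w T" if "T \<in> cut_mesh S" for T
    using that diameter_mesh_pos[OF cut_mesh_subset[OF that]] by (intro add_nonneg_nonneg Gen_nonneg mult_nonneg_nonneg Jen_nonneg) auto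
  have hT: "0 < diameter T" if "T \<in> ?St" for T using diameter_mesh_pos star_subset_mesh that by blast
  have JSt: "0 \<le> inverse (diameter T) * Jen w T" if "T \<in> ?St" for T
    using hT[OF that] Jen_nonneg by (intro mult_nonneg_nonneg) auto
  have sub: "(\<Sum>T\<in>?St. Gen w T + inverse (diameter T) * Jen w T) \<le> X"
    unfolding X_def using star_subset_vnbrs[OF v0(1)] Xi finite_vnbrs
    by (intro sum_mono2) (auto simp: vnbrs_def)
  have GX: "(\<Sum>T\<in>?St. Gen w T) \<le> X"
  proof -
    have "(\<Sum>T\<in>?St. Gen w T) \<le> (\<Sum>T\<in>?St. Gen w T + inverse (diameter T) * Jen w T)"
      using JSt by (intro sum_mono) simp
    then show ?thesis using sub by linarith
  qed
  have JX: "(\<Sum>T\<in>?St. inverse (diameter T) * Jen w T) \<le> X"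
  proof -
    have "(\<Sum>T\<in>?St. inverse (diameter T) * Jen w T) \<le> (\<Sum>T\<in>?St. Gen w T + inverse (diameter T) * Jen w T)"
      using Gen_nonneg by (intro sum_mono) simp
    then show ?thesis using sub by linarith
  qed
  have X0: "0 \<le> X" using GX sum_nonneg[of ?St "Gen w"] Gen_nonneg by (meson order_trans)
  have osc: "\<bar>w a - w b\<bar> \<le> o2 T" if "T \<in> ?St" "a \<in> T" "b \<in> T" for T a b
  proof -
    have "(w a - w b)\<^sup>2 \<le> Co * Gen w T / diameter T ^ ?m"
      using wosc[OF star_subset_mesh[OF that(1)] that(2,3)] hT[OF that(1)] by (simp add: field_simps)
    then have "sqrt ((w a - w b)\<^sup>2) \<le> o2 T" unfolding o2_def by (rule real_sqrt_le_mono)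
    then show ?thesis by simp
  qed
  have o2pos: "0 \<le> o2 T" if "T \<in> ?St" for T
    unfolding o2_def using hT[OF that] Co(1) Gen_nonneg by (intro real_sqrt_ge_zero divide_nonneg_nonneg mult_nonneg_nonneg) auto
  have O2: "?h ^ ?m * ?O\<^sup>2 \<le> real (mult_bound CARD('n) \<sigma>) * Co * ?t ^ ?m * X"
  proof -
    have "?O\<^sup>2 \<le> (\<Sum>T\<in>?St. (o2 T)\<^sup>2) * real (card ?St)" by (rule sum_squared_le_sum_of_squares)
    also have "\<dots> \<le> (\<Sum>T\<in>?St. (o2 T)\<^sup>2) * real (mult_bound CARD('n) \<sigma>)"
      using card_star[of T0 v0] by (intro mult_left_mono sum_nonneg) auto
    finally have "?h ^ ?m * ?O\<^sup>2 \<le> ?h ^ ?m * ((\<Sum>T\<in>?St. (o2 T)\<^sup>2) * real (mult_bound CARD('n) \<sigma>))"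
      using hp by (intro mult_left_mono) auto
    also have "\<dots> = real (mult_bound CARD('n) \<sigma>) * (\<Sum>T\<in>?St. ?h ^ ?m * (o2 T)\<^sup>2)" by (simp add: sum_distrib_left mult_ac)
    also have "\<dots> \<le> real (mult_bound CARD('n) \<sigma>) * (\<Sum>T\<in>?St. Co * ?t ^ ?m * Gen w T)"
    proof (intro mult_left_mono sum_mono)
      fix T assume T: "T \<in> ?St"
      \<comment> \<open>Comparability inside the star allows the size of \<open>T0\<close> to be
        replaced by that of \<open>T\<close>, so that the weight in \<open>o2\<close>
        cancels.\<close>
      have "?h ^ ?m \<le> (?t * diameter T) ^ ?m" using T hp unfolding star_def by (intro power_mono) auto
      then have "?h ^ ?m \<le> ?t ^ ?m * diameter T ^ ?m" by (simp only: power_mult_distrib)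
      then have "?h ^ ?m * (Co * Gen w T / diameter T ^ ?m) \<le> (?t ^ ?m * diameter T ^ ?m) * (Co * Gen w T / diameter T ^ ?m)"
        using hT[OF T] Co(1) Gen_nonneg by (intro mult_right_mono divide_nonneg_nonneg mult_nonneg_nonneg) auto
      also have "\<dots> = Co * ?t ^ ?m * Gen w T" using hT[OF T] by simp
      also have "Co * Gen w T / diameter T ^ ?m = (o2 T)\<^sup>2"
        unfolding o2_def using hT[OF T] Co(1) Gen_nonneg
        by (intro real_sqrt_pow2[symmetric] divide_nonneg_nonneg mult_nonneg_nonneg) auto
      finally show "?h ^ ?m * (o2 T)\<^sup>2 \<le> Co * ?t ^ ?m * Gen w T" .
    qed simp
    also have "\<dots> = real (mult_bound CARD('n) \<sigma>) * Co * ?t ^ ?m * (\<Sum>T\<in>?St. Gen w T)"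
      by (simp only: sum_distrib_left[symmetric] mult.assoc)
    also have "\<dots> \<le> real (mult_bound CARD('n) \<sigma>) * Co * ?t ^ ?m * X"
      using GX Co(1) t by (intro mult_left_mono mult_nonneg_nonneg) auto
    finally show ?thesis .
  qed
  \<comment> \<open>The part of the value at \<open>x\<close> that the oscillation cannot explain.
    It is 0 if the walk may run into a zero of \<open>w\<close>; otherwise the interface term bounds
    it.\<close>
  define V where "V = max 0 (\<bar>w x\<bar> - ?O)"
  have V2: "?h ^ ?m * V\<^sup>2 \<le> (2 / ?c) ^ (?n - 1) / ?u * ?t * X"
  proof (cases "\<bar>w x\<bar> > ?O")
    case True
    then have Ve: "V = \<bar>w x\<bar> - ?O" by (simp add: V_def)
    let ?q = "(?c / 2) ^ (?n - 1)"
    have q: "0 < ?q" using c by simp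
    have nm: "?n - 1 = Suc ?m" using dim_ge_2 by simp
    have "V\<^sup>2 * (?u * (?c * ?h / 2) ^ (?n - 1)) \<le> (\<Sum>T\<in>?St. Jen w T)"
      unfolding Ve by (rule interface_point_dichotomy[OF T0 xT x(2) w v0(2) osc o2pos D True])
    moreover have "(?c * ?h / 2) ^ (?n - 1) = ?q * (?h * ?h ^ ?m)"
    proof -
      have "?h ^ (?n - 1) = ?h * ?h ^ ?m" by (simp only: nm power_Suc)
      moreover have "(a * b / 2) ^ l = (a / 2) ^ l * b ^ l" for a b :: real and l
        by (simp add: power_mult_distrib power_divide)
      ultimately show ?thesis by (simp only:)
    qed
    moreover define kk where "kk = ?u * ?q"
    ultimately have kV: "kk * (?h * (?h ^ ?m * V\<^sup>2)) \<le> (\<Sum>T\<in>?St. Jen w T)" by (simp only: mult_ac)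
    have kk: "0 < kk" unfolding kk_def using u q by (rule mult_pos_pos)
    have gen: "s / (a * b) = 1 / a * (inverse b * s)" "a * (b * s) \<le> s' \<Longrightarrow> 0 < a \<Longrightarrow> 0 < b \<Longrightarrow> s \<le> s' / (a * b)"
      for a b s s' :: real by (simp_all add: field_simps)
    have "?h ^ ?m * V\<^sup>2 \<le> (\<Sum>T\<in>?St. Jen w T) / (kk * ?h)" by (rule gen(2)[OF kV kk hp])
    also have "\<dots> = 1 / kk * (\<Sum>T\<in>?St. inverse ?h * Jen w T)"
      unfolding sum_distrib_left[symmetric] by (rule gen(1))
    also have "\<dots> \<le> 1 / kk * (\<Sum>T\<in>?St. ?t * (inverse (diameter T) * Jen w T))"
    proof (intro mult_left_mono sum_mono)
      fix T assume T: "T \<in> ?St"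
      have "diameter T \<le> ?t * ?h" using T unfolding star_def by simp
      then have "inverse ?h \<le> ?t * inverse (diameter T)" using hp hT[OF T] by (simp add: field_simps)
      then have "inverse ?h * Jen w T \<le> (?t * inverse (diameter T)) * Jen w T" by (rule mult_right_mono[OF _ Jen_nonneg])
      then show "inverse ?h * Jen w T \<le> ?t * (inverse (diameter T) * Jen w T)" by (simp only: mult.assoc)
    qed (use kk in simp)
    also have "\<dots> = 1 / kk * ?t * (\<Sum>T\<in>?St. inverse (diameter T) * Jen w T)"
      by (simp only: sum_distrib_left[symmetric] mult.assoc)
    also have "\<dots> \<le> 1 / kk * ?t * X" using kk t by (intro mult_left_mono[OF JX] mult_nonneg_nonneg) auto
    also have "1 / kk = (2 / ?c) ^ (?n - 1) / ?u"
    proof -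
      have "1 / (a * (b / 2) ^ l) = (2 / b) ^ l / a" for a b :: real and l by (simp add: power_divide)
      then show ?thesis unfolding kk_def .
    qed
    finally show ?thesis .
  next
    case False
    then have "V = 0" by (simp add: V_def)
    then show ?thesis using c u t X0 by (auto intro!: mult_nonneg_nonneg divide_nonneg_nonneg)
  qed
  have O0: "0 \<le> ?O" using o2pos by (rule sum_nonneg)
  have wx: "(w x)\<^sup>2 \<le> 2 * ?O\<^sup>2 + 2 * V\<^sup>2"
  proof -
    have "\<bar>w x\<bar> \<le> ?O + V" by (simp add: V_def)
    then have "(w x)\<^sup>2 \<le> (?O + V)\<^sup>2" by (rule square_le_if_abs_le)
    also have "\<dots> \<le> 2 * ?O\<^sup>2 + 2 * V\<^sup>2" by (rule square_sum_le)
    finally show ?thesis .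
  qed
  have wy: "(w y)\<^sup>2 \<le> 2 * (w x)\<^sup>2 + 2 * (w y - w x)\<^sup>2" using square_sum_le[of "w x" "w y - w x"] by simp
  have T0v: "T0 \<in> vnbrs T0" unfolding vnbrs_def using T0 v0 by blast
  have G0: "Gen w T0 \<le> X"
  proof -
    have "Gen w T0 \<le> Gen w T0 + inverse ?h * Jen w T0" using hp Jen_nonneg[of w T0] by simp
    also have "\<dots> \<le> X" unfolding X_def
      using member_le_sum[OF T0v, of "\<lambda>T. Gen w T + inverse (diameter T) * Jen w T"] finite_vnbrs Xi by (auto simp: vnbrs_def)
    finally show ?thesis .
  qed
  have "?h ^ ?m * (w y)\<^sup>2 \<le> ?h ^ ?m * (4 * ?O\<^sup>2 + 4 * V\<^sup>2 + 2 * (w y - w x)\<^sup>2)"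
    using wx wy hp by (intro mult_left_mono) auto
  also have "\<dots> = 4 * (?h ^ ?m * ?O\<^sup>2) + 4 * (?h ^ ?m * V\<^sup>2) + 2 * (?h ^ ?m * (w y - w x)\<^sup>2)"
    by (simp only: distrib_left mult.left_commute)
  also have "\<dots> \<le> 4 * (real (mult_bound CARD('n) \<sigma>) * Co * ?t ^ ?m * X) + 4 * ((2 / ?c) ^ (?n - 1) / ?u * ?t * X) + 2 * (Co * X)"
  proof -
    have "?h ^ ?m * (w y - w x)\<^sup>2 \<le> Co * X"
      using wosc[OF T0m y xT] mult_left_mono[OF G0, of Co] Co(1) by linarith
    then show ?thesis using O2 V2 by linarith
  qed
  also have "\<dots> = key_const ?n \<sigma> r K D Co * X"
    unfolding key_const_def by (simp only: distrib_right mult.assoc)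
  finally show ?thesis unfolding X_def .
qed

lemma card_vnbrs: "real (card {T0\<in>cut_mesh S. T \<in> vnbrs T0}) \<le> real ((CARD('n) + 1) * (mult_bound CARD('n) \<sigma>))" if T: "T \<in> mesh S"
proof -
  have "{T0\<in>cut_mesh S. T \<in> vnbrs T0} \<subseteq> (\<Union>v\<in>verts T. {T0\<in>mesh S. v \<in> T0})"
    unfolding vnbrs_def using verts_subset cut_mesh_subset by blast
  then have "card {T0\<in>cut_mesh S. T \<in> vnbrs T0} \<le> card (\<Union>v\<in>verts T. {T0\<in>mesh S. v \<in> T0})"
    using finite_verts[OF nsimplex_mesh[OF T]] finite_mesh by (intro card_mono) auto
  also have "\<dots> \<le> (\<Sum>v\<in>verts T. card {T0\<in>mesh S. v \<in> T0})"
    by (rule card_UN_le[OF finite_verts[OF nsimplex_mesh[OF T]]])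
  also have "\<dots> \<le> (\<Sum>v\<in>verts T. (mult_bound CARD('n) \<sigma>))" by (intro sum_mono card_at_point)
  also have "\<dots> = (CARD('n) + 1) * (mult_bound CARD('n) \<sigma>)" using card_verts[OF nsimplex_mesh[OF T]] by simp
  finally show ?thesis by (rule of_nat_mono)
qed

text \<open>Finite overlap: after exchanging the sums, each simplex is counted once for every cut
  simplex sharing a vertex with it.\<close>

lemma sum_vnbrs_le:
  assumes X: "\<And>T. T \<in> cut_mesh S \<Longrightarrow> 0 \<le> X T"
  shows "(\<Sum>T0\<in>cut_mesh S. \<Sum>T\<in>vnbrs T0. X T) \<le> real ((CARD('n) + 1) * (mult_bound CARD('n) \<sigma>)) * (\<Sum>T\<in>cut_mesh S. X T)"
proof -
  have "(\<Sum>T0\<in>cut_mesh S. \<Sum>T\<in>vnbrs T0. X T) = (\<Sum>T0\<in>cut_mesh S. \<Sum>T\<in>cut_mesh S. if T \<in> vnbrs T0 then X T else 0)"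
    using finite_cut_mesh by (intro sum.cong refl sum.mono_neutral_cong_left) (auto simp: vnbrs_def)
  also have "\<dots> = (\<Sum>T\<in>cut_mesh S. \<Sum>T0\<in>cut_mesh S. if T \<in> vnbrs T0 then X T else 0)" by (rule sum.swap)
  also have "\<dots> = (\<Sum>T\<in>cut_mesh S. real (card {T0\<in>cut_mesh S. T \<in> vnbrs T0}) * X T)"
    using finite_cut_mesh by (intro sum.cong refl) (simp add: sum.If_cases Int_def)
  also have "\<dots> \<le> (\<Sum>T\<in>cut_mesh S. real ((CARD('n) + 1) * (mult_bound CARD('n) \<sigma>)) * X T)"
    using X card_vnbrs cut_mesh_subset by (intro sum_mono mult_right_mono) auto
  finally show ?thesis by (simp add: sum_distrib_left)
qed

end

section \<open>The bilinear forms on piecewise polynomials\<close>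

lemma set_integral_linear:
  fixes f g :: "'a \<Rightarrow> real"
  assumes "set_integrable M A f" "set_integrable M A g"
  shows "(LINT x:A|M. c * f x + g x) = c * (LINT x:A|M. f x) + (LINT x:A|M. g x)"
  using assms by (simp add: set_integral_add)

lemma lgrad_nth: "lgrad k u T x $ i = pd i (lpoly k u T) x"
  unfolding lgrad_def pd_def by simp

lemma norm_lgrad: "(norm (lgrad k u T x))\<^sup>2 = grad2 (lpoly k u T) x"
  unfolding norm_vec_def L2_set_def grad2_def by (simp add: sum_nonneg lgrad_nth)

text \<open>The coefficients are the partial derivatives at the origin. They cannot all vanish,
  because the coordinate distinguishes \<open>v\<close> from another vertex.\<close>

lemma bary_formula:
  fixes T :: "(real ^ 'n::finite) set"
  assumes T: "nsimplex T" and v: "v \<in> verts T"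
  obtains c where "\<And>x y. bary T v x - bary T v y = (\<Sum>i\<in>UNIV. c i * (x $ i - y $ i))" "\<exists>i. c i \<noteq> 0"
proof -
  obtain q where q: "\<And>x. (bary T v has_derivative (\<lambda>h. \<Sum>i\<in>UNIV. h $ i * q i x)) (at x)"
    using poly_le_derivative_ex[OF bary_poly_le[OF T v]] by blast
  define c where "c i = q i 0" for i
  have *: "bary T v x - bary T v y = (\<Sum>i\<in>UNIV. c i * (x $ i - y $ i))" for x y
  proof -
    have line: "bary T v (t *\<^sub>R (x - y)) = bary T v 0 + t * (bary T v x - bary T v y)" for t
      using bary_move[OF T v, of 0 t x y] by simp
    have "((\<lambda>t. bary T v (0 + t *\<^sub>R (x - y))) has_real_derivative (\<Sum>i\<in>UNIV. (x - y) $ i * pd i (bary T v) (0 + 0 *\<^sub>R (x - y)))) (at 0)"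
      by (rule poly_le_line_deriv[OF bary_poly_le[OF T v]])
    then have "((\<lambda>t. bary T v 0 + t * (bary T v x - bary T v y)) has_real_derivative (\<Sum>i\<in>UNIV. (x - y) $ i * pd i (bary T v) 0)) (at 0)"
      by (simp add: line)
    moreover have "((\<lambda>t. bary T v 0 + t * (bary T v x - bary T v y)) has_real_derivative (bary T v x - bary T v y)) (at 0)"
      by (auto intro!: derivative_eq_intros)
    moreover have "pd i (bary T v) 0 = c i" for i unfolding c_def by (rule pd_unique[OF q])
    ultimately show ?thesis using DERIV_unique by (fastforce simp: mult.commute)
  qed
  have "\<exists>i. c i \<noteq> 0"
  proof (rule ccontr)
    assume "\<not> ?thesis"
    then have eq: "bary T v x = bary T v y" for x y using *[of x y] by simp
    have "verts T \<noteq> {v}" using card_verts[OF T] by auto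
    then obtain w where "w \<in> verts T" "w \<noteq> v" using v by blast
    then show False using eq[of v w] bary_vertex[OF T v v] bary_vertex[OF T v, of w] by auto
  qed
  then show thesis using that * by blast
qed

text \<open>A facet lies in the hyperplane where the coordinate of the opposite vertex is 0. Solving
  this equation for a component with nonzero coefficient presents the facet as a bounded Lipschitz
  graph.\<close>

lemma facet_measure_finite:
  fixes T :: "(real ^ 'n::finite) set"
  assumes T: "nsimplex T" and F: "F facet_of T" shows "hausdorff_outer (CARD('n) - 1) F < top"
proof -
  have "F facet_of convex hull (verts T)" using F convex_hull_verts[OF T] by simp
  then obtain v where v: "v \<in> verts T" "F = convex hull (verts T - {v})"
    using facet_of_convex_hull_affine_independent[OF affine_independent_verts[OF T]] by blast
  have face: "F face_of T" using F facet_of_imp_face_of by blast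
  have vF: "v \<notin> F"
  proof
    assume "v \<in> F"
    then have "verts T \<subseteq> F" using v(2) hull_subset[of "verts T - {v}" convex] by auto
    then have "T \<subseteq> F" using convex_hull_verts[OF T] hull_minimal[of "verts T" F convex] v(2) by simp
    then have "F = T" using face face_of_imp_subset by blast
    then show False using F facet_of_irrefl by blast
  qed
  have z: "bary T v x = 0" if "x \<in> F" for x by (rule bary_face_zero[OF T face that v(1) vF])
  obtain c where c: "\<And>x y. bary T v x - bary T v y = (\<Sum>i\<in>UNIV. c i * (x $ i - y $ i))" "\<exists>i. c i \<noteq> 0"
    using bary_formula[OF T v(1)] by metis
  then obtain i where i: "c i \<noteq> 0" by blast
  let ?B = "\<Sum>j\<in>UNIV. \<bar>c j\<bar>"
  show ?thesis
  proof (rule hausdorff_outer_graph_finite[where i = i and C = "?B / \<bar>c i\<bar>"])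
    show "bounded F"
      using compact_imp_bounded[OF compact_nsimplex[OF T]] face_of_imp_subset[OF face] bounded_subset by blast
    show "0 \<le> ?B / \<bar>c i\<bar>" by (intro divide_nonneg_nonneg sum_nonneg) auto
    fix x y assume xy: "x \<in> F" "y \<in> F"
    have "0 = (\<Sum>j\<in>UNIV. c j * (x $ j - y $ j))" using c(1)[of x y] z xy by simp
    also have "\<dots> = c i * (x $ i - y $ i) + (\<Sum>j\<in>UNIV - {i}. c j * (x $ j - y $ j))" by (subst sum.remove[of _ i]) auto
    finally have "c i * (x $ i - y $ i) = - (\<Sum>j\<in>UNIV - {i}. c j * (x $ j - y $ j))" by linarith
    then have "\<bar>c i\<bar> * \<bar>x $ i - y $ i\<bar> = \<bar>\<Sum>j\<in>UNIV - {i}. c j * (x $ j - y $ j)\<bar>" by (metis abs_minus_cancel abs_mult)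
    also have "\<dots> \<le> (\<Sum>j\<in>UNIV - {i}. \<bar>c j * (x $ j - y $ j)\<bar>)" by (rule sum_abs)
    also have "\<dots> \<le> (\<Sum>j\<in>UNIV - {i}. ?B * \<bar>x $ j - y $ j\<bar>)"
      unfolding abs_mult by (intro sum_mono mult_right_mono member_le_sum) auto
    finally have "\<bar>c i\<bar> * \<bar>x $ i - y $ i\<bar> \<le> ?B * (\<Sum>j\<in>UNIV - {i}. \<bar>x $ j - y $ j\<bar>)" by (simp only: sum_distrib_left)
    then show "\<bar>x $ i - y $ i\<bar> \<le> ?B / \<bar>c i\<bar> * (\<Sum>j\<in>UNIV - {i}. \<bar>x $ j - y $ j\<bar>)"
      using i by (simp add: pos_le_divide_eq mult.commute)
  qed
qed

lemma grad2_diff_le: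
  assumes "p \<in> poly_le k" "q \<in> poly_le k"
  shows "grad2 (\<lambda>x. p x - q x) x \<le> 2 * grad2 p x + 2 * grad2 q x"
proof -
  have "pd i (\<lambda>x. p x - q x) x = pd i p x - pd i q x" for i
    using fun_cong[OF pd_linear[OF assms(2,1), of i "-1"], of x] by (simp add: algebra_simps)
  then have "grad2 (\<lambda>x. p x - q x) x = (\<Sum>i\<in>UNIV. (pd i p x - pd i q x)\<^sup>2)" by (simp add: grad2_def)
  also have "\<dots> \<le> (\<Sum>i\<in>UNIV. 2 * (pd i p x)\<^sup>2 + 2 * (pd i q x)\<^sup>2)"
  proof (rule sum_mono)
    fix i show "(pd i p x - pd i q x)\<^sup>2 \<le> 2 * (pd i p x)\<^sup>2 + 2 * (pd i q x)\<^sup>2"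
      using zero_le_power2[of "pd i p x + pd i q x"] by (simp add: power2_eq_square algebra_simps)
  qed
  finally show ?thesis by (simp add: grad2_def sum.distrib sum_distrib_left)
qed

context cutfem_geom
begin

text \<open>The pairs of functions on which the forms are bilinear: on them \<open>lpoly\<close>
  acts linearly and all integrals exist. No continuity across faces is demanded.\<close>

definition pw :: "(nat \<Rightarrow> real ^ 'n \<Rightarrow> real) \<Rightarrow> bool" where
  "pw u \<longleftrightarrow> (\<forall>i\<in>{1,2}. \<forall>T\<in>act_mesh S i. \<exists>p\<in>poly_le (deg S). \<forall>x\<in>T. u i x = p x)"

abbreviation lp where "lp u i T \<equiv> lpoly (deg S) (u i) T"

lemma act_mesh_subset: "T \<in> act_mesh S i \<Longrightarrow> T \<in> mesh S" unfolding act_mesh_def by simp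

lemma finite_act_mesh: "finite (act_mesh S i)" unfolding act_mesh_def using finite_mesh by simp

lemma pw_lpoly:
  assumes "pw u" "i \<in> {1,2}" "T \<in> act_mesh S i"
  shows "lp u i T \<in> poly_le (deg S)" and "\<And>x. x \<in> T \<Longrightarrow> lp u i T x = u i x"
proof -
  obtain p where p: "p \<in> poly_le (deg S)" "\<forall>x\<in>T. u i x = p x" using assms unfolding pw_def by blast
  have "lp u i T = p" using p by (intro lpoly_eq[OF nsimplex_mesh[OF act_mesh_subset[OF assms(3)]] deg_pos]) auto
  then show "lp u i T \<in> poly_le (deg S)" "\<And>x. x \<in> T \<Longrightarrow> lp u i T x = u i x" using p by auto
qed

lemma lpoly_pw_linear:
  assumes u: "pw u" and v: "pw v" and i: "i \<in> {1,2}" "T \<in> act_mesh S i"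
  shows "lpoly (deg S) (\<lambda>x. c * u i x + v i x) T = (\<lambda>x. c * lp u i T x + lp v i T x)"
  using pw_lpoly[OF u i] pw_lpoly[OF v i]
  by (intro lpoly_eq[OF nsimplex_mesh[OF act_mesh_subset[OF i(2)]] deg_pos]) (auto intro: poly_le_add poly_le_cmult)

lemma pw_linear: assumes "pw u" "pw v" shows "pw (\<lambda>i x. c * u i x + v i x)"
  unfolding pw_def
proof (intro ballI)
  fix i T assume i: "i \<in> {1,2::nat}" and T: "T \<in> act_mesh S i"
  show "\<exists>p\<in>poly_le (deg S). \<forall>x\<in>T. c * u i x + v i x = p x"
    using pw_lpoly[OF assms(1) i T] pw_lpoly[OF assms(2) i T]
    by (intro bexI[of _ "\<lambda>x. c * lp u i T x + lp v i T x"]) (auto intro: poly_le_add poly_le_cmult)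
qed

lemma pw_zero: "pw (\<lambda>i x. 0)"
  unfolding pw_def by (intro ballI bexI[of _ "\<lambda>x. 0"]) (auto intro: poly_le_zero)

lemma pw_sum:
  assumes "\<And>j. j \<in> I \<Longrightarrow> pw (e j)" shows "pw (\<lambda>i x. \<Sum>j\<in>I. c j * e j i x)"
  using assms
proof (induction I rule: infinite_finite_induct)
  case (insert j I)
  have "pw (\<lambda>i x. c j * e j i x + (\<Sum>j\<in>I. c j * e j i x))" using insert by (intro pw_linear) auto
  then show ?case using insert by simp
qed (auto intro: pw_zero)

lemma lgrad_linear:
  assumes u: "pw u" and v: "pw v" and i: "i \<in> {1,2}" "T \<in> act_mesh S i"
  shows "lgrad (deg S) (\<lambda>x. c * u i x + v i x) T x = c *\<^sub>R lgrad (deg S) (u i) T x + lgrad (deg S) (v i) T x"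
proof -
  have "lgrad (deg S) (\<lambda>x. c * u i x + v i x) T x $ j
      = (c *\<^sub>R lgrad (deg S) (u i) T x + lgrad (deg S) (v i) T x) $ j" for j
    using fun_cong[OF pd_linear[OF pw_lpoly(1)[OF u i] pw_lpoly(1)[OF v i], of j c], of x]
    by (simp add: lgrad_nth lpoly_pw_linear[OF u v i])
  then show ?thesis by (simp add: Finite_Cartesian_Product.vec_eq_iff)
qed

lemma continuous_lgrad:
  assumes u: "pw u" and i: "i \<in> {1,2}" "T \<in> act_mesh S i"
  shows "continuous_on A (lgrad (deg S) (u i) T)"
proof -
  have "lgrad (deg S) (u i) T = (\<lambda>x. \<chi> j. pd j (lp u i T) x)"
    by (auto simp: fun_eq_iff Finite_Cartesian_Product.vec_eq_iff lgrad_nth)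
  then show ?thesis
    by (simp only:) (intro continuous_on_vec_lambda poly_le_continuous[OF pd_poly_le[OF pw_lpoly(1)[OF u i]]])
qed

lemma bulk_linear:
  assumes u: "pw u" "pw u'" and v: "pw v"
  shows "bulk S (\<lambda>i x. c * u i x + u' i x) v = c * bulk S u v + bulk S u' v"
proof -
  let ?f = "\<lambda>u i T x. coef S i * inner (lgrad (deg S) (u i) T x) (lgrad (deg S) (v i) T x)"
  have *: "(LINT x:T \<inter> sub S i|lborel. ?f (\<lambda>i x. c * u i x + u' i x) i T x)
     = c * (LINT x:T \<inter> sub S i|lborel. ?f u i T x) + (LINT x:T \<inter> sub S i|lborel. ?f u' i T x)"
    if i: "i \<in> {1,2}" and T: "T \<in> act_mesh S i" for i T
  proof -
    have int: "set_integrable lborel (T \<inter> sub S i) (?f u i T)" if "pw u" for u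
    proof (rule set_integrable_poly)
      show "T \<inter> sub S i \<in> sets borel" using closed_mesh[OF act_mesh_subset[OF T]] open_sub[OF i] by auto
      show "bounded (T \<inter> sub S i)"
        using compact_imp_bounded[OF compact_nsimplex[OF nsimplex_mesh[OF act_mesh_subset[OF T]]]] bounded_subset by blast
      show "continuous_on UNIV (?f u i T)" by (intro continuous_intros continuous_lgrad that v i T)
    qed
    have "?f (\<lambda>i x. c * u i x + u' i x) i T x = c * ?f u i T x + ?f u' i T x" for x
      unfolding lgrad_linear[OF u i T] inner_add_left inner_scaleR_left by (simp add: algebra_simps)
    then show ?thesis using set_integral_linear[OF int[OF u(1)] int[OF u(2)], of c] by simp
  qed
  show ?thesis unfolding bulk_def sum_distrib_left sum.distrib[symmetric] by (intro sum.cong refl) (rule *)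
qed

lemma continuous_jump:
  assumes u: "pw u" and T: "T \<in> cut_mesh S" shows "continuous_on (T \<inter> Gam) (jumpG u)"
proof -
  have "jumpG u x = lp u 1 T x - lp u 2 T x" if "x \<in> T \<inter> Gam" for x
    using pw_lpoly(2)[OF u, of 1 T x] pw_lpoly(2)[OF u, of 2 T x] cut_mesh_subset_act_mesh[OF T] that by (simp add: jumpG_def)
  moreover have "continuous_on (T \<inter> Gam) (\<lambda>x. lp u 1 T x - lp u 2 T x)"
    using pw_lpoly(1)[OF u] cut_mesh_subset_act_mesh[OF T]
    by (intro continuous_intros poly_le_continuous[where k = "deg S"]) auto
  ultimately show ?thesis using continuous_on_cong[of "T \<inter> Gam" "T \<inter> Gam" "jumpG u" "\<lambda>x. lp u 1 T x - lp u 2 T x"] by simp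
qed

lemma jumpG_linear: "jumpG (\<lambda>i x. c * u i x + v i x) x = c * jumpG u x + jumpG v x"
  unfolding jumpG_def by (simp add: algebra_simps)

lemma jump_form_linear:
  assumes u: "pw u" "pw u'" and v: "pw v"
  shows "jump_form S (\<lambda>i x. c * u i x + u' i x) v = c * jump_form S u v + jump_form S u' v"
proof -
  have *: "(LINT x:T \<inter> Gam|surf. jumpG (\<lambda>i x. c * u i x + u' i x) x * jumpG v x)
     = c * (LINT x:T \<inter> Gam|surf. jumpG u x * jumpG v x) + (LINT x:T \<inter> Gam|surf. jumpG u' x * jumpG v x)"
    if T: "T \<in> cut_mesh S" for T
  proof -
    have int: "set_integrable surf (T \<inter> Gam) (\<lambda>x. jumpG u x * jumpG v x)" if "pw u" for u
      by (rule set_integrable_interface_continuous[OF Int_lower2 closed_Int_interface[OF cut_mesh_subset[OF T]]])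
        (intro continuous_intros continuous_jump that v T)
    have "jumpG (\<lambda>i x. c * u i x + u' i x) x * jumpG v x = c * (jumpG u x * jumpG v x) + jumpG u' x * jumpG v x" for x
      unfolding jumpG_linear by (simp add: algebra_simps)
    then show ?thesis using set_integral_linear[OF int[OF u(1)] int[OF u(2)], of c] by simp
  qed
  show ?thesis unfolding jump_form_def sum_distrib_left sum.distrib[symmetric]
    by (intro sum.cong refl) (simp only: * distrib_left mult.left_commute)
qed

definition nit :: "(nat \<Rightarrow> real ^ 'n \<Rightarrow> real) \<Rightarrow> (nat \<Rightarrow> real ^ 'n \<Rightarrow> real) \<Rightarrow> (real ^ 'n) set \<Rightarrow> real ^ 'n \<Rightarrow> real" where
  "nit u v T x = inner (\<Sum>i\<in>{1,2}. wt S i x *\<^sub>R (- (coef S i *\<^sub>R lgrad (deg S) (v i) T x))) (nrm S x) * jumpG u x"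

lemma nit_expand:
  "nit u v T x = - (wt S 1 x * (coef S 1 * inner (lgrad (deg S) (v 1) T x) (nrm S x))
    + wt S 2 x * (coef S 2 * inner (lgrad (deg S) (v 2) T x) (nrm S x))) * jumpG u x"
proof -
  have "inner (\<Sum>i\<in>{1,2}. wt S i x *\<^sub>R (- (coef S i *\<^sub>R lgrad (deg S) (v i) T x))) n
    = - (wt S 1 x * (coef S 1 * inner (lgrad (deg S) (v 1) T x) n) + wt S 2 x * (coef S 2 * inner (lgrad (deg S) (v 2) T x) n))" for n
    unfolding inner_sum_left by (simp add: inner_minus_left)
  then show ?thesis unfolding nit_def by simp
qed

lemma wt_bounds: "i \<in> {1,2} \<Longrightarrow> wt S i \<in> borel_measurable borel" "i \<in> {1,2} \<Longrightarrow> \<bar>wt S i x\<bar> \<le> 1"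
proof -
  have W: "\<forall>i\<in>{1,2}. wt S i \<in> borel_measurable borel \<and> (\<forall>x. 0 \<le> wt S i x)" "\<forall>x. wt S 1 x + wt S 2 x = 1"
    using setting unfolding cutfem_setting_def by simp_all
  show "i \<in> {1,2} \<Longrightarrow> wt S i \<in> borel_measurable borel" using W(1) by blast
  have "0 \<le> wt S 1 x" "0 \<le> wt S 2 x" "wt S 1 x + wt S 2 x = 1" using W by auto
  then show "i \<in> {1,2} \<Longrightarrow> \<bar>wt S i x\<bar> \<le> 1" by auto
qed

lemma nit_integrable:
  assumes u: "pw u" and v: "pw v" and T: "T \<in> cut_mesh S"
  shows "set_integrable surf (T \<inter> Gam) (nit u v T)"
proof -
  let ?A = "T \<inter> Gam"
  have clA: "closed ?A" by (rule closed_Int_interface[OF cut_mesh_subset[OF T]])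
  have cA: "compact ?A" using clA compact_interface compact_Int_closed[of Gam T] closed_mesh[OF cut_mesh_subset[OF T]] by (simp add: Int_commute)
  \<comment> \<open>The weights are only measurable and bounded by 1; all the rest of the integrand
    is gathered in \<open>h\<close>, which is continuous on a compact set.\<close>
  define h where "h i x = - (coef S i * inner (lgrad (deg S) (v i) T x) (nrm S x) * jumpG u x)" for i x
  have hc: "continuous_on ?A (h i)" if i: "i \<in> {1,2}" for i
    unfolding h_def using continuous_on_subset[OF interface_normal_continuous, of ?A]
    by (intro continuous_intros continuous_lgrad[OF v i cut_mesh_subset_act_mesh[OF T i]] continuous_jump[OF u T]) auto
  have int: "set_integrable surf ?A (\<lambda>x. wt S i x * h i x)" if i: "i \<in> {1,2}" for i
  proof -
    have "bounded (h i ` ?A)" using hc[OF i] cA compact_continuous_image compact_imp_bounded by blast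
    then obtain B where B: "\<And>x. x \<in> ?A \<Longrightarrow> \<bar>h i x\<bar> \<le> B" unfolding bounded_iff by auto
    show ?thesis
    proof (rule set_integrable_interface[OF _ clA])
      have "(\<lambda>x. indicat_real ?A x *\<^sub>R h i x) \<in> borel_measurable borel"
        using borel_measurable_continuous_on_indicator[OF _ hc[OF i]] clA by auto
      then have "(\<lambda>x. wt S i x * (indicat_real ?A x *\<^sub>R h i x)) \<in> borel_measurable borel"
        by (intro borel_measurable_times wt_bounds(1)[OF i])
      then show "set_borel_measurable borel ?A (\<lambda>x. wt S i x * h i x)"
        unfolding set_borel_measurable_def by (simp add: mult_ac)
      fix x assume "x \<in> ?A"
      then have "\<bar>wt S i x\<bar> * \<bar>h i x\<bar> \<le> 1 * B" using wt_bounds(2)[OF i] B by (intro mult_mono) auto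
      then show "\<bar>wt S i x * h i x\<bar> \<le> B" by (simp add: abs_mult)
    qed simp
  qed
  have "nit u v T = (\<lambda>x. wt S 1 x * h 1 x + wt S 2 x * h 2 x)"
    unfolding nit_expand[abs_def] h_def by (simp only: fun_eq_iff) (simp add: algebra_simps)
  then show ?thesis using set_integral_add(1)[OF int[of 1] int[of 2]] by simp
qed

lemma nitsche_linear_left:
  assumes u: "pw u" "pw u'" and v: "pw v"
  shows "nitsche S (\<lambda>i x. c * u i x + u' i x) v = c * nitsche S u v + nitsche S u' v"
proof -
  have *: "(LINT x:T \<inter> Gam|surf. nit (\<lambda>i x. c * u i x + u' i x) v T x)
      = c * (LINT x:T \<inter> Gam|surf. nit u v T x) + (LINT x:T \<inter> Gam|surf. nit u' v T x)" if T: "T \<in> cut_mesh S" for T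
  proof -
    have "nit (\<lambda>i x. c * u i x + u' i x) v T x = c * nit u v T x + nit u' v T x" for x
      unfolding nit_def jumpG_linear by (simp only: distrib_left mult.left_commute)
    then show ?thesis using set_integral_linear[OF nit_integrable[OF u(1) v T] nit_integrable[OF u(2) v T], of c] by simp
  qed
  show ?thesis unfolding nitsche_def nit_def[symmetric] sum_distrib_left sum.distrib[symmetric]
    by (intro sum.cong refl) (rule *)
qed

lemma nitsche_linear_right:
  assumes u: "pw u" "pw u'" and v: "pw v"
  shows "nitsche S v (\<lambda>i x. c * u i x + u' i x) = c * nitsche S v u + nitsche S v u'"
proof -
  have *: "(LINT x:T \<inter> Gam|surf. nit v (\<lambda>i x. c * u i x + u' i x) T x)
      = c * (LINT x:T \<inter> Gam|surf. nit v u T x) + (LINT x:T \<inter> Gam|surf. nit v u' T x)" if T: "T \<in> cut_mesh S" for T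
  proof -
    note act = cut_mesh_subset_act_mesh[OF T]
    have "nit v (\<lambda>i x. c * u i x + u' i x) T x = c * nit v u T x + nit v u' T x" for x
    proof -
      have e: "lgrad (deg S) (\<lambda>x. c * u 1 x + u' 1 x) T x = c *\<^sub>R lgrad (deg S) (u 1) T x + lgrad (deg S) (u' 1) T x"
        "lgrad (deg S) (\<lambda>x. c * u 2 x + u' 2 x) T x = c *\<^sub>R lgrad (deg S) (u 2) T x + lgrad (deg S) (u' 2) T x"
        by (rule lgrad_linear[OF u _ act], simp, simp)+
      have gen: "- (w1 * (a1 * (c * p + p')) + w2 * (a2 * (c * q + q'))) * J
          = c * (- (w1 * (a1 * p) + w2 * (a2 * q)) * J) + - (w1 * (a1 * p') + w2 * (a2 * q')) * J"
        for w1 a1 w2 a2 p p' q q' J :: real by (simp add: algebra_simps)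
      show ?thesis unfolding nit_expand e inner_add_left inner_scaleR_left by (rule gen)
    qed
    then show ?thesis using set_integral_linear[OF nit_integrable[OF v u(1) T] nit_integrable[OF v u(2) T], of c] by simp
  qed
  show ?thesis unfolding nitsche_def nit_def[symmetric] sum_distrib_left sum.distrib[symmetric]
    by (intro sum.cong refl) (rule *)
qed

lemma ghost_face:
  assumes "i \<in> {1,2}" "F \<in> ghost S i"
  obtains T T' where "T \<in> act_mesh S i" "T' \<in> act_mesh S i" "T \<noteq> T'" "F = T \<inter> T'" "F facet_of T"
proof -
  have "\<forall>i\<in>{1,2}. \<forall>F\<in>ghost S i. F \<subseteq> cut_dom S \<and>
        (\<exists>T\<in>act_mesh S i. \<exists>T'\<in>act_mesh S i. T \<noteq> T' \<and> F = T \<inter> T' \<and> F facet_of T)"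
    using setting unfolding cutfem_setting_def by (elim conjE)
  from bspec[OF bspec[OF this assms(1)] assms(2)] show ?thesis by (elim conjE bexE) (rule that)
qed

text \<open>\<open>face_nbrs\<close> may pick any two mesh simplices that meet in the face. Since a
  facet has only two neighbours, these are the active ones, on which the pair of functions is
  polynomial.\<close>

lemma face_nbrs_act:
  assumes i: "i \<in> {1,2}" and F: "F \<in> ghost S i"
  shows "fst (face_nbrs S F) \<in> act_mesh S i" "snd (face_nbrs S F) \<in> act_mesh S i"
proof -
  obtain T T' where T: "T \<in> act_mesh S i" "T' \<in> act_mesh S i" "T \<noteq> T'" "F = T \<inter> T'" "F facet_of T"
    using ghost_face[OF i F] by metis
  note Tm = act_mesh_subset[OF T(1)] act_mesh_subset[OF T(2)]
  let ?P = "\<lambda>q. case q of (T, T') \<Rightarrow> T \<in> mesh S \<and> T' \<in> mesh S \<and> T \<noteq> T' \<and> T \<inter> T' = F"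
  have "?P (T, T')" using T Tm by simp
  then have P: "?P (face_nbrs S F)" unfolding face_nbrs_def by (rule someI)
  have "R = T \<or> R = T'" if "R \<in> mesh S" "F \<subseteq> R" for R
    using facet_two_neighbours[OF Tm that(1) T(3)] T(4,5) that(2) dim_ge_2 by auto
  then show "fst (face_nbrs S F) \<in> act_mesh S i" "snd (face_nbrs S F) \<in> act_mesh S i"
    using P T(1,2) by (auto simp: case_prod_beta)
qed

lemma ghost_form_linear:
  assumes u: "pw u" "pw u'" and v: "pw v"
  shows "ghost_form S (\<lambda>i x. c * u i x + u' i x) v = c * ghost_form S u v + ghost_form S u' v"
proof -
  have *: "(LINT x:F|surf. face_jump S l F (\<lambda>x. c * u i x + u' i x) x * face_jump S l F (v i) x)
     = c * (LINT x:F|surf. face_jump S l F (u i) x * face_jump S l F (v i) x)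
       + (LINT x:F|surf. face_jump S l F (u' i) x * face_jump S l F (v i) x)"
    if i: "i \<in> {1,2}" and F: "F \<in> ghost S i" for i l F
  proof -
    note nb = face_nbrs_act[OF i F]
    obtain T T' where T: "T \<in> act_mesh S i" "T' \<in> act_mesh S i" "F = T \<inter> T'" "F facet_of T"
      using ghost_face[OF i F] by metis
    note nT = nsimplex_mesh[OF act_mesh_subset[OF T(1)]]
    have clF: "closed F" unfolding T(3) using closed_mesh[OF act_mesh_subset[OF T(1)]] closed_mesh[OF act_mesh_subset[OF T(2)]] by blast
    have cF: "compact F" unfolding T(3) using compact_nsimplex[OF nT] closed_mesh[OF act_mesh_subset[OF T(2)]] by (rule compact_Int_closed)
    have fin: "hausdorff_outer (CARD('n) - 1) F < top" by (rule facet_measure_finite[OF nT T(4)])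
    have fc: "continuous_on F (face_jump S l F (u i))" if "pw u" for u
      unfolding face_jump_def[abs_def] using pw_lpoly(1)[OF that i nb(1)] pw_lpoly(1)[OF that i nb(2)]
      by (intro continuous_intros poly_le_continuous[OF dir_deriv_poly_le(1)])
    have int: "set_integrable surf F (\<lambda>x. face_jump S l F (u i) x * face_jump S l F (v i) x)" if "pw u" for u
    proof -
      have c: "continuous_on F (\<lambda>x. face_jump S l F (u i) x * face_jump S l F (v i) x)"
        by (intro continuous_intros fc that v)
      then have "bounded ((\<lambda>x. face_jump S l F (u i) x * face_jump S l F (v i) x) ` F)"
        using cF compact_continuous_image compact_imp_bounded by blast
      then obtain B where "\<And>x. x \<in> F \<Longrightarrow> \<bar>face_jump S l F (u i) x * face_jump S l F (v i) x\<bar> \<le> B"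
        unfolding bounded_iff by auto
      moreover have "set_borel_measurable borel F (\<lambda>x. face_jump S l F (u i) x * face_jump S l F (v i) x)"
        unfolding set_borel_measurable_def using borel_measurable_continuous_on_indicator[OF _ c] clF by auto
      ultimately show ?thesis using clF fin by (intro set_integrable_hausdorff) auto
    qed
    have lin: "dir_deriv l (face_nrm F) (lpoly (deg S) (\<lambda>x. c * u i x + u' i x) R) x
       = c * dir_deriv l (face_nrm F) (lp u i R) x + dir_deriv l (face_nrm F) (lp u' i R) x" if "R \<in> act_mesh S i" for R x
      unfolding lpoly_pw_linear[OF u i that] by (rule dir_deriv_linear[OF pw_lpoly(1)[OF u(1) i that] pw_lpoly(1)[OF u(2) i that]])
    have "face_jump S l F (\<lambda>x. c * u i x + u' i x) x = c * face_jump S l F (u i) x + face_jump S l F (u' i) x" for x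
      unfolding face_jump_def lin[OF nb(1)] lin[OF nb(2)] by (simp add: algebra_simps)
    then have "face_jump S l F (\<lambda>x. c * u i x + u' i x) x * face_jump S l F (v i) x
        = c * (face_jump S l F (u i) x * face_jump S l F (v i) x) + face_jump S l F (u' i) x * face_jump S l F (v i) x" for x
      by (simp add: algebra_simps)
    then show ?thesis using set_integral_linear[OF int[OF u(1)] int[OF u(2)], of c] by simp
  qed
  let ?G = "\<lambda>u. \<Sum>i\<in>{1,2}. \<Sum>l=1..deg S. \<Sum>F\<in>ghost S i.
     diameter F ^ (2 * l - 1) * (LINT x:F|surf. face_jump S l F (u i) x * face_jump S l F (v i) x)"
  have "?G (\<lambda>i x. c * u i x + u' i x) = c * ?G u + ?G u'"
    unfolding sum_distrib_left sum.distrib[symmetric]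
    by (intro sum.cong refl) (simp only: * distrib_left mult.left_commute)
  then show ?thesis unfolding ghost_form_def by (simp only: distrib_left mult.left_commute)
qed

lemma Ah_linear:
  assumes "pw u" "pw u'" "pw v"
  shows "Ah S (\<lambda>i x. c * u i x + u' i x) v = c * Ah S u v + Ah S u' v"
  unfolding Ah_def bulk_linear[OF assms] jump_form_linear[OF assms] ghost_form_linear[OF assms]
    nitsche_linear_left[OF assms] nitsche_linear_right[OF assms] by (simp add: algebra_simps)

lemma Ah_commute: "Ah S u v = Ah S v u"
proof -
  have "bulk S u v = bulk S v u" unfolding bulk_def by (simp add: inner_commute)
  moreover have "jump_form S u v = jump_form S v u" unfolding jump_form_def by (simp add: mult.commute)
  moreover have "ghost_form S u v = ghost_form S v u" unfolding ghost_form_def by (simp add: mult.commute)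
  ultimately show ?thesis unfolding Ah_def by simp
qed

lemma Ah_zero: assumes "pw v" shows "Ah S (\<lambda>i x. 0) v = 0"
  using Ah_linear[OF pw_zero pw_zero assms, of 1] by simp

lemma Ah_sum_left:
  assumes "\<And>j. j \<in> I \<Longrightarrow> pw (e j)" "pw v"
  shows "Ah S (\<lambda>i x. \<Sum>j\<in>I. c j * e j i x) v = (\<Sum>j\<in>I. c j * Ah S (e j) v)"
  using assms(1)
proof (induction I rule: infinite_finite_induct)
  case (insert j I)
  have "Ah S (\<lambda>i x. c j * e j i x + (\<Sum>j\<in>I. c j * e j i x)) v
      = c j * Ah S (e j) v + Ah S (\<lambda>i x. \<Sum>j\<in>I. c j * e j i x) v"
    using insert by (intro Ah_linear pw_sum assms(2)) auto
  then show ?case using insert by simp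
qed (simp_all add: Ah_zero[OF assms(2)])

lemma Ah_sum_right:
  assumes "\<And>j. j \<in> I \<Longrightarrow> pw (e j)" "pw v"
  shows "Ah S v (\<lambda>i x. \<Sum>j\<in>I. c j * e j i x) = (\<Sum>j\<in>I. c j * Ah S v (e j))"
  using Ah_sum_left[OF assms, where c = c] by (simp add: Ah_commute[of v])

lemma Ah_expand:
  assumes u: "pw u" and v: "pw v"
  shows "Ah S (\<lambda>i x. c * u i x + v i x) (\<lambda>i x. c * u i x + v i x) = c\<^sup>2 * Ah S u u + 2 * c * Ah S u v + Ah S v v"
proof -
  have uv: "pw (\<lambda>i x. c * u i x + v i x)" by (rule pw_linear[OF u v])
  show ?thesis
    unfolding Ah_linear[OF u v uv] Ah_commute[of u "\<lambda>i x. c * u i x + v i x"] Ah_commute[of v "\<lambda>i x. c * u i x + v i x"]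
      Ah_linear[OF u v u] Ah_linear[OF u v v] Ah_commute[of v u]
    by (simp add: power2_eq_square algebra_simps)
qed

end

section \<open>The stable splitting\<close>

context cutfem_geom
begin

lemma I\<Gamma>_subset: "I\<Gamma> S \<subseteq> I0 S" unfolding I\<Gamma>_def by blast

lemma finite_I\<Gamma>: "finite (I\<Gamma> S)" using I\<Gamma>_subset finite_I0 by (rule finite_subset)

lemma I\<Gamma>_sub_subset: "I\<Gamma>_sub S i \<subseteq> I\<Gamma> S" unfolding I\<Gamma>_sub_def by blast

lemma I\<Gamma>_sub_2: "I\<Gamma>_sub S 2 = I\<Gamma> S - I\<Gamma>_sub S 1"
proof -
  have "j \<in> sub S 1 \<longleftrightarrow> j \<notin> sub S 2" if "j \<in> I\<Gamma> S" for j
    using that I\<Gamma>_subset nodes_not_on_interface dom_split sub_disjoint unfolding I0_eq by blast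
  then show ?thesis unfolding I\<Gamma>_sub_def by blast
qed

lemma phi\<Gamma>_cut: "T \<in> cut_mesh S \<Longrightarrow> x \<in> T \<Longrightarrow> \<phi>\<Gamma> S j x = \<phi> S j x"
  unfolding \<phi>\<Gamma>_def restr_def cut_dom_def by auto

lemma phi\<Gamma>_node: "j \<in> I\<Gamma> S \<Longrightarrow> l \<in> I\<Gamma> S \<Longrightarrow> \<phi>\<Gamma> S j l = (if l = j then 1 else 0)"
  using phi_node[of j l] I\<Gamma>_subset unfolding \<phi>\<Gamma>_def restr_def I\<Gamma>_def by auto

lemma sum_I\<Gamma>_sub: "(\<Sum>j\<in>I\<Gamma>_sub S i. f j) = (\<Sum>j\<in>I\<Gamma> S. if j \<in> I\<Gamma>_sub S i then f j else (0::real))"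
  using sum.inter_restrict[OF finite_I\<Gamma>, of f "I\<Gamma>_sub S i"] I\<Gamma>_sub_subset by (simp add: Int_absorb1)

text \<open>The coefficients are the values at the nodes in \<open>I\<Gamma> S\<close>, so a
  function determines them and the description in \<open>Q\<close> singles out one function.\<close>

lemma Q_eq:
  "Q S i (\<lambda>x. \<Sum>j\<in>I\<Gamma> S. b j * \<phi>\<Gamma> S j x) = (\<lambda>x. \<Sum>j\<in>I\<Gamma>_sub S i. b j * \<phi>\<Gamma> S j x)"
  unfolding Q_def
proof (rule the_equality)
  fix w assume "\<exists>b'. (\<lambda>x. \<Sum>j\<in>I\<Gamma> S. b j * \<phi>\<Gamma> S j x) = (\<lambda>x. \<Sum>j\<in>I\<Gamma> S. b' j * \<phi>\<Gamma> S j x) \<and>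
    w = (\<lambda>x. \<Sum>j\<in>I\<Gamma>_sub S i. b' j * \<phi>\<Gamma> S j x)"
  then obtain b' where b': "(\<lambda>x. \<Sum>j\<in>I\<Gamma> S. b j * \<phi>\<Gamma> S j x) = (\<lambda>x. \<Sum>j\<in>I\<Gamma> S. b' j * \<phi>\<Gamma> S j x)"
    and w: "w = (\<lambda>x. \<Sum>j\<in>I\<Gamma>_sub S i. b' j * \<phi>\<Gamma> S j x)" by blast
  have val: "(\<Sum>j\<in>I\<Gamma> S. c j * \<phi>\<Gamma> S j l) = c l" if l: "l \<in> I\<Gamma> S" for c l
  proof -
    have "(\<Sum>j\<in>I\<Gamma> S. c j * \<phi>\<Gamma> S j l) = (\<Sum>j\<in>I\<Gamma> S. if l = j then c j else 0)"
      using l by (intro sum.cong refl) (auto simp: phi\<Gamma>_node)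
    then show ?thesis using l finite_I\<Gamma> by simp
  qed
  have "b l = b' l" if "l \<in> I\<Gamma> S" for l using fun_cong[OF b', of l] val[OF that] by simp
  then show "w = (\<lambda>x. \<Sum>j\<in>I\<Gamma>_sub S i. b j * \<phi>\<Gamma> S j x)"
    unfolding w using subsetD[OF I\<Gamma>_sub_subset] by (intro ext sum.cong) auto
qed blast

definition e0 :: "real ^ 'n \<Rightarrow> nat \<Rightarrow> real ^ 'n \<Rightarrow> real" where
  "e0 j i x = restr (act_dom S i) (\<phi> S j) x"

definition eG :: "real ^ 'n \<Rightarrow> nat \<Rightarrow> real ^ 'n \<Rightarrow> real" where
  "eG j i x = (if j \<in> I\<Gamma>_sub S i then \<phi>\<Gamma> S j x else 0)"

text \<open>The general pair in the image of \<open>L\<close>, parametrized by coefficients;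
  evaluating \<open>Ah\<close> on it gives the quadratic form of the stiffness matrix.\<close>

definition comb :: "(real ^ 'n \<Rightarrow> real) \<Rightarrow> (real ^ 'n \<Rightarrow> real) \<Rightarrow> nat \<Rightarrow> real ^ 'n \<Rightarrow> real" where
  "comb a b i x = (\<Sum>j\<in>I0 S. a j * e0 j i x) + (\<Sum>j\<in>I\<Gamma> S. b j * eG j i x)"

lemma L_comb:
  "L S (\<lambda>x. \<Sum>j\<in>I0 S. a j * \<phi> S j x, \<lambda>x. \<Sum>j\<in>I\<Gamma> S. b j * \<phi>\<Gamma> S j x) = comb a b"
proof (intro ext)
  fix i x
  have "restr (act_dom S i) (\<lambda>x. \<Sum>j\<in>I0 S. a j * \<phi> S j x) x = (\<Sum>j\<in>I0 S. a j * e0 j i x)"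
    unfolding restr_def e0_def by simp
  moreover have "(\<Sum>j\<in>I\<Gamma>_sub S i. b j * \<phi>\<Gamma> S j x) = (\<Sum>j\<in>I\<Gamma> S. b j * eG j i x)"
    unfolding sum_I\<Gamma>_sub eG_def by (intro sum.cong) auto
  ultimately show "L S (\<lambda>x. \<Sum>j\<in>I0 S. a j * \<phi> S j x, \<lambda>x. \<Sum>j\<in>I\<Gamma> S. b j * \<phi>\<Gamma> S j x) i x = comb a b i x"
    unfolding L_def comb_def by (simp add: Q_eq)
qed

lemma sum_indicator_coeff:
  fixes f :: "'b \<Rightarrow> real"
  assumes "finite I" "j \<in> I" shows "(\<Sum>l\<in>I. (if l = j then 1 else 0) * f l) = f j"
proof -
  have "(\<Sum>l\<in>I. (if l = j then 1 else 0) * f l) = (\<Sum>l\<in>I. if l = j then f l else 0)" by (intro sum.cong) auto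
  then show ?thesis using assms by simp
qed

lemma L_e0: assumes "j \<in> I0 S" shows "L S (\<phi> S j, \<lambda>x. 0) = e0 j"
proof -
  have "L S (\<phi> S j, \<lambda>x. 0) = comb (\<lambda>l. if l = j then 1 else 0) (\<lambda>l. 0)"
    using L_comb[of "\<lambda>l. if l = j then 1 else 0" "\<lambda>l. 0"] sum_indicator_coeff[OF finite_I0 assms] by simp
  then show ?thesis using sum_indicator_coeff[OF finite_I0 assms] by (simp add: comb_def fun_eq_iff)
qed

lemma L_eG: assumes "j \<in> I\<Gamma> S" shows "L S (\<lambda>x. 0, \<phi>\<Gamma> S j) = eG j"
proof -
  have "L S (\<lambda>x. 0, \<phi>\<Gamma> S j) = comb (\<lambda>l. 0) (\<lambda>l. if l = j then 1 else 0)"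
    using L_comb[of "\<lambda>l. 0" "\<lambda>l. if l = j then 1 else 0"] sum_indicator_coeff[OF finite_I\<Gamma> assms] by simp
  then show ?thesis using sum_indicator_coeff[OF finite_I\<Gamma> assms] by (simp add: comb_def fun_eq_iff)
qed

lemma pw_e0: assumes "j \<in> I0 S" shows "pw (e0 j)"
  unfolding pw_def
proof (intro ballI)
  fix i T assume T: "T \<in> act_mesh S i"
  obtain p where "p \<in> poly_le (deg S)" "\<forall>x\<in>T. \<phi> S j x = p x"
    using Vh_piece[OF phi_Vh[OF assms] act_mesh_subset[OF T]] by blast
  then show "\<exists>p\<in>poly_le (deg S). \<forall>x\<in>T. e0 j i x = p x"
    using T unfolding e0_def restr_def act_dom_def by (intro bexI[of _ p]) auto
qed

lemma eG_uncut:
  assumes j: "j \<in> I\<Gamma> S" and i: "i \<in> {1,2}" and T: "T \<in> act_mesh S i" "T \<notin> cut_mesh S" and x: "x \<in> T"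
  shows "eG j i x = 0"
proof (cases "j \<in> I\<Gamma>_sub S i")
  case True
  have j0: "j \<in> I0 S" using j I\<Gamma>_subset by blast
  have "j \<notin> T" using act_mesh_uncut[OF i T j0] True unfolding I\<Gamma>_sub_def by blast
  then show ?thesis using phi_eq_0[OF j0 act_mesh_subset[OF T(1)] x] unfolding eG_def \<phi>\<Gamma>_def restr_def by simp
qed (simp add: eG_def)

lemma pw_eG: assumes j: "j \<in> I\<Gamma> S" shows "pw (eG j)"
  unfolding pw_def
proof (intro ballI)
  fix i T assume i: "i \<in> {1,2::nat}" and T: "T \<in> act_mesh S i"
  have j0: "j \<in> I0 S" using j I\<Gamma>_subset by blast
  show "\<exists>p\<in>poly_le (deg S). \<forall>x\<in>T. eG j i x = p x"
  proof (cases "T \<in> cut_mesh S \<and> j \<in> I\<Gamma>_sub S i")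
    case True
    obtain p where "p \<in> poly_le (deg S)" "\<forall>x\<in>T. \<phi> S j x = p x"
      using Vh_piece[OF phi_Vh[OF j0] act_mesh_subset[OF T]] by blast
    then show ?thesis using True phi\<Gamma>_cut unfolding eG_def by (intro bexI[of _ p]) auto
  next
    case False
    then have "eG j i x = 0" if "x \<in> T" for x using eG_uncut[OF j i T _ that] by (auto simp: eG_def)
    then show ?thesis by (intro bexI[of _ "\<lambda>x. 0"]) (auto intro: poly_le_zero)
  qed
qed

lemma comb_linear: "comb (\<lambda>j. c * a j + a' j) (\<lambda>j. c * b j + b' j) = (\<lambda>i x. c * comb a b i x + comb a' b' i x)"
  unfolding comb_def by (intro ext) (simp add: sum.distrib sum_distrib_left algebra_simps)

lemma pw_comb: "pw (comb a b)"
proof -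
  have "pw (\<lambda>i x. 1 * (\<Sum>j\<in>I0 S. a j * e0 j i x) + (\<Sum>j\<in>I\<Gamma> S. b j * eG j i x))"
    using pw_e0 pw_eG by (intro pw_linear pw_sum) auto
  then show ?thesis unfolding comb_def[abs_def] by simp
qed

text \<open>The jump of \<^term>\<open>comb a b\<close> on the cut elements, as a single finite element function: since every
  node near the interface carries exactly one extra basis function, its nodal values are, up to
  sign, those of \<open>b\<close>.\<close>

definition jumpW :: "(real ^ 'n \<Rightarrow> real) \<Rightarrow> real ^ 'n \<Rightarrow> real" where
  "jumpW b x = (\<Sum>j\<in>I\<Gamma> S. (if j \<in> I\<Gamma>_sub S 1 then b j else - b j) * \<phi> S j x)"

lemma jumpW_Vh: "jumpW b \<in> Vh S"
  unfolding jumpW_def[abs_def] using I\<Gamma>_subset by (intro Vh_sum phi_Vh) auto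

lemma jumpG_comb: assumes "T \<in> cut_mesh S" "x \<in> T" shows "jumpG (comb a b) x = jumpW b x"
proof -
  have act: "x \<in> act_dom S i" if "i \<in> {1,2}" for i
    using cut_mesh_subset_act_mesh[OF assms(1) that] assms(2) unfolding act_dom_def by blast
  have "jumpG (comb a b) x = (\<Sum>j\<in>I\<Gamma> S. b j * eG j 1 x - b j * eG j 2 x)"
    unfolding jumpG_def comb_def e0_def restr_def using act by (simp add: sum_subtractf)
  also have "\<dots> = jumpW b x"
    unfolding jumpW_def eG_def I\<Gamma>_sub_2 phi\<Gamma>_cut[OF assms] by (intro sum.cong) auto
  finally show ?thesis .
qed

lemma jumpW_node:
  assumes "l \<in> I\<Gamma> S" shows "jumpW b l = (if l \<in> I\<Gamma>_sub S 1 then b l else - b l)"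
proof -
  have "jumpW b l = (\<Sum>j\<in>I\<Gamma> S. if l = j then (if j \<in> I\<Gamma>_sub S 1 then b j else - b j) else 0)"
    unfolding jumpW_def using subsetD[OF I\<Gamma>_subset] assms by (intro sum.cong refl) (auto simp: phi_node)
  then show ?thesis using assms finite_I\<Gamma> by simp
qed

section \<open>Energy of the pair, of its jump and of the extra part\<close>

definition En :: "(nat \<Rightarrow> real ^ 'n \<Rightarrow> real) \<Rightarrow> nat \<Rightarrow> (real ^ 'n) set \<Rightarrow> real" where
  "En u i T = (LINT x:T|lborel. grad2 (lp u i T) x)"

lemma En_nonneg: "0 \<le> En u i T" unfolding En_def by (rule set_integral_grad2_nonneg)

lemma energy_eq: "energy S u = (\<Sum>T\<in>act_mesh S 1. En u 1 T) + (\<Sum>T\<in>act_mesh S 2. En u 2 T) + jump_form S u u"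
  unfolding energy_def norm_lgrad En_def[symmetric] by simp

lemma jump_form_comb:
  "jump_form S (comb a b) (comb a b) = (\<Sum>T\<in>cut_mesh S. inverse (diameter T) * Jen (jumpW b) T)"
proof -
  have "(LINT x:T \<inter> Gam|surf. jumpG (comb a b) x * jumpG (comb a b) x) = Jen (jumpW b) T" if T: "T \<in> cut_mesh S" for T
  proof -
    have "indicator (T \<inter> Gam) x *\<^sub>R (jumpG (comb a b) x * jumpG (comb a b) x) = indicator (T \<inter> Gam) x *\<^sub>R (jumpW b x)\<^sup>2" for x
      using jumpG_comb[OF T, of x a b] by (cases "x \<in> T") (auto simp: power2_eq_square indicator_def)
    then show ?thesis unfolding Jen_def set_lebesgue_integral_def by (simp only:)
  qed
  then show ?thesis unfolding jump_form_def by simp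
qed

lemma jump_form_comb_nonneg: "0 \<le> jump_form S (comb a b) (comb a b)"
  unfolding jump_form_comb using Jen_nonneg diameter_mesh_pos cut_mesh_subset
  by (intro sum_nonneg mult_nonneg_nonneg) (auto simp: less_imp_le)

lemma energy_comb_nonneg: "0 \<le> energy S (comb a b)"
  unfolding energy_eq using jump_form_comb_nonneg by (simp add: sum_nonneg En_nonneg)

lemma Gen_jumpW_le:
  assumes T: "T \<in> cut_mesh S"
  shows "Gen (jumpW b) T \<le> 2 * En (comb a b) 1 T + 2 * En (comb a b) 2 T"
proof -
  let ?u = "comb a b"
  note act = cut_mesh_subset_act_mesh[OF T] and nT = nsimplex_mesh[OF cut_mesh_subset[OF T]]
  have p: "lp ?u i T \<in> poly_le (deg S)" if "i \<in> {1,2}" for i using pw_lpoly(1)[OF pw_comb that act[OF that]] .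
  have val: "lp ?u i T x = ?u i x" if "i \<in> {1,2}" "x \<in> T" for i x using pw_lpoly(2)[OF pw_comb that(1) act[OF that(1)] that(2)] .
  have q: "(\<lambda>x. lp ?u 1 T x - lp ?u 2 T x) \<in> poly_le (deg S)" using p by (intro poly_le_diff) auto
  have "lpoly (deg S) (jumpW b) T = (\<lambda>x. lp ?u 1 T x - lp ?u 2 T x)"
    using jumpG_comb[OF T, of _ a b] val by (intro lpoly_eq[OF nT deg_pos q]) (auto simp: jumpG_def)
  then have "Gen (jumpW b) T = (LINT x:T|lborel. grad2 (\<lambda>x. lp ?u 1 T x - lp ?u 2 T x) x)" unfolding Gen_def by simp
  also have "\<dots> \<le> (LINT x:T|lborel. 2 * grad2 (lp ?u 1 T) x + 2 * grad2 (lp ?u 2 T) x)"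
    using continuous_grad2[OF p[of 1]] continuous_grad2[OF p[of 2]] p
    by (intro set_integral_mono set_integrable_nsimplex[OF nT] continuous_grad2[OF q] grad2_diff_le[where k = "deg S"] continuous_intros) auto
  also have "\<dots> = 2 * En ?u 1 T + 2 * En ?u 2 T"
    unfolding En_def using set_integrable_nsimplex[OF nT continuous_grad2[OF p[of 1]]] set_integrable_nsimplex[OF nT continuous_grad2[OF p[of 2]]]
    by (subst set_integral_add) auto
  finally show ?thesis .
qed

definition Xen :: "(real ^ 'n \<Rightarrow> real) \<Rightarrow> (real ^ 'n) set \<Rightarrow> real" where
  "Xen b T = Gen (jumpW b) T + inverse (diameter T) * Jen (jumpW b) T"

lemma Xen_nonneg: "T \<in> cut_mesh S \<Longrightarrow> 0 \<le> Xen b T"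
  unfolding Xen_def using Gen_nonneg Jen_nonneg diameter_mesh_pos cut_mesh_subset
  by (intro add_nonneg_nonneg mult_nonneg_nonneg) (auto simp: less_imp_le)

lemma sum_Xen_le: "(\<Sum>T\<in>cut_mesh S. Xen b T) \<le> 2 * energy S (comb a b)"
proof -
  have "(\<Sum>T\<in>cut_mesh S. Gen (jumpW b) T) \<le> (\<Sum>T\<in>cut_mesh S. 2 * En (comb a b) 1 T + 2 * En (comb a b) 2 T)"
    by (intro sum_mono Gen_jumpW_le)
  also have "\<dots> = 2 * (\<Sum>T\<in>cut_mesh S. En (comb a b) 1 T) + 2 * (\<Sum>T\<in>cut_mesh S. En (comb a b) 2 T)"
    by (simp add: sum.distrib sum_distrib_left)
  also have "\<dots> \<le> 2 * (\<Sum>T\<in>act_mesh S 1. En (comb a b) 1 T) + 2 * (\<Sum>T\<in>act_mesh S 2. En (comb a b) 2 T)"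
    by (intro add_mono mult_left_mono sum_mono2 finite_act_mesh subsetI cut_mesh_subset_act_mesh En_nonneg) auto
  finally show ?thesis
    unfolding energy_eq jump_form_comb[symmetric] Xen_def sum.distrib using jump_form_comb_nonneg[of a b]
    by (simp add: jump_form_comb[of a b])
qed


text \<open>The inverse estimates as predicates of their constant: the constant is obtained for all
  shape regular simplices at once, before a discretization is fixed, and handed to the lemmas
  here.\<close>

definition osc_bound :: "real \<Rightarrow> bool" where
  "osc_bound C \<longleftrightarrow> (\<forall>T :: (real ^ 'n) set. \<forall>p\<in>poly_le (deg S). \<forall>x\<in>T. \<forall>y\<in>T. shape \<sigma> T \<longrightarrow>
     diameter T ^ (CARD('n) - 2) * (p x - p y)\<^sup>2 \<le> C * (LINT x:T|lborel. grad2 p x))"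

definition nodal_bound :: "real \<Rightarrow> bool" where
  "nodal_bound C \<longleftrightarrow> (\<forall>T :: (real ^ 'n) set. \<forall>p\<in>poly_le (deg S). \<forall>m. shape \<sigma> T \<longrightarrow>
     (\<forall>j\<in>lagrange_nodes (deg S) T. \<bar>p j\<bar> \<le> m) \<longrightarrow>
     (LINT x:T|lborel. grad2 p x) \<le> C * diameter T ^ (CARD('n) - 2) * m\<^sup>2)"

lemma osc_boundD:
  fixes T :: "(real ^ 'n) set"
  assumes "osc_bound C" "shape \<sigma> T" "p \<in> poly_le (deg S)" "x \<in> T" "y \<in> T"
  shows "diameter T ^ (CARD('n) - 2) * (p x - p y)\<^sup>2 \<le> C * (LINT x:T|lborel. grad2 p x)"
  using bspec[OF bspec[OF bspec[OF spec[OF assms(1)[unfolded osc_bound_def], of T] assms(3)] assms(4)] assms(5), THEN mp, OF assms(2)] .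

lemma nodal_boundD:
  fixes T :: "(real ^ 'n) set"
  assumes "nodal_bound C" "shape \<sigma> T" "p \<in> poly_le (deg S)" "\<And>j. j \<in> lagrange_nodes (deg S) T \<Longrightarrow> \<bar>p j\<bar> \<le> m"
  shows "(LINT x:T|lborel. grad2 p x) \<le> C * diameter T ^ (CARD('n) - 2) * m\<^sup>2"
  using spec[OF bspec[OF spec[OF assms(1)[unfolded nodal_bound_def], of T] assms(3)], of m, THEN mp, OF assms(2), THEN mp] assms(4) by blast

lemma jumpW_le:
  assumes Co: "0 < Co" "osc_bound Co" and T: "T \<in> cut_mesh S" "y \<in> T" and D: "diameter T \<le> D"
  shows "diameter T ^ (CARD('n) - 2) * (jumpW b y)\<^sup>2 \<le> key_const CARD('n) \<sigma> r K D Co * (\<Sum>T\<in>vnbrs T. Xen b T)"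
  unfolding Xen_def using osc_boundD[OF Co(2)] by (intro key_estimate Co(1) T jumpW_Vh D)

lemma nonpos_if_mult_nonpos: "0 < c \<Longrightarrow> c * x \<le> 0 \<Longrightarrow> x \<le> (0::real)"
  by (simp add: mult_le_0_iff)

definition "diam = max 1 (diameter (closure Dom))"

lemma diam_pos: "0 < diam" unfolding diam_def by simp

text \<open>\<open>Cg\<close> passes from nodal values to gradients, \<open>key_const\<close> from
  values of the jump to energies, and the last factor is the overlap bound. The 4 combines the two
  sides with the 2 of \<open>sum_Xen_le\<close>, and the summand 1 pays for the jump term.\<close>

definition split_const :: "real \<Rightarrow> real \<Rightarrow> real" where
  "split_const Co Cg = 4 * Cg * key_const CARD('n) \<sigma> r K diam Co * real ((CARD('n) + 1) * mult_bound CARD('n) \<sigma>) + 1"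

text \<open>On side \<open>i\<close> each nodal value of the extra part is, up to sign, that of
  \<open>jumpW b\<close>, or 0. Hence the pointwise bound for the jump function bounds all nodal
  values, and the inverse estimate for gradients applies.\<close>

lemma gradient_extra_part_le:
  assumes Co: "0 < Co" "osc_bound Co"
    and Cg: "0 < Cg" "nodal_bound Cg"
    and i: "i \<in> {1,2}" and T: "T \<in> cut_mesh S"
  shows "En (comb (\<lambda>j. 0) b) i T \<le> Cg * (key_const CARD('n) \<sigma> r K diam Co * (\<Sum>T\<in>vnbrs T. Xen b T))"
proof -
  let ?m = "CARD('n) - 2" let ?h = "diameter T" let ?u = "comb (\<lambda>j. 0) b"
  let ?Y = "key_const CARD('n) \<sigma> r K diam Co * (\<Sum>T\<in>vnbrs T. Xen b T)"
  note Tm = cut_mesh_subset[OF T] and act = cut_mesh_subset_act_mesh[OF T i]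
  have hp: "0 < ?h ^ ?m" using diameter_mesh_pos[OF Tm] by simp
  have dT: "?h \<le> diam"
    using diameter_subset[OF mesh_subset[OF Tm] bounded_closure[OF bounded_dom]] unfolding diam_def by simp
  have key: "?h ^ ?m * (jumpW b y)\<^sup>2 \<le> ?Y" if "y \<in> T" for y
    by (rule jumpW_le[OF Co T that dT])
  have T_ne: "T \<noteq> {}" using interior_nsimplex_nonempty[OF nsimplex_mesh[OF Tm]] interior_subset by blast
  then have Y0: "0 \<le> ?Y" using key hp by (meson all_not_in_conv order_trans mult_nonneg_nonneg less_imp_le zero_le_power2)
  \<comment> \<open>The nodal bound is chosen so that \<open>?h ^ ?m * m\<^sup>2\<close> equals the
    right-hand side of the key estimate.\<close>
  define m where "m = sqrt (?Y / ?h ^ ?m)"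
  have m2: "?h ^ ?m * m\<^sup>2 = ?Y"
    unfolding m_def real_sqrt_pow2[OF divide_nonneg_pos[OF Y0 hp]] times_divide_eq_right
    by (rule nonzero_mult_div_cancel_left) (use hp in linarith)
  have node: "\<bar>lp ?u i T j\<bar> \<le> m" if j: "j \<in> lagrange_nodes (deg S) T" for j
  proof -
    have jn: "j \<in> nodes" using j Tm unfolding nodes_def by blast
    have jT: "j \<in> T" using lagrange_nodes_subset[OF nsimplex_mesh[OF Tm] deg_pos] j by blast
    have lpj: "lp ?u i T j = (\<Sum>l\<in>I\<Gamma> S. b l * eG l i j)"
      using pw_lpoly(2)[OF pw_comb i act jT, of "\<lambda>j. 0" b] by (simp add: comb_def)
    have "\<bar>lp ?u i T j\<bar> \<le> \<bar>jumpW b j\<bar>"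
    proof (cases "j \<in> I0 S")
      case True
      then have jG: "j \<in> I\<Gamma> S" using jT T unfolding I\<Gamma>_def cut_dom_def by blast
      have "(\<Sum>l\<in>I\<Gamma> S. b l * eG l i j) = (\<Sum>l\<in>I\<Gamma> S. if j = l then (if l \<in> I\<Gamma>_sub S i then b l else 0) else 0)"
        unfolding eG_def by (intro sum.cong refl) (auto simp: phi\<Gamma>_node[OF _ jG])
      then show ?thesis unfolding lpj jumpW_node[OF jG] using jG finite_I\<Gamma> by simp
    next
      \<comment> \<open>A node of \<open>T\<close> that is not in \<open>I0 S\<close> lies outside
        the open domain, where all functions in \<open>Vh S\<close> are 0.\<close>
      case False
      have "eG l i j = 0" if "l \<in> I\<Gamma> S" for l
        using Vh_node_zero[OF phi_Vh jn False, of l] subsetD[OF I\<Gamma>_subset that] phi\<Gamma>_cut[OF T jT] by (simp add: eG_def)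
      then show ?thesis unfolding lpj by simp
    qed
    moreover have "\<bar>jumpW b j\<bar> \<le> m"
    proof (rule power2_le_imp_le)
      have "?h ^ ?m * \<bar>jumpW b j\<bar>\<^sup>2 \<le> ?h ^ ?m * m\<^sup>2" using key[OF jT] m2 by simp
      then show "\<bar>jumpW b j\<bar>\<^sup>2 \<le> m\<^sup>2" using hp mult_le_cancel_left_pos by blast
      show "0 \<le> m" unfolding m_def using Y0 hp by simp
    qed
    ultimately show ?thesis by simp
  qed
  have "En ?u i T \<le> Cg * ?h ^ ?m * m\<^sup>2"
    unfolding En_def by (rule nodal_boundD[OF Cg(2) shape_mesh[OF Tm] pw_lpoly(1)[OF pw_comb i act] node])
  then show ?thesis using m2 by (simp add: mult.assoc)
qed

lemma En_extra_part_uncut: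
  assumes i: "i \<in> {1,2}" and T: "T \<in> act_mesh S i" "T \<notin> cut_mesh S"
  shows "En (comb (\<lambda>j. 0) b) i T = 0"
proof -
  have "lp (comb (\<lambda>j. 0) b) i T = (\<lambda>x. 0)"
    using eG_uncut[OF _ i T] by (intro lpoly_eq[OF nsimplex_mesh[OF act_mesh_subset[OF T(1)]] deg_pos poly_le_zero]) (simp add: comb_def)
  moreover have "pd j (\<lambda>x. 0) x = 0" for j :: 'n and x
    using fun_cong[OF pd_linear[OF poly_le_zero[where k = 0] poly_le_zero[where k = 0], of j 1], of x] by simp
  then have "grad2 (\<lambda>x. 0) = (\<lambda>x::real^'n. 0)" by (simp add: grad2_def fun_eq_iff)
  ultimately show ?thesis unfolding En_def set_lebesgue_integral_def by simp
qed

text \<open>The first component of the pair cancels in the jump, so the jump term of the extra part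
  is that of the whole pair. Gradients of the extra part live on the cut simplices only and are
  summed with finite overlap.\<close>

lemma energy_extra_part_le:
  assumes Co: "0 < Co" "osc_bound Co"
    and Cg: "0 < Cg" "nodal_bound Cg"
  shows "energy S (comb (\<lambda>j. 0) b) \<le> split_const Co Cg * energy S (comb a b)"
proof -
  let ?K = "key_const CARD('n) \<sigma> r K diam Co" let ?u = "comb (\<lambda>j. 0) b"
  let ?M = "real ((CARD('n) + 1) * mult_bound CARD('n) \<sigma>)"
  have K: "0 < ?K" using sigma_pos r_pos diam_pos Co(1) by (intro key_const_pos) auto
  have part: "(\<Sum>T\<in>act_mesh S i. En ?u i T) \<le> Cg * ?K * ?M * (2 * energy S (comb a b))" if i: "i \<in> {1,2}" for i
  proof -
    have "(\<Sum>T\<in>act_mesh S i. En ?u i T) = (\<Sum>T\<in>cut_mesh S. En ?u i T)"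
      using cut_mesh_subset_act_mesh[OF _ i] En_extra_part_uncut[OF i] by (intro sum.mono_neutral_right finite_act_mesh) auto
    also have "\<dots> \<le> (\<Sum>T\<in>cut_mesh S. Cg * (?K * (\<Sum>T\<in>vnbrs T. Xen b T)))"
      by (intro sum_mono gradient_extra_part_le[OF Co Cg i])
    also have "\<dots> = Cg * ?K * (\<Sum>T\<in>cut_mesh S. \<Sum>T\<in>vnbrs T. Xen b T)" by (simp add: sum_distrib_left mult.assoc)
    also have "\<dots> \<le> Cg * ?K * (?M * (\<Sum>T\<in>cut_mesh S. Xen b T))"
      using K Cg(1) by (intro mult_left_mono sum_vnbrs_le Xen_nonneg) auto
    also have "\<dots> \<le> Cg * ?K * (?M * (2 * energy S (comb a b)))"
      using K Cg(1) by (intro mult_left_mono sum_Xen_le) auto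
    finally show ?thesis by (simp only: mult.assoc)
  qed
  have "jump_form S ?u ?u \<le> energy S (comb a b)"
    unfolding energy_eq[of "comb a b"] jump_form_comb by (simp add: sum_nonneg En_nonneg)
  then have "energy S ?u \<le> Cg * ?K * ?M * (2 * energy S (comb a b)) + Cg * ?K * ?M * (2 * energy S (comb a b)) + energy S (comb a b)"
    unfolding energy_eq[of ?u] by (intro add_mono part) auto
  also have "\<dots> = (4 * (Cg * ?K * ?M) + 1) * energy S (comb a b)"
  proof -
    have "c * (2 * e) + c * (2 * e) + e = (4 * c + 1) * e" for c e :: real by (simp add: algebra_simps)
    then show ?thesis .
  qed
  finally show ?thesis unfolding split_const_def mult.assoc .
qed

section \<open>From energies to the bilinear form\<close>

lemma comb_coeffs_Vh: "(\<lambda>x. \<Sum>j\<in>I0 S. a j * \<phi> S j x) \<in> Vh S"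
  by (intro Vh_sum phi_Vh)

lemma comb_coeffs_V\<Gamma>: "(\<lambda>x. \<Sum>j\<in>I\<Gamma> S. b j * \<phi>\<Gamma> S j x) \<in> V\<Gamma> S"
proof -
  have "(\<Sum>j\<in>I\<Gamma> S. b j * \<phi>\<Gamma> S j x) = (\<Sum>j\<in>I\<Gamma>_sub S 1. b j * \<phi>\<Gamma> S j x) + (\<Sum>j\<in>I\<Gamma>_sub S 2. b j * \<phi>\<Gamma> S j x)" for x
    unfolding I\<Gamma>_sub_2 using sum.subset_diff[OF I\<Gamma>_sub_subset finite_I\<Gamma>] by (simp add: add.commute)
  then have eq: "(\<lambda>x. \<Sum>j\<in>I\<Gamma> S. b j * \<phi>\<Gamma> S j x) = (\<lambda>x. (\<Sum>j\<in>I\<Gamma>_sub S 1. b j * \<phi>\<Gamma> S j x) + (\<Sum>j\<in>I\<Gamma>_sub S 2. b j * \<phi>\<Gamma> S j x))"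
    by (rule ext)
  show ?thesis unfolding V\<Gamma>_def V\<Gamma>_sub_def eq
    by (rule CollectI, intro exI conjI, rule refl) blast+
qed

lemma norm_equivalence_comb:
  assumes "norm_equivalence S c d"
  shows "c * energy S (comb a b) \<le> Ah S (comb a b) (comb a b)"
    and "Ah S (comb a b) (comb a b) \<le> d * energy S (comb a b)"
  using assms comb_coeffs_Vh[of a] comb_coeffs_V\<Gamma>[of b] unfolding norm_equivalence_def Ahat_def L_comb[symmetric] by blast+

lemma Ah_comb_scale:
  "Ah S (comb a (\<lambda>j. s * b j)) (comb a (\<lambda>j. s * b j)) = s\<^sup>2 * Ah S (comb (\<lambda>j. 0) b) (comb (\<lambda>j. 0) b)
    + 2 * s * Ah S (comb (\<lambda>j. 0) b) (comb a (\<lambda>j. 0)) + Ah S (comb a (\<lambda>j. 0)) (comb a (\<lambda>j. 0))"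
proof -
  have "comb a (\<lambda>j. s * b j) = (\<lambda>i x. s * comb (\<lambda>j. 0) b i x + comb a (\<lambda>j. 0) i x)"
    using comb_linear[of s "\<lambda>j. 0" a b "\<lambda>j. 0"] by simp
  then show ?thesis using Ah_expand[OF pw_comb pw_comb] by simp
qed

text \<open>The mixed term is controlled without Cauchy-Schwarz. Nonnegativity with the extra part
  scaled by -1 gives \<open>2 * ?X \<le> ?A + ?B\<close>, hence the first claim. Scaled by 2 it
  gives \<open>?A \<le> 2 * ?H + 2 * ?B\<close>, so that only \<open>?B\<close> remains to be
  bounded by \<open>?H\<close>, which is what \<open>energy_extra_part_le\<close> and the norm
  equivalence provide.\<close>

lemma stable_splitting:
  assumes Co: "0 < Co" "osc_bound Co"
    and Cg: "0 < Cg" "nodal_bound Cg"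
    and ne: "norm_equivalence S c d" "0 < c" "0 < d"
  shows "Ah S (comb a b) (comb a b)
      \<le> 2 * (Ah S (comb a (\<lambda>j. 0)) (comb a (\<lambda>j. 0)) + Ah S (comb (\<lambda>j. 0) b) (comb (\<lambda>j. 0) b))"
    and "Ah S (comb a (\<lambda>j. 0)) (comb a (\<lambda>j. 0)) + Ah S (comb (\<lambda>j. 0) b) (comb (\<lambda>j. 0) b)
      \<le> (2 + 3 * (d * split_const Co Cg / c)) * Ah S (comb a b) (comb a b)"
proof -
  let ?A = "Ah S (comb a (\<lambda>j. 0)) (comb a (\<lambda>j. 0))" and ?B = "Ah S (comb (\<lambda>j. 0) b) (comb (\<lambda>j. 0) b)"
  let ?X = "Ah S (comb (\<lambda>j. 0) b) (comb a (\<lambda>j. 0))" and ?H = "Ah S (comb a b) (comb a b)"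
  have pos: "0 \<le> Ah S (comb a b') (comb a b')" for b'
    using norm_equivalence_comb(1)[OF ne(1), of a b'] energy_comb_nonneg[of a b'] ne(2) by (meson mult_nonneg_nonneg less_imp_le order_trans)
  have H: "?H = ?B + 2 * ?X + ?A" using Ah_comb_scale[of a 1 b] by simp
  have m1: "0 \<le> ?B - 2 * ?X + ?A" using Ah_comb_scale[of a "-1" b] pos[of "\<lambda>j. -1 * b j"] by simp
  have p2: "0 \<le> 4 * ?B + 4 * ?X + ?A" using Ah_comb_scale[of a 2 b] pos[of "\<lambda>j. 2 * b j"] by simp
  show "?H \<le> 2 * (?A + ?B)" using H m1 by simp
  have c1: "0 \<le> split_const Co Cg" unfolding split_const_def
    using key_const_pos[of "CARD('n)" \<sigma> r _ Co K] sigma_pos r_pos diam_pos Co(1) Cg(1) by (intro add_nonneg_nonneg mult_nonneg_nonneg) (auto simp: less_imp_le)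
  have "?B \<le> d * (split_const Co Cg * energy S (comb a b))"
    using norm_equivalence_comb(2)[OF ne(1), of "\<lambda>j. 0" b] energy_extra_part_le[OF Co Cg, of b a] ne(3)
    by (meson mult_left_mono less_imp_le order_trans)
  also have "\<dots> \<le> d * (split_const Co Cg * (?H / c))"
    using norm_equivalence_comb(1)[OF ne(1), of a b] ne c1 by (intro mult_left_mono) (auto simp: pos_le_divide_eq mult.commute)
  also have "\<dots> = d * split_const Co Cg / c * ?H" by simp
  finally have "?B \<le> d * split_const Co Cg / c * ?H" .
  then show "?A + ?B \<le> (2 + 3 * (d * split_const Co Cg / c)) * ?H" using H p2 by (simp add: distrib_right)
qed

text \<open>Otherwise the interior of \<open>T\<close> would lie in the interface, hence in the
  closure of \<open>sub S 1\<close>, and an open set meeting that closure meets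
  \<open>sub S 1\<close>.\<close>

lemma mesh_active: assumes "T \<in> mesh S" shows "T \<in> act_mesh S 1 \<or> T \<in> act_mesh S 2"
proof (rule ccontr)
  assume no: "\<not> ?thesis"
  have "interior T \<subseteq> Gam" using no assms interior_mesh_subset[OF assms] dom_split interior_subset[of T] unfolding act_mesh_def by blast
  then have "interior T \<inter> closure (sub S 1) \<noteq> {}" using interior_nsimplex_nonempty[OF nsimplex_mesh[OF assms]] unfolding interface_def by blast
  then have "interior T \<inter> sub S 1 \<noteq> {}" using open_Int_closure_eq_empty[OF open_interior] by blast
  then show False using no assms interior_subset[of T] unfolding act_mesh_def by blast
qed

text \<open>Zero energy makes the jump function vanish by the same key estimate, so \<open>b\<close>
  is 0. What remains is a continuous function that is constant on each simplex; it takes finitely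
  many values, is therefore constant, and vanishes outside the bounded domain.\<close>

lemma Ah_comb_definite:
  assumes Co: "0 < Co" "osc_bound Co"
    and ne: "norm_equivalence S c d" "0 < c" and zero: "Ah S (comb a b) (comb a b) \<le> 0"
  shows "j \<in> I0 S \<Longrightarrow> a j = 0" and "j \<in> I\<Gamma> S \<Longrightarrow> b j = 0"
proof -
  have "c * energy S (comb a b) \<le> 0" using norm_equivalence_comb(1)[OF ne(1), of a b] zero by simp
  then have "energy S (comb a b) \<le> 0" using ne(2) by (simp add: mult_le_0_iff)
  then have e: "energy S (comb a b) = 0" using energy_comb_nonneg[of a b] by simp
  have En1: "(\<Sum>T\<in>act_mesh S 1. En (comb a b) 1 T) = 0" "(\<Sum>T\<in>act_mesh S 2. En (comb a b) 2 T) = 0"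
    using e jump_form_comb_nonneg[of a b] sum_nonneg[of "act_mesh S 1" "En (comb a b) 1"] sum_nonneg[of "act_mesh S 2" "En (comb a b) 2"]
    unfolding energy_eq by (auto simp: En_nonneg)
  then have En: "En (comb a b) i T = 0" if "i \<in> {1,2}" "T \<in> act_mesh S i" for i T
    using that by (auto simp: sum_nonneg_eq_0_iff[OF finite_act_mesh] En_nonneg)
  have "(\<Sum>T\<in>cut_mesh S. Xen b T) = 0" using sum_Xen_le[of b a] e sum_nonneg[of "cut_mesh S" "Xen b"] Xen_nonneg by simp
  then have Xz: "Xen b T = 0" if "T \<in> cut_mesh S" for T
    using that by (simp add: sum_nonneg_eq_0_iff[OF finite_cut_mesh] Xen_nonneg)
  have bz: "b j = 0" if j: "j \<in> I\<Gamma> S" for j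
  proof -
    obtain T where T: "T \<in> cut_mesh S" "j \<in> T" using j unfolding I\<Gamma>_def cut_dom_def by blast
    \<comment> \<open>The size of the constant is irrelevant here, so \<open>diameter T\<close>
      itself serves as the bound for the diameter.\<close>
    have "diameter T ^ (CARD('n) - 2) * (jumpW b j)\<^sup>2 \<le> key_const CARD('n) \<sigma> r K (diameter T) Co * (\<Sum>T\<in>vnbrs T. Xen b T)"
      by (rule jumpW_le[OF Co T order_refl])
    also have "(\<Sum>T\<in>vnbrs T. Xen b T) = 0" using Xz by (intro sum.neutral) (auto simp: vnbrs_def)
    finally have *: "diameter T ^ (CARD('n) - 2) * (jumpW b j)\<^sup>2 \<le> 0" by (simp only: mult_zero_right)
    have "(jumpW b j)\<^sup>2 \<le> 0"
      by (rule nonpos_if_mult_nonpos[OF zero_less_power[OF diameter_mesh_pos[OF cut_mesh_subset[OF T(1)]]] *])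
    then have "jumpW b j = 0" by simp
    then show ?thesis using jumpW_node[OF j, of b] by (auto split: if_splits)
  qed
  then show "j \<in> I\<Gamma> S \<Longrightarrow> b j = 0" .
  define v where "v x = (\<Sum>j\<in>I0 S. a j * \<phi> S j x)" for x
  have v: "v \<in> Vh S" unfolding v_def[abs_def] by (rule comb_coeffs_Vh)
  have const: "v x = v y" if T: "T \<in> mesh S" and xy: "x \<in> T" "y \<in> T" for T x y
  proof -
    obtain i where i: "i \<in> {1,2}" "T \<in> act_mesh S i" using mesh_active[OF T] by auto
    have "comb a b i x = v x" if "x \<in> T" for x
    proof -
      have "x \<in> act_dom S i" using that i(2) unfolding act_dom_def by blast
      then show ?thesis using bz unfolding comb_def v_def e0_def restr_def by (simp add: sum.neutral)
    qed
    then have "lp (comb a b) i T x = v x" "lp (comb a b) i T y = v y" using pw_lpoly(2)[OF pw_comb i] xy by auto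
    then have "diameter T ^ (CARD('n) - 2) * (v x - v y)\<^sup>2 \<le> Co * En (comb a b) i T"
      using osc_boundD[OF Co(2) shape_mesh[OF T] pw_lpoly(1)[OF pw_comb i] xy] unfolding En_def by metis
    then have *: "diameter T ^ (CARD('n) - 2) * (v x - v y)\<^sup>2 \<le> 0" unfolding En[OF i] by (simp only: mult_zero_right)
    have "(v x - v y)\<^sup>2 \<le> 0" by (rule nonpos_if_mult_nonpos[OF zero_less_power[OF diameter_mesh_pos[OF T]] *])
    then show ?thesis by simp
  qed
  have fin: "finite (range v)"
  proof (rule finite_subset)
    define pt where "pt T = (SOME x. x \<in> T)" for T :: "(real ^ 'n) set"
    show "range v \<subseteq> insert 0 ((\<lambda>T. v (pt T)) ` mesh S)"
    proof clarify
      fix x assume "v x \<notin> (\<lambda>T. v (pt T)) ` mesh S"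
      moreover have "v x = v (pt T)" if "T \<in> mesh S" "x \<in> T" for T
        using const[OF that] someI[of "\<lambda>x. x \<in> T", OF that(2)] unfolding pt_def by blast
      ultimately have "x \<notin> Dom" using mesh_cover[of x] closure_subset[of Dom] by blast
      then show "v x = 0" by (rule Vh_zero_outside[OF v])
    qed
  qed (use finite_mesh in simp)
  have "v constant_on UNIV" by (rule continuous_finite_range_constant[OF connected_UNIV Vh_continuous[OF v] fin])
  moreover have "Dom \<noteq> UNIV" using bounded_dom not_bounded_UNIV by metis
  then obtain z where "z \<notin> Dom" by blast
  then have "v z = 0" by (rule Vh_zero_outside[OF v])
  ultimately have v0: "v x = 0" for x unfolding constant_on_def by (metis UNIV_I)
  show "a j = 0" if j: "j \<in> I0 S"
  proof -
    have "v j = (\<Sum>l\<in>I0 S. if j = l then a l else 0)" unfolding v_def using j by (intro sum.cong refl) (auto simp: phi_node)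
    then show ?thesis using v0[of j] j finite_I0 by simp
  qed
qed

end

section \<open>Block preconditioning of symmetric positive definite matrices\<close>

text \<open>The form is taken on plain functions of the index, which frees the estimates from
  carrier conditions on vectors.\<close>

definition mform :: "nat \<Rightarrow> real mat \<Rightarrow> (nat \<Rightarrow> real) \<Rightarrow> (nat \<Rightarrow> real) \<Rightarrow> real" where
  "mform N M f g = (\<Sum>i<N. \<Sum>j<N. f i * M $$ (i, j) * g j)"

lemma mult_mat_vec_index:
  assumes "M \<in> carrier_mat N N" "x \<in> carrier_vec N" "i < N"
  shows "vec_index (M *\<^sub>v x) i = (\<Sum>j<N. M $$ (i, j) * vec_index x j)"
  using assms by (auto simp: scalar_prod_def lessThan_atLeast0 intro!: sum.cong)

lemma scalar_prod_mform:
  assumes "M \<in> carrier_mat N N" "x \<in> carrier_vec N"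
  shows "scalar_prod x (M *\<^sub>v x) = mform N M (vec_index x) (vec_index x)"
proof -
  have "scalar_prod x (M *\<^sub>v x) = (\<Sum>i<N. vec_index x i * vec_index (M *\<^sub>v x) i)"
    using assms by (simp add: scalar_prod_def lessThan_atLeast0)
  also have "\<dots> = mform N M (vec_index x) (vec_index x)"
    unfolding mform_def
    by (intro sum.cong refl) (simp only: lessThan_iff mult_mat_vec_index[OF assms] sum_distrib_left mult.assoc)
  finally show ?thesis .
qed

lemma mform_eq_rows:
  assumes "\<And>i. i < N \<Longrightarrow> (\<Sum>j<N. A $$ (i, j) * g j) = s * (\<Sum>j<N. D $$ (i, j) * h j) + t * (\<Sum>j<N. D $$ (i, j) * h' j)"
  shows "mform N A f g = s * mform N D f h + t * mform N D f h'"
proof -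
  have "mform N A f g = (\<Sum>i<N. f i * (\<Sum>j<N. A $$ (i, j) * g j))"
    unfolding mform_def by (simp add: sum_distrib_left mult.assoc)
  also have "\<dots> = (\<Sum>i<N. s * (f i * (\<Sum>j<N. D $$ (i, j) * h j)) + t * (f i * (\<Sum>j<N. D $$ (i, j) * h' j)))"
    using assms by (intro sum.cong refl) (simp add: algebra_simps)
  finally show ?thesis unfolding mform_def by (simp add: sum.distrib sum_distrib_left mult.assoc)
qed

lemma mform_commute:
  assumes "\<And>i j. i < N \<Longrightarrow> j < N \<Longrightarrow> M $$ (i, j) = M $$ (j, i)" shows "mform N M f g = mform N M g f"
  unfolding mform_def by (subst sum.swap) (auto simp: assms mult_ac intro!: sum.cong)

text \<open>\<open>E * A\<close> need not be symmetric, but an eigenvector solves the pencil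
  equation \<open>A z = \<mu> D z\<close>. Testing with its real part \<open>x\<close> and imaginary
  part \<open>y\<close>, the symmetry of \<open>A\<close> and \<open>D\<close> yields that
  \<open>Im \<mu>\<close> times the positive number \<open>?D x x + ?D y y\<close> is 0. Then \<mu>
  is a Rayleigh quotient, confined by the equivalence of the forms.\<close>

lemma pencil_spectrum:
  fixes A D E :: "real mat"
  assumes A: "A \<in> carrier_mat N N" and D: "D \<in> carrier_mat N N" and E: "E \<in> carrier_mat N N" and DE: "D * E = 1\<^sub>m N"
    and symA: "\<And>i j. i < N \<Longrightarrow> j < N \<Longrightarrow> A $$ (i, j) = A $$ (j, i)"
    and symD: "\<And>i j. i < N \<Longrightarrow> j < N \<Longrightarrow> D $$ (i, j) = D $$ (j, i)"
    and pos: "\<And>f i. i < N \<Longrightarrow> f i \<noteq> 0 \<Longrightarrow> 0 < mform N A f f"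
    and c: "0 < c1" "0 < c2"
    and lower: "\<And>f. c1 * mform N A f f \<le> mform N D f f" and upper: "\<And>f. mform N D f f \<le> c2 * mform N A f f"
    and \<mu>: "\<mu> \<in> spectrum (map_mat complex_of_real (E * A))"
  obtains m where "\<mu> = complex_of_real m" "1 / c2 \<le> m" "m \<le> 1 / c1"
proof -
  note EA = mult_carrier_mat[OF E A]
  obtain z where z: "eigenvector (map_mat complex_of_real (E * A)) z \<mu>"
    using \<mu> unfolding spectrum_def eigenvalue_def by auto
  have zN: "z \<in> carrier_vec N" and z0: "z \<noteq> 0\<^sub>v N" and ev: "map_mat complex_of_real (E * A) *\<^sub>v z = \<mu> \<cdot>\<^sub>v z"
    using z EA E A unfolding eigenvector_def by auto
  have "D * (E * A) = A" using assoc_mult_mat[OF D E A] DE A by simp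
  then have "map_mat complex_of_real A = map_mat complex_of_real D * map_mat complex_of_real (E * A)"
    using of_real_hom.mat_hom_mult[OF D EA] by simp
  then have "map_mat complex_of_real A *\<^sub>v z = map_mat complex_of_real D *\<^sub>v (map_mat complex_of_real (E * A) *\<^sub>v z)"
    using assoc_mult_mat_vec[of "map_mat complex_of_real D" N N "map_mat complex_of_real (E * A)" N z] D EA zN by simp
  then have "map_mat complex_of_real A *\<^sub>v z = map_mat complex_of_real D *\<^sub>v (\<mu> \<cdot>\<^sub>v z)" unfolding ev .
  then have eq: "map_mat complex_of_real A *\<^sub>v z = \<mu> \<cdot>\<^sub>v (map_mat complex_of_real D *\<^sub>v z)"
    using mult_mat_vec[of "map_mat complex_of_real D" N N z \<mu>] D zN by simp
  define x where "x i = Re (vec_index z i)" for i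
  define y where "y i = Im (vec_index z i)" for i
  have row: "(\<Sum>j<N. complex_of_real (A $$ (i, j)) * vec_index z j) = \<mu> * (\<Sum>j<N. complex_of_real (D $$ (i, j)) * vec_index z j)"
    if i: "i < N" for i
  proof -
    have M: "vec_index (map_mat complex_of_real M *\<^sub>v z) i = (\<Sum>j<N. complex_of_real (M $$ (i, j)) * vec_index z j)"
      if "M \<in> carrier_mat N N" for M :: "real mat"
      using that zN i by (auto simp: scalar_prod_def lessThan_atLeast0 intro!: sum.cong)
    show ?thesis using arg_cong[OF eq, of "\<lambda>v. vec_index v i"] M[OF A] M[OF D] i D zN by simp
  qed
  have reA: "(\<Sum>j<N. A $$ (i, j) * x j) = Re \<mu> * (\<Sum>j<N. D $$ (i, j) * x j) + - Im \<mu> * (\<Sum>j<N. D $$ (i, j) * y j)" if "i < N" for i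
    using arg_cong[OF row[OF that], of Re] unfolding x_def y_def by simp
  have imA: "(\<Sum>j<N. A $$ (i, j) * y j) = Re \<mu> * (\<Sum>j<N. D $$ (i, j) * y j) + Im \<mu> * (\<Sum>j<N. D $$ (i, j) * x j)" if "i < N" for i
    using arg_cong[OF row[OF that], of Im] unfolding x_def y_def by simp
  let ?A = "mform N A" and ?D = "mform N D"
  have xx: "?A x x = Re \<mu> * ?D x x + - Im \<mu> * ?D x y" and yx: "?A y x = Re \<mu> * ?D y x + - Im \<mu> * ?D y y"
    by (rule mform_eq_rows[OF reA], assumption)+
  have yy: "?A y y = Re \<mu> * ?D y y + Im \<mu> * ?D y x" and xy: "?A x y = Re \<mu> * ?D x y + Im \<mu> * ?D x x"
    by (rule mform_eq_rows[OF imA], assumption)+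
  have sA: "?A y x = ?A x y" and sD: "?D y x = ?D x y" using mform_commute[OF symA] mform_commute[OF symD] by blast+
  have nonneg: "0 \<le> ?A f f" for f
  proof (cases "\<exists>i<N. f i \<noteq> 0")
    case False then show ?thesis unfolding mform_def by simp
  qed (use pos less_imp_le in blast)
  obtain i where i: "i < N" "vec_index z i \<noteq> 0" using z0 zN by (metis eq_vecI carrier_vecD index_zero_vec)
  then have "x i \<noteq> 0 \<or> y i \<noteq> 0" unfolding x_def y_def by (metis complex_eqI zero_complex.simps)
  then have Ap: "0 < ?A x x + ?A y y" using pos[OF i(1)] nonneg by (metis add_pos_nonneg add_nonneg_pos)
  have low: "c1 * (?A x x + ?A y y) \<le> ?D x x + ?D y y" using lower[of x] lower[of y] by (simp add: distrib_left)
  have upp: "?D x x + ?D y y \<le> c2 * (?A x x + ?A y y)" using upper[of x] upper[of y] by (simp add: distrib_left)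
  have Dp: "0 < ?D x x + ?D y y" using low mult_pos_pos[OF c(1) Ap] by linarith
  have "Im \<mu> * (?D x x + ?D y y) = 0" using xy yx sA sD by (simp add: algebra_simps)
  then have im: "Im \<mu> = 0" using Dp by simp
  have re: "?A x x + ?A y y = Re \<mu> * (?D x x + ?D y y)" using xx yy im by (simp add: algebra_simps)
  show thesis
  proof (rule that)
    show "\<mu> = complex_of_real (Re \<mu>)" using im by (simp add: complex_eq_iff)
    have mp: "0 < Re \<mu>" using re Ap Dp by (metis zero_less_mult_pos2)
    have "1 * (?D x x + ?D y y) \<le> (c2 * Re \<mu>) * (?D x x + ?D y y)" using upp unfolding re by (simp add: mult.assoc)
    then have "1 \<le> c2 * Re \<mu>" using Dp mult_right_le_imp_le by blast
    then show "1 / c2 \<le> Re \<mu>" using c by (simp add: divide_le_eq mult.commute)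
    have "(c1 * Re \<mu>) * (?D x x + ?D y y) \<le> 1 * (?D x x + ?D y y)" using low unfolding re by (simp add: mult.assoc)
    then have "c1 * Re \<mu> \<le> 1" using Dp mult_right_le_imp_le by blast
    then show "Re \<mu> \<le> 1 / c1" using c by (simp add: le_divide_eq mult.commute)
  qed
qed

lemma of_real_mem_spectrum_iff:
  assumes "M \<in> carrier_mat N N"
  shows "complex_of_real m \<in> spectrum (map_mat complex_of_real M) \<longleftrightarrow> m \<in> spectrum M"
proof -
  have "map_mat complex_of_real M \<in> carrier_mat N N" using assms by simp
  then show ?thesis
    unfolding spectrum_root_char_poly[OF assms] by (simp add: spectrum_root_char_poly of_real_hom.char_poly_hom[OF assms])
qed

lemma block_diagonal_index:
  assumes A: "A \<in> carrier_mat N N" and n: "n \<le> N"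
  shows "block_diagonal n A \<in> carrier_mat N N"
    and "i < N \<Longrightarrow> j < N \<Longrightarrow> block_diagonal n A $$ (i, j) = (if (i < n) = (j < n) then A $$ (i, j) else 0)"
  using A n by (auto simp: block_diagonal_def split_block_def Let_def)

lemma mform_block_diagonal:
  assumes A: "A \<in> carrier_mat N N" and n: "n \<le> N"
  shows "mform N (block_diagonal n A) f f
    = mform N A (\<lambda>i. if i < n then f i else 0) (\<lambda>i. if i < n then f i else 0)
    + mform N A (\<lambda>i. if i < n then 0 else f i) (\<lambda>i. if i < n then 0 else f i)"
  unfolding mform_def sum.distrib[symmetric]
  by (intro sum.cong refl) (simp add: block_diagonal_index(2)[OF A n])

text \<open>A kernel vector of the block diagonal matrix would have zero form, against the lower
  bound and the definiteness of \<open>A\<close>; so the inverse exists and the pencil lemma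
  applies.\<close>

lemma block_diagonal_preconditioner:
  fixes A :: "real mat"
  assumes A: "A \<in> carrier_mat N N" and n: "n \<le> N" and N: "0 < N"
    and sym: "\<And>i j. i < N \<Longrightarrow> j < N \<Longrightarrow> A $$ (i, j) = A $$ (j, i)"
    and pos: "\<And>f i. i < N \<Longrightarrow> f i \<noteq> 0 \<Longrightarrow> 0 < mform N A f f"
    and c: "0 < c1" "0 < c2"
    and lower: "\<And>f. c1 * mform N A f f \<le> mform N (block_diagonal n A) f f"
    and upper: "\<And>f. mform N (block_diagonal n A) f f \<le> c2 * mform N A f f"
  shows "\<exists>E. mat_inverse (block_diagonal n A) = Some E \<and>
    spectrum (map_mat complex_of_real (E * A)) \<subseteq> complex_of_real ` {0<..} \<and> spectral_cond (E * A) \<le> c2 / c1"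
proof -
  let ?D = "block_diagonal n A"
  note D = block_diagonal_index(1)[OF A n]
  have symD: "?D $$ (i, j) = ?D $$ (j, i)" if "i < N" "j < N" for i j
    using that sym[OF that] by (auto simp: block_diagonal_index(2)[OF A n])
  have "det ?D \<noteq> 0"
  proof
    assume "det ?D = 0"
    then obtain v where v: "v \<in> carrier_vec N" "v \<noteq> 0\<^sub>v N" "?D *\<^sub>v v = 0\<^sub>v N"
      using det_0_iff_vec_prod_zero_field[OF D] by blast
    obtain i where i: "i < N" "vec_index v i \<noteq> 0" using v by (metis eq_vecI carrier_vecD index_zero_vec)
    have "mform N ?D (vec_index v) (vec_index v) = 0" using scalar_prod_mform[OF D v(1)] v by simp
    moreover have "0 < c1 * mform N A (vec_index v) (vec_index v)" by (intro mult_pos_pos c pos[of i] i)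
    ultimately show False using lower[of "vec_index v"] by linarith
  qed
  then have "?D \<in> Units (ring_mat TYPE(real) N ())" by (rule det_non_zero_imp_unit[OF D])
  then obtain E where E: "mat_inverse ?D = Some E" using mat_inverse(1)[OF D] by fastforce
  have DE: "?D * E = 1\<^sub>m N" and Ec: "E \<in> carrier_mat N N" using mat_inverse(2)[OF D E] by auto
  note EA = mult_carrier_mat[OF Ec A]
  have spec: "\<exists>m. \<mu> = complex_of_real m \<and> 1 / c2 \<le> m \<and> m \<le> 1 / c1" if "\<mu> \<in> spectrum (map_mat complex_of_real (E * A))" for \<mu>
    by (rule pencil_spectrum[OF A D Ec DE sym symD pos c lower upper that]) blast+
  have c2p: "0 < 1 / c2" using c by simp
  have "spectrum (map_mat complex_of_real (E * A)) \<subseteq> complex_of_real ` {0<..}"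
    using spec less_le_trans[OF c2p] by fastforce
  moreover have "spectral_cond (E * A) \<le> c2 / c1"
  proof -
    let ?R = "spectrum (E * A)"
    have fin: "finite ?R" by (rule card_finite_spectrum(1)[OF EA])
    \<comment> \<open>A complex eigenvalue always exists in positive dimension. Since all of them
      are real, the real spectrum is nonempty as well, and \<open>Max\<close> and \<open>Min\<close>
      are attained.\<close>
    have "spectrum (map_mat complex_of_real (E * A)) \<noteq> {}" using EA N by (intro spectrum_non_empty) auto
    then have ne: "?R \<noteq> {}" using spec of_real_mem_spectrum_iff[OF EA] by blast
    have bd: "1 / c2 \<le> m \<and> m \<le> 1 / c1" if "m \<in> ?R" for m
      using spec[of "complex_of_real m"] that of_real_mem_spectrum_iff[OF EA] by auto
    have "Max ?R / Min ?R \<le> (1 / c1) / (1 / c2)"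
      using bd[OF Max_in[OF fin ne]] bd[OF Min_in[OF fin ne]] c c2p by (intro frac_le) auto
    then show ?thesis unfolding spectral_cond_def by simp
  qed
  ultimately show ?thesis using E by blast
qed

section \<open>The stiffness matrix\<close>

context cutfem_geom
begin

definition basis_fun :: "(real ^ 'n) list \<Rightarrow> (real ^ 'n) list \<Rightarrow> nat \<Rightarrow> nat \<Rightarrow> real ^ 'n \<Rightarrow> real" where
  "basis_fun ns gs k = (if k < length ns then e0 (ns ! k) else eG (gs ! (k - length ns)))"

definition coeff0 :: "(real ^ 'n) list \<Rightarrow> (nat \<Rightarrow> real) \<Rightarrow> real ^ 'n \<Rightarrow> real" where
  "coeff0 ns f j = f (the_inv_into {..<length ns} ((!) ns) j)"

lemma coeff0_nth: "distinct ns \<Longrightarrow> k < length ns \<Longrightarrow> coeff0 ns f (ns ! k) = f k"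
  unfolding coeff0_def by (subst the_inv_into_f_f) (auto simp: inj_on_nth)

lemma sum_coeff0:
  fixes g :: "real ^ 'n \<Rightarrow> real"
  assumes "distinct ns" shows "(\<Sum>k<length ns. f k * g (ns ! k)) = (\<Sum>j\<in>set ns. coeff0 ns f j * g j)"
  using sum.reindex_bij_betw[OF bij_betw_nth[OF assms refl refl], of "\<lambda>j. coeff0 ns f j * g j"] coeff0_nth[OF assms] by simp

context
  fixes ns gs :: "(real ^ 'n) list"
  assumes ns: "distinct ns" "set ns = I0 S" and gs: "distinct gs" "set gs = I\<Gamma> S"
begin

lemma pw_basis: "k < length ns + length gs \<Longrightarrow> pw (basis_fun ns gs k)"
  unfolding basis_fun_def using ns(2) gs(2) nth_mem[of k ns] nth_mem[of "k - length ns" gs] by (auto intro: pw_e0 pw_eG)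

lemma L_hat_basis: "k < length ns + length gs \<Longrightarrow> L S (hat_basis S ns gs ! k) = basis_fun ns gs k"
  unfolding basis_fun_def hat_basis_def using ns(2) gs(2) nth_mem[of k ns] nth_mem[of "k - length ns" gs]
  by (auto simp: nth_append L_e0 L_eG)

lemma stiffness_carrier: "stiffness S ns gs \<in> carrier_mat (length ns + length gs) (length ns + length gs)"
  unfolding stiffness_def hat_basis_def Let_def by simp

lemma stiffness_index:
  assumes "i < length ns + length gs" "j < length ns + length gs"
  shows "stiffness S ns gs $$ (i, j) = Ah S (basis_fun ns gs j) (basis_fun ns gs i)"
proof -
  have "length (hat_basis S ns gs) = length ns + length gs" unfolding hat_basis_def by simp
  then show ?thesis using assms unfolding stiffness_def Let_def Ahat_def by (simp add: L_hat_basis)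
qed

lemma sum_basis_fun:
  "(\<Sum>k<length ns + length gs. f k * basis_fun ns gs k i x) = comb (coeff0 ns f) (coeff0 gs (\<lambda>k. f (k + length ns))) i x"
proof -
  have "(\<Sum>k<length ns + length gs. f k * basis_fun ns gs k i x)
      = (\<Sum>k<length ns. f k * basis_fun ns gs k i x) + (\<Sum>k=length ns..<length ns + length gs. f k * basis_fun ns gs k i x)"
    by (simp add: lessThan_atLeast0 sum.atLeastLessThan_concat)
  also have "(\<Sum>k=length ns..<length ns + length gs. f k * basis_fun ns gs k i x)
      = (\<Sum>k<length gs. f (k + length ns) * eG (gs ! k) i x)"
    using sum.shift_bounds_nat_ivl[of "\<lambda>k. f k * basis_fun ns gs k i x" 0 "length ns" "length gs"]
    by (simp add: add.commute lessThan_atLeast0 basis_fun_def)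
  also have "(\<Sum>k<length ns. f k * basis_fun ns gs k i x) = (\<Sum>k<length ns. f k * e0 (ns ! k) i x)"
    by (simp add: basis_fun_def)
  finally show ?thesis
    using sum_coeff0[OF ns(1), of f "\<lambda>j. e0 j i x"] sum_coeff0[OF gs(1), of "\<lambda>k. f (k + length ns)" "\<lambda>j. eG j i x"]
    by (simp add: comb_def ns(2) gs(2))
qed

lemma mform_stiffness:
  "mform (length ns + length gs) (stiffness S ns gs) f f
    = Ah S (comb (coeff0 ns f) (coeff0 gs (\<lambda>k. f (k + length ns)))) (comb (coeff0 ns f) (coeff0 gs (\<lambda>k. f (k + length ns))))"
proof -
  let ?N = "length ns + length gs" let ?u = "\<lambda>i x. \<Sum>k<?N. f k * basis_fun ns gs k i x"
  have u: "pw ?u" by (intro pw_sum pw_basis) simp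
  have "Ah S ?u ?u = (\<Sum>j<?N. f j * Ah S (basis_fun ns gs j) ?u)" by (intro Ah_sum_left u pw_basis) simp
  also have "\<dots> = (\<Sum>j<?N. f j * (\<Sum>i<?N. f i * Ah S (basis_fun ns gs j) (basis_fun ns gs i)))"
    by (intro sum.cong refl arg_cong2[where f = "(*)"] Ah_sum_right pw_basis) auto
  also have "\<dots> = mform ?N (stiffness S ns gs) f f"
    unfolding mform_def sum_distrib_left by (subst sum.swap) (auto simp: stiffness_index intro!: sum.cong)
  finally show ?thesis unfolding sum_basis_fun by simp
qed

lemma comb_cong:
  assumes "\<And>j. j \<in> I0 S \<Longrightarrow> a j = a' j" "\<And>j. j \<in> I\<Gamma> S \<Longrightarrow> b j = b' j" shows "comb a b = comb a' b'"
  unfolding comb_def using assms by (intro ext arg_cong2[where f = "(+)"] sum.cong) auto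

text \<open>Dropping the off-diagonal blocks means evaluating the form separately on the two parts
  of the splitting.\<close>

lemma mform_block_diagonal_stiffness:
  "mform (length ns + length gs) (block_diagonal (length ns) (stiffness S ns gs)) f f
    = Ah S (comb (coeff0 ns f) (\<lambda>j. 0)) (comb (coeff0 ns f) (\<lambda>j. 0))
    + Ah S (comb (\<lambda>j. 0) (coeff0 gs (\<lambda>k. f (k + length ns)))) (comb (\<lambda>j. 0) (coeff0 gs (\<lambda>k. f (k + length ns))))"
proof -
  have *: "coeff0 l f' j = coeff0 l f'' j" if "distinct l" "j \<in> set l" "\<And>k. k < length l \<Longrightarrow> f' k = f'' k" for l :: "(real ^ 'n) list" and f' f'' j
    using that by (auto simp: in_set_conv_nth coeff0_nth)
  have c0: "coeff0 l (\<lambda>k. 0) = (\<lambda>j. 0)" for l unfolding coeff0_def by simp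
  have "comb (coeff0 ns (\<lambda>i. if i < length ns then f i else 0)) (coeff0 gs (\<lambda>k. if k + length ns < length ns then f (k + length ns) else 0)) = comb (coeff0 ns f) (\<lambda>j. 0)"
    by (intro comb_cong *[OF ns(1)]) (auto simp: ns gs c0)
  moreover have "comb (coeff0 ns (\<lambda>i. if i < length ns then 0 else f i)) (coeff0 gs (\<lambda>k. if k + length ns < length ns then 0 else f (k + length ns))) = comb (\<lambda>j. 0) (coeff0 gs (\<lambda>k. f (k + length ns)))"
    unfolding c0[of ns, symmetric] by (intro comb_cong *[OF ns(1)]) (auto simp: ns gs)
  ultimately show ?thesis unfolding mform_block_diagonal[OF stiffness_carrier le_add1] mform_stiffness by simp
qed

end

end

theorem mainTheorem2:
  fixes \<Omega> :: "(real ^ 'n::finite) set"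
    and k :: nat and \<alpha> :: "nat \<Rightarrow> real" and \<gamma> \<beta> \<sigma> r K a b :: real
  assumes "CARD('n) \<in> {2, 3}" and "k \<ge> 1" and "polygonal_domain \<Omega>"
    and "\<alpha> 1 > 0" and "\<alpha> 2 > 0" and "\<gamma> > 0" and "\<beta> > 0"
    and "\<sigma> > 0" and "r > 0" and "a > 0" and "b > 0"
  shows "\<exists>c1 > 0. \<exists>c2 > 0. \<exists>C. \<forall>S :: 'n cutfem. \<forall>ns gs.
    dom_of S = \<Omega> \<and> deg S = k \<and> coef S = \<alpha> \<and> gam S = \<gamma> \<and> bet S = \<beta> \<and>
    cutfem_setting S \<and> shape_regular \<sigma> (mesh S) \<and> smooth_interface S r K \<and>
    norm_equivalence S a b \<and>
    distinct ns \<and> set ns = I0 S \<and> distinct gs \<and> set gs = I\<Gamma> S \<longrightarrow>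
    (let A = stiffness S ns gs; D = block_diagonal (length ns) A in
       (\<forall>x\<in>carrier_vec (length ns + length gs).
          c1 * scalar_prod x (A *\<^sub>v x) \<le> scalar_prod x (D *\<^sub>v x) \<and>
          scalar_prod x (D *\<^sub>v x) \<le> c2 * scalar_prod x (A *\<^sub>v x)) \<and>
       (ns \<noteq> [] \<longrightarrow>
          (\<exists>E. mat_inverse D = Some E \<and>
             spectrum (map_mat complex_of_real (E * A)) \<subseteq> complex_of_real ` {0<..} \<and>
             spectral_cond (E * A) \<le> C)))"
proof -
  have n2: "CARD('n) \<ge> 2" and n0: "0 < CARD('n)" using assms(1) by auto
  \<comment> \<open>Both inverse estimates are taken before any discretization is introduced; their
    constants depend on the degree, \<sigma> and the dimension.\<close>
  obtain Co where Co: "0 < Co" "\<And>(T :: (real ^ 'n) set) (p :: real ^ 'n \<Rightarrow> real) x y. shape \<sigma> T \<Longrightarrow> p \<in> poly_le k \<Longrightarrow>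
      x \<in> T \<Longrightarrow> y \<in> T \<Longrightarrow> diameter T ^ (CARD('n) - 2) * (p x - p y)\<^sup>2 \<le> Co * (LINT x:T|lborel. grad2 p x)"
    using oscillation_le_gradient[OF assms(2,8) n2] by blast
  obtain Cg where Cg: "0 < Cg" "\<And>(T :: (real ^ 'n) set) (p :: real ^ 'n \<Rightarrow> real) m. shape \<sigma> T \<Longrightarrow> p \<in> poly_le k \<Longrightarrow>
      (\<And>j. j \<in> lagrange_nodes k T \<Longrightarrow> \<bar>p j\<bar> \<le> m) \<Longrightarrow>
      (LINT x:T|lborel. grad2 p x) \<le> Cg * diameter T ^ (CARD('n) - 2) * m\<^sup>2"
    using gradient_le_nodal_values[OF assms(2,8) n2] by blast
  define D where "D = max 1 (diameter (closure \<Omega>))"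
  define M where "M = 4 * Cg * key_const CARD('n) \<sigma> r K D Co * real ((CARD('n) + 1) * mult_bound CARD('n) \<sigma>) + 1"
  define c2 where "c2 = 2 + 3 * (b * M / a)"
  have Dpos: "0 < D" unfolding D_def by simp
  have "0 < key_const CARD('n) \<sigma> r K D Co" by (intro key_const_pos n0 assms Dpos Co(1))
  then have Mpos: "0 < M" unfolding M_def using Cg(1) by (intro add_nonneg_pos mult_nonneg_nonneg) auto
  have c2: "0 < c2" unfolding c2_def using Mpos assms(10,11) by (intro add_pos_pos mult_pos_pos divide_pos_pos) auto
  \<comment> \<open>The two inequalities of \<open>stable_splitting\<close> are read as matrix
    inequalities with constants \<open>1 / 2\<close> and \<open>c2\<close>; their ratio bounds the
    condition number.\<close>
  have main: "let A = stiffness S ns gs; D = block_diagonal (length ns) A in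
       (\<forall>x\<in>carrier_vec (length ns + length gs).
          1 / 2 * scalar_prod x (A *\<^sub>v x) \<le> scalar_prod x (D *\<^sub>v x) \<and>
          scalar_prod x (D *\<^sub>v x) \<le> c2 * scalar_prod x (A *\<^sub>v x)) \<and>
       (ns \<noteq> [] \<longrightarrow>
          (\<exists>E. mat_inverse D = Some E \<and>
             spectrum (map_mat complex_of_real (E * A)) \<subseteq> complex_of_real ` {0<..} \<and>
             spectral_cond (E * A) \<le> c2 / (1 / 2)))"
    if S: "dom_of S = \<Omega>" "deg S = k" "cutfem_setting S" "shape_regular \<sigma> (mesh S)" "smooth_interface S r K"
      "norm_equivalence S a b" and ns: "distinct ns" "set ns = I0 S" and gs: "distinct gs" "set gs = I\<Gamma> S" for S :: "'n cutfem" and ns gs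
  proof -
    interpret cutfem_geom S \<sigma> r K
      using S assms n2 unfolding cutfem_setting_def by unfold_locales (simp_all add: cutfem_setting_def)
    have osc: "osc_bound Co" unfolding osc_bound_def using Co(2) S(2) by blast
    have nodal: "nodal_bound Cg" unfolding nodal_bound_def using Cg(2) S(2) by blast
    have sc: "split_const Co Cg = M" unfolding split_const_def M_def D_def diam_def S(1) ..
    note split = stable_splitting[OF Co(1) osc Cg(1) nodal S(6) assms(10,11), unfolded sc, folded c2_def]
    let ?N = "length ns + length gs" let ?A = "stiffness S ns gs" let ?D = "block_diagonal (length ns) ?A"
    note A = stiffness_carrier[OF ns gs]
    have Dc: "?D \<in> carrier_mat ?N ?N" by (rule block_diagonal_index(1)[OF A le_add1])
    have lower: "1 / 2 * mform ?N ?A f f \<le> mform ?N ?D f f" for f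
      unfolding mform_stiffness[OF ns gs] mform_block_diagonal_stiffness[OF ns gs]
      using split(1)[of "coeff0 ns f" "coeff0 gs (\<lambda>k. f (k + length ns))"] by simp
    have upper: "mform ?N ?D f f \<le> c2 * mform ?N ?A f f" for f
      unfolding mform_stiffness[OF ns gs] mform_block_diagonal_stiffness[OF ns gs] by (rule split(2))
    have pos: "0 < mform ?N ?A f f" if i: "i < ?N" "f i \<noteq> 0" for f i
    proof (rule ccontr)
      assume "\<not> ?thesis"
      then have le: "Ah S (comb (coeff0 ns f) (coeff0 gs (\<lambda>k. f (k + length ns)))) (comb (coeff0 ns f) (coeff0 gs (\<lambda>k. f (k + length ns)))) \<le> 0"
        unfolding mform_stiffness[OF ns gs] by simp
      note d = Ah_comb_definite[OF Co(1) osc S(6) assms(10) le]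
      show False
      proof (cases "i < length ns")
        case True
        then show ?thesis using d(1)[of "ns ! i"] coeff0_nth[OF ns(1) True] ns(2) nth_mem[OF True] i(2) by simp
      next
        case False
        then have "i - length ns < length gs" using i(1) by simp
        then show ?thesis using d(2)[of "gs ! (i - length ns)"] coeff0_nth[OF gs(1)] gs(2) nth_mem False i(2) by fastforce
      qed
    qed
    have sym: "?A $$ (i, j) = ?A $$ (j, i)" if "i < ?N" "j < ?N" for i j
      using stiffness_index[OF ns gs that] stiffness_index[OF ns gs that(2,1)] Ah_commute by simp
    have "1 / 2 * scalar_prod x (?A *\<^sub>v x) \<le> scalar_prod x (?D *\<^sub>v x) \<and> scalar_prod x (?D *\<^sub>v x) \<le> c2 * scalar_prod x (?A *\<^sub>v x)"
      if "x \<in> carrier_vec ?N" for x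
      unfolding scalar_prod_mform[OF A that] scalar_prod_mform[OF Dc that] using lower upper by blast
    \<comment> \<open>A nonempty list of nodes makes the dimension positive, without which there
      would be no eigenvalue.\<close>
    moreover have "\<exists>E. mat_inverse ?D = Some E \<and> spectrum (map_mat complex_of_real (E * ?A)) \<subseteq> complex_of_real ` {0<..} \<and>
        spectral_cond (E * ?A) \<le> c2 / (1 / 2)" if "ns \<noteq> []"
      by (rule block_diagonal_preconditioner[OF A le_add1 _ sym pos _ c2 lower upper]) (use that in auto)
    ultimately show ?thesis unfolding Let_def by blast
  qed
  have half: "(0 :: real) < 1 / 2" by simp
  show ?thesis
  proof (rule exI[of _ "1 / 2 :: real"], rule conjI[OF half], rule exI[of _ c2], rule conjI[OF c2], rule exI[of _ "c2 / (1 / 2)"], intro allI impI)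
  qed (elim conjE, rule main)
qed

end
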